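(* Consider the Singleton Inverse Linear Feasibility Problem with the LP in standard form: given $A\in\mathbb{Q}^{m\times n}$, $B\in\mathbb{Q}^{m\times k}$, $b\in\mathbb{Q}^m$, $C\in\mathbb{Q}^{n\times k}$, $c\in\mathbb{Q}^n$, a polyhedron $X=\{x\in\mathbb{R}^k \mid Dx\le d\}$ with $D\in\mathbb{Q}^{g\times k}$, $d\in\mathbb{Q}^g$, and a target solution $\bar y\in\mathbb{Q}^n$, decide (optimistic scenario) whether there exists $x\in X$ such that $\bar y\in\arg\min\{(Cx+c)^\top y \mid Ay= Bx+b,\ y\in\mathbb{R}^n,\ y\ge 0\}$; (pessimistic scenario) whether there exists $x\in X$ such that $\arg\min\{(Cx+c)^\top y \mid Ay= Bx+b,\ y\in\mathbb{R}^n,\ y\ge 0\}=\{\bar y\}$. Both of these decision problems are solvable in polynomial time.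
   Context: All input data are rational and given in the usual binary encoding; polynomial time means polynomial in the encoding length of the input. For each fixed parameter $x$, $\arg\min$ denotes the set of optimal solutions of the LP (empty if the LP is infeasible or unbounded). *)

theory Defs
  imports
    Complex_Main
    "HOL-Library.Log_Nat"
    "HOL-Computational_Algebra.Polynomial"
    "Jordan_Normal_Form.Matrix"
begin

section \<open>Polynomial time\<close>

text \<open>
  The machine model is the random access machine on integers with addition, subtraction,
  multiplication and division under the logarithmic cost criterion (Cook and Reckhow; Aho,
  Hopcroft and Ullman), with structured control flow in place of jumps. Every integer that is
  computed, used as an address, read from memory or written to memory is charged its binary
  encoding length, so that running times are polynomially related to those of multitape Turing
  machines.
\<close>

text \<open>Length of a signed binary encoding: one sign bit plus \<open>\<lceil>log 2 (\<bar>i\<bar> + 1)\<rceil>\<close> digits.\<close>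
definition int_length :: "int \<Rightarrow> nat" where
  "int_length i = Suc (nat (bitlen \<bar>i\<bar>))"

type_synonym memory = "int \<Rightarrow> int"

datatype exp =
    Const int
  | Mem exp
  | Plus exp exp
  | Minus exp exp
  | Times exp exp
  | Div exp exp

fun exp_val :: "exp \<Rightarrow> memory \<Rightarrow> int" where
  "exp_val (Const i) \<sigma> = i"
| "exp_val (Mem e) \<sigma> = \<sigma> (exp_val e \<sigma>)"
| "exp_val (Plus e1 e2) \<sigma> = exp_val e1 \<sigma> + exp_val e2 \<sigma>"
| "exp_val (Minus e1 e2) \<sigma> = exp_val e1 \<sigma> - exp_val e2 \<sigma>"
| "exp_val (Times e1 e2) \<sigma> = exp_val e1 \<sigma> * exp_val e2 \<sigma>"
| "exp_val (Div e1 e2) \<sigma> = exp_val e1 \<sigma> div exp_val e2 \<sigma>"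

text \<open>The total encoding length of the values of all subexpressions.\<close>
fun exp_cost :: "exp \<Rightarrow> memory \<Rightarrow> nat" where
  "exp_cost (Const i) \<sigma> = int_length i"
| "exp_cost (Mem e) \<sigma> = exp_cost e \<sigma> + int_length (exp_val (Mem e) \<sigma>)"
| "exp_cost (Plus e1 e2) \<sigma> =
     exp_cost e1 \<sigma> + exp_cost e2 \<sigma> + int_length (exp_val (Plus e1 e2) \<sigma>)"
| "exp_cost (Minus e1 e2) \<sigma> =
     exp_cost e1 \<sigma> + exp_cost e2 \<sigma> + int_length (exp_val (Minus e1 e2) \<sigma>)"
| "exp_cost (Times e1 e2) \<sigma> =
     exp_cost e1 \<sigma> + exp_cost e2 \<sigma> + int_length (exp_val (Times e1 e2) \<sigma>)"
| "exp_cost (Div e1 e2) \<sigma> =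
     exp_cost e1 \<sigma> + exp_cost e2 \<sigma> + int_length (exp_val (Div e1 e2) \<sigma>)"

text \<open>
  \<open>Store e1 e2\<close> writes the value of \<open>e2\<close> to the cell addressed by the value of \<open>e1\<close>.
  The tests of \<open>If\<close> and \<open>While\<close> ask whether the value is positive.
\<close>
datatype prog =
    Skip
  | Store exp exp
  | Seq prog prog
  | If exp prog prog
  | While exp prog

text \<open>\<open>exec p \<sigma> t \<tau>\<close>: started in \<open>\<sigma>\<close>, the program \<open>p\<close> halts in \<open>\<tau>\<close> at total cost \<open>t\<close>.\<close>
inductive exec :: "prog \<Rightarrow> memory \<Rightarrow> nat \<Rightarrow> memory \<Rightarrow> bool" where
  Skip: "exec Skip \<sigma> 1 \<sigma>"
| Store: "exec (Store e1 e2) \<sigma> (1 + exp_cost e1 \<sigma> + exp_cost e2 \<sigma>)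
            (\<sigma>(exp_val e1 \<sigma> := exp_val e2 \<sigma>))"
| Seq: "exec p1 \<sigma> t1 \<sigma>' \<Longrightarrow> exec p2 \<sigma>' t2 \<tau> \<Longrightarrow> exec (Seq p1 p2) \<sigma> (1 + t1 + t2) \<tau>"
| IfTrue: "exp_val e \<sigma> > 0 \<Longrightarrow> exec p1 \<sigma> t \<tau> \<Longrightarrow>
    exec (If e p1 p2) \<sigma> (1 + exp_cost e \<sigma> + t) \<tau>"
| IfFalse: "\<not> exp_val e \<sigma> > 0 \<Longrightarrow> exec p2 \<sigma> t \<tau> \<Longrightarrow>
    exec (If e p1 p2) \<sigma> (1 + exp_cost e \<sigma> + t) \<tau>"
| WhileFalse: "\<not> exp_val e \<sigma> > 0 \<Longrightarrow> exec (While e p) \<sigma> (1 + exp_cost e \<sigma>) \<sigma>"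
| WhileTrue: "exp_val e \<sigma> > 0 \<Longrightarrow> exec p \<sigma> t1 \<sigma>' \<Longrightarrow> exec (While e p) \<sigma>' t2 \<tau> \<Longrightarrow>
    exec (While e p) \<sigma> (1 + exp_cost e \<sigma> + t1 + t2) \<tau>"

inductive_cases exec_SkipE: "exec Skip \<sigma> t \<tau>"
inductive_cases exec_StoreE: "exec (Store e1 e2) \<sigma> t \<tau>"
inductive_cases exec_SeqE: "exec (Seq p1 p2) \<sigma> t \<tau>"
inductive_cases exec_IfE: "exec (If e p1 p2) \<sigma> t \<tau>"
inductive_cases exec_WhileE: "exec (While e p) \<sigma> t \<tau>"

lemma exec_deterministic:
  "exec p \<sigma> t \<tau> \<Longrightarrow> exec p \<sigma> t' \<tau>' \<Longrightarrow> t' = t \<and> \<tau>' = \<tau>"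
proof (induction arbitrary: t' \<tau>' rule: exec.induct)
  case (Skip \<sigma>)
  then show ?case by (auto elim: exec_SkipE)
next
  case (Store e1 e2 \<sigma>)
  then show ?case by (auto elim: exec_StoreE)
next
  case (Seq p1 \<sigma> t1 \<sigma>' p2 t2 \<tau>)
  from Seq.prems obtain s1 \<rho> s2 where
    "exec p1 \<sigma> s1 \<rho>" "exec p2 \<rho> s2 \<tau>'" "t' = 1 + s1 + s2"
    by (elim exec_SeqE) simp
  with Seq.IH(1)[of s1 \<rho>] Seq.IH(2)[of s2 \<tau>'] show ?case by auto
next
  case (IfTrue e \<sigma> p1 t \<tau> p2)
  from IfTrue.prems obtain s where "exec p1 \<sigma> s \<tau>'" "t' = 1 + exp_cost e \<sigma> + s"
    by (rule exec_IfE) (use IfTrue.hyps in simp_all)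
  with IfTrue.IH[of s \<tau>'] show ?case by simp
next
  case (IfFalse e \<sigma> p2 t \<tau> p1)
  from IfFalse.prems obtain s where "exec p2 \<sigma> s \<tau>'" "t' = 1 + exp_cost e \<sigma> + s"
    by (rule exec_IfE) (use IfFalse.hyps in simp_all)
  with IfFalse.IH[of s \<tau>'] show ?case by simp
next
  case (WhileFalse e \<sigma> p)
  from WhileFalse.prems show ?case
    by (rule exec_WhileE) (use WhileFalse.hyps in simp_all)
next
  case (WhileTrue e \<sigma> p t1 \<sigma>' t2 \<tau>)
  from WhileTrue.prems obtain s1 \<rho> s2 where
    "exec p \<sigma> s1 \<rho>" "exec (While e p) \<rho> s2 \<tau>'" "t' = 1 + exp_cost e \<sigma> + s1 + s2"
    by (rule exec_WhileE) (use WhileTrue.hyps in simp_all)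
  with WhileTrue.IH(1)[of s1 \<rho>] WhileTrue.IH(2)[of s2 \<tau>'] show ?case by auto
qed

text \<open>The input occupies the cells \<open>0, 1, 2, \<dots>\<close>; all other cells are initially \<open>0\<close>.\<close>
definition load :: "int list \<Rightarrow> memory" where
  "load xs = (\<lambda>a. if 0 \<le> a \<and> a < int (length xs) then xs ! nat a else 0)"

definition encoding_length :: "int list \<Rightarrow> nat" where
  "encoding_length xs = sum_list (map int_length xs)"

text \<open>
  A decision problem consists of a set of instances, an encoding of the instances, and the
  property to be decided. The answer is returned in cell \<open>0\<close>.
\<close>
definition polytime_decidable :: "'a set \<Rightarrow> ('a \<Rightarrow> int list) \<Rightarrow> ('a \<Rightarrow> bool) \<Rightarrow> bool" where
  "polytime_decidable Inst enc P \<longleftrightarrow>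
     (\<exists>(p :: prog) (q :: nat poly). \<forall>I\<in>Inst. \<exists>t \<tau>.
        exec p (load (enc I)) t \<tau> \<and>
        t \<le> poly q (encoding_length (enc I)) \<and>
        \<tau> 0 = (if P I then 1 else 0))"

section \<open>The singleton inverse linear feasibility problem\<close>

abbreviation real_vec :: "rat vec \<Rightarrow> real vec" where
  "real_vec v \<equiv> map_vec real_of_rat v"

abbreviation real_mat :: "rat mat \<Rightarrow> real mat" where
  "real_mat M \<equiv> map_mat real_of_rat M"

definition polyhedron :: "real mat \<Rightarrow> real vec \<Rightarrow> real vec set" where
  "polyhedron D d = {x \<in> carrier_vec (dim_col D). D *\<^sub>v x \<le> d}"

definition lp_feasible :: "real mat \<Rightarrow> real vec \<Rightarrow> real vec set" where
  "lp_feasible A r = {y \<in> carrier_vec (dim_col A). A *\<^sub>v y = r \<and> 0\<^sub>v (dim_col A) \<le> y}"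

text \<open>
  The set of optimal solutions of \<open>min {w \<bullet> y | A y = r, y \<ge> 0}\<close>; it is empty if the LP is
  infeasible or unbounded.
\<close>
definition lp_argmin :: "real vec \<Rightarrow> real mat \<Rightarrow> real vec \<Rightarrow> real vec set" where
  "lp_argmin w A r = {y \<in> lp_feasible A r. \<forall>z\<in>lp_feasible A r. w \<bullet> y \<le> w \<bullet> z}"

type_synonym silfp =
  "rat mat \<times> rat mat \<times> rat vec \<times> rat mat \<times> rat vec \<times> rat mat \<times> rat vec \<times> rat vec"

definition silfp_instances :: "silfp set" where
  "silfp_instances = {(A, B, b, C, c, D, d, ybar) | A B b C c D d ybar m n k g.
     A \<in> carrier_mat m n \<and> B \<in> carrier_mat m k \<and> b \<in> carrier_vec m \<and>
     C \<in> carrier_mat n k \<and> c \<in> carrier_vec n \<and>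
     D \<in> carrier_mat g k \<and> d \<in> carrier_vec g \<and> ybar \<in> carrier_vec n}"

fun optimistic :: "silfp \<Rightarrow> bool" where
  "optimistic (A, B, b, C, c, D, d, ybar) \<longleftrightarrow>
     (\<exists>x \<in> polyhedron (real_mat D) (real_vec d).
        real_vec ybar \<in> lp_argmin (real_mat C *\<^sub>v x + real_vec c)
                          (real_mat A) (real_mat B *\<^sub>v x + real_vec b))"

fun pessimistic :: "silfp \<Rightarrow> bool" where
  "pessimistic (A, B, b, C, c, D, d, ybar) \<longleftrightarrow>
     (\<exists>x \<in> polyhedron (real_mat D) (real_vec d).
        lp_argmin (real_mat C *\<^sub>v x + real_vec c)
          (real_mat A) (real_mat B *\<^sub>v x + real_vec b) = {real_vec ybar})"

text \<open>Rationals are encoded by numerator and denominator in lowest terms.\<close>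
definition rat_encoding :: "rat \<Rightarrow> int list" where
  "rat_encoding r = [fst (quotient_of r), snd (quotient_of r)]"

definition vec_encoding :: "rat vec \<Rightarrow> int list" where
  "vec_encoding v = concat (map rat_encoding (list_of_vec v))"

text \<open>Row by row.\<close>
definition mat_encoding :: "rat mat \<Rightarrow> int list" where
  "mat_encoding M = concat (map rat_encoding (concat (mat_to_list M)))"

text \<open>The dimensions \<open>m, n, k, g\<close> come first, so that the remaining data can be located.\<close>
fun silfp_encoding :: "silfp \<Rightarrow> int list" where
  "silfp_encoding (A, B, b, C, c, D, d, ybar) =
     [int (dim_row A), int (dim_col A), int (dim_col B), int (dim_row D)] @
     mat_encoding A @ mat_encoding B @ vec_encoding b @
     mat_encoding C @ vec_encoding c @
     mat_encoding D @ vec_encoding d @ vec_encoding ybar"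

end

theory Submission
  imports Defs "Jordan_Normal_Form.Determinant"
begin

text \<open>
  By Farkas' lemma, \<open>y\<close> is optimal iff it is feasible and some dual vector \<open>u\<close> satisfies
  complementary slackness. It is the only optimal solution iff, in addition, complementarity can be
  made strict and the columns of \<open>A\<close> in the support of \<open>y\<close> are linearly independent, that is, for
  every \<open>j\<close> the unit vector \<open>e\<^sub>j\<close> agrees on the support with \<open>A\<^sup>T v\<close> for some \<open>v\<close>. Scaling by a
  variable \<open>t \<ge> 1\<close> makes these conditions jointly linear in \<open>x, u, v, t\<close>, so that both problems
  amount to the feasibility of one system of linear inequalities for every \<open>j\<close>.

  A system \<open>F x \<le> h\<close> of size \<open>S\<close> is solved by a variant of the method of Yamnitsky and Levin. For
  \<open>W = S\<^bsup>4n+8\<^esup>\<close>, feasibility is equivalent to feasibility of \<open>F x \<le> h + 1/W\<close>, and in the feasible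
  case the homogenized relaxed system has a full-dimensional set of solutions inside an initial
  simplicial cone. As long as the sum of the generators violates some inequality, the cone is
  replaced by one of smaller volume that contains the same solutions. The generators are kept
  integral, and the volume decreases by a factor \<open>1 - 1/poly(n)\<close>, so that after polynomially many
  steps either the sum of the generators is a solution or the system is infeasible.

  The programs are verified with a weakest precondition calculus in which one number bounds the
  iterations of every loop and another one the bit length of every memory cell; the running time
  is then a polynomial in these two numbers.
\<close>

section \<open>Exact solutions from approximate ones\<close>

text \<open>The relaxation by 1/W serves the volume argument: the solutions of an exact system may
  lie in a hyperplane, and then no bound on volumes tells when to stop. After relaxing and
  homogenizing, a bounded exact solution is a vertex of a small simplex of solutions, while
  determinant bounds make 1/W too small for an infeasible system to become feasible. Cones are
  shrunk rather than simplices because generators may be multiplied by any positive integer: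
  denominators are cleared and never stored, the entries grow by a bounded factor per step, and
  their bit length stays linear in the number of steps. Only the multipliers are rounded; square
  roots, as with ellipsoids, do not occur. The systems for different j share all constraints on x,
  u, t and differ only in the right-hand side for v. Hence x, u, t of any one of them can be
  combined with the vectors v of all of them. Infeasibility is never certified: it is concluded from
  the fact that a fixed number of passes has not produced a solution.\<close>

lemma abs_det_le:
  fixes A :: "real mat"
  assumes A: "A \<in> carrier_mat n n" and U: "\<And>i j. i < n \<Longrightarrow> j < n \<Longrightarrow> \<bar>A $$ (i, j)\<bar> \<le> U"
  shows "\<bar>det A\<bar> \<le> fact n * U ^ n"
proof -
  have "\<bar>signof p * (\<Prod>i = 0..<n. A $$ (i, p i))\<bar> \<le> U ^ n" if p: "p permutes {0..<n}" for p
  proof -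
    have "\<bar>signof p * (\<Prod>i = 0..<n. A $$ (i, p i))\<bar> = (\<Prod>i = 0..<n. \<bar>A $$ (i, p i)\<bar>)"
      by (simp add: abs_mult abs_prod sign_def)
    also have "\<dots> \<le> (\<Prod>i = 0..<n. U)"
      using p permutes_in_image[OF p] by (intro prod_mono) (auto intro!: U)
    finally show ?thesis by simp
  qed
  then have "\<bar>det A\<bar> \<le> (\<Sum>p | p permutes {0..<n}. U ^ n)"
    unfolding det_def'[OF A] by (intro order.trans[OF sum_abs] sum_mono) auto
  also have "\<dots> = fact n * U ^ n"
    by (simp add: card_permutations)
  finally show ?thesis .
qed

lemma det_in_Ints:
  fixes A :: "real mat"
  assumes "A \<in> carrier_mat n n" "\<And>i j. i < n \<Longrightarrow> j < n \<Longrightarrow> A $$ (i, j) \<in> \<int>"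
  shows "det A \<in> \<int>"
  unfolding det_def'[OF assms(1)]
proof (intro Ints_sum Ints_mult Ints_prod)
  fix p i assume "p \<in> {p. p permutes {0..<n}}" "i \<in> {0..<n}"
  then show "A $$ (i, p i) \<in> \<int>"
    using permutes_in_image[of p "{0..<n}" i] by (auto intro!: assms(2))
qed (auto simp: sign_def)

lemma mat_delete_entry:
  assumes "A \<in> carrier_mat n n" "i < n - 1" "j < n - 1"
  shows "\<exists>i'<n. \<exists>j'<n. mat_delete A r c $$ (i, j) = A $$ (i', j')"
  using assms unfolding mat_delete_def
  by (intro exI[of _ "if i < r then i else Suc i"] conjI exI[of _ "if j < c then j else Suc j"]) auto

lemma abs_cofactor_le:
  fixes A :: "real mat"
  assumes A: "A \<in> carrier_mat n n" and U: "\<And>i j. i < n \<Longrightarrow> j < n \<Longrightarrow> \<bar>A $$ (i, j)\<bar> \<le> U"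
  shows "\<bar>cofactor A i j\<bar> \<le> fact (n - 1) * U ^ (n - 1)"
proof -
  have "\<bar>det (mat_delete A i j)\<bar> \<le> fact (n - 1) * U ^ (n - 1)"
  proof (rule abs_det_le[OF mat_delete_carrier[OF A]])
    fix a b assume "a < n - 1" "b < n - 1"
    from mat_delete_entry[OF A this] U show "\<bar>mat_delete A i j $$ (a, b)\<bar> \<le> U" by metis
  qed
  then show ?thesis by (simp add: cofactor_def abs_mult power_abs)
qed

lemma cofactor_in_Ints:
  fixes A :: "real mat"
  assumes A: "A \<in> carrier_mat n n" and "\<And>i j. i < n \<Longrightarrow> j < n \<Longrightarrow> A $$ (i, j) \<in> \<int>"
  shows "cofactor A i j \<in> \<int>"
proof -
  have "det (mat_delete A i j) \<in> \<int>"
  proof (rule det_in_Ints[OF mat_delete_carrier[OF A]])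
    fix a b assume "a < n - 1" "b < n - 1"
    from mat_delete_entry[OF A this] assms(2) show "mat_delete A i j $$ (a, b) \<in> \<int>" by metis
  qed
  then show ?thesis by (simp add: cofactor_def)
qed

section \<open>Rounding an approximate solution to an exact one\<close>

lemma sum_dist_line:
  fixes g x y :: "nat \<Rightarrow> real"
  shows "(\<Sum>c<N. g c * (x c + s * y c)) = (\<Sum>c<N. g c * x c) + s * (\<Sum>c<N. g c * y c)"
  by (simp add: algebra_simps sum.distrib sum_distrib_left)

lemma abs_sum_mult_le:
  fixes f g :: "'i \<Rightarrow> real"
  assumes "\<And>l. l \<in> J \<Longrightarrow> \<bar>f l\<bar> \<le> U" "\<And>l. l \<in> J \<Longrightarrow> \<bar>g l\<bar> \<le> W" "0 \<le> U"
  shows "\<bar>\<Sum>l\<in>J. f l * g l\<bar> \<le> real (card J) * (U * W)"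
proof -
  have "\<bar>\<Sum>l\<in>J. f l * g l\<bar> \<le> (\<Sum>l\<in>J. U * W)"
    using assms by (intro order.trans[OF sum_abs] sum_mono) (auto simp: abs_mult intro!: mult_mono)
  then show ?thesis by simp
qed

text \<open>If some direction \<open>y\<close> leaves all tight constraints unchanged, moving along
  it until the next constraint becomes tight enlarges the tight set. A feasible point with the
  largest tight set therefore has no such direction; \<open>ker\<close> guarantees that every
  nonzero direction meets some constraint.\<close>

lemma maximal_tight_point:
  fixes G :: "'i \<Rightarrow> nat \<Rightarrow> real" and h :: "'i \<Rightarrow> real"
  assumes fin: "finite I"
    and ker: "\<And>y. (\<forall>i\<in>I. (\<Sum>c<N. G i c * y c) = 0) \<Longrightarrow> \<forall>c<N. y c = 0"
    and x: "\<forall>i\<in>I. (\<Sum>c<N. G i c * x c) \<le> h i"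
  shows "\<exists>x' J. J \<subseteq> I \<and> (\<forall>i\<in>I. (\<Sum>c<N. G i c * x' c) \<le> h i) \<and>
    (\<forall>i\<in>J. (\<Sum>c<N. G i c * x' c) = h i) \<and>
    (\<forall>y. (\<forall>i\<in>J. (\<Sum>c<N. G i c * y c) = 0) \<longrightarrow> (\<forall>c<N. y c = 0))"
proof -
  define S where "S = {x. \<forall>i\<in>I. (\<Sum>c<N. G i c * x c) \<le> h i}"
  define T where "T x = {i\<in>I. (\<Sum>c<N. G i c * x c) = h i}" for x
  have "\<forall>x. x \<in> S \<longrightarrow> card (T x) < Suc (card I)"
    using fin by (auto simp: T_def less_Suc_eq_le intro: card_mono)
  then obtain x' where x': "x' \<in> S" and mx: "\<And>z. z \<in> S \<Longrightarrow> card (T z) \<le> card (T x')"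
    using ex_has_greatest_nat[of "\<lambda>x. x \<in> S" x "\<lambda>x. card (T x)" "Suc (card I)"] x
    by (auto simp: S_def less_imp_le)
  have "\<forall>c<N. y c = 0" if y: "\<forall>i\<in>T x'. (\<Sum>c<N. G i c * y c) = 0" for y
  proof (rule ccontr)
    assume "\<not> ?thesis"
    with ker[of y] obtain l where l: "l \<in> I" "(\<Sum>c<N. G l c * y c) \<noteq> 0" by blast
    \<comment> \<open>The orientation in which constraint \<open>l\<close> is approached, so that
      \<open>P\<close> is nonempty.\<close>
    define sg where "sg = sgn (\<Sum>c<N. G l c * y c)"
    define w where "w c = sg * y c" for c
    have w: "(\<Sum>c<N. G i c * w c) = sg * (\<Sum>c<N. G i c * y c)" for i
      by (simp add: w_def sum_distrib_left mult_ac)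
    define P where "P = {i\<in>I. (\<Sum>c<N. G i c * w c) > 0}"
    define q where "q i = (h i - (\<Sum>c<N. G i c * x' c)) / (\<Sum>c<N. G i c * w c)" for i
    have "l \<in> P"
      using l by (simp add: P_def w sg_def sgn_if)
    then have P: "finite P" "P \<noteq> {}" using fin by (auto simp: P_def)
    \<comment> \<open>The ratio test: the longest step along \<open>w\<close> that violates no
      constraint.\<close>
    define s where "s = Min (q ` P)"
    obtain k where k: "k \<in> P" "s = q k" using Min_in[of "q ` P"] P by (metis (no_types) image_iff finite_imageI image_is_empty s_def)
    have sle: "s \<le> q i" if "i \<in> P" for i using P that by (simp add: s_def)
    have s0: "s \<ge> 0" using x' k by (auto simp: q_def P_def S_def)
    let ?z = "\<lambda>c. x' c + s * w c"
    have "?z \<in> S"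
      unfolding S_def mem_Collect_eq sum_dist_line
    proof
      fix i assume i: "i \<in> I"
      show "(\<Sum>c<N. G i c * x' c) + s * (\<Sum>c<N. G i c * w c) \<le> h i"
      proof (cases "i \<in> P")
        case True
        then show ?thesis using sle[OF True] by (simp add: q_def P_def field_simps)
      next
        case False
        then have "s * (\<Sum>c<N. G i c * w c) \<le> 0"
          using i s0 by (auto simp: P_def mult_nonneg_nonpos)
        then show ?thesis using x' i unfolding S_def by fastforce
      qed
    qed
    moreover have "insert k (T x') \<subseteq> T ?z"
      unfolding T_def sum_dist_line using k y by (auto simp: q_def P_def T_def w)
    moreover have "k \<notin> T x'" using k y by (auto simp: P_def w)
    moreover have "finite (T z)" for z using fin by (simp add: T_def)
    ultimately have "card (T x') < card (T ?z)"
      by (metis card_insert_disjoint card_mono less_eq_Suc_le)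
    with mx[OF \<open>?z \<in> S\<close>] show False by simp
  qed
  then show ?thesis
    using x' unfolding S_def by (intro exI[of _ x'] exI[of _ "T x'"]) (simp add: T_def)
qed

text \<open>
  A point with a maximal set \<open>J\<close> of tight constraints solves the normal equations
  \<open>G\<^sub>J\<^sup>T G\<^sub>J x = G\<^sub>J\<^sup>T h\<^sub>J\<close>. Replacing the right-hand side \<open>h + \<epsilon>\<close> by \<open>h\<close> moves the solution so
  little that every constraint violation, a multiple of the inverse of the determinant, vanishes.
\<close>
lemma exact_from_approximate:
  fixes G :: "'i \<Rightarrow> nat \<Rightarrow> real" and h :: "'i \<Rightarrow> real"
  assumes fin: "finite I" and I: "I \<noteq> {}"
    and ker: "\<And>y. (\<forall>i\<in>I. (\<Sum>c<N. G i c * y c) = 0) \<Longrightarrow> \<forall>c<N. y c = 0"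
    and x: "\<forall>i\<in>I. (\<Sum>c<N. G i c * x c) \<le> h i + e"
    and Gint: "\<And>i c. i \<in> I \<Longrightarrow> c < N \<Longrightarrow> G i c \<in> \<int>" and hint: "\<And>i. i \<in> I \<Longrightarrow> h i \<in> \<int>"
    and GU: "\<And>i c. i \<in> I \<Longrightarrow> c < N \<Longrightarrow> \<bar>G i c\<bar> \<le> U" and hU: "\<And>i. i \<in> I \<Longrightarrow> \<bar>h i\<bar> \<le> U"
    and U: "U \<ge> 1" and N: "N \<ge> 1"
    and Y: "Y = (real N * real (card I) * U\<^sup>2) ^ N"
    and e: "e \<ge> 0" "e * (Y + N * U * Y) < 1"
  shows "\<exists>x0. (\<forall>i\<in>I. (\<Sum>c<N. G i c * x0 c) \<le> h i) \<and> (\<forall>c<N. \<bar>x0 c\<bar> \<le> Y)"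
proof -
  have "\<exists>x' J. J \<subseteq> I \<and> (\<forall>i\<in>I. (\<Sum>c<N. G i c * x' c) \<le> h i + e) \<and>
      (\<forall>i\<in>J. (\<Sum>c<N. G i c * x' c) = h i + e) \<and>
      (\<forall>y. (\<forall>i\<in>J. (\<Sum>c<N. G i c * y c) = 0) \<longrightarrow> (\<forall>c<N. y c = 0))"
    using fin ker x by (rule maximal_tight_point)
  then obtain x' J where J: "J \<subseteq> I" and x': "\<forall>i\<in>I. (\<Sum>c<N. G i c * x' c) \<le> h i + e"
    and tight: "\<forall>i\<in>J. (\<Sum>c<N. G i c * x' c) = h i + e"
    and kerJ: "\<And>y. (\<forall>i\<in>J. (\<Sum>c<N. G i c * y c) = 0) \<Longrightarrow> \<forall>c<N. y c = 0"
    by auto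
  have finJ: "finite J" using J fin finite_subset by blast
  define R where "R = real (card I)"
  have R: "R \<ge> 1" using fin I by (simp add: R_def Suc_le_eq card_gt_0_iff)
  have cardJ: "real (card J) \<le> R" using J fin by (simp add: R_def card_mono)
  \<comment> \<open>The Gram matrix of the tight rows, square even if there are more than
    \<open>N\<close> of them.\<close>
  define A where "A = mat N N (\<lambda>(a, b). \<Sum>l\<in>J. G l a * G l b)"
  have A: "A \<in> carrier_mat N N" by (simp add: A_def)
  define D where "D = det A"
  define K where "K = R * U\<^sup>2"
  have K1: "K \<ge> 1" using R U mult_mono[of 1 R 1 "U\<^sup>2"] by (simp add: K_def)
  have AU: "\<bar>A $$ (i, j)\<bar> \<le> K" if "i < N" "j < N" for i j
  proof -
    have "\<bar>A $$ (i, j)\<bar> \<le> real (card J) * (U * U)"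
      using that J GU U unfolding A_def by (auto intro!: abs_sum_mult_le)
    also have "\<dots> \<le> K" using cardJ U by (auto simp: K_def power2_eq_square intro!: mult_right_mono)
    finally show ?thesis .
  qed
  have AZ: "A $$ (i, j) \<in> \<int>" if "i < N" "j < N" for i j
    using that J Gint unfolding A_def by (auto intro!: Ints_sum Ints_mult)
  \<comment> \<open>For a kernel vector \<open>v\<close> of the Gram matrix, the product of
    \<open>v\<close> with \<open>A v\<close> is the sum of the squares of the tight rows at
    \<open>v\<close>. All of them vanish, so \<open>kerJ\<close> gives v = 0.\<close>
  have "D \<noteq> 0"
  proof
    assume "D = 0"
    then obtain v where v: "v \<in> carrier_vec N" "v \<noteq> 0\<^sub>v N" "A *\<^sub>v v = 0\<^sub>v N"
      using det_0_iff_vec_prod_zero[OF A] by (auto simp: D_def)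
    have "(\<Sum>b<N. \<Sum>l\<in>J. G l a * G l b * v $ b) = 0" if "a < N" for a
    proof -
      have "(A *\<^sub>v v) $ a = (\<Sum>b<N. \<Sum>l\<in>J. G l a * G l b * v $ b)"
        using that v(1) by (simp add: A_def scalar_prod_def atLeast0LessThan sum_distrib_right)
      then show ?thesis using v(3) that by simp
    qed
    then have "(\<Sum>a<N. v $ a * (\<Sum>b<N. \<Sum>l\<in>J. G l a * G l b * v $ b)) = 0" by simp
    also have "(\<Sum>a<N. v $ a * (\<Sum>b<N. \<Sum>l\<in>J. G l a * G l b * v $ b))
        = (\<Sum>a<N. \<Sum>b<N. \<Sum>l\<in>J. (G l a * v $ a) * (G l b * v $ b))"
      by (simp add: sum_distrib_left mult_ac)
    also have "\<dots> = (\<Sum>a<N. \<Sum>l\<in>J. \<Sum>b<N. (G l a * v $ a) * (G l b * v $ b))"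
      by (intro sum.cong refl sum.swap)
    also have "\<dots> = (\<Sum>l\<in>J. \<Sum>a<N. \<Sum>b<N. (G l a * v $ a) * (G l b * v $ b))"
      by (rule sum.swap)
    also have "\<dots> = (\<Sum>l\<in>J. (\<Sum>a<N. G l a * v $ a)\<^sup>2)"
      by (simp add: power2_eq_square sum_product)
    finally have "\<forall>l\<in>J. (\<Sum>a<N. G l a * v $ a) = 0"
      using finJ by (simp add: sum_nonneg_eq_0_iff)
    then have "\<forall>c<N. v $ c = 0" by (rule kerJ)
    then show False using v by (auto intro: eq_vecI)
  qed
  moreover have "D \<in> \<int>" unfolding D_def using A AZ by (rule det_in_Ints)
  ultimately have D1: "\<bar>D\<bar> \<ge> 1" by (rule Ints_nonzero_abs_ge1[rotated])
  have Yeq: "Y = (N * K) ^ N" by (simp add: Y K_def R_def mult_ac)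
  have fact_le: "fact N * K ^ N \<le> Y"
    using K1 by (simp add: Yeq power_mult_distrib) (metis fact_le_power of_nat_fact of_nat_power le_refl of_nat_le_iff)
  have DY: "\<bar>D\<bar> \<le> Y"
    unfolding D_def using abs_det_le[OF A AU] fact_le by simp
  define ad where "ad i j = cofactor A j i" for i j
  have adU: "\<bar>ad i j\<bar> \<le> fact (N - 1) * K ^ (N - 1)" for i j
    unfolding ad_def using A AU by (rule abs_cofactor_le)
  have adZ: "ad i j \<in> \<int>" for i j unfolding ad_def using A AZ by (rule cofactor_in_Ints)
  \<comment> \<open>The adjugate of \<open>A\<close> times the transposed tight rows times
    \<open>f\<close>: by Cramer's rule \<open>nu f / D\<close> solves the normal equations with
    right-hand side \<open>f\<close>, and \<open>nu f\<close> is integral for integral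
    \<open>f\<close>.\<close>
  define nu where "nu f i = (\<Sum>j<N. ad i j * (\<Sum>l\<in>J. G l j * f l))" for f i
  have nu_bound: "\<bar>nu f i\<bar> \<le> Y" if f: "\<And>l. l \<in> I \<Longrightarrow> \<bar>f l\<bar> \<le> U" for f i
  proof -
    have 1: "\<bar>\<Sum>l\<in>J. G l j * f l\<bar> \<le> K" if "j < N" for j
    proof -
      have "\<bar>\<Sum>l\<in>J. G l j * f l\<bar> \<le> real (card J) * (U * U)"
        using that J GU U f by (auto intro!: abs_sum_mult_le)
      also have "\<dots> \<le> K" using cardJ U by (auto simp: K_def power2_eq_square intro!: mult_right_mono)
      finally show ?thesis .
    qed
    have "\<bar>nu f i\<bar> \<le> real (card {..<N}) * ((fact (N - 1) * K ^ (N - 1)) * K)"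
      unfolding nu_def using adU 1 K1 by (intro abs_sum_mult_le) auto
    also have "\<dots> = fact N * K ^ N"
      using N by (cases N) (simp_all add: algebra_simps)
    finally show ?thesis using fact_le by simp
  qed
  have sol: "D * x' i = nu (\<lambda>l. h l + e) i" if i: "i < N" for i
  proof -
    have "nu (\<lambda>l. h l + e) i = (\<Sum>j<N. ad i j * (\<Sum>l\<in>J. G l j * (\<Sum>c<N. G l c * x' c)))"
      unfolding nu_def using tight by simp
    also have "\<dots> = (\<Sum>j<N. ad i j * (\<Sum>c<N. A $$ (j, c) * x' c))"
    proof (intro sum.cong refl arg_cong2[where f = "(*)"])
      fix j assume j: "j \<in> {..<N}"
      have "(\<Sum>l\<in>J. G l j * (\<Sum>c<N. G l c * x' c)) = (\<Sum>l\<in>J. \<Sum>c<N. G l j * G l c * x' c)"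
        by (simp add: sum_distrib_left mult_ac)
      also have "\<dots> = (\<Sum>c<N. \<Sum>l\<in>J. G l j * G l c * x' c)" by (rule sum.swap)
      finally show "(\<Sum>l\<in>J. G l j * (\<Sum>c<N. G l c * x' c)) = (\<Sum>c<N. A $$ (j, c) * x' c)"
        using j by (simp add: A_def sum_distrib_right)
    qed
    also have "\<dots> = (\<Sum>j<N. \<Sum>c<N. ad i j * A $$ (j, c) * x' c)"
      by (simp add: sum_distrib_left mult_ac)
    also have "\<dots> = (\<Sum>c<N. (\<Sum>j<N. ad i j * A $$ (j, c)) * x' c)"
      by (subst sum.swap) (simp add: sum_distrib_right)
    also have "\<dots> = (\<Sum>c<N. (if i = c then D else 0) * x' c)"
    proof (intro sum.cong refl arg_cong2[where f = "(*)"])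
      fix c assume c: "c \<in> {..<N}"
      have "(adj_mat A * A) $$ (i, c) = (\<Sum>j<N. ad i j * A $$ (j, c))"
        using i c A by (auto simp: adj_mat_def ad_def scalar_prod_def atLeast0LessThan intro!: sum.cong)
      then show "(\<Sum>j<N. ad i j * A $$ (j, c)) = (if i = c then D else 0)"
        using i c by (auto simp: adj_mat(3)[OF A] D_def)
    qed
    also have "\<dots> = (\<Sum>c<N. if i = c then D * x' c else 0)"
      by (intro sum.cong) auto
    also have "\<dots> = D * x' i" using i by simp
    finally show ?thesis by simp
  qed
  have split: "nu (\<lambda>l. h l + e) i = nu h i + e * nu (\<lambda>_. 1) i" for i
    by (simp add: nu_def algebra_simps sum.distrib sum_distrib_left)
  define x0 where "x0 c = nu h c / D" for c
  show ?thesis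
  proof (intro exI conjI ballI allI impI)
    fix i assume i: "i \<in> I"
    define g where "g = (\<Sum>c<N. G i c * nu (\<lambda>_. 1) c)"
    have gY: "\<bar>g\<bar> \<le> N * U * Y"
    proof -
      have "\<bar>g\<bar> \<le> real (card {..<N}) * (U * Y)" unfolding g_def
        using GU[OF i] nu_bound[of "\<lambda>_. 1"] U by (intro abs_sum_mult_le) auto
      then show ?thesis by (simp add: mult_ac)
    qed
    have "D * (\<Sum>c<N. G i c * x' c) = (\<Sum>c<N. G i c * (nu h c + e * nu (\<lambda>_. 1) c))"
      by (simp add: sum_distrib_left mult.left_commute[of D] sol split)
    then have xx: "D * (\<Sum>c<N. G i c * x' c) = (\<Sum>c<N. G i c * nu h c) + e * g"
      by (simp only: sum_dist_line g_def)
    have x0e: "D * (\<Sum>c<N. G i c * x0 c) = (\<Sum>c<N. G i c * nu h c)"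
      using \<open>D \<noteq> 0\<close> by (simp add: x0_def sum_distrib_left)
    \<comment> \<open>\<open>D\<close> times the violation of constraint \<open>i\<close> at
      \<open>x0\<close>. It is an integer, and once the sign of \<open>D\<close> is divided out it
      is below 1, hence not positive.\<close>
    define d where "d = D * ((\<Sum>c<N. G i c * x0 c) - h i)"
    have "d \<in> \<int>"
      unfolding d_def right_diff_distrib x0e nu_def
      using i Gint hint J adZ \<open>D \<in> \<int>\<close>
      by (auto intro!: Ints_diff Ints_sum Ints_mult simp: subset_iff)
    then have dZ: "sgn D * d \<in> \<int>" by (auto simp: sgn_if)
    have "d = D * ((\<Sum>c<N. G i c * x' c) - h i) - e * g"
      unfolding d_def right_diff_distrib x0e xx by simp
    then have "sgn D * d = \<bar>D\<bar> * ((\<Sum>c<N. G i c * x' c) - h i) - e * (sgn D * g)"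
      by (simp only: abs_sgn) (simp only: right_diff_distrib mult_ac)
    also have "\<dots> \<le> \<bar>D\<bar> * e + e * \<bar>g\<bar>"
    proof -
      have "\<bar>D\<bar> * ((\<Sum>c<N. G i c * x' c) - h i) \<le> \<bar>D\<bar> * e"
        using x' i by (intro mult_left_mono) auto
      moreover have "e * (- (sgn D * g)) \<le> e * \<bar>g\<bar>"
        using e by (intro mult_left_mono) (auto simp: sgn_if)
      ultimately show ?thesis by simp
    qed
    also have "\<dots> \<le> e * (Y + N * U * Y)"
      using DY gY e mult_left_mono[of "\<bar>D\<bar> + \<bar>g\<bar>" "Y + N * U * Y" e] by (simp add: algebra_simps)
    also have "\<dots> < 1" by (rule e)
    finally have "sgn D * d \<le> 0" using dZ by (auto elim!: Ints_cases)
    then have "\<bar>D\<bar> * ((\<Sum>c<N. G i c * x0 c) - h i) \<le> 0"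
      by (simp add: d_def abs_sgn mult_ac)
    then show "(\<Sum>c<N. G i c * x0 c) \<le> h i"
      using \<open>D \<noteq> 0\<close> by (simp add: mult_le_0_iff)
  next
    fix c assume "c < N"
    have "\<bar>x0 c\<bar> \<le> \<bar>nu h c\<bar> / 1"
      unfolding x0_def abs_divide using D1 by (intro divide_left_mono) auto
    then show "\<bar>x0 c\<bar> \<le> Y" using nu_bound[of h c] hU by simp
  qed
qed

text \<open>The trivial kernel that rounding requires comes from nonnegativity: each variable is
  written as \<open>z c - z n\<close> with \<open>z\<close> nonnegative, one shared extra variable
  instead of one per coordinate. The added rows count in \<open>card I\<close>, which is why n + r +
  2 enters \<open>S\<close>.\<close>

lemma free_exact_from_approximate:
  fixes F :: "nat \<Rightarrow> nat \<Rightarrow> int" and h :: "nat \<Rightarrow> int" and S W :: real and x :: "nat \<Rightarrow> real"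
  assumes S: "real (n + r + 2) \<le> S" "\<And>i. i < r \<Longrightarrow> (\<Sum>c<n. \<bar>real_of_int (F i c)\<bar>) \<le> S"
      "\<And>i. i < r \<Longrightarrow> \<bar>real_of_int (h i)\<bar> \<le> S"
    and W: "W \<ge> S ^ (4 * n + 8)"
    and x: "\<And>i. i < r \<Longrightarrow> (\<Sum>c<n. F i c * x c) \<le> h i + 1 / W"
  shows "\<exists>x :: nat \<Rightarrow> real. (\<forall>i<r. (\<Sum>c<n. F i c * x c) \<le> h i) \<and> (\<forall>c<n. \<bar>x c\<bar> \<le> S ^ (4 * n + 5))"
proof -
  define N where "N = Suc n"
  define I where "I = {..<r + N}"
  define G :: "nat \<Rightarrow> nat \<Rightarrow> real" where "G i c = (if i < r then if c < n then F i c else - (\<Sum>c<n. F i c)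
    else if i = r + c then -1 else 0)" for i c
  define k :: "nat \<Rightarrow> real" where "k i = (if i < r then h i else 0)" for i
  define Y where "Y = (real N * real (card I) * S\<^sup>2) ^ N"
  have S2: "S \<ge> 2" using S(1) by simp
  have "S ^ (4 * n + 8) > 0" using S2 by simp
  then have W0: "W > 0" using W by simp
  have row: "(\<Sum>c<N. G i c * z c) = (if i < r then \<Sum>c<n. F i c * (z c - z n) else - z (i - r))"
    if "i \<in> I" for i and z :: "nat \<Rightarrow> real"
  proof (cases "i < r")
    case True
    then show ?thesis
      by (simp add: G_def N_def right_diff_distrib sum_subtractf sum_distrib_right)
  next
    case False
    have "(\<Sum>c<N. G i c * z c) = (\<Sum>c<N. if c = i - r then - z c else 0)"
      using False by (intro sum.cong) (auto simp: G_def)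
    then show ?thesis using False that by (simp add: I_def)
  qed
  have NS: "real N \<le> S" and IS: "real (card I) \<le> S"
    using S(1) by (auto simp: N_def I_def)
  have Y0: "Y \<ge> 0" by (simp add: Y_def)
  have YS: "Y \<le> S ^ (4 * n + 4)"
  proof -
    have "Y \<le> (S * S * S\<^sup>2) ^ N" unfolding Y_def
      using NS IS S2 by (intro power_mono mult_mono) auto
    also have "S * S * S\<^sup>2 = S ^ 4" by (simp add: power2_eq_square power4_eq_xxxx)
    finally show ?thesis by (simp add: N_def power_mult[symmetric] power_add[symmetric] algebra_simps)
  qed
  have "\<exists>z. (\<forall>i\<in>I. (\<Sum>c<N. G i c * z c) \<le> k i) \<and> (\<forall>c<N. \<bar>z c\<bar> \<le> Y)"
  proof (rule exact_from_approximate[where U = S and e = "1 / W"])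
    show "finite I" "I \<noteq> {}" "N \<ge> 1" by (auto simp: I_def N_def)
    fix y :: "nat \<Rightarrow> real"
    assume y: "\<forall>i\<in>I. (\<Sum>c<N. G i c * y c) = 0"
    show "\<forall>c<N. y c = 0"
    proof (intro allI impI)
      fix c assume "c < N"
      then have "r + c \<in> I" by (simp add: I_def)
      from row[OF this, of y] y this show "y c = 0" by simp
    qed
  next
    \<comment> \<open>A shift that makes all coordinates nonnegative; differences with coordinate
      \<open>n\<close> do not see it.\<close>
    define t where "t = Max ((\<lambda>c. \<bar>x c\<bar>) ` {..<n} \<union> {0})"
    have t: "\<bar>x c\<bar> \<le> t" if "c < n" for c using that by (auto simp: t_def)
    have t0: "t \<ge> 0" by (simp add: t_def)
    define z where "z c = (if c < n then x c + t else t)" for c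
    have "(\<Sum>c<N. G i c * z c) \<le> k i + 1 / W" if i: "i \<in> I" for i
    proof (cases "i < r")
      case True
      then show ?thesis using x[OF True] by (simp add: row[OF i] z_def k_def)
    next
      case False
      have "- z (i - r) \<le> 0" using t[of "i - r"] t0 by (auto simp: z_def)
      moreover have "0 \<le> k i + 1 / W" using False W0 by (simp add: k_def)
      ultimately show ?thesis using False by (simp add: row[OF i])
    qed
    then show "\<forall>i\<in>I. (\<Sum>c<N. G i c * z c) \<le> k i + 1 / W" by simp
  next
    fix i assume i: "i \<in> I"
    show "\<bar>k i\<bar> \<le> S" "k i \<in> \<int>" using S S2 by (auto simp: k_def)
    fix c assume c: "c < N"
    show "G i c \<in> \<int>" by (auto simp: G_def)
    have "\<bar>real_of_int (F i c)\<bar> \<le> S" if "i < r" "c < n"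
      using member_le_sum[of c "{..<n}" "\<lambda>c. \<bar>real_of_int (F i c)\<bar>"] S(2)[of i] that by simp
    moreover have "\<bar>\<Sum>c<n. real_of_int (F i c)\<bar> \<le> S" if "i < r"
      using S(2)[OF that] sum_abs[of "\<lambda>c. real_of_int (F i c)" "{..<n}"] by linarith
    ultimately show "\<bar>G i c\<bar> \<le> S"
      using S2 by (auto simp: G_def)
  next
    show "S \<ge> 1" "1 / W \<ge> 0" using S2 W0 by auto
    show "Y = (real N * real (card I) * S\<^sup>2) ^ N" by (rule Y_def)
    \<comment> \<open>Origin of the exponent: Y <= S^(4n+4), the factor 1 + N S is at most S^3, and
      one further power of S makes the product strictly smaller than W.\<close>
    have "Y + real N * S * Y \<le> Y + S * S * Y"
      using NS S2 Y0 by (intro add_left_mono mult_right_mono) auto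
    also have "\<dots> \<le> S ^ 3 * Y"
    proof -
      have "1 + S * S \<le> S * (S * S)"
        using S2 mult_right_mono[of 2 S "S * S"] mult_mono[of 2 S 2 S] by linarith
      from mult_right_mono[OF this Y0] show ?thesis by (simp add: power3_eq_cube algebra_simps)
    qed
    also have "\<dots> \<le> S ^ 3 * S ^ (4 * n + 4)" using YS S2 by (intro mult_left_mono) auto
    also have "\<dots> = S ^ (4 * n + 7)" by (simp add: power_add[symmetric] add.commute)
    also have "\<dots> < S ^ (4 * n + 8)" using S2 by (intro power_strict_increasing) auto
    finally show "1 / W * (Y + real N * S * Y) < 1" using W W0 by (simp add: field_simps)
  qed
  then obtain z where z: "\<And>i. i \<in> I \<Longrightarrow> (\<Sum>c<N. G i c * z c) \<le> k i" "\<And>c. c < N \<Longrightarrow> \<bar>z c\<bar> \<le> Y" by blast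
  show ?thesis
  proof (intro exI[of _ "\<lambda>c. z c - z n"] conjI allI impI)
    fix i assume "i < r"
    then show "(\<Sum>c<n. F i c * (z c - z n)) \<le> h i"
      using z(1)[of i] row[of i z] by (simp add: I_def k_def)
  next
    fix c assume "c < n"
    then have "\<bar>z c - z n\<bar> \<le> 2 * Y" using z(2)[of c] z(2)[of n] by (simp add: N_def)
    also have "\<dots> \<le> S * S ^ (4 * n + 4)" using YS S2 Y0 by (intro mult_mono) auto
    also have "\<dots> = S ^ (4 * n + 5)" by (simp add: power_add eval_nat_numeral)
    finally show "\<bar>z c - z n\<bar> \<le> S ^ (4 * n + 5)" .
  qed
qed

section \<open>Shrinking simplicial cones\<close>

text \<open>
  The columns of the integer matrix \<open>V\<close> generate the cone; their scale \<open>s\<close> is only used in the analysis.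
\<close>
definition cone_state ::
  "nat \<Rightarrow> (nat \<Rightarrow> real) set \<Rightarrow> real \<Rightarrow> (nat \<Rightarrow> nat \<Rightarrow> int) \<Rightarrow> real \<Rightarrow> bool" where
  "cone_state N Z B V \<delta> \<longleftrightarrow>
     (\<exists>s>0. (\<forall>z\<in>Z. \<exists>w. (\<forall>l<N. 0 \<le> w l) \<and> (\<Sum>l<N. w l) \<le> B \<and>
                (\<forall>c<N. z c = (\<Sum>l<N. w l * (V c l / s)))) \<and>
            \<bar>det (mat N N (\<lambda>(c, l). V c l / s))\<bar> \<le> \<delta>)"

text \<open>With t = 1/(2 N^2), the first constant is 1/t. The second keeps the rounding error of a
  multiplier below t/(16 N), so that all roundings of a step together cost less volume than the
  exact multipliers gain.\<close>

definition shrink_num :: "nat \<Rightarrow> int" where "shrink_num N = 2 * int N ^ 2"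
definition shrink_prec :: "nat \<Rightarrow> int" where "shrink_prec N = 32 * int N ^ 3"

text \<open>
  Here \<open>p l\<close> is the value of a violated inequality at column \<open>l\<close>, and \<open>j\<close> maximizes \<open>p\<close>. Column \<open>l\<close> is
  moved by a multiple of column \<open>j\<close>; the multiplier \<open>p l / (2 N\<^sup>2 p j - p l)\<close> is rounded up to a multiple
  of \<open>1 / shrink_prec N\<close>.
\<close>
definition shrink_coeff :: "nat \<Rightarrow> (nat \<Rightarrow> int) \<Rightarrow> nat \<Rightarrow> nat \<Rightarrow> int" where
  "shrink_coeff N p j l = - ((- (shrink_prec N * p l)) div (shrink_num N * p j - p l))"

text \<open>Column l becomes 1 + q times itself minus q times column j, and the common denominator
  \<open>shrink_prec N\<close> of all q is cleared. At l = j the coefficient cancels: column j is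
  only multiplied by that denominator.\<close>

definition shrink :: "nat \<Rightarrow> (nat \<Rightarrow> int) \<Rightarrow> nat \<Rightarrow> (nat \<Rightarrow> nat \<Rightarrow> int) \<Rightarrow> nat \<Rightarrow> nat \<Rightarrow> int" where
  "shrink N p j V c l =
     (shrink_prec N + shrink_coeff N p j l) * V c l - shrink_coeff N p j l * V c j"

section \<open>Volume loss of one shrinking step\<close>

text \<open>Replacing two values p, q <= 1 by 1 and p + q - 1 preserves their sum and lowers (1 - t
  p)(1 - t q) by t^2 (1 - p)(1 - q). Repetition drives all values but one to 1, the extreme case on
  the left.\<close>

lemma prod_merge_ge:
  fixes p :: "'i \<Rightarrow> real"
  assumes "finite A" "A \<noteq> {}" "\<And>i. i \<in> A \<Longrightarrow> p i \<le> 1" "0 \<le> t" "t \<le> 1"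
  shows "(1 - t) ^ (card A - 1) * (1 - t * (sum p A - (real (card A) - 1))) \<le> (\<Prod>i\<in>A. 1 - t * p i)"
  using assms
proof (induction A rule: finite_ne_induct)
  case (insert a A)
  define B where "B = sum p A - (real (card A) - 1)"
  have cA: "card A \<ge> 1" using insert by (simp add: Suc_le_eq card_gt_0_iff)
  have "sum p A \<le> (\<Sum>i\<in>A. 1)" using insert by (intro sum_mono) auto
  then have B1: "B \<le> 1" by (simp add: B_def)
  have IH: "(1 - t) ^ (card A - 1) * (1 - t * B) \<le> (\<Prod>i\<in>A. 1 - t * p i)"
    unfolding B_def using insert by (intro insert.IH) auto
  have a1: "p a \<le> 1" using insert.prems by simp
  have ta: "0 \<le> 1 - t * p a" using insert.prems a1 mult_left_mono[of "p a" 1 t] by simp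
  have "0 \<le> t * t * ((1 - p a) * (1 - B))" using a1 B1 by simp
  then have merge: "(1 - t) * (1 - t * (p a + B - 1)) \<le> (1 - t * p a) * (1 - t * B)"
    by (simp add: algebra_simps)
  have "(1 - t) ^ card A * (1 - t * (p a + B - 1))
      = (1 - t) ^ (card A - 1) * ((1 - t) * (1 - t * (p a + B - 1)))"
    using cA by (cases "card A") auto
  also have "\<dots> \<le> (1 - t) ^ (card A - 1) * ((1 - t * p a) * (1 - t * B))"
    using merge insert.prems by (intro mult_left_mono) auto
  also have "\<dots> \<le> (1 - t * p a) * (\<Prod>i\<in>A. 1 - t * p i)"
    using mult_left_mono[OF IH ta] by (simp add: mult_ac)
  finally show ?case
    using insert.hyps cA by (simp add: B_def algebra_simps)
qed simp

text \<open>The product is the reciprocal of the volume factor for exact multipliers, with values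
  cut off at -(N-1) to keep the factors bounded. The cut-off is harmless: either it does not occur,
  and the values other than \<open>p j = 1\<close> sum to at most -1, or one value -(N-1) outweighs
  the other N - 2, which are at most 1.\<close>

lemma prod_shrink_ge:
  fixes p :: "nat \<Rightarrow> real"
  assumes j: "j < N" and N: "N \<ge> 2" and pj: "p j = 1" and p1: "\<And>l. l < N \<Longrightarrow> p l \<le> 1"
    and sum: "(\<Sum>l<N. p l) \<le> 0" and t: "t = 1 / (2 * real N ^ 2)"
  shows "1 + t / 2 \<le> (\<Prod>l\<in>{..<N} - {j}. 1 - t * max (p l) (- (real N - 1)))"
proof -
  define A where "A = {..<N} - {j}"
  define q where "q l = max (p l) (- (real N - 1))" for l
  have A: "finite A" "card A = N - 1" using j by (auto simp: A_def)
  have Ane: "A \<noteq> {}" using A N by force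
  have "1 \<le> real N ^ 2" using N by (intro one_le_power) simp
  then have "t \<le> 1 / 2" unfolding t by (intro frac_le) linarith+
  then have t0: "0 \<le> t" "t \<le> 1" by (simp_all add: t)
  have q1: "q l \<le> 1" if "l \<in> A" for l using that p1[of l] N by (auto simp: q_def A_def)
  have sq: "sum q A \<le> -1"
  proof (cases "\<exists>l\<in>A. p l < - (real N - 1)")
    case True
    then obtain l where l: "l \<in> A" "p l < - (real N - 1)" by blast
    have "sum q (A - {l}) \<le> (\<Sum>i\<in>A - {l}. 1)" using q1 by (intro sum_mono) auto
    also have "\<dots> = real N - 2" using A l N by (simp add: card_Diff_singleton of_nat_diff)
    finally show ?thesis using l A by (simp add: sum.remove[of A l] q_def)
  next
    case False
    then have "sum q A = sum p A" by (intro sum.cong) (auto simp: q_def)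
    also have "\<dots> = (\<Sum>l<N. p l) - p j" using j by (simp add: A_def sum_diff1)
    finally show ?thesis using sum pj by simp
  qed
  have Nt: "(real N - 2) * t \<ge> 0" using N t0 by simp
  \<comment> \<open>Expansion gives 1 + t - (N-1)(N-2) t^2; the choice t = 1/(2 N^2) keeps the
    quadratic term at most t/2.\<close>
  have "1 + t / 2 \<le> (1 - (real N - 2) * t) * (1 + t * (real N - 1))"
  proof -
    have "(real N - 2) * (real N - 1) * t * t \<le> real N ^ 2 * t * t"
      using N t0 by (intro mult_right_mono) (auto simp: power2_eq_square intro!: mult_mono)
    also have "\<dots> = t / 2" using N by (simp add: t field_simps power2_eq_square)
    finally show ?thesis by (simp add: algebra_simps)
  qed
  also have "\<dots> \<le> (1 - t) ^ (N - 2) * (1 - t * (sum q A - (real (card A) - 1)))"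
  proof (intro mult_mono)
    show "1 - (real N - 2) * t \<le> (1 - t) ^ (N - 2)"
      using Bernoulli_inequality[of "- t" "N - 2"] t0 N by (simp add: of_nat_diff)
    have "t * (sum q A - (real (card A) - 1)) \<le> t * (-1 - (real N - 2))"
      using sq A N t0 by (intro mult_left_mono) (auto simp: of_nat_diff)
    then show "1 + t * (real N - 1) \<le> 1 - t * (sum q A - (real (card A) - 1))"
      by (simp add: algebra_simps)
    show "0 \<le> (1 - t) ^ (N - 2)" "0 \<le> 1 + t * (real N - 1)" using t0 N by auto
  qed
  also have "\<dots> = (1 - t) ^ (card A - 1) * (1 - t * (sum q A - (real (card A) - 1)))"
    using A by (simp add: numeral_2_eq_2)
  also have "\<dots> \<le> (\<Prod>l\<in>A. 1 - t * q l)"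
    using A Ane q1 t0 by (intro prod_merge_ge) auto
  finally show ?thesis by (simp add: A_def q_def)
qed

text \<open>The operations amount to right multiplication by a matrix whose off-diagonal entries lie
  in row \<open>j\<close> only. A permutation other than the identity moves some index different
  from \<open>j\<close>, so in the Leibniz formula only the diagonal survives.\<close>

lemma det_column_ops:
  fixes w :: "nat \<Rightarrow> nat \<Rightarrow> real"
  assumes j: "j < N"
  shows "det (mat N N (\<lambda>(c, l). (1 + q l) * w c l - q l * w c j))
       = (\<Prod>l\<in>{..<N} - {j}. 1 + q l) * det (mat N N (\<lambda>(c, l). w c l))"
proof -
  define E where "E = mat N N (\<lambda>(a, l). (if a = l then 1 + q l else 0) - (if a = j then q l else 0))"
  have E: "E \<in> carrier_mat N N" by (simp add: E_def)
  have "mat N N (\<lambda>(c, l). (1 + q l) * w c l - q l * w c j) = mat N N (\<lambda>(c, l). w c l) * E"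
  proof (rule eq_matI)
    fix c l assume cl: "c < dim_row (mat N N (\<lambda>(c, l). w c l) * E)" "l < dim_col (mat N N (\<lambda>(c, l). w c l) * E)"
    have "(mat N N (\<lambda>(c, l). w c l) * E) $$ (c, l)
        = (\<Sum>a<N. w c a * ((if a = l then 1 + q l else 0) - (if a = j then q l else 0)))"
      using cl by (simp add: E_def scalar_prod_def atLeast0LessThan)
    also have "\<dots> = (\<Sum>a<N. if a = l then w c a * (1 + q l) else 0) - (\<Sum>a<N. if a = j then w c a * q l else 0)"
      by (simp add: right_diff_distrib sum_subtractf if_distrib[of "(*) _"] cong: if_cong)
    also have "\<dots> = w c l * (1 + q l) - w c j * q l" using cl j by (simp add: E_def)
    finally show "mat N N (\<lambda>(c, l). (1 + q l) * w c l - q l * w c j) $$ (c, l) = (mat N N (\<lambda>(c, l). w c l) * E) $$ (c, l)"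
      using cl by (simp add: E_def mult_ac)
  qed (auto simp: E_def)
  moreover have "det E = (\<Prod>l\<in>{..<N} - {j}. 1 + q l)"
  proof -
    have "signof p * (\<Prod>i = 0..<N. E $$ (i, p i)) = 0" if p: "p permutes {0..<N}" "p \<noteq> id" for p
    proof -
      obtain i where i: "p i \<noteq> i" using p by (auto simp: fun_eq_iff)
      have "\<exists>i. i \<noteq> j \<and> p i \<noteq> i"
      \<comment> \<open>A permutation that moves \<open>j\<close> also moves \<open>p j\<close>,
        which differs from \<open>j\<close>.\<close>
      proof (cases "i = j")
        case True
        then have "p (p j) \<noteq> p j" using i permutes_inj[OF p(1)] by (auto dest: injD)
        then show ?thesis using i True by blast
      qed (use i in blast)
      then obtain a where a: "a \<noteq> j" "p a \<noteq> a" by blast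
      then have "a \<in> {0..<N}" using p(1) by (auto simp: permutes_def)
      moreover from this have "p a < N" using permutes_in_image[OF p(1), of a] by simp
      ultimately have "E $$ (a, p a) = 0" using a by (simp add: E_def)
      then have "(\<Prod>i = 0..<N. E $$ (i, p i)) = 0" using \<open>a \<in> {0..<N}\<close> by (intro prod_zero) auto
      then show ?thesis by simp
    qed
    then have "det E = (\<Sum>p\<in>{id}. signof p * (\<Prod>i = 0..<N. E $$ (i, p i)))"
      unfolding det_def'[OF E] by (intro sum.mono_neutral_right) (auto intro: permutes_id finite_permutations)
    also have "\<dots> = (\<Prod>i<N. E $$ (i, i))" by (simp add: atLeast0LessThan)
    also have "\<dots> = E $$ (j, j) * (\<Prod>i\<in>{..<N} - {j}. E $$ (i, i))"
      using j by (intro prod.remove) auto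
    also have "\<dots> = (\<Prod>l\<in>{..<N} - {j}. 1 + q l)"
      using j by (simp add: E_def)
    finally show ?thesis .
  qed
  ultimately show ?thesis by (simp add: det_mult[OF _ E])
qed

text \<open>The negated floor of a negated quotient is a ceiling. The quotient lies between -1 and 1
  because \<open>shrink_num N\<close> is at least 8 and \<open>p l\<close> is at most
  \<open>p j\<close>; the bound on the coefficient that follows controls the growth of the
  integers.\<close>

lemma shrink_coeff_bounds:
  assumes N: "N \<ge> 2" and pj: "p j > 0" and le: "p l \<le> p j"
  shows "shrink_prec N * (real_of_int (p l) / (shrink_num N * p j - p l)) \<le> shrink_coeff N p j l"
    "shrink_coeff N p j l < shrink_prec N * (real_of_int (p l) / (shrink_num N * p j - p l)) + 1"
    "shrink_num N * p j - p l > 0" "\<bar>shrink_coeff N p j l\<bar> \<le> shrink_prec N"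
proof -
  define K where "K = shrink_num N"
  define Q where "Q = shrink_prec N"
  have Q: "Q \<ge> 0" by (simp add: Q_def shrink_prec_def)
  have "4 \<le> int N ^ 2" using N power_mono[of 2 "int N" 2] by simp
  then have K: "K \<ge> 8" by (simp add: K_def shrink_num_def)
  have KP: "K * p j \<ge> 8 * p j" using K pj by (intro mult_right_mono) auto
  then show den: "shrink_num N * p j - p l > 0" using le pj unfolding K_def by linarith
  have c: "shrink_coeff N p j l = \<lceil>real_of_int (Q * p l) / real_of_int (K * p j - p l)\<rceil>"
    by (simp only: ceiling_divide_eq_div shrink_coeff_def K_def Q_def minus_mult_left)
  have e: "real_of_int (Q * p l) / real_of_int (K * p j - p l) = Q * (real_of_int (p l) / (K * p j - p l))"
    by simp
  show "shrink_prec N * (real_of_int (p l) / (shrink_num N * p j - p l)) \<le> shrink_coeff N p j l"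
    "shrink_coeff N p j l < shrink_prec N * (real_of_int (p l) / (shrink_num N * p j - p l)) + 1"
    unfolding c e using ceiling_correct[of "Q * (real_of_int (p l) / (K * p j - p l))"]
    by (auto simp: K_def Q_def)
  have den': "real_of_int (K * p j - p l) > 0" using den by (simp only: K_def of_int_0_less_iff)
  have "real_of_int (p l) \<le> real_of_int (K * p j - p l)" "- real_of_int (p l) \<le> real_of_int (K * p j - p l)"
    unfolding of_int_le_iff of_int_minus[symmetric] using KP le pj by linarith+
  then have "real_of_int (p l) / real_of_int (K * p j - p l) \<le> 1" "-1 \<le> real_of_int (p l) / real_of_int (K * p j - p l)"
    using den' by (simp_all add: divide_simps)
  then have "Q * (real_of_int (p l) / real_of_int (K * p j - p l)) \<le> real_of_int Q * 1" "real_of_int Q * (-1) \<le> Q * (real_of_int (p l) / real_of_int (K * p j - p l))"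
    using Q by (intro mult_left_mono; simp)+
  then have "shrink_coeff N p j l \<le> Q" "- Q \<le> shrink_coeff N p j l"
    unfolding c e by (auto simp: ceiling_le_iff le_ceiling_iff)
  then show "\<bar>shrink_coeff N p j l\<bar> \<le> shrink_prec N" by (simp add: Q_def)
qed

text \<open>For a point with weights v, the new weights are v_l/(1 + q_l) for l other than j, and
  column j takes up the rest: v_j plus the sum of v_l q_l/(1 + q_l). The total weight does not
  change, so \<open>B\<close> is kept. The weight of column j is nonnegative because the point
  satisfies the violated inequality: the sum of v_l p_l is positive, and q_l/(1 + q_l) >= t p_l/p_j.
  The determinant is multiplied by the product of all 1 + q_l with l other than j.\<close>

lemma cone_state_shrink:
  fixes V :: "nat \<Rightarrow> nat \<Rightarrow> int" and a :: "nat \<Rightarrow> int"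
  assumes st: "cone_state N Z B V \<delta>" and N: "N \<ge> 2" and j: "j < N"
    and pos: "\<And>z :: nat \<Rightarrow> real. z \<in> Z \<Longrightarrow> (\<Sum>c<N. a c * z c) > 0" and Z: "Z \<noteq> {}"
    and p: "\<And>l. l < N \<Longrightarrow> p l = (\<Sum>c<N. a c * V c l)"
    and le: "\<And>l. l < N \<Longrightarrow> p l \<le> p j" and sum: "(\<Sum>l<N. p l) \<le> 0"
  shows "p j > 0" "cone_state N Z B (shrink N p j V) (\<delta> / (1 + 1 / (16 * real N ^ 2)))"
proof -
  obtain s where s: "s > 0"
    and w: "\<And>z. z \<in> Z \<Longrightarrow> \<exists>w. (\<forall>l<N. 0 \<le> w l) \<and> (\<Sum>l<N. w l) \<le> B \<and>
                (\<forall>c<N. z c = (\<Sum>l<N. w l * (V c l / s)))"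
    and dt: "\<bar>det (mat N N (\<lambda>(c, l). V c l / s))\<bar> \<le> \<delta>"
    using st unfolding cone_state_def by blast
  have az: "(\<Sum>l<N. w l * p l) > 0"
    if z: "z \<in> Z" and wz: "\<forall>c<N. z c = (\<Sum>l<N. w l * (V c l / s))" for z w :: "nat \<Rightarrow> real"
  proof -
    have "s * (\<Sum>c<N. a c * z c) = (\<Sum>c<N. \<Sum>l<N. a c * (w l * V c l))"
      using s wz by (simp add: sum_distrib_left)
    also have "\<dots> = (\<Sum>l<N. \<Sum>c<N. a c * (w l * V c l))" by (rule sum.swap)
    also have "\<dots> = (\<Sum>l<N. w l * p l)" by (simp add: p sum_distrib_left mult_ac)
    finally show ?thesis using s pos[OF z] by (metis mult_pos_pos)
  qed
  \<comment> \<open>If no generator had a positive value, no point of the cone would satisfy the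
    inequality.\<close>
  show pj: "p j > 0"
  proof (rule ccontr)
    assume npj: "\<not> p j > 0"
    obtain z where z: "z \<in> Z" using Z by blast
    obtain v where v: "\<forall>l<N. 0 \<le> v l" "\<forall>c<N. z c = (\<Sum>l<N. v l * (V c l / s))" using w[OF z] by blast
    have "(\<Sum>l<N. v l * p l) \<le> 0"
      using v(1) le npj by (intro sum_nonpos mult_nonneg_nonpos) force+
    then show False using az[OF z v(2)] by simp
  qed
  define t where "t = 1 / (2 * real N ^ 2)"
  define P where "P l = real_of_int (p l) / p j" for l
  define Q where "Q = shrink_prec N"
  define H where "H = shrink_coeff N p j"
  define q where "q l = real_of_int (H l) / Q" for l
  \<comment> \<open>The exact multiplier, determined by 1 + x = 1/(1 - t P).\<close>
  define x where "x l = t * P l / (1 - t * P l)" for l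
  have "4 \<le> real N ^ 2" using N power_mono[of 2 "real N" 2] by simp
  then have "t \<le> 1 / 8" unfolding t_def by (intro frac_le) linarith+
  moreover have "0 < t" using N by (simp add: t_def)
  ultimately have t: "0 < t" "t \<le> 1 / 8" by blast+
  have Q: "Q > 0" using N by (simp add: Q_def shrink_prec_def)
  have P1: "P l \<le> 1" if "l < N" for l using le[OF that] pj by (simp add: P_def)
  have tP: "1 - t * P l \<ge> 7 / 8" if "l < N" for l
    using mult_left_mono[OF P1[OF that], of t] t by linarith
  have xeq: "real_of_int (p l) / (shrink_num N * p j - p l) = x l" for l
    using pj N unfolding x_def P_def t_def shrink_num_def by (simp add: divide_simps) (simp add: algebra_simps)?
  have qx: "x l \<le> q l" "q l < x l + 1 / Q" if "l < N" for l
    using shrink_coeff_bounds(1,2)[of N p j l, OF N pj le[OF that]] Q unfolding xeq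
    by (auto simp: q_def H_def Q_def divide_simps algebra_simps)
  have x1: "1 + x l = 1 / (1 - t * P l)" if "l < N" for l
    using tP[OF that] by (simp add: x_def field_simps)
  have x1p: "1 + x l > 0" if "l < N" for l using tP[OF that] x1[OF that] by simp
  have q1: "1 + q l > 0" if "l < N" for l using qx(1)[OF that] x1p[OF that] by simp
  have V': "shrink N p j V c l / (Q * s) = (1 + q l) * (V c l / s) - q l * (V c j / s)" for c l
    using s Q by (simp add: shrink_def q_def H_def Q_def field_simps)
  show "cone_state N Z B (shrink N p j V) (\<delta> / (1 + 1 / (16 * real N ^ 2)))"
    unfolding cone_state_def
  \<comment> \<open>The factor \<open>Q\<close> with which \<open>shrink\<close> clears denominators
    is absorbed by the scale.\<close>
  proof (intro exI[of _ "Q * s"] conjI ballI)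
    show "0 < Q * s" using Q s by simp
  next
    fix z assume z: "z \<in> Z"
    obtain v where v: "\<forall>l<N. 0 \<le> v l" "(\<Sum>l<N. v l) \<le> B"
      "\<forall>c<N. z c = (\<Sum>l<N. v l * (V c l / s))" using w[OF z] by blast
    define A where "A = {..<N} - {j}"
    have spl: "(\<Sum>l<N. f l) = f j + sum f A" for f :: "nat \<Rightarrow> real"
      using j by (simp add: A_def sum.remove)
    define y where "y = (\<Sum>l\<in>A. v l * (q l / (1 + q l)))"
    define u where "u l = (if l = j then v j + y else v l / (1 + q l))" for l
    have uA: "(\<Sum>l\<in>A. f (u l) l) = (\<Sum>l\<in>A. f (v l / (1 + q l)) l)" for f :: "real \<Rightarrow> nat \<Rightarrow> real"
      by (intro sum.cong) (auto simp: A_def u_def)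
    have AN: "l \<in> A \<Longrightarrow> l < N" for l by (auto simp: A_def)
    have "u j \<ge> 0"
    proof -
      have "t * (\<Sum>l\<in>A. v l * P l) \<le> y"
        unfolding y_def sum_distrib_left
      proof (rule sum_mono)
        fix l assume "l \<in> A"
        then have l: "l < N" by (rule AN)
        \<comment> \<open>Here the direction of rounding matters: 1 - 1/(1 + x) increases with x, so
          a multiplier that is rounded up keeps the inequality.\<close>
        have "t * P l = 1 - 1 / (1 + x l)" using x1[OF l] tP[OF l] by simp
        also have "\<dots> \<le> 1 - 1 / (1 + q l)"
          using qx(1)[OF l] x1p[OF l] by (simp add: frac_le)
        also have "\<dots> = q l / (1 + q l)" using q1[OF l] by (simp add: field_simps)
        finally have "v l * (t * P l) \<le> v l * (q l / (1 + q l))"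
          using v(1) l by (intro mult_left_mono) auto
        then show "t * (v l * P l) \<le> v l * (q l / (1 + q l))" by (simp add: mult_ac)
      qed
      moreover have "0 \<le> (\<Sum>l<N. v l * P l)"
        using az[OF z v(3)] pj by (simp add: P_def sum_divide_distrib[symmetric])
      then have "t * 0 \<le> t * (v j + (\<Sum>l\<in>A. v l * P l))"
        using t pj by (intro mult_left_mono) (simp_all add: spl P_def)
      moreover have "t * v j \<le> 1 * v j" using t v(1) j by (intro mult_right_mono) auto
      ultimately show ?thesis by (simp add: u_def distrib_left)
    qed
    show "\<exists>w. (\<forall>l<N. 0 \<le> w l) \<and> (\<Sum>l<N. w l) \<le> B \<and>
           (\<forall>c<N. z c = (\<Sum>l<N. w l * (real_of_int (shrink N p j V c l) / (Q * s))))"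
    proof (intro exI[of _ u] conjI allI impI)
      fix l assume l: "l < N"
      show "0 \<le> u l" using \<open>u j \<ge> 0\<close> v(1) q1[OF l] l by (cases "l = j") (auto simp: u_def)
    next
      have "(\<Sum>l<N. u l) = v j + (\<Sum>l\<in>A. v l * (q l / (1 + q l)) + v l / (1 + q l))"
        using uA[of "\<lambda>u l. u"] by (simp add: spl y_def sum.distrib) (simp add: u_def y_def)
      also have "(\<Sum>l\<in>A. v l * (q l / (1 + q l)) + v l / (1 + q l)) = sum v A"
      proof (rule sum.cong)
        fix l assume "l \<in> A"
        then have "0 < 1 + q l" by (intro q1 AN)
        then have "q l / (1 + q l) = 1 - 1 / (1 + q l)" by (simp add: field_simps)
        then show "v l * (q l / (1 + q l)) + v l / (1 + q l) = v l" by (simp add: right_diff_distrib)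
      qed simp
      finally show "(\<Sum>l<N. u l) \<le> B" using v(2) by (simp add: spl)
    next
      fix c assume c: "c < N"
      define b where "b l = V c l / s" for l
      have "(\<Sum>l<N. u l * (real_of_int (shrink N p j V c l) / (Q * s)))
          = (\<Sum>l<N. u l * ((1 + q l) * b l - q l * b j))"
        unfolding V' b_def ..
      also have "\<dots> = (v j + y) * b j + (\<Sum>l\<in>A. v l / (1 + q l) * ((1 + q l) * b l - q l * b j))"
        unfolding spl uA[of "\<lambda>u l. u * ((1 + q l) * b l - q l * b j)"] by (simp add: u_def algebra_simps)
      also have "(\<Sum>l\<in>A. v l / (1 + q l) * ((1 + q l) * b l - q l * b j))
          = (\<Sum>l\<in>A. v l * b l - v l * (q l / (1 + q l)) * b j)"
      proof (rule sum.cong)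
        fix l assume "l \<in> A"
        then have "0 < 1 + q l" by (intro q1 AN)
        then show "v l / (1 + q l) * ((1 + q l) * b l - q l * b j)
            = v l * b l - v l * (q l / (1 + q l)) * b j"
          by (simp add: right_diff_distrib)
      qed simp
      also have "\<dots> = (\<Sum>l\<in>A. v l * b l) - y * b j"
        by (simp add: sum_subtractf y_def sum_distrib_right)
      also have "(v j + y) * b j + ((\<Sum>l\<in>A. v l * b l) - y * b j) = (\<Sum>l<N. v l * b l)"
        by (simp add: spl algebra_simps)
      finally show "z c = (\<Sum>l<N. u l * (real_of_int (shrink N p j V c l) / (Q * s)))"
        using v(3) c by (simp add: b_def)
    qed
  next
    define A where "A = {..<N} - {j}"
    \<comment> \<open>Cut off below, so that 1 - t m <= 2 and the additive rounding error in q
      becomes a relative error \<open>e\<close>.\<close>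
    define m where "m l = max (P l) (- (real N - 1))" for l
    define e where "e = 2 / real_of_int Q"
    have e: "e = t / (8 * N)" using N
      by (simp add: e_def Q_def shrink_prec_def t_def field_simps power2_eq_square power3_eq_cube)
    have e01: "0 < e" "e \<le> 1" using t N unfolding e by (auto simp: divide_simps)
    have tm: "t * m l \<le> t * 1" if "l < N" for l
      using P1[OF that] N t by (intro mult_left_mono) (auto simp: m_def)
    have m1: "0 < 1 - t * m l" if "l < N" for l using tm[OF that] t by linarith
    have m2: "1 - t * m l \<le> 2" for l
    proof -
      have "t * (- (real N - 1)) \<le> t * m l" using t by (intro mult_left_mono) (auto simp: m_def)
      moreover have "t * (real N - 1) \<le> 1"
      proof -
        have "real N * 1 \<le> real N * real N" using N by (intro mult_left_mono) auto
        then have "real N - 1 \<le> real N ^ 2 * 2" unfolding power2_eq_square by linarith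
        then show ?thesis using N by (simp add: t_def field_simps)
      qed
      ultimately show ?thesis unfolding mult_minus_right by linarith
    qed
    have fac: "1 + q l \<le> (1 + e) / (1 - t * m l)" if l: "l < N" for l
    proof -
      have "1 + q l \<le> 1 / (1 - t * P l) + e / 2" using qx(2)[OF l] x1[OF l] by (simp add: e_def)
      also have "\<dots> \<le> 1 / (1 - t * m l) + e / (1 - t * m l)"
      proof (intro add_mono)
        have "t * P l \<le> t * m l" using t by (intro mult_left_mono) (auto simp: m_def)
        then show "1 / (1 - t * P l) \<le> 1 / (1 - t * m l)" using m1[OF l] by (intro frac_le) auto
        show "e / 2 \<le> e / (1 - t * m l)" using e01 m1[OF l] m2[of l] by (intro frac_le) auto
      qed
      finally show ?thesis by (simp add: add_divide_distrib)
    qed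
    have "(\<Prod>l\<in>A. 1 + q l) \<le> (\<Prod>l\<in>A. (1 + e) / (1 - t * m l))"
      using fac q1 by (intro prod_mono) (force simp: A_def less_imp_le)
    also have "\<dots> = (1 + e) ^ (N - 1) / (\<Prod>l\<in>A. 1 - t * m l)"
      using j by (simp add: prod_dividef A_def)
    also have "\<dots> \<le> (1 / (1 - t / 8)) / (1 + t / 2)"
    proof (rule frac_le)
      have sumP: "(\<Sum>l<N. P l) \<le> 0"
      proof -
        have "(\<Sum>l<N. P l) = real_of_int (\<Sum>l<N. p l) / p j" by (simp add: P_def sum_divide_distrib)
        then show ?thesis using sum pj by (simp add: divide_nonpos_pos del: of_int_sum)
      qed
      show "1 + t / 2 \<le> (\<Prod>l\<in>A. 1 - t * m l)"
        unfolding A_def m_def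
        by (rule prod_shrink_ge[where p = P]) (use j N P1 sumP pj in \<open>simp_all add: t_def P_def\<close>)
      \<comment> \<open>Bernoulli bounds (1 - e)^N from below; since (1 - e)(1 + e) <= 1, this turns
        into an upper bound for (1 + e)^N.\<close>
      have "(1 - t / 8) \<le> (1 - e) ^ N"
        using Bernoulli_inequality[of "- e" N] e01 N by (simp add: e)
      then have "(1 - t / 8) * (1 + e) ^ N \<le> (1 - e) ^ N * (1 + e) ^ N"
        using e01 by (intro mult_right_mono) auto
      also have "\<dots> = (1 - e * e) ^ N" by (simp add: power_mult_distrib[symmetric] algebra_simps)
      also have "\<dots> \<le> 1" using e01 by (intro power_le_one) (auto simp: mult_le_one)
      finally have "(1 + e) ^ N \<le> 1 / (1 - t / 8)" using t by (simp add: field_simps)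
      moreover have "(1 + e) ^ (N - 1) \<le> (1 + e) ^ N" using e01 by (intro power_increasing) auto
      ultimately show "(1 + e) ^ (N - 1) \<le> 1 / (1 - t / 8)" by simp
    qed (use t in auto)
    \<comment> \<open>The gain 1 + t/2 outweighs the rounding loss 1/(1 - t/8) and leaves 1 + t/8 =
      1 + 1/(16 N^2).\<close>
    also have "\<dots> \<le> 1 / (1 + t / 8)"
    proof -
      have "t * t \<le> t * 1" using t by (intro mult_left_mono) auto
      moreover have "(1 - t / 8) * (1 + t / 2) = 1 + 3 * t / 8 - t * t / 16"
        by (simp add: field_simps)
      ultimately have "1 + t / 8 \<le> (1 - t / 8) * (1 + t / 2)" using t by linarith
      then have "1 / ((1 - t / 8) * (1 + t / 2)) \<le> 1 / (1 + t / 8)" using t by (intro frac_le) auto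
      then show ?thesis by simp
    qed
    finally have pr: "(\<Prod>l\<in>A. 1 + q l) \<le> 1 / (1 + 1 / (16 * real N ^ 2))"
      by (simp add: t_def)
    have pr0: "(\<Prod>l\<in>A. 1 + q l) \<ge> 0" using q1 by (intro prod_nonneg) (force simp: A_def less_imp_le)
    have "\<bar>det (mat N N (\<lambda>(c, l). real_of_int (shrink N p j V c l) / (Q * s)))\<bar>
        = (\<Prod>l\<in>A. 1 + q l) * \<bar>det (mat N N (\<lambda>(c, l). V c l / s))\<bar>"
      unfolding V' using pr0 det_column_ops[OF j, of q "\<lambda>c l. V c l / s"] by (simp add: A_def abs_mult)
    also have "\<dots> \<le> 1 / (1 + 1 / (16 * real N ^ 2)) * \<delta>"
      using pr dt pr0 by (intro mult_mono) auto
    finally show "\<bar>det (mat N N (\<lambda>(c, l). real_of_int (shrink N p j V c l) / (Q * s)))\<bar>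
        \<le> \<delta> / (1 + 1 / (16 * real N ^ 2))" by simp
  qed
qed

section \<open>Initial volume and lower bound for the volume\<close>

text \<open>The weights of the points z0 + \<rho> e_k minus those of z0, divided by \<rho>, form the
  inverse of the scaled generator matrix. Its entries are at most B/\<rho> because all weights lie
  between 0 and B. So its determinant is bounded, and that of the generator matrix cannot be too
  small.\<close>

lemma cone_state_lower_bound:
  assumes st: "cone_state N Z B V \<delta>" and \<rho>: "\<rho> > 0" and N: "N \<ge> 1"
    and z0: "z0 \<in> Z" and zk: "\<And>k. k < N \<Longrightarrow> (\<lambda>c. z0 c + (if c = k then \<rho> else 0)) \<in> Z"
  shows "1 \<le> \<delta> * (fact N * (B / \<rho>) ^ N)"
proof -
  obtain s where s: "s > 0"
    and w: "\<And>z. z \<in> Z \<Longrightarrow> \<exists>w. (\<forall>l<N. 0 \<le> w l) \<and> (\<Sum>l<N. w l) \<le> B \<and>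
                (\<forall>c<N. z c = (\<Sum>l<N. w l * (V c l / s)))"
    and dt: "\<bar>det (mat N N (\<lambda>(c, l). V c l / s))\<bar> \<le> \<delta>"
    using st unfolding cone_state_def by blast
  obtain v where v: "\<forall>l<N. 0 \<le> v l" "(\<Sum>l<N. v l) \<le> B" "\<forall>c<N. z0 c = (\<Sum>l<N. v l * (V c l / s))"
    using w[OF z0] by blast
  have "\<forall>k. \<exists>u. k < N \<longrightarrow> (\<forall>l<N. 0 \<le> u l) \<and> (\<Sum>l<N. u l) \<le> B \<and>
                (\<forall>c<N. z0 c + (if c = k then \<rho> else 0) = (\<Sum>l<N. u l * (V c l / s)))"
    using w[OF zk] by blast
  then obtain u where u: "\<And>k l. k < N \<Longrightarrow> l < N \<Longrightarrow> 0 \<le> u k l" "\<And>k. k < N \<Longrightarrow> (\<Sum>l<N. u k l) \<le> B"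
    "\<And>k c. k < N \<Longrightarrow> c < N \<Longrightarrow> z0 c + (if c = k then \<rho> else 0) = (\<Sum>l<N. u k l * (V c l / s))"
    by metis
  define Vm where "Vm = mat N N (\<lambda>(c, l). V c l / s)"
  define X where "X = mat N N (\<lambda>(l, k). (u k l - v l) / \<rho>)"
  have "Vm * X = 1\<^sub>m N"
  proof (rule eq_matI)
    fix c k assume "c < dim_row (1\<^sub>m N :: real mat)" "k < dim_col (1\<^sub>m N :: real mat)"
    then have ck: "c < N" "k < N" by auto
    have "(Vm * X) $$ (c, k) = (\<Sum>l<N. (V c l / s) * ((u k l - v l) / \<rho>))"
      using ck by (simp add: Vm_def X_def scalar_prod_def atLeast0LessThan)
    also have "\<dots> = ((\<Sum>l<N. u k l * (V c l / s)) - (\<Sum>l<N. v l * (V c l / s))) / \<rho>"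
      unfolding sum_subtractf[symmetric] sum_divide_distrib by (intro sum.cong) (simp_all add: algebra_simps diff_divide_distrib)
    also have "\<dots> = 1\<^sub>m N $$ (c, k)"
      using u(3)[OF ck(2,1), symmetric] v(3) ck \<rho> by simp
    finally show "(Vm * X) $$ (c, k) = 1\<^sub>m N $$ (c, k)" .
  qed (auto simp: Vm_def X_def)
  then have "det Vm * det X = 1"
    using det_mult[of Vm N X] by (simp add: Vm_def X_def)
  then have "1 = \<bar>det Vm\<bar> * \<bar>det X\<bar>" by (metis abs_mult abs_one)
  also have "\<dots> \<le> \<delta> * (fact N * (B / \<rho>) ^ N)"
  proof (rule mult_mono)
    show "\<bar>det Vm\<bar> \<le> \<delta>" using dt by (simp add: Vm_def)
    then show "0 \<le> \<delta>" by (smt (verit))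
    show "\<bar>det X\<bar> \<le> fact N * (B / \<rho>) ^ N"
    proof (rule abs_det_le)
      show "X \<in> carrier_mat N N" by (simp add: X_def)
      fix l k assume lk: "l < N" "k < N"
      have "v l \<le> B" using member_le_sum[of l "{..<N}" v] v lk by simp
      moreover have "u k l \<le> B" using member_le_sum[of l "{..<N}" "u k"] u lk by fastforce
      ultimately have "\<bar>u k l - v l\<bar> \<le> B" using u(1)[OF lk(2,1)] v(1) lk by force
      then show "\<bar>X $$ (l, k)\<bar> \<le> B / \<rho>" using lk \<rho> by (simp add: X_def divide_right_mono)
    qed
  qed simp
  finally show ?thesis .
qed

text \<open>Generated by unit vectors and the column (-W, ..., -W, 1): after dehomogenization this
  is the orthant of all x with every coordinate at least -W. The matrix is triangular with
  determinant 1.\<close>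

definition cone_init :: "nat \<Rightarrow> int \<Rightarrow> nat \<Rightarrow> nat \<Rightarrow> int" where
  "cone_init n W c l = (if c = l then 1 else if l = n then - W else 0)"

lemma cone_state_init:
  assumes Z: "\<And>z. z \<in> Z \<Longrightarrow> 0 \<le> z n \<and> (\<forall>l<n. 0 \<le> z l + W * z n) \<and> (\<Sum>l<n. z l + W * z n) + z n \<le> B"
  shows "cone_state (Suc n) Z B (cone_init n W) 1"
  unfolding cone_state_def
proof (intro exI[of _ 1] conjI ballI)
  fix z assume z: "z \<in> Z"
  define w where "w l = (if l < n then z l + W * z n else z l)" for l
  show "\<exists>w. (\<forall>l<Suc n. 0 \<le> w l) \<and> (\<Sum>l<Suc n. w l) \<le> B \<and>
            (\<forall>c<Suc n. z c = (\<Sum>l<Suc n. w l * (real_of_int (cone_init n W c l) / 1)))"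
  proof (intro exI[of _ w] conjI allI impI)
    fix c assume c: "c < Suc n"
    have "(\<Sum>l<n. w l * real_of_int (cone_init n W c l)) = (\<Sum>l<n. if l = c then w l else 0)"
      by (intro sum.cong) (auto simp: cone_init_def)
    then show "z c = (\<Sum>l<Suc n. w l * (real_of_int (cone_init n W c l) / 1))"
      using c by (cases "c = n") (simp_all add: w_def cone_init_def)
  qed (use Z[OF z] in \<open>auto simp: w_def less_Suc_eq\<close>)
next
  define A where "A = mat (Suc n) (Suc n) (\<lambda>(c, l). real_of_int (cone_init n W c l) / 1)"
  have "upper_triangular A" by (auto simp: A_def upper_triangular_def cone_init_def)
  then have "det A = prod_list (diag_mat A)" by (rule det_upper_triangular[of _ "Suc n"]) (simp add: A_def)
  also have "\<dots> = 1" by (simp add: prod_list_diag_prod A_def cone_init_def)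
  finally show "\<bar>det (mat (Suc n) (Suc n) (\<lambda>(c, l). real_of_int (cone_init n W c l) / 1))\<bar> \<le> 1"
    by (simp add: A_def)
qed simp

text \<open>The inequality \<open>F x \<le> h + 1/W\<close>, homogenized with the variable of index \<open>n\<close> and multiplied by \<open>W\<close>.\<close>
definition hom_row :: "nat \<Rightarrow> int \<Rightarrow> (nat \<Rightarrow> nat \<Rightarrow> int) \<Rightarrow> (nat \<Rightarrow> int) \<Rightarrow> nat \<Rightarrow> nat \<Rightarrow> int" where
  "hom_row n W F h i c = (if c < n then - W * F i c else W * h i + 1)"

definition lin_feasible :: "nat \<Rightarrow> nat \<Rightarrow> (nat \<Rightarrow> nat \<Rightarrow> int) \<Rightarrow> (nat \<Rightarrow> int) \<Rightarrow> bool" where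
  "lin_feasible r n F h \<longleftrightarrow> (\<exists>x :: nat \<Rightarrow> real. \<forall>i<r. (\<Sum>c<n. F i c * x c) \<le> h i)"

text \<open>Squares take the place of absolute values, which are not an operation of the machine; on
  integers they are at least as large. The summand 2 keeps the size at least 2.\<close>

definition lin_size :: "nat \<Rightarrow> nat \<Rightarrow> (nat \<Rightarrow> nat \<Rightarrow> int) \<Rightarrow> (nat \<Rightarrow> int) \<Rightarrow> int" where
  "lin_size r n F h = int r + int n + 2 + (\<Sum>i<r. (\<Sum>c<n. F i c * F i c) + h i * h i)"

lemma lin_size_bounds:
  shows "real (n + r + 2) \<le> lin_size r n F h"
    and "i < r \<Longrightarrow> (\<Sum>c<n. \<bar>real_of_int (F i c)\<bar>) \<le> lin_size r n F h"
    and "i < r \<Longrightarrow> \<bar>real_of_int (h i)\<bar> \<le> lin_size r n F h"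
proof -
  have sq: "\<bar>a\<bar> \<le> a * a" for a :: int
    using mult_left_mono[of 1 "\<bar>a\<bar>" "\<bar>a\<bar>"] by (cases "a = 0") (auto simp: abs_mult[symmetric] simp del: abs_mult)
  define R where "R i = (\<Sum>c<n. F i c * F i c) + h i * h i" for i
  have FF: "(\<Sum>c<n. \<bar>F i c\<bar>) \<le> (\<Sum>c<n. F i c * F i c)" for i by (intro sum_mono sq)
  have R: "(\<Sum>c<n. \<bar>F i c\<bar>) + \<bar>h i\<bar> \<le> R i" for i
    unfolding R_def by (intro add_mono FF sq)
  have R0: "R i \<ge> 0" for i using R[of i] by (smt (verit) sum_nonneg abs_ge_zero)
  have sz: "lin_size r n F h = int r + int n + 2 + (\<Sum>i<r. R i)" by (simp add: lin_size_def R_def)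
  have S0: "(\<Sum>i<r. R i) \<ge> 0" using R0 by (intro sum_nonneg)
  then have "int (n + r + 2) \<le> lin_size r n F h" unfolding sz by simp
  then have "real_of_int (int (n + r + 2)) \<le> lin_size r n F h" by (simp only: of_int_le_iff)
  then show "real (n + r + 2) \<le> lin_size r n F h" by simp
  assume i: "i < r"
  have "R i \<le> (\<Sum>i<r. R i)" using i R0 by (intro member_le_sum) auto
  then have *: "(\<Sum>c<n. \<bar>F i c\<bar>) + \<bar>h i\<bar> \<le> lin_size r n F h" using R[of i] unfolding sz by linarith
  have "(\<Sum>c<n. \<bar>F i c\<bar>) \<ge> 0" by (intro sum_nonneg) auto
  with * have "\<bar>h i\<bar> \<le> lin_size r n F h" "(\<Sum>c<n. \<bar>F i c\<bar>) \<le> lin_size r n F h" by linarith+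
  then have "real_of_int \<bar>h i\<bar> \<le> lin_size r n F h" "real_of_int (\<Sum>c<n. \<bar>F i c\<bar>) \<le> lin_size r n F h"
    unfolding of_int_le_iff by blast+
  then show "(\<Sum>c<n. \<bar>real_of_int (F i c)\<bar>) \<le> lin_size r n F h" "\<bar>real_of_int (h i)\<bar> \<le> lin_size r n F h"
    by simp_all
qed

text \<open>The zero row \<open>i0\<close> is what makes dehomogenization possible: its relaxed
  homogenized form says that coordinate \<open>n\<close> is positive. Division by this coordinate
  gives a solution of the relaxed system, which rounding turns into an exact one.\<close>

lemma center_feasible:
  fixes z :: "nat \<Rightarrow> int"
  assumes W: "W \<ge> lin_size r n F h ^ (4 * n + 8)"
    and pos: "\<And>i. i < r \<Longrightarrow> (\<Sum>c<Suc n. hom_row n W F h i c * z c) > 0"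
    and zero: "i0 < r" "\<And>c. c < n \<Longrightarrow> F i0 c = 0" "h i0 = 0"
  shows "lin_feasible r n F h"
proof -
  have S2: "real_of_int (lin_size r n F h) \<ge> 2" using lin_size_bounds(1)[where n = n and r = r and F = F and h = h] by linarith
  then have "real_of_int (lin_size r n F h) ^ (4 * n + 8) > 0" by simp
  moreover have W': "real_of_int (lin_size r n F h) ^ (4 * n + 8) \<le> W"
    using W by (metis of_int_le_iff of_int_power)
  ultimately have W0: "real_of_int W > 0" by linarith
  have row: "(\<Sum>c<Suc n. hom_row n W F h i c * z c) = (W * h i + 1) * z n - W * (\<Sum>c<n. F i c * z c)" for i
    by (simp add: hom_row_def sum_distrib_left sum_negf mult_ac)
  have zn: "z n > 0" using pos[OF zero(1)] zero unfolding row by simp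
  have "(\<Sum>c<n. F i c * (real_of_int (z c) / z n)) \<le> h i + 1 / W" if i: "i < r" for i
  proof -
    have "real_of_int (W * (\<Sum>c<n. F i c * z c)) \<le> real_of_int ((W * h i + 1) * z n)"
      unfolding of_int_le_iff using pos[OF i] unfolding row by simp
    then have "W * (\<Sum>c<n. F i c * real_of_int (z c)) \<le> (W * h i + 1) * real_of_int (z n)" by simp
    then have "(\<Sum>c<n. F i c * real_of_int (z c)) / z n \<le> (W * h i + 1) / W"
      using W0 zn by (simp add: divide_simps mult_ac)
    also have "\<dots> = h i + 1 / W" using W0 by (simp add: field_simps)
    finally show ?thesis by (simp add: sum_divide_distrib)
  qed
  then have "\<exists>x :: nat \<Rightarrow> real. (\<forall>i<r. (\<Sum>c<n. F i c * x c) \<le> h i) \<and>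
      (\<forall>c<n. \<bar>x c\<bar> \<le> real_of_int (lin_size r n F h) ^ (4 * n + 5))"
    by (intro free_exact_from_approximate[where W = W] lin_size_bounds W')
  then show ?thesis unfolding lin_feasible_def by blast
qed

text \<open>Only n + 2 points are tracked: a bounded exact solution with last coordinate 1, and its
  translates by \<rho> along each axis. They are affinely independent, which is all that the volume
  bound asks for. The exponent 5 combines (n+1)! <= w^(n+1) with w^2/\<rho> = w^4.\<close>

lemma lin_feasible_cone_state:
  assumes feas: "lin_feasible r n F h" and W: "W = lin_size r n F h ^ (4 * n + 8)"
  shows "\<exists>(Z :: (nat \<Rightarrow> real) set) B. Z \<noteq> {} \<and> (\<forall>(z :: nat \<Rightarrow> real)\<in>Z. \<forall>i<r. (\<Sum>c<Suc n. hom_row n W F h i c * z c) > 0) \<and>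
    cone_state (Suc n) Z B (cone_init n W) 1 \<and>
    (\<forall>V \<delta>. cone_state (Suc n) Z B V \<delta> \<longrightarrow> 1 \<le> \<delta> * real_of_int W ^ (5 * Suc n))"
proof -
  define S where "S = real_of_int (lin_size r n F h)"
  define w where "w = real_of_int W"
  have wS: "w = S ^ (4 * n + 8)" by (simp add: w_def S_def W)
  note size = lin_size_bounds[where n = n and r = r and F = F and h = h, folded S_def]
  have S2: "S \<ge> 2" using size(1) by linarith
  have Sn: "real n + 2 \<le> S" using size(1) by simp
  have Sw: "S ^ k \<le> w" if "k \<le> 4 * n + 8" for k unfolding wS using S2 that by (intro power_increasing) auto
  have w0: "w > 0" unfolding wS using S2 by simp
  have S_lt_w: "S < w" unfolding wS using S2 power_strict_increasing[of 1 "4 * n + 8" S] by simp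
  obtain x0 :: "nat \<Rightarrow> real" where "\<forall>i<r. (\<Sum>c<n. F i c * x0 c) \<le> h i"
    using feas unfolding lin_feasible_def by blast
  \<comment> \<open>An exact solution is rounded in order to bound its entries.\<close>
  then have "\<exists>x :: nat \<Rightarrow> real. (\<forall>i<r. (\<Sum>c<n. F i c * x c) \<le> h i) \<and> (\<forall>c<n. \<bar>x c\<bar> \<le> S ^ (4 * n + 5))"
    using w0 by (intro free_exact_from_approximate[where W = w and x = x0] size) (auto simp: wS intro: add_increasing2)
  then obtain x :: "nat \<Rightarrow> real" where x: "\<And>i. i < r \<Longrightarrow> (\<Sum>c<n. F i c * x c) \<le> h i"
    and xb: "\<And>c. c < n \<Longrightarrow> \<bar>x c\<bar> \<le> S ^ (4 * n + 5)" by blast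
  have xw: "\<bar>x c\<bar> \<le> w" if "c < n" for c using xb[OF that] Sw[of "4 * n + 5"] by simp
  \<comment> \<open>A translate changes the value of a homogenized inequality by at most \<rho>(wS +
    1) < 1, while the value at \<open>z0\<close> is at least 1 thanks to the relaxation.\<close>
  define \<rho> where "\<rho> = 1 / w\<^sup>2"
  have w1: "w \<ge> 1" using S_lt_w S2 by simp
  have \<rho>: "0 < \<rho>" "\<rho> \<le> 1" using w1 w0 by (auto simp: \<rho>_def)
  define z0 where "z0 c = (if c < n then x c else 1)" for c
  define zk where "zk k c = z0 c + (if c = k then \<rho> else 0)" for k c
  define Z where "Z = insert z0 (zk ` {..<Suc n})"
  have coef: "\<bar>real_of_int (hom_row n W F h i k)\<bar> \<le> w * S + 1" if "i < r" "k < Suc n" for i k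
  proof (cases "k < n")
    case True
    have "\<bar>real_of_int (F i k)\<bar> \<le> S"
      using member_le_sum[of k "{..<n}" "\<lambda>c. \<bar>real_of_int (F i c)\<bar>"] size(2)[OF that(1)] True by simp
    then have "w * \<bar>real_of_int (F i k)\<bar> \<le> w * S" using w0 by (intro mult_left_mono) auto
    moreover have "\<bar>real_of_int (hom_row n W F h i k)\<bar> = w * \<bar>real_of_int (F i k)\<bar>"
      using True w0 by (simp add: hom_row_def abs_mult w_def)
    ultimately show ?thesis by linarith
  next
    case False
    have "w * \<bar>real_of_int (h i)\<bar> \<le> w * S" using size(3)[OF that(1)] w0 by (intro mult_left_mono) auto
    then have "\<bar>w * real_of_int (h i)\<bar> \<le> w * S" using w0 by (simp add: abs_mult)
    moreover have "real_of_int (hom_row n W F h i k) = w * real_of_int (h i) + 1"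
      using False by (simp add: hom_row_def w_def)
    ultimately show ?thesis by linarith
  qed
  have at0: "(\<Sum>c<Suc n. hom_row n W F h i c * z0 c) \<ge> 1" if i: "i < r" for i
  proof -
    have "(\<Sum>c<Suc n. hom_row n W F h i c * z0 c) = w * (h i - (\<Sum>c<n. F i c * x c)) + 1"
      by (simp add: hom_row_def z0_def w_def sum_distrib_left sum_negf algebra_simps)
    moreover have "w * (h i - (\<Sum>c<n. F i c * x c)) \<ge> 0" using x[OF i] w0 by (intro mult_nonneg_nonneg) auto
    ultimately show ?thesis by linarith
  qed
  have small: "\<rho> * (w * S + 1) < 1"
  proof -
    have "w * S + 1 < w * S + w * 1" using w1 S_lt_w S2 by simp
    also have "\<dots> = w * (S + 1)" by (simp add: algebra_simps)
    also have "\<dots> \<le> w * w"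
    proof -
      have "2 * S \<le> S * S" using S2 by (intro mult_right_mono) auto
      then have "S + 1 \<le> S ^ 2" using S2 unfolding power2_eq_square by linarith
      also have "\<dots> \<le> w" by (rule Sw) simp
      finally show ?thesis using w0 by (intro mult_left_mono) auto
    qed
    finally show ?thesis using w0 by (simp add: \<rho>_def power2_eq_square field_simps)
  qed
  have pos: "(\<Sum>c<Suc n. hom_row n W F h i c * z c) > 0" if z: "z \<in> Z" and i: "i < r" for z :: "nat \<Rightarrow> real" and i
  proof -
    consider "z = z0" | k where "k < Suc n" "z = zk k" using z by (auto simp: Z_def)
    then show ?thesis
    proof cases
      case 1
      then show ?thesis using at0[OF i] by simp
    next
      case (2 k)
      have "(\<Sum>c<Suc n. hom_row n W F h i c * z c)
          = (\<Sum>c<Suc n. hom_row n W F h i c * z0 c) + (\<Sum>c<Suc n. if c = k then hom_row n W F h i c * \<rho> else 0)"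
        unfolding 2 zk_def distrib_left sum.distrib by (intro arg_cong2[where f = "(+)"] refl sum.cong) auto
      also have "(\<Sum>c<Suc n. if c = k then hom_row n W F h i c * \<rho> else 0) = hom_row n W F h i k * \<rho>"
        using 2(1) by (simp only: sum.delta finite_lessThan lessThan_iff if_True)
      finally have eq: "(\<Sum>c<Suc n. hom_row n W F h i c * z c)
          = (\<Sum>c<Suc n. hom_row n W F h i c * z0 c) + hom_row n W F h i k * \<rho>" .
      have "\<bar>hom_row n W F h i k * \<rho>\<bar> \<le> (w * S + 1) * \<rho>"
        using coef[OF i 2(1)] \<rho> by (simp add: abs_mult mult_right_mono)
      then have "\<bar>hom_row n W F h i k * \<rho>\<bar> < 1" using small by (simp add: mult.commute)
      then show ?thesis using at0[OF i] unfolding eq by linarith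
    qed
  qed
  \<comment> \<open>Each weight z_l + W z_n is at most 3 w + 1, and all weights together fit into
    w^2 because 4 n + 2 <= S^3 <= w.\<close>
  have init: "cone_state (Suc n) Z (w\<^sup>2) (cone_init n W) 1"
  proof (rule cone_state_init)
    fix z assume "z \<in> Z"
    then have z: "z0 c \<le> z c" "z c \<le> z0 c + \<rho>" for c using \<rho> by (auto simp: Z_def zk_def)
    have zn: "1 \<le> z n" "z n \<le> 2" using z[of n] \<rho> by (auto simp: z0_def)
    have W0: "W \<ge> 0" using w0 by (simp add: w_def)
    have zl: "0 \<le> z l + W * z n" "z l + W * z n \<le> w + 1 + w * 2" if "l < n" for l
    proof -
      have "w * 1 \<le> w * z n" "w * z n \<le> w * 2" using zn w0 by (intro mult_left_mono; simp)+
      moreover have "- w \<le> z l" "z l \<le> w + 1" using z[of l] xw[OF that] that \<rho> by (auto simp: z0_def)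
      ultimately show "0 \<le> z l + W * z n" "z l + W * z n \<le> w + 1 + w * 2" by (auto simp: w_def)
    qed
    have "(\<Sum>l<n. z l + W * z n) \<le> (\<Sum>l<n. w + 1 + w * 2)" using zl by (intro sum_mono) auto
    also have "\<dots> = real n * (3 * w + 1)" by simp
    also have "\<dots> \<le> real n * (4 * w)" using w1 by (intro mult_left_mono) auto
    finally have "(\<Sum>l<n. z l + W * z n) + z n \<le> (4 * real n + 2) * w"
      using zn w1 by (simp add: algebra_simps)
    also have "\<dots> \<le> w * w"
    proof -
      have "4 * real n + 2 \<le> 4 * S" using Sn by simp
      also have "\<dots> \<le> S\<^sup>2 * S" using S2 power_mono[of 2 S 2] by (intro mult_right_mono) auto
      also have "\<dots> = S ^ 3" by (simp add: power2_eq_square power3_eq_cube)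
      also have "\<dots> \<le> w" by (rule Sw) simp
      finally show ?thesis using w0 by (intro mult_right_mono) auto
    qed
    finally show "0 \<le> z n \<and> (\<forall>l<n. 0 \<le> z l + W * z n) \<and> (\<Sum>l<n. z l + W * z n) + z n \<le> w\<^sup>2"
      using zn zl by (simp add: power2_eq_square)
  qed
  have lower: "1 \<le> \<delta> * w ^ (5 * Suc n)" if st: "cone_state (Suc n) Z (w\<^sup>2) V \<delta>" for V \<delta>
  proof -
    have "1 \<le> \<delta> * (fact (Suc n) * (w\<^sup>2 / \<rho>) ^ Suc n)"
    proof (rule cone_state_lower_bound[OF st \<rho>(1)])
      show "z0 \<in> Z" by (simp add: Z_def)
      show "(\<lambda>c. z0 c + (if c = k then \<rho> else 0)) \<in> Z" if "k < Suc n" for k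
        using that unfolding Z_def zk_def[abs_def] by blast
    qed simp
    also have "w\<^sup>2 / \<rho> = w ^ 4" by (simp add: \<rho>_def power_add[symmetric])
    also have "\<delta> * (fact (Suc n) * (w ^ 4) ^ Suc n) \<le> \<delta> * (w ^ Suc n * (w ^ 4) ^ Suc n)"
    proof (intro mult_left_mono mult_right_mono)
      have "fact (Suc n) \<le> real (Suc n) ^ Suc n"
        by (metis fact_le_power of_nat_fact of_nat_power le_refl of_nat_le_iff)
      also have "\<dots> \<le> w ^ Suc n" using Sn S_lt_w by (intro power_mono) auto
      finally show "fact (Suc n) \<le> w ^ Suc n" .
      show "\<delta> \<ge> 0" using st unfolding cone_state_def by (meson abs_ge_zero order_trans)
    qed (use w0 in simp)
    also have "w ^ Suc n * (w ^ 4) ^ Suc n = w ^ (5 * Suc n)"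
      by (simp only: power_mult[symmetric] power_add[symmetric]) simp
    finally show ?thesis .
  qed
  show ?thesis
    by (rule exI[of _ Z], rule exI[of _ "w\<^sup>2"]) (use pos init lower in \<open>auto simp: Z_def w_def\<close>)
qed

text \<open>With m = 16 N^2, Bernoulli gives (1 + 1/m)^m >= 2, so m k steps divide the volume by
  2^k. As S < 2^\<beta>, the admissible ratio W^(5N) is below 2^k for k = 40 N^2 \<beta>, and m k =
  640 N^4 \<beta>.\<close>

lemma shrink_count_bound:
  assumes N: "N \<ge> 1" and c: "1 \<le> (1 / (1 + 1 / (16 * real N ^ 2))) ^ T * real_of_int W ^ (5 * N)"
    and W: "W = S ^ (4 * N + 4)" and S: "0 \<le> S" "S < 2 ^ \<beta>" and T: "T \<ge> 640 * N ^ 4 * \<beta>"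
  shows False
proof -
  define m where "m = 16 * N ^ 2"
  define k where "k = 40 * N ^ 2 * \<beta>"
  define g where "g = 1 + 1 / real m"
  have m: "m > 0" using N by (simp add: m_def)
  have g1: "g \<ge> 1" by (simp add: g_def)
  have "2 \<le> g ^ m"
    using Bernoulli_inequality[of "1 / real m" m] m by (simp add: g_def order.trans[of _ 0])
  then have "2 ^ k \<le> (g ^ m) ^ k" by (intro power_mono) auto
  also have "\<dots> = g ^ (m * k)" by (simp add: power_mult)
  also have "\<dots> \<le> g ^ T"
  proof (rule power_increasing)
    have "m * k = 640 * N ^ 4 * \<beta>" by (simp add: m_def k_def power2_eq_square power4_eq_xxxx)
    then show "m * k \<le> T" using T by simp
  qed (use g1 in simp)
  finally have gT: "2 ^ k \<le> g ^ T" .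
  have "1 \<le> (1 / g) ^ T * real_of_int W ^ (5 * N)"
    using c by (simp add: g_def m_def)
  then have gW: "g ^ T \<le> real_of_int W ^ (5 * N)" using g1 by (simp add: power_divide field_simps)
  have e: "real_of_int W ^ (5 * N) = real_of_int S ^ ((4 * N + 4) * (5 * N))"
    by (simp only: W of_int_power power_mult)
  have pos: "(4 * N + 4) * (5 * N) > 0" using N by simp
  have "real_of_int S < 2 ^ \<beta>" using S(2) by (metis of_int_less_iff of_int_numeral of_int_power)
  then have "real_of_int S ^ ((4 * N + 4) * (5 * N)) < (2 ^ \<beta>) ^ ((4 * N + 4) * (5 * N))"
    using S pos by (intro power_strict_mono) auto
  also have "\<dots> = 2 ^ (\<beta> * ((4 * N + 4) * (5 * N)))" by (simp only: power_mult)
  also have "\<dots> \<le> 2 ^ k"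
  proof (intro power_increasing)
    have "(4 * N + 4) * (5 * N) \<le> 40 * N ^ 2"
      using N by (simp add: power2_eq_square algebra_simps)
    then have "\<beta> * ((4 * N + 4) * (5 * N)) \<le> \<beta> * (40 * N ^ 2)" by (intro mult_left_mono) auto
    then show "\<beta> * ((4 * N + 4) * (5 * N)) \<le> k" by (simp add: k_def mult_ac)
  qed simp
  finally show False using gT gW e by simp
qed

section \<open>Optimality and uniqueness conditions\<close>

lemma sum_pad:
  fixes f :: "nat \<Rightarrow> 'a :: comm_monoid_add"
  assumes "m \<le> K"
  shows "(\<Sum>i<K. if i < m then f i else 0) = (\<Sum>i<m. f i)"
proof -
  have "(\<Sum>i<m. f i) = (\<Sum>i<m. if i < m then f i else 0)" by (intro sum.cong) auto
  also have "\<dots> = (\<Sum>i<K. if i < m then f i else 0)"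
    using assms by (intro sum.mono_neutral_left) auto
  finally show ?thesis ..
qed

text \<open>Bartl's induction on the number of inequalities.\<close>
lemma farkas:
  fixes a :: "'i \<Rightarrow> nat \<Rightarrow> real"
  assumes "finite I"
    and "\<And>z. (\<And>i. i \<in> I \<Longrightarrow> (\<Sum>c<n. a i c * z c) \<le> 0) \<Longrightarrow> (\<Sum>c<n. g c * z c) \<le> 0"
  shows "\<exists>u. (\<forall>i\<in>I. 0 \<le> u i) \<and> (\<forall>c<n. g c = (\<Sum>i\<in>I. u i * a i c))"
  using assms
proof (induction I arbitrary: a g rule: finite_induct)
  case empty
  from empty[of g] have "(\<Sum>c<n. g c * g c) \<le> 0" by simp
  moreover have "(\<Sum>c<n. g c * g c) \<ge> 0" by (intro sum_nonneg) simp
  ultimately have "(\<Sum>c<n. g c * g c) = 0" by simp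
  then show ?case by (simp add: sum_nonneg_eq_0_iff)
next
  case (insert k I)
  show ?case
  proof (cases "\<forall>z. (\<forall>i\<in>I. (\<Sum>c<n. a i c * z c) \<le> 0) \<longrightarrow> (\<Sum>c<n. g c * z c) \<le> 0")
    case True
    then obtain u where u: "\<forall>i\<in>I. 0 \<le> u i" "\<forall>c<n. g c = (\<Sum>i\<in>I. u i * a i c)"
      using insert.IH[of a g] by blast
    have "(\<Sum>i\<in>insert k I. (u(k := 0)) i * a i c) = (\<Sum>i\<in>I. u i * a i c)" for c
      using insert.hyps by (simp add: sum.insert) (intro sum.cong, auto)
    then show ?thesis using u by (intro exI[of _ "u(k := 0)"]) auto
  next
    case False
    then obtain x where x: "\<And>i. i \<in> I \<Longrightarrow> (\<Sum>c<n. a i c * x c) \<le> 0" "(\<Sum>c<n. g c * x c) > 0"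
      by (auto simp: not_le)
    define dt where "dt f y = (\<Sum>c<n. f c * y c)" for f y :: "nat \<Rightarrow> real"
    note x' = x[folded dt_def]
    have dt_lin: "dt (\<lambda>c. f c - r * h c) y = dt f y - r * dt h y" for f h y r
      by (simp add: dt_def algebra_simps sum_subtractf sum_distrib_left)
    have dt_lin2: "dt f (\<lambda>c. y c - r * w c) = dt f y - r * dt f w" for f w y r
      by (simp add: dt_def algebra_simps sum_subtractf sum_distrib_left)
    have k: "dt (a k) x > 0"
    proof (rule ccontr)
      assume "\<not> ?thesis"
      then have "dt g x \<le> 0" unfolding dt_def by (intro insert.prems) (use x in \<open>auto simp: dt_def\<close>)
      then show False using x' by simp
    qed
    \<comment> \<open>Subtracts the multiple of \<open>a k\<close> that makes the functional vanish
      at \<open>x\<close>. Dually, points are projected along \<open>x\<close> onto the hyperplane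
      where \<open>a k\<close> vanishes; there inequality \<open>k\<close> holds automatically, and
      the induction hypothesis applies.\<close>
    define b where "b f c = f c - (dt f x / dt (a k) x) * a k c" for f c
    have b: "dt (b f) z = dt f (\<lambda>c. z c - (dt (a k) z / dt (a k) x) * x c)" for f z
      unfolding b_def[abs_def] dt_lin dt_lin2 using k by (simp add: field_simps)
    have "\<exists>u. (\<forall>i\<in>I. 0 \<le> u i) \<and> (\<forall>c<n. b g c = (\<Sum>i\<in>I. u i * b (a i) c))"
    proof (rule insert.IH)
      fix z :: "nat \<Rightarrow> real" assume z: "\<And>i. i \<in> I \<Longrightarrow> (\<Sum>c<n. b (a i) c * z c) \<le> 0"
      let ?z = "\<lambda>c. z c - (dt (a k) z / dt (a k) x) * x c"
      have "dt (a i) ?z \<le> 0" if "i \<in> insert k I" for i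
      proof (cases "i = k")
        case True
        then show ?thesis using k dt_lin2[of "a k" z "dt (a k) z / dt (a k) x" x] by simp
      next
        case False
        then have "dt (b (a i)) z \<le> 0" using z[of i] that by (simp add: dt_def)
        then show ?thesis by (simp add: b)
      qed
      then have "dt g ?z \<le> 0" unfolding dt_def by (intro insert.prems)
      then show "(\<Sum>c<n. b g c * z c) \<le> 0" using b[of g z] by (simp add: dt_def)
    qed
    then obtain u where u: "\<And>i. i \<in> I \<Longrightarrow> 0 \<le> u i" "\<And>c. c < n \<Longrightarrow> b g c = (\<Sum>i\<in>I. u i * b (a i) c)"
      by blast
    \<comment> \<open>Collects the multiples of \<open>a k\<close> subtracted in \<open>b\<close>.
      It is nonnegative because at \<open>x\<close> the functionals \<open>g\<close> and
      \<open>a k\<close> are positive and those of \<open>I\<close> are not.\<close>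
    define v where "v = (dt g x - (\<Sum>i\<in>I. u i * dt (a i) x)) / dt (a k) x"
    have "(\<Sum>i\<in>I. u i * dt (a i) x) \<le> 0"
      using u(1) x'(1) by (intro sum_nonpos) (simp add: mult_nonneg_nonpos)
    then have v: "v \<ge> 0" using x'(2) k by (simp add: v_def)
    have "g c = (\<Sum>i\<in>insert k I. (u(k := v)) i * a i c)" if c: "c < n" for c
    proof -
      have "g c = (\<Sum>i\<in>I. u i * b (a i) c) + (dt g x / dt (a k) x) * a k c"
        using u(2)[OF c] by (simp add: b_def)
      also have "(\<Sum>i\<in>I. u i * b (a i) c)
          = (\<Sum>i\<in>I. u i * a i c) - (\<Sum>i\<in>I. u i * dt (a i) x) / dt (a k) x * a k c"
        by (simp add: b_def algebra_simps sum_subtractf sum_distrib_left sum_distrib_right sum_divide_distrib)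
      also have "\<dots> + (dt g x / dt (a k) x) * a k c = (\<Sum>i\<in>I. u i * a i c) + v * a k c"
        by (simp add: v_def algebra_simps diff_divide_distrib)
      also have "(\<Sum>i\<in>I. u i * a i c) = (\<Sum>i\<in>I. (u(k := v)) i * a i c)"
        using insert.hyps by (intro sum.cong) auto
      finally show ?thesis using insert.hyps by (simp add: add.commute)
    qed
    then show ?thesis using u(1) v insert.hyps by (intro exI[of _ "u(k := v)"]) auto
  qed
qed

text \<open>Each equation is split into two opposite inequalities, whose multipliers combine to the
  free \<open>u\<close>. The four kinds of inequalities are padded with zero rows to a common
  length, which makes the index set a product.\<close>

lemma farkas_mixed:
  fixes A :: "nat \<Rightarrow> nat \<Rightarrow> real" and w g :: "nat \<Rightarrow> real" and N :: "nat \<Rightarrow> bool"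
  assumes g: "\<And>z. (\<And>i. i < m \<Longrightarrow> (\<Sum>l<n. A i l * z l) = 0) \<Longrightarrow> (\<And>l. l < n \<Longrightarrow> N l \<Longrightarrow> 0 \<le> z l) \<Longrightarrow>
      (\<Sum>l<n. w l * z l) \<le> 0 \<Longrightarrow> (\<Sum>l<n. g l * z l) \<le> 0"
  shows "\<exists>u \<sigma> \<tau>. 0 \<le> \<tau> \<and> (\<forall>l. 0 \<le> \<sigma> l) \<and> (\<forall>l. \<not> N l \<longrightarrow> \<sigma> l = 0) \<and>
    (\<forall>l<n. g l = (\<Sum>i<m. A i l * u i) - \<sigma> l + \<tau> * w l)"
proof -
  define K where "K = m + n + 1"
  define a :: "nat \<times> nat \<Rightarrow> nat \<Rightarrow> real" where "a = (\<lambda>(f, i) l.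
     if f = 0 then (if i < m then A i l else 0)
     else if f = 1 then (if i < m then - A i l else 0)
     else if f = 2 then (if i < n then (if i = l \<and> N i then -1 else 0) else 0)
     else (if i < 1 then w l else 0))"
  have "\<exists>u. (\<forall>i\<in>{..<4} \<times> {..<K}. 0 \<le> u i) \<and> (\<forall>c<n. g c = (\<Sum>i\<in>{..<4} \<times> {..<K}. u i * a i c))"
  proof (rule farkas)
    fix z :: "nat \<Rightarrow> real" assume z: "\<And>i. i \<in> {..<4} \<times> {..<K} \<Longrightarrow> (\<Sum>c<n. a i c * z c) \<le> 0"
    show "(\<Sum>c<n. g c * z c) \<le> 0"
    proof (rule g)
      fix i assume i: "i < m"
      have "(\<Sum>l<n. A i l * z l) \<le> 0" "- (\<Sum>l<n. A i l * z l) \<le> 0"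
        using z[of "(0, i)"] z[of "(1, i)"] i by (auto simp: K_def a_def sum_negf)
      then show "(\<Sum>l<n. A i l * z l) = 0" by simp
    next
      fix l assume l: "l < n" "N l"
      have "(\<Sum>c<n. a (2, l) c * z c) = (\<Sum>c<n. if c = l then - z c else 0)"
        using l by (intro sum.cong) (auto simp: a_def)
      then show "0 \<le> z l" using z[of "(2, l)"] l by (simp add: K_def)
    next
      show "(\<Sum>l<n. w l * z l) \<le> 0" using z[of "(3, 0)"] by (simp add: K_def a_def)
    qed
  qed simp
  then obtain u where u: "\<And>f i. f < 4 \<Longrightarrow> i < K \<Longrightarrow> 0 \<le> u (f, i)"
    "\<And>c. c < n \<Longrightarrow> g c = (\<Sum>i\<in>{..<4} \<times> {..<K}. u i * a i c)" by auto
  define \<sigma> where "\<sigma> l = (if l < n \<and> N l then u (2, l) else 0)" for l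
  have "g l = (\<Sum>i<m. A i l * (u (0, i) - u (1, i))) - \<sigma> l + u (3, 0) * w l" if l: "l < n" for l
  proof -
    have "g l = (\<Sum>f<4. \<Sum>i<K. u (f, i) * a (f, i) l)"
      unfolding u(2)[OF l] by (simp add: sum.cartesian_product)
    also have "\<dots> = (\<Sum>i<K. u (0, i) * a (0, i) l) + (\<Sum>i<K. u (1, i) * a (1, i) l)
        + (\<Sum>i<K. u (2, i) * a (2, i) l) + (\<Sum>i<K. u (3, i) * a (3, i) l)"
      by (simp add: eval_nat_numeral)
    also have "(\<Sum>i<K. u (0, i) * a (0, i) l) = (\<Sum>i<K. if i < m then A i l * u (0, i) else 0)"
      by (intro sum.cong) (auto simp: a_def)
    also have "\<dots> = (\<Sum>i<m. A i l * u (0, i))" by (rule sum_pad) (simp add: K_def)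
    also have "(\<Sum>i<K. u (1, i) * a (1, i) l) = (\<Sum>i<K. if i < m then - A i l * u (1, i) else 0)"
      by (intro sum.cong) (auto simp: a_def)
    also have "\<dots> = (\<Sum>i<m. - A i l * u (1, i))" by (rule sum_pad) (simp add: K_def)
    also have "(\<Sum>i<K. u (2, i) * a (2, i) l) = (\<Sum>i<K. if i = l then - \<sigma> l else 0)"
      using l by (intro sum.cong) (auto simp: a_def \<sigma>_def)
    also have "\<dots> = - \<sigma> l" using l by (simp add: K_def)
    also have "(\<Sum>i<K. u (3, i) * a (3, i) l) = (\<Sum>i<K. if i < 1 then u (3, i) * w l else 0)"
      by (intro sum.cong) (auto simp: a_def)
    also have "\<dots> = (\<Sum>i<1. u (3, i) * w l)" by (rule sum_pad) (simp add: K_def)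
    finally show ?thesis by (simp add: right_diff_distrib sum_subtractf sum_negf)
  qed
  then show ?thesis
    using u(1) by (intro exI[of _ "\<lambda>i. u (0, i) - u (1, i)"] exI[of _ \<sigma>] exI[of _ "u (3, 0)"])
      (auto simp: \<sigma>_def K_def)
qed

section \<open>Optimal and uniquely optimal points of an LP in standard form\<close>

definition std_feasible ::
  "nat \<Rightarrow> nat \<Rightarrow> (nat \<Rightarrow> nat \<Rightarrow> real) \<Rightarrow> (nat \<Rightarrow> real) \<Rightarrow> (nat \<Rightarrow> real) \<Rightarrow> bool" where
  "std_feasible m n A r y \<longleftrightarrow> (\<forall>i<m. (\<Sum>l<n. A i l * y l) = r i) \<and> (\<forall>l<n. 0 \<le> y l)"

definition std_optimal ::
  "nat \<Rightarrow> nat \<Rightarrow> (nat \<Rightarrow> nat \<Rightarrow> real) \<Rightarrow> (nat \<Rightarrow> real) \<Rightarrow> (nat \<Rightarrow> real) \<Rightarrow> (nat \<Rightarrow> real) \<Rightarrow> bool" where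
  "std_optimal m n A r w y \<longleftrightarrow> std_feasible m n A r y \<and>
     (\<forall>z. std_feasible m n A r z \<longrightarrow> (\<Sum>l<n. w l * y l) \<le> (\<Sum>l<n. w l * z l))"

lemma feasible_direction:
  assumes y: "std_feasible m n A r y"
    and z: "\<And>i. i < m \<Longrightarrow> (\<Sum>l<n. A i l * z l) = 0" "\<And>l. l < n \<Longrightarrow> y l \<le> 0 \<Longrightarrow> 0 \<le> z l"
  obtains s where "s > 0" "std_feasible m n A r (\<lambda>l. y l + s * z l)"
proof -
  \<comment> \<open>Only the positive coordinates limit the step. The summand 1 in the denominator
    avoids division by zero, and the element 1 makes the set nonempty.\<close>
  define T where "T = insert 1 ((\<lambda>l. y l / (1 + \<bar>z l\<bar>)) ` {l. l < n \<and> y l > 0})"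
  define s where "s = Min T"
  have T: "finite T" "T \<noteq> {}" by (auto simp: T_def)
  have Tpos: "\<forall>x\<in>T. x > 0" by (auto simp: T_def add_pos_nonneg)
  then have s0: "s > 0" using T by (auto simp: s_def)
  have "0 \<le> y l + s * z l" if l: "l < n" for l
  proof (cases "y l > 0")
    case True
    then have "s \<le> y l / (1 + \<bar>z l\<bar>)" unfolding s_def using l T by (intro Min_le) (auto simp: T_def)
    then have "s * (1 + \<bar>z l\<bar>) \<le> y l" by (simp add: pos_le_divide_eq add_pos_nonneg)
    moreover have "s * (- \<bar>z l\<bar>) \<le> s * z l" using s0 by (intro mult_left_mono) auto
    ultimately show ?thesis using s0 unfolding distrib_left mult_minus_right by linarith
  next
    case False
    then have "0 \<le> z l" "0 \<le> y l" using z(2)[of l] l y by (auto simp: std_feasible_def)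
    then show ?thesis using s0 by simp
  qed
  then have "std_feasible m n A r (\<lambda>l. y l + s * z l)"
    using y z(1) sum_dist_line[of "A _" y s z n] by (simp add: std_feasible_def)
  then show ?thesis using s0 that by blast
qed

text \<open>Every feasible point has the same product with the transpose of \<open>A\<close> times
  \<open>u\<close>, namely that of \<open>u\<close> with \<open>r\<close>; at \<open>y\<close> this
  product is the objective value, by complementary slackness.\<close>

lemma std_duality_gap:
  assumes "std_feasible m n A r y" "std_feasible m n A r z"
    and u: "\<And>l. l < n \<Longrightarrow> y l > 0 \<Longrightarrow> (\<Sum>i<m. A i l * u i) = w l"
  shows "(\<Sum>l<n. w l * z l) - (\<Sum>l<n. w l * y l) = (\<Sum>l<n. (w l - (\<Sum>i<m. A i l * u i)) * z l)"
proof -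
  have q: "(\<Sum>l<n. (\<Sum>i<m. A i l * u i) * x l) = (\<Sum>i<m. u i * r i)"
    if "std_feasible m n A r x" for x
  proof -
    have "(\<Sum>l<n. (\<Sum>i<m. A i l * u i) * x l) = (\<Sum>l<n. \<Sum>i<m. u i * (A i l * x l))"
      by (simp add: sum_distrib_left mult_ac)
    also have "\<dots> = (\<Sum>i<m. u i * (\<Sum>l<n. A i l * x l))"
      by (subst sum.swap) (simp add: sum_distrib_left)
    finally show ?thesis using that by (simp add: std_feasible_def)
  qed
  have "(\<Sum>l<n. w l * y l) = (\<Sum>l<n. (\<Sum>i<m. A i l * u i) * y l)"
  proof (rule sum.cong)
    fix l assume "l \<in> {..<n}"
    then show "w l * y l = (\<Sum>i<m. A i l * u i) * y l"
      using u[of l] assms(1) by (cases "y l > 0") (auto simp: std_feasible_def order.antisym)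
  qed simp
  then show ?thesis using q[OF assms(1)] q[OF assms(2)] by (simp add: left_diff_distrib sum_subtractf)
qed

lemma std_optimal_iff:
  "std_optimal m n A r w y \<longleftrightarrow> std_feasible m n A r y \<and>
     (\<exists>u. \<forall>l<n. (\<Sum>i<m. A i l * u i) \<le> w l \<and> (y l > 0 \<longrightarrow> (\<Sum>i<m. A i l * u i) = w l))"
  (is "?L \<longleftrightarrow> _ \<and> (\<exists>u. ?D u)")
proof (intro iffI conjI; (elim conjE exE)?)
  assume L: ?L
  then show y: "std_feasible m n A r y" by (simp add: std_optimal_def)
  \<comment> \<open>Farkas' lemma for the cone of feasible directions; the objective inequality of
    \<open>farkas_mixed\<close> is made trivial by the coefficient vector 0.\<close>
  have "\<exists>u \<sigma> \<tau>. 0 \<le> \<tau> \<and> (\<forall>l. 0 \<le> \<sigma> l) \<and> (\<forall>l. \<not> y l \<le> 0 \<longrightarrow> \<sigma> l = 0) \<and>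
    (\<forall>l<n. - w l = (\<Sum>i<m. A i l * u i) - \<sigma> l + \<tau> * 0)"
  proof (rule farkas_mixed)
    fix z :: "nat \<Rightarrow> real" assume z: "\<And>i. i < m \<Longrightarrow> (\<Sum>l<n. A i l * z l) = 0" "\<And>l. l < n \<Longrightarrow> y l \<le> 0 \<Longrightarrow> 0 \<le> z l"
    obtain s where s: "s > 0" "std_feasible m n A r (\<lambda>l. y l + s * z l)"
      using feasible_direction[OF y z] by blast
    then have "(\<Sum>l<n. w l * y l) \<le> (\<Sum>l<n. w l * (y l + s * z l))"
      using L by (simp add: std_optimal_def)
    then have "0 \<le> s * (\<Sum>l<n. w l * z l)" by (simp add: sum_dist_line)
    then show "(\<Sum>l<n. - w l * z l) \<le> 0" using s by (simp add: zero_le_mult_iff sum_negf)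
  qed
  then obtain u \<sigma> where u: "\<forall>l. 0 \<le> \<sigma> l" "\<forall>l. \<not> y l \<le> 0 \<longrightarrow> \<sigma> l = 0"
    "\<And>l. l < n \<Longrightarrow> - w l = (\<Sum>i<m. A i l * u i) - \<sigma> l" by auto
  have "(\<Sum>i<m. A i l * - u i) = w l - \<sigma> l" if "l < n" for l
    using u(3)[OF that] by (simp add: sum_negf)
  then show "\<exists>u. ?D u" using u(1,2) by (intro exI[of _ "\<lambda>i. - u i"]) auto
next
  fix u assume y: "std_feasible m n A r y" and u: "?D u"
  have "(\<Sum>l<n. w l * y l) \<le> (\<Sum>l<n. w l * z l)" if z: "std_feasible m n A r z" for z
  proof -
    have "0 \<le> (\<Sum>l<n. (w l - (\<Sum>i<m. A i l * u i)) * z l)"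
      using u z by (intro sum_nonneg mult_nonneg_nonneg) (auto simp: std_feasible_def)
    then show ?thesis using std_duality_gap[OF y z, of u w] u by simp
  qed
  then show ?L using y by (simp add: std_optimal_def)
qed

definition std_unique ::
  "nat \<Rightarrow> nat \<Rightarrow> (nat \<Rightarrow> nat \<Rightarrow> real) \<Rightarrow> (nat \<Rightarrow> real) \<Rightarrow> (nat \<Rightarrow> real) \<Rightarrow> (nat \<Rightarrow> real) \<Rightarrow> bool" where
  "std_unique m n A r w y \<longleftrightarrow> std_optimal m n A r w y \<and>
     (\<forall>z. std_optimal m n A r w z \<longrightarrow> (\<forall>l<n. z l = y l))"

text \<open>Uniqueness means that 0 is the only feasible direction along which the objective does
  not increase. Farkas' lemma then represents every unit vector. Adding these representations for
  all j off the support to an optimal dual solution produces slack at least 1 there; the second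
  family shows that the columns in the support are independent. Conversely, strict complementarity
  forces any other optimum to vanish off the support, and \<open>v\<close> excludes a difference on
  it.\<close>

lemma std_unique_iff:
  "std_unique m n A r w y \<longleftrightarrow> std_feasible m n A r y \<and>
     (\<exists>u t. t \<ge> 1 \<and> (\<forall>l<n. (\<Sum>i<m. A i l * u i) \<le> t * w l - (if y l > 0 then 0 else 1) \<and>
        (y l > 0 \<longrightarrow> (\<Sum>i<m. A i l * u i) = t * w l))) \<and>
     (\<forall>j<n. \<exists>v. \<forall>l<n. y l > 0 \<longrightarrow> (\<Sum>i<m. A i l * v i) = (if l = j then 1 else 0 :: real))"
  (is "?L \<longleftrightarrow> _ \<and> (\<exists>u t. ?D u t) \<and> (\<forall>j<n. \<exists>v. ?V j v)")
proof (intro iffI conjI; (elim conjE exE)?)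
  assume L: ?L
  then have opt: "std_optimal m n A r w y" by (simp add: std_unique_def)
  then show y: "std_feasible m n A r y" by (simp add: std_optimal_def)
  have dir0: "\<forall>l<n. z l = 0" if z: "\<And>i. i < m \<Longrightarrow> (\<Sum>l<n. A i l * z l) = 0"
    "\<And>l. l < n \<Longrightarrow> y l \<le> 0 \<Longrightarrow> 0 \<le> z l" "(\<Sum>l<n. w l * z l) \<le> 0" for z :: "nat \<Rightarrow> real"
  proof -
    obtain s where s: "s > 0" "std_feasible m n A r (\<lambda>l. y l + s * z l)"
      using feasible_direction[OF y z(1,2)] by blast
    have "(\<Sum>l<n. w l * (y l + s * z l)) \<le> (\<Sum>l<n. w l * y l)"
      unfolding sum_dist_line using z(3) s(1) by (simp add: mult_nonneg_nonpos)
    then have "std_optimal m n A r w (\<lambda>l. y l + s * z l)"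
      using opt s(2) unfolding std_optimal_def by (meson order_trans)
    then have "\<forall>l<n. y l + s * z l = y l" using L unfolding std_unique_def by blast
    then show ?thesis using s(1) by simp
  qed
  obtain u0 where u0': "\<forall>l<n. (\<Sum>i<m. A i l * u0 i) \<le> w l \<and> (y l > 0 \<longrightarrow> (\<Sum>i<m. A i l * u0 i) = w l)"
    using opt[unfolded std_optimal_iff] by (elim conjE exE)
  then have u0: "\<And>l. l < n \<Longrightarrow> (\<Sum>i<m. A i l * u0 i) \<le> w l"
    "\<And>l. l < n \<Longrightarrow> y l > 0 \<Longrightarrow> (\<Sum>i<m. A i l * u0 i) = w l" by simp_all
  have "\<exists>(u :: nat \<Rightarrow> real) (\<sigma> :: nat \<Rightarrow> real) (\<tau> :: real). 0 \<le> \<tau> \<and> (\<forall>l. 0 \<le> \<sigma> l) \<and> (\<forall>l. \<not> y l \<le> 0 \<longrightarrow> \<sigma> l = 0) \<and>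
    (\<forall>l<n. (if l = j then 1 else 0 :: real) = (\<Sum>i<m. A i l * u i) - \<sigma> l + \<tau> * w l)" if j: "j < n" for j
  proof (rule farkas_mixed[where m = m and n = n and A = A and w = w and N = "\<lambda>l. y l \<le> 0" and g = "\<lambda>l. if l = j then 1 else 0"])
    fix z :: "nat \<Rightarrow> real" assume z: "\<And>i. i < m \<Longrightarrow> (\<Sum>l<n. A i l * z l) = 0" "\<And>l. l < n \<Longrightarrow> y l \<le> 0 \<Longrightarrow> 0 \<le> z l"
      "(\<Sum>l<n. w l * z l) \<le> 0"
    have "\<forall>l<n. z l = 0" by (rule dir0) (fact z)+
    then show "(\<Sum>l<n. (if l = j then 1 else 0 :: real) * z l) \<le> 0" by simp
  qed
  note fm = this
  define R where "R j u \<sigma> \<tau> \<longleftrightarrow> (j < n \<longrightarrow> 0 \<le> \<tau> \<and> (\<forall>l. 0 \<le> \<sigma> l) \<and> (\<forall>l. \<not> y l \<le> 0 \<longrightarrow> \<sigma> l = 0) \<and>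
    (\<forall>l<n. (if l = j then 1 else 0 :: real) = (\<Sum>i<m. A i l * u i) - \<sigma> l + \<tau> * w l))" for j and u \<sigma> :: "nat \<Rightarrow> real" and \<tau> :: real
  have "\<forall>j. \<exists>u \<sigma> \<tau>. R j u \<sigma> \<tau>" unfolding R_def using fm by blast
  then obtain u \<sigma> \<tau> where "\<And>j. R j (u j) (\<sigma> j) (\<tau> j)" by metis
  then have f: "\<And>j. j < n \<Longrightarrow> 0 \<le> \<tau> j" "\<And>j l. j < n \<Longrightarrow> 0 \<le> \<sigma> j l"
    "\<And>j l. j < n \<Longrightarrow> \<not> y l \<le> 0 \<Longrightarrow> \<sigma> j l = 0"
    "\<And>j l. j < n \<Longrightarrow> l < n \<Longrightarrow> (if l = j then 1 else 0 :: real) = (\<Sum>i<m. A i l * u j i) - \<sigma> j l + \<tau> j * w l"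
    unfolding R_def by auto
  define J where "J = {j. j < n \<and> y j \<le> 0}"
  have J: "finite J" "j \<in> J \<Longrightarrow> j < n" for j by (auto simp: J_def)
  \<comment> \<open>The multiples of \<open>w\<close> in the added representations accumulate here;
    this is why the certificate is stated for a scaled objective.\<close>
  define t where "t = 1 + sum \<tau> J"
  define U where "U i = u0 i - (\<Sum>j\<in>J. u j i)" for i
  have slack: "t * w l - (\<Sum>i<m. A i l * U i)
      = (w l - (\<Sum>i<m. A i l * u0 i)) + (\<Sum>j\<in>J. (if l = j then 1 else 0 :: real) + \<sigma> j l)" if l: "l < n" for l
  proof -
    have "(\<Sum>j\<in>J. (if l = j then 1 else 0 :: real) + \<sigma> j l) = (\<Sum>j\<in>J. \<tau> j * w l + (\<Sum>i<m. A i l * u j i))"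
      using f(4)[OF J(2) l] by (intro sum.cong) auto
    also have "\<dots> = sum \<tau> J * w l + (\<Sum>j\<in>J. \<Sum>i<m. A i l * u j i)"
      by (simp add: sum.distrib sum_distrib_right)
    also have "(\<Sum>j\<in>J. \<Sum>i<m. A i l * u j i) = (\<Sum>i<m. A i l * (\<Sum>j\<in>J. u j i))"
      by (subst sum.swap) (simp add: sum_distrib_left)
    finally show ?thesis by (simp add: t_def U_def algebra_simps sum_subtractf)
  qed
  have "?D U t"
  proof (intro conjI allI impI)
    show "t \<ge> 1" unfolding t_def using f(1) J by (simp add: sum_nonneg)
    fix l assume l: "l < n"
    have s: "(\<Sum>j\<in>J. (if l = j then 1 else 0 :: real) + \<sigma> j l) = (if y l > 0 then 0 else 1) + (\<Sum>j\<in>J. \<sigma> j l)"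
      using l J(1) by (simp add: sum.distrib J_def not_le)
    have s0: "(\<Sum>j\<in>J. \<sigma> j l) \<ge> 0" using f(2) J by (intro sum_nonneg) auto
    then show "(\<Sum>i<m. A i l * U i) \<le> t * w l - (if y l > 0 then 0 else 1)"
      using slack[OF l] u0(1)[OF l] unfolding s by linarith
    assume p: "y l > 0"
    then have "(\<Sum>j\<in>J. \<sigma> j l) = 0" using f(3) J by (intro sum.neutral) auto
    then show "(\<Sum>i<m. A i l * U i) = t * w l" using slack[OF l] u0(2)[OF l p] p unfolding s by simp
  qed
  then show "\<exists>u t. ?D u t" by blast
  show "\<forall>j<n. \<exists>v. ?V j v"
  proof (intro allI impI)
    fix j assume j: "j < n"
    \<comment> \<open>With the indicator of the complement of the support in place of
      \<open>w\<close>, the admissible directions vanish off the support.\<close>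
    have "\<exists>(u :: nat \<Rightarrow> real) (\<sigma> :: nat \<Rightarrow> real) (\<tau> :: real). 0 \<le> \<tau> \<and> (\<forall>l. 0 \<le> \<sigma> l) \<and> (\<forall>l. \<not> y l \<le> 0 \<longrightarrow> \<sigma> l = 0) \<and>
      (\<forall>l<n. (if l = j then 1 else 0 :: real) = (\<Sum>i<m. A i l * u i) - \<sigma> l + \<tau> * (if y l \<le> 0 then 1 else 0 :: real))"
    proof (rule farkas_mixed[where m = m and n = n and A = A and w = "\<lambda>l. if y l \<le> 0 then 1 else 0" and N = "\<lambda>l. y l \<le> 0" and g = "\<lambda>l. if l = j then 1 else 0"])
      fix z :: "nat \<Rightarrow> real" assume z: "\<And>i. i < m \<Longrightarrow> (\<Sum>l<n. A i l * z l) = 0" "\<And>l. l < n \<Longrightarrow> y l \<le> 0 \<Longrightarrow> 0 \<le> z l"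
        "(\<Sum>l<n. (if y l \<le> 0 then 1 else 0 :: real) * z l) \<le> 0"
      have nn: "\<forall>l\<in>{..<n}. 0 \<le> (if y l \<le> 0 then 1 else 0 :: real) * z l" using z(2) by auto
      then have "(\<Sum>l<n. (if y l \<le> 0 then 1 else 0 :: real) * z l) = 0"
        using z(3) sum_nonneg[of "{..<n}" "\<lambda>l. (if y l \<le> 0 then 1 else 0 :: real) * z l"] by simp
      then have zN: "z l = 0" if "l < n" "y l \<le> 0" for l
        using nn that by (subst (asm) sum_nonneg_eq_0_iff) (auto split: if_splits)
      \<comment> \<open>Both z and -z are feasible directions, so the sign can be chosen such that
        the objective does not increase.\<close>
      define g where "g = (if (\<Sum>l<n. w l * z l) \<le> 0 then 1 else -1 :: real)"
      have "\<forall>l<n. g * z l = 0"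
      proof (rule dir0)
        show "(\<Sum>l<n. A i l * (g * z l)) = 0" if "i < m" for i
          using z(1)[OF that] by (simp add: mult.left_commute[of _ g] sum_distrib_left[symmetric])
        show "(\<Sum>l<n. w l * (g * z l)) \<le> 0"
          by (auto simp: mult.left_commute[of _ g] sum_distrib_left[symmetric] g_def sum_negf)
      qed (simp add: zN)
      then show "(\<Sum>l<n. (if l = j then 1 else 0 :: real) * z l) \<le> 0" by (intro sum_nonpos) (auto simp: g_def split: if_splits)
    qed
    then obtain u \<sigma> :: "nat \<Rightarrow> real" and \<tau> where u: "\<And>l. \<not> y l \<le> 0 \<Longrightarrow> \<sigma> l = 0"
      "\<And>l. l < n \<Longrightarrow> (if l = j then 1 else 0 :: real) = (\<Sum>i<m. A i l * u i) - \<sigma> l + \<tau> * (if y l \<le> 0 then 1 else 0 :: real)"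
      by blast
    have "?V j u"
    proof (intro allI impI)
      fix l assume "l < n" "y l > 0"
      then show "(\<Sum>i<m. A i l * u i) = (if l = j then 1 else 0 :: real)" using u(2)[of l] u(1)[of l] by simp
    qed
    then show "\<exists>v. ?V j v" by blast
  qed
next
  fix u t assume y: "std_feasible m n A r y" and V: "\<forall>j<n. \<exists>v. ?V j v" and t: "t \<ge> 1"
    and D: "\<forall>l<n. (\<Sum>i<m. A i l * u i) \<le> t * w l - (if y l > 0 then 0 else 1) \<and>
        (y l > 0 \<longrightarrow> (\<Sum>i<m. A i l * u i) = t * w l)"
  define U where "U i = u i / t" for i
  have U: "(\<Sum>i<m. A i l * U i) = (\<Sum>i<m. A i l * u i) / t" for l by (simp add: U_def sum_divide_distrib)
  have Ule: "(\<Sum>i<m. A i l * U i) \<le> w l" "y l > 0 \<longrightarrow> (\<Sum>i<m. A i l * U i) = w l"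
    "\<not> y l > 0 \<Longrightarrow> (\<Sum>i<m. A i l * U i) < w l" if l: "l < n" for l
    using D l t unfolding U by (auto simp: field_simps split: if_splits)
  have opt: "std_optimal m n A r w y" unfolding std_optimal_iff using y Ule by blast
  show ?L
    unfolding std_unique_def
  proof (intro conjI opt allI impI)
    fix z j assume z: "std_optimal m n A r w z" and j: "j < n"
    then have zf: "std_feasible m n A r z" by (simp add: std_optimal_def)
    have "(\<Sum>l<n. w l * z l) = (\<Sum>l<n. w l * y l)"
      using z opt y zf unfolding std_optimal_def by (meson order.antisym)
    then have "(\<Sum>l<n. (w l - (\<Sum>i<m. A i l * U i)) * z l) = 0"
      using std_duality_gap[OF y zf, of U w] Ule(2) by simp
    then have "\<forall>l\<in>{..<n}. (w l - (\<Sum>i<m. A i l * U i)) * z l = 0"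
      using Ule(1) zf by (subst (asm) sum_nonneg_eq_0_iff) (auto simp: std_feasible_def)
    then have zN: "z l = y l" if "l < n" "\<not> y l > 0" for l
      using Ule(3)[OF that] that y by (force simp: std_feasible_def)
    show "z j = y j"
    proof (cases "y j > 0")
      case True
      obtain v where v: "\<And>l. l < n \<Longrightarrow> y l > 0 \<Longrightarrow> (\<Sum>i<m. A i l * v i) = (if l = j then 1 else 0 :: real)"
        using V j by blast
      \<comment> \<open>Testing A(z - y) = 0 with \<open>v\<close> isolates coordinate
        \<open>j\<close>, as z - y vanishes off the support.\<close>
      have "0 = (\<Sum>i<m. v i * (\<Sum>l<n. A i l * (z l - y l)))"
        using y zf by (simp add: std_feasible_def right_diff_distrib sum_subtractf)
      also have "\<dots> = (\<Sum>l<n. (\<Sum>i<m. A i l * v i) * (z l - y l))"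
        unfolding sum_distrib_left sum_distrib_right by (subst sum.swap) (simp add: mult_ac)
      also have "\<dots> = (\<Sum>l<n. if l = j then z l - y l else 0)"
      proof (rule sum.cong)
        fix l assume "l \<in> {..<n}"
        then show "(\<Sum>i<m. A i l * v i) * (z l - y l) = (if l = j then z l - y l else 0)"
          using zN[of l] v[of l] True by (cases "y l > 0") auto
      qed simp
      finally show ?thesis using j by simp
    qed (use zN j in blast)
  qed
qed

section \<open>Reduction to linear feasibility\<close>

text \<open>Expressions of the machine offer arithmetic and floor division but no comparison. These
  quotients are the indicators of a = b and y > 0; with them each coefficient of the system is a
  single expression without branches.\<close>

definition eqi :: "int \<Rightarrow> int \<Rightarrow> int" where "eqi a b = 1 div (1 + (a - b) * (a - b))"
definition posi :: "int \<Rightarrow> int" where "posi y = - ((- y) div (1 + y * y))"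

lemma eqi_eq: "eqi a b = (if a = b then 1 else 0)"
proof (cases "a = b")
  case False
  then have "(a - b) * (a - b) > 0" by (simp add: zero_less_mult_iff) linarith
  then show ?thesis using False by (simp add: eqi_def)
qed (simp add: eqi_def)

lemma posi_eq: "posi y = (if y > 0 then 1 else 0)"
proof (cases "y > 0")
  case True
  then have "y * 1 \<le> y * y" by (intro mult_left_mono) auto
  then have "- y div (1 + y * y) = -1"
    using True by (intro int_div_pos_eq[where r = "1 + y * y - y"]) (simp, linarith+)
  then show ?thesis using True by (simp add: posi_def)
next
  case False
  then have "0 \<le> y * y + y" using mult_nonpos_nonpos[of y "y + 1"] by (cases "y = 0") (auto simp: algebra_simps)
  then have "- y div (1 + y * y) = 0" using False by (intro div_pos_pos_trivial) auto
  then show ?thesis using False by (simp add: posi_def)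
qed

text \<open>
  The arrays \<open>P 0, \<dots>, P 7\<close> hold \<open>A, B, b, C, c, D, d, y\<close>, scaled by \<open>\<Delta>\<close> and padded with zeros to
  size \<open>s \<times> s\<close>. Row \<open>10 i + f\<close> is the \<open>i\<close>-th inequality of family \<open>f\<close>; columns \<open>3 c\<close>, \<open>3 c + 1\<close>,
  \<open>3 c + 2\<close> belong to \<open>x\<^sub>c\<close>, to the dual variable \<open>u\<^sub>c\<close>, and to the solution \<open>v\<^sub>c\<close> of
  \<open>A\<^sub>+\<^sup>T v = e\<^sub>j\<close>, where \<open>A\<^sub>+\<close> consists of the columns of \<open>A\<close> in the support of \<open>y\<close>; column \<open>3 s\<close>
  is the homogenizing variable \<open>t \<ge> 1\<close>. Family 9 is identically zero.
\<close>
definition sys_coeff ::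
  "(nat \<Rightarrow> nat \<Rightarrow> nat \<Rightarrow> int) \<Rightarrow> int \<Rightarrow> nat \<Rightarrow> int \<Rightarrow> int \<Rightarrow> nat \<Rightarrow> nat \<Rightarrow> int \<Rightarrow> int" where
  "sys_coeff P \<Delta> s f g i c t =
     eqi f 0 * (eqi g 0 * P 5 i c - t * P 6 i 0)
   + (eqi f 1 - eqi f 2) *
       (eqi g 0 * (\<Delta> * P 1 i c) + t * (\<Delta> * P 2 i 0 - (\<Sum>l<s. P 0 i l * P 7 l 0)))
   - eqi f 3 * (t * P 7 i 0)
   + (eqi f 4 - eqi f 5 * posi (P 7 i 0)) * (eqi g 1 * P 0 c i - eqi g 0 * P 3 i c - t * P 4 i 0)
   + (eqi f 6 - eqi f 7) * (posi (P 7 i 0) * (eqi g 2 * P 0 c i))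
   - eqi f 8 * t"

text \<open>Remainders are expressed through \<open>div\<close>, the division that the machine
  offers. In the last column c div 3 equals s and the remainder is 0, so column s of the arrays 1, 3
  and 5 is read there and has to be zero.\<close>

definition sys_mat :: "(nat \<Rightarrow> nat \<Rightarrow> nat \<Rightarrow> int) \<Rightarrow> int \<Rightarrow> nat \<Rightarrow> nat \<Rightarrow> nat \<Rightarrow> int" where
  "sys_mat P \<Delta> s r c = sys_coeff P \<Delta> s (int r - 10 * (int r div 10)) (int c - 3 * (int c div 3))
     (r div 10) (c div 3) (eqi (int c) (3 * int s))"

text \<open>Families: 0 is D x <= d t, 1 and 2 are B x + b t = (A y) t, 3 is y >= 0, 4 is dual
  feasibility, 5 its converse on the support, 6 and 7 fix the values of v on the support, 8 is t >=
  1. In the pessimistic case family 4 asks for slack 1 off the support, but only for i < n: a padded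
  row would read 0 <= -1.\<close>

definition sys_rhs :: "(nat \<Rightarrow> nat \<Rightarrow> nat \<Rightarrow> int) \<Rightarrow> int \<Rightarrow> nat \<Rightarrow> nat \<Rightarrow> nat \<Rightarrow> int" where
  "sys_rhs P md n j r =
     (let f = int r - 10 * (int r div 10); i = r div 10 in
       md * (eqi (int i) (int j) * (posi (P 7 i 0) * (eqi f 6 - eqi f 7))
         - eqi f 4 * ((1 - posi (P 7 i 0)) * posi (int n - int i))) - eqi f 8)"

section \<open>The integer systems express the optimality conditions\<close>

lemma sum_mod3:
  fixes f :: "nat \<Rightarrow> real"
  shows "(\<Sum>c<3 * s + 1. f c) = (\<Sum>c<s. f (3 * c) + f (3 * c + 1) + f (3 * c + 2)) + f (3 * s)"
  by (induction s) (simp_all add: eval_nat_numeral algebra_simps)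

lemma ball_mod10: "(\<forall>r<10 * s. Q r) \<longleftrightarrow> (\<forall>i<s. \<forall>f<10. Q (10 * i + f))" for s :: nat
proof (intro iffI allI impI)
  fix r assume Q: "\<forall>i<s. \<forall>f<10. Q (10 * i + f)" and r: "r < 10 * s"
  have "r div 10 < s" "r mod 10 < 10" using r by (simp_all add: less_mult_imp_div_less mult.commute)
  then have "Q (10 * (r div 10) + r mod 10)" using Q by blast
  then show "Q r" by (simp only: mult_div_mod_eq)
next
  fix i f :: nat assume Q: "\<forall>r<10 * s. Q r" and "i < s" "f < 10"
  then have "10 * i + f < 10 * s" by linarith
  then show "Q (10 * i + f)" using Q by blast
qed

lemma ball_10: "(\<forall>f<10. Q f) \<longleftrightarrow>
  Q 0 \<and> Q 1 \<and> Q 2 \<and> Q 3 \<and> Q 4 \<and> Q 5 \<and> Q 6 \<and> Q 7 \<and> Q 8 \<and> Q (9 :: nat)"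
  by (simp add: numeral_eq_Suc All_less_Suc conj_ac)

lemma eqi_simps: "eqi a a = 1" "a \<noteq> b \<Longrightarrow> eqi a b = 0"
  by (auto simp: eqi_eq)

lemma sys_mat_entry:
  assumes "f < 10" "g < 3" "c < s"
  shows "sys_mat P \<Delta> s (10 * i + f) (3 * c + g) = sys_coeff P \<Delta> s (int f) (int g) i c 0"
    "sys_mat P \<Delta> s (10 * i + f) (3 * s) = sys_coeff P \<Delta> s (int f) 0 i s 1"
proof -
  have 1: "(10 * i + f) div 10 = i" "(3 * c + g) div 3 = c" using assms by auto
  have 2: "int (10 * i + f) div 10 = int i" "int (3 * c + g) div 3 = int c" using assms by auto
  have "int (3 * c + g) \<noteq> 3 * int s" using assms by auto
  then show "sys_mat P \<Delta> s (10 * i + f) (3 * c + g) = sys_coeff P \<Delta> s (int f) (int g) i c 0"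
    unfolding sys_mat_def 1 2 by (simp add: eqi_simps)
  show "sys_mat P \<Delta> s (10 * i + f) (3 * s) = sys_coeff P \<Delta> s (int f) 0 i s 1"
    unfolding sys_mat_def 1 2 by (simp add: eqi_simps)
qed

text \<open>With \<open>md = 0\<close> the condition on \<open>v\<close> is met by v = 0 and no
  slack is demanded, so that one family of systems serves both scenarios.\<close>

definition sys_conditions where
  "sys_conditions P \<Delta> s md n j x u v t \<longleftrightarrow> (\<forall>i<s.
     (\<Sum>c<s. real_of_int (P 5 i c) * x c) \<le> real_of_int (P 6 i 0) * t \<and>
     \<Delta> * (\<Sum>c<s. real_of_int (P 1 i c) * x c) + \<Delta> * real_of_int (P 2 i 0) * t =
       (\<Sum>l<s. real_of_int (P 0 i l) * real_of_int (P 7 l 0)) * t \<and>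
     0 \<le> real_of_int (P 7 i 0) * t \<and>
     (\<Sum>c<s. real_of_int (P 0 c i) * u c) \<le>
       (\<Sum>c<s. real_of_int (P 3 i c) * x c) + real_of_int (P 4 i 0) * t -
       (if md = 1 \<and> i < n \<and> \<not> P 7 i 0 > 0 then 1 else 0) \<and>
     (P 7 i 0 > 0 \<longrightarrow>
       (\<Sum>c<s. real_of_int (P 0 c i) * u c) = (\<Sum>c<s. real_of_int (P 3 i c) * x c) + real_of_int (P 4 i 0) * t \<and>
       (\<Sum>c<s. real_of_int (P 0 c i) * v c) = (if md = 1 \<and> i = j then 1 else 0))) \<and> t \<ge> (1 :: real)"
  for x u v :: "nat \<Rightarrow> real" and \<Delta> :: int and md :: int

lemma lin_feasible_sys_iff:
  assumes s: "s > 0" and pad: "\<And>k i. k \<in> {1, 3, 5} \<Longrightarrow> P k i s = 0" and md: "md = 0 \<or> md = 1"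
  shows "lin_feasible (10 * s) (3 * s + 1) (sys_mat P \<Delta> s) (sys_rhs P md n j) \<longleftrightarrow>
    (\<exists>x u v t. sys_conditions P \<Delta> s md n j x u v t)"
proof -
  define fam where "fam x u v t i f \<longleftrightarrow> (\<Sum>c<s. real_of_int (sys_coeff P \<Delta> s (int f) 0 i c 0) * x c
       + real_of_int (sys_coeff P \<Delta> s (int f) 1 i c 0) * u c + real_of_int (sys_coeff P \<Delta> s (int f) 2 i c 0) * v c)
       + real_of_int (sys_coeff P \<Delta> s (int f) 0 i s 1) * t \<le> real_of_int (md * ((if i = j then 1 else 0) *
         (posi (P 7 i 0) * (eqi (int f) 6 - eqi (int f) 7))
         - eqi (int f) 4 * ((1 - posi (P 7 i 0)) * posi (int n - int i))) - eqi (int f) 8)"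
    for x u v :: "nat \<Rightarrow> real" and t :: real and i f :: nat
  have rhs: "sys_rhs P md n j (10 * i + f) = md * ((if i = j then 1 else 0) * (posi (P 7 i 0) * (eqi (int f) 6 - eqi (int f) 7))
         - eqi (int f) 4 * ((1 - posi (P 7 i 0)) * posi (int n - int i))) - eqi (int f) 8" if "f < 10" for i f
  proof -
    have 1: "(10 * i + f) div 10 = i" "int (10 * i + f) div 10 = int i" using that by auto
    show ?thesis unfolding sys_rhs_def 1 by (simp add: eqi_eq)
  qed
  have rw: "(\<Sum>c<3 * s + 1. real_of_int (sys_mat P \<Delta> s (10 * i + f) c) * z c) \<le> real_of_int (sys_rhs P md n j (10 * i + f))
      \<longleftrightarrow> fam (\<lambda>c. z (3 * c)) (\<lambda>c. z (3 * c + 1)) (\<lambda>c. z (3 * c + 2)) (z (3 * s)) i f"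
    if "f < 10" for i f z
  proof -
    have "sys_mat P \<Delta> s (10 * i + f) (3 * c) = sys_coeff P \<Delta> s (int f) 0 i c 0"
      "sys_mat P \<Delta> s (10 * i + f) (3 * c + 1) = sys_coeff P \<Delta> s (int f) 1 i c 0"
      "sys_mat P \<Delta> s (10 * i + f) (3 * c + 2) = sys_coeff P \<Delta> s (int f) 2 i c 0"
      "sys_mat P \<Delta> s (10 * i + f) (3 * s) = sys_coeff P \<Delta> s (int f) 0 i s 1" if "c < s" for c
      using sys_mat_entry(1)[OF \<open>f < 10\<close> _ that, of 0] sys_mat_entry(1)[OF \<open>f < 10\<close> _ that, of 1]
        sys_mat_entry(1)[OF \<open>f < 10\<close> _ that, of 2] sys_mat_entry(2)[OF \<open>f < 10\<close> _ that, of 0] by simp_all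
    then show ?thesis unfolding sum_mod3 fam_def rhs[OF that] using s by simp
  qed
  have pads: "P (Suc 0) i s = 0" "P 3 i s = 0" "P 5 i s = 0" for i using pad by auto
  have cond: "(\<forall>i<s. \<forall>f<10. fam x u v t i f) \<longleftrightarrow> sys_conditions P \<Delta> s md n j x u v t" for x u v t
  proof -
    have fam_iff: "(\<forall>f<10. fam x u v t i f) \<longleftrightarrow>
     (\<Sum>c<s. real_of_int (P 5 i c) * x c) \<le> real_of_int (P 6 i 0) * t \<and>
     \<Delta> * (\<Sum>c<s. real_of_int (P 1 i c) * x c) + \<Delta> * real_of_int (P 2 i 0) * t =
       (\<Sum>l<s. real_of_int (P 0 i l) * real_of_int (P 7 l 0)) * t \<and>
     0 \<le> real_of_int (P 7 i 0) * t \<and>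
     (\<Sum>c<s. real_of_int (P 0 c i) * u c) \<le>
       (\<Sum>c<s. real_of_int (P 3 i c) * x c) + real_of_int (P 4 i 0) * t -
       (if md = 1 \<and> i < n \<and> \<not> P 7 i 0 > 0 then 1 else 0) \<and>
     (P 7 i 0 > 0 \<longrightarrow>
       (\<Sum>c<s. real_of_int (P 0 c i) * u c) = (\<Sum>c<s. real_of_int (P 3 i c) * x c) + real_of_int (P 4 i 0) * t \<and>
       (\<Sum>c<s. real_of_int (P 0 c i) * v c) = (if md = 1 \<and> i = j then 1 else 0)) \<and> t \<ge> 1" for i
    proof -
      have r0: "fam x u v t i 0 \<longleftrightarrow> (\<Sum>c<s. real_of_int (P 5 i c) * x c) \<le> real_of_int (P 6 i 0) * t"
        by (simp add: fam_def sys_coeff_def eqi_simps pads)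
      have r1: "fam x u v t i 1 \<longleftrightarrow> \<Delta> * (\<Sum>c<s. real_of_int (P 1 i c) * x c) + \<Delta> * real_of_int (P 2 i 0) * t \<le>
          (\<Sum>l<s. real_of_int (P 0 i l) * real_of_int (P 7 l 0)) * t"
        by (simp add: fam_def sys_coeff_def eqi_simps pads sum_distrib_left algebra_simps)
      have r2: "fam x u v t i 2 \<longleftrightarrow> \<Delta> * (\<Sum>c<s. real_of_int (P 1 i c) * x c) + \<Delta> * real_of_int (P 2 i 0) * t \<ge>
          (\<Sum>l<s. real_of_int (P 0 i l) * real_of_int (P 7 l 0)) * t"
        by (simp add: fam_def sys_coeff_def eqi_simps pads sum_distrib_left sum_negf algebra_simps)
      have r3: "fam x u v t i 3 \<longleftrightarrow> 0 \<le> real_of_int (P 7 i 0) * t"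
        by (simp add: fam_def sys_coeff_def eqi_simps pads)
      have r4: "fam x u v t i 4 \<longleftrightarrow> (\<Sum>c<s. real_of_int (P 0 c i) * u c) \<le>
         (\<Sum>c<s. real_of_int (P 3 i c) * x c) + real_of_int (P 4 i 0) * t -
         (if md = 1 \<and> i < n \<and> \<not> P 7 i 0 > 0 then 1 else 0)"
        using md by (auto simp: fam_def sys_coeff_def eqi_simps pads posi_eq sum.distrib sum_negf sum_subtractf)
      have r5: "fam x u v t i 5 \<longleftrightarrow> (P 7 i 0 > 0 \<longrightarrow>
         (\<Sum>c<s. real_of_int (P 0 c i) * u c) \<ge> (\<Sum>c<s. real_of_int (P 3 i c) * x c) + real_of_int (P 4 i 0) * t)"
        by (auto simp: fam_def sys_coeff_def eqi_simps pads posi_eq sum.distrib sum_negf sum_subtractf)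
      have r6: "fam x u v t i 6 \<longleftrightarrow> (P 7 i 0 > 0 \<longrightarrow>
         (\<Sum>c<s. real_of_int (P 0 c i) * v c) \<le> (if md = 1 \<and> i = j then 1 else 0))"
        using md by (auto simp: fam_def sys_coeff_def eqi_simps pads posi_eq sum.distrib sum_negf sum_subtractf)
      have r7: "fam x u v t i 7 \<longleftrightarrow> (P 7 i 0 > 0 \<longrightarrow>
         (\<Sum>c<s. real_of_int (P 0 c i) * v c) \<ge> (if md = 1 \<and> i = j then 1 else 0))"
        using md by (auto simp: fam_def sys_coeff_def eqi_simps pads posi_eq sum.distrib sum_negf sum_subtractf)
      have r8: "fam x u v t i 8 \<longleftrightarrow> t \<ge> 1"
        by (simp add: fam_def sys_coeff_def eqi_simps pads)
      have r9: "fam x u v t i 9 \<longleftrightarrow> True"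
        by (simp add: fam_def sys_coeff_def eqi_simps pads)
      show ?thesis
      proof (cases "P 7 i 0 > 0")
        case True
        show ?thesis
          unfolding ball_10 r0 r1 r2 r3 r4 r5 r6 r7 r8 r9
          by (simp only: True simp_thms if_False)
            (rule iffI; elim conjE; intro conjI; linarith)
      next
        case False
        show ?thesis
          unfolding ball_10 r0 r1 r2 r3 r4 r5 r6 r7 r8 r9
          by (simp only: False simp_thms) (rule iffI; elim conjE; intro conjI; linarith)
      qed
    qed
    have all_conj: "(\<forall>i<s. Q i \<and> T) \<longleftrightarrow> (\<forall>i<s. Q i) \<and> T" for Q T using s by blast
    show ?thesis unfolding sys_conditions_def fam_iff all_conj[symmetric] by (simp only: conj_assoc)
  qed
  show ?thesis
  proof
    assume "lin_feasible (10 * s) (3 * s + 1) (sys_mat P \<Delta> s) (sys_rhs P md n j)"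
    then obtain z :: "nat \<Rightarrow> real" where
      "\<forall>r<10 * s. (\<Sum>c<3 * s + 1. real_of_int (sys_mat P \<Delta> s r c) * z c) \<le> real_of_int (sys_rhs P md n j r)"
      unfolding lin_feasible_def by blast
    then have "\<forall>i<s. \<forall>f<10. fam (\<lambda>c. z (3 * c)) (\<lambda>c. z (3 * c + 1)) (\<lambda>c. z (3 * c + 2)) (z (3 * s)) i f"
      unfolding ball_mod10 using rw by blast
    then show "\<exists>x u v t. sys_conditions P \<Delta> s md n j x u v t" unfolding cond by blast
  next
    assume "\<exists>x u v t. sys_conditions P \<Delta> s md n j x u v t"
    then obtain x u v t where sc: "sys_conditions P \<Delta> s md n j x u v t" by blast
    define z where "z c = (if c = 3 * s then t else if c mod 3 = 0 then x (c div 3)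
      else if c mod 3 = 1 then u (c div 3) else v (c div 3))" for c
    have z: "z (3 * c) = x c" "z (3 * c + 1) = u c" "z (3 * c + 2) = v c" if "c < s" for c
    proof -
      have "3 * c + 1 \<noteq> 3 * s" "3 * c + 2 \<noteq> 3 * s" "(3 * c + 1) div 3 = c" "(3 * c + 2) div 3 = c"
        "(3 * c + 1) mod 3 = 1" "(3 * c + 2) mod 3 = 2" by presburger+
      note * = this
      show "z (3 * c) = x c" using that by (simp add: z_def)
      show "z (3 * c + 1) = u c" "z (3 * c + 2) = v c"
        unfolding z_def * using *(1,2) by (simp_all only: if_False if_True) simp_all
    qed
    have "fam (\<lambda>c. z (3 * c)) (\<lambda>c. z (3 * c + 1)) (\<lambda>c. z (3 * c + 2)) (z (3 * s)) i f
      \<longleftrightarrow> fam x u v t i f" for i f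
    proof -
      have "z (3 * s) = t" by (simp add: z_def)
      then show ?thesis using z unfolding fam_def by simp
    qed
    then have "\<forall>r<10 * s. (\<Sum>c<3 * s + 1. real_of_int (sys_mat P \<Delta> s r c) * z c) \<le> real_of_int (sys_rhs P md n j r)"
      unfolding ball_mod10 using rw sc[folded cond] by blast
    then show "lin_feasible (10 * s) (3 * s + 1) (sys_mat P \<Delta> s) (sys_rhs P md n j)"
      unfolding lin_feasible_def by blast
  qed
qed

lemma sum_pad_mult:
  fixes p q x :: "nat \<Rightarrow> real"
  assumes "\<And>c. p c = (if c < k then D * q c else 0)" "k \<le> s"
  shows "(\<Sum>c<s. p c * x c) = D * (\<Sum>c<k. q c * x c)"
proof -
  have "(\<Sum>c<s. p c * x c) = (\<Sum>c<s. if c < k then D * (q c * x c) else 0)"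
    by (intro sum.cong) (auto simp: assms(1))
  then show ?thesis using assms(2) by (simp add: sum_pad sum_distrib_left)
qed

text \<open>Strictness of the bounds in \<open>dims\<close> leaves the zero column s that the
  homogenizing column of the system reads.\<close>

locale padded_instance =
  fixes P :: "nat \<Rightarrow> nat \<Rightarrow> nat \<Rightarrow> int" and \<Delta> :: int and m n k g s :: nat
    and A B C D :: "nat \<Rightarrow> nat \<Rightarrow> real" and b c d y :: "nat \<Rightarrow> real" and md :: int
  assumes \<Delta>: "\<Delta> > 0" and md: "md = 0 \<or> md = 1"
    and dims: "m < s" "n < s" "k < s" "g < s"
    and P0: "\<And>i l. real_of_int (P 0 i l) = (if i < m \<and> l < n then \<Delta> * A i l else 0)"
    and P1: "\<And>i l. real_of_int (P 1 i l) = (if i < m \<and> l < k then \<Delta> * B i l else 0)"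
    and P2: "\<And>i. real_of_int (P 2 i 0) = (if i < m then \<Delta> * b i else 0)"
    and P3: "\<And>i l. real_of_int (P 3 i l) = (if i < n \<and> l < k then \<Delta> * C i l else 0)"
    and P4: "\<And>i. real_of_int (P 4 i 0) = (if i < n then \<Delta> * c i else 0)"
    and P5: "\<And>i l. real_of_int (P 5 i l) = (if i < g \<and> l < k then \<Delta> * D i l else 0)"
    and P6: "\<And>i. real_of_int (P 6 i 0) = (if i < g then \<Delta> * d i else 0)"
    and P7: "\<And>i. real_of_int (P 7 i 0) = (if i < n then \<Delta> * y i else 0)"
begin

abbreviation "Dx x i \<equiv> \<Sum>l<k. D i l * x l"
abbreviation "Bx x i \<equiv> \<Sum>l<k. B i l * x l"
abbreviation "Cx x i \<equiv> \<Sum>l<k. C i l * x l"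
abbreviation "Ay i \<equiv> \<Sum>l<n. A i l * y l"
abbreviation "Au u l \<equiv> \<Sum>i<m. A i l * u i"

lemma pad_sums:
  "(\<Sum>l<s. real_of_int (P 5 i l) * x l) = (if i < g then \<Delta> * Dx x i else 0)"
  "(\<Sum>l<s. real_of_int (P 1 i l) * x l) = (if i < m then \<Delta> * Bx x i else 0)"
  "(\<Sum>l<s. real_of_int (P 3 i l) * x l) = (if i < n then \<Delta> * Cx x i else 0)"
  "(\<Sum>l<s. real_of_int (P 0 l i) * x l) = (if i < n then \<Delta> * Au x i else 0)"
  "(\<Sum>l<s. real_of_int (P 0 i l) * real_of_int (P 7 l 0)) = (if i < m then \<Delta> * (\<Delta> * Ay i) else 0)"
proof -
  show "(\<Sum>l<s. real_of_int (P 5 i l) * x l) = (if i < g then \<Delta> * Dx x i else 0)"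
    using dims sum_pad_mult[of "\<lambda>l. P 5 i l" k \<Delta> "D i" s x] by (auto simp: P5)
  show "(\<Sum>l<s. real_of_int (P 1 i l) * x l) = (if i < m then \<Delta> * Bx x i else 0)"
    using dims sum_pad_mult[of "\<lambda>l. P 1 i l" k \<Delta> "B i" s x] by (auto simp: P1[unfolded One_nat_def])
  show "(\<Sum>l<s. real_of_int (P 3 i l) * x l) = (if i < n then \<Delta> * Cx x i else 0)"
    using dims sum_pad_mult[of "\<lambda>l. P 3 i l" k \<Delta> "C i" s x] by (auto simp: P3)
  show "(\<Sum>l<s. real_of_int (P 0 l i) * x l) = (if i < n then \<Delta> * Au x i else 0)"
    using dims sum_pad_mult[of "\<lambda>l. P 0 l i" m \<Delta> "\<lambda>l. A l i" s x] by (auto simp: P0)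
  have "(\<Sum>l<n. A i l * real_of_int (P 7 l 0)) = \<Delta> * Ay i"
    by (simp add: P7 sum_distrib_left mult_ac)
  then show "(\<Sum>l<s. real_of_int (P 0 i l) * real_of_int (P 7 l 0)) = (if i < m then \<Delta> * (\<Delta> * Ay i) else 0)"
    using dims sum_pad_mult[of "\<lambda>l. P 0 i l" n \<Delta> "A i" s "\<lambda>l. real_of_int (P 7 l 0)"] by (auto simp: P0)
qed

text \<open>The conditions without padding. The factor \<open>\<Delta>\<close> stays where the
  right-hand side contains the unscaled 1.\<close>

definition core where
  "core j x u v t \<longleftrightarrow> t \<ge> (1 :: real) \<and> (\<forall>i<g. Dx x i \<le> d i * t) \<and> (\<forall>i<m. Bx x i + b i * t = Ay i * t) \<and>
     (\<forall>l<n. 0 \<le> y l \<and> \<Delta> * Au u l \<le> \<Delta> * (Cx x l + c l * t) - (if md = 1 \<and> \<not> y l > 0 then 1 else 0) \<and>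
       (y l > 0 \<longrightarrow> Au u l = Cx x l + c l * t \<and> \<Delta> * Au v l = (if md = 1 \<and> l = j then 1 else 0)))"
  for x u v :: "nat \<Rightarrow> real"

lemma sys_conditions_iff: "sys_conditions P \<Delta> s md n j x u v t \<longleftrightarrow> core j x u v t"
proof (cases "t \<ge> 1")
  case True
  then have t: "t > 0" by simp
  have D: "real_of_int \<Delta> > 0" using \<Delta> by simp
  have P7pos: "P 7 i 0 > 0 \<longleftrightarrow> i < n \<and> y i > 0" for i
  proof -
    have "P 7 i 0 > 0 \<longleftrightarrow> real_of_int (P 7 i 0) > 0" by simp
    also have "\<dots> \<longleftrightarrow> i < n \<and> y i > 0" unfolding P7 using D by (simp add: zero_less_mult_iff)
    finally show ?thesis .
  qed
  have e5: "(\<Sum>l<s. real_of_int (P 5 i l) * x l) \<le> real_of_int (P 6 i 0) * t \<longleftrightarrow> (i < g \<longrightarrow> Dx x i \<le> d i * t)" for i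
    unfolding pad_sums P6 using D by (simp add: mult.assoc)
  have e1: "\<Delta> * (\<Sum>l<s. real_of_int (P 1 i l) * x l) + \<Delta> * real_of_int (P 2 i 0) * t =
       (\<Sum>l<s. real_of_int (P 0 i l) * real_of_int (P 7 l 0)) * t \<longleftrightarrow> (i < m \<longrightarrow> Bx x i + b i * t = Ay i * t)" for i
  proof (cases "i < m")
    case True
    have "\<Delta> * (\<Delta> * Bx x i) + \<Delta> * (\<Delta> * b i) * t = \<Delta> * (\<Delta> * (Bx x i + b i * t))"
      "\<Delta> * (\<Delta> * Ay i) * t = \<Delta> * (\<Delta> * (Ay i * t))" by (simp_all add: algebra_simps)
    then show ?thesis unfolding pad_sums P2 using D True by simp
  qed (simp add: pad_sums pad_sums[unfolded One_nat_def] P2)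
  have e7: "0 \<le> real_of_int (P 7 i 0) * t \<longleftrightarrow> (i < n \<longrightarrow> 0 \<le> y i)" for i
    unfolding P7 using D t by (simp add: zero_le_mult_iff)
  have e4: "(\<Sum>l<s. real_of_int (P 0 l i) * u l) \<le> (\<Sum>l<s. real_of_int (P 3 i l) * x l) + real_of_int (P 4 i 0) * t -
       (if md = 1 \<and> i < n \<and> \<not> P 7 i 0 > 0 then 1 else 0) \<longleftrightarrow>
     (i < n \<longrightarrow> \<Delta> * Au u i \<le> \<Delta> * (Cx x i + c i * t) - (if md = 1 \<and> \<not> y i > 0 then 1 else 0))" for i
    unfolding pad_sums P4 P7pos by (simp add: algebra_simps)
  have e3: "(\<Sum>l<s. real_of_int (P 0 l i) * u l) = (\<Sum>l<s. real_of_int (P 3 i l) * x l) + real_of_int (P 4 i 0) * t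
     \<longleftrightarrow> (i < n \<longrightarrow> Au u i = Cx x i + c i * t)" for i
  proof (cases "i < n")
    case True
    have "\<Delta> * Cx x i + \<Delta> * c i * t = \<Delta> * (Cx x i + c i * t)" by (simp add: algebra_simps)
    then show ?thesis unfolding pad_sums P4 using D True by simp
  qed (simp add: pad_sums P4)
  have ev: "(\<Sum>l<s. real_of_int (P 0 l i) * v l) = (if i < n then \<Delta> * Au v i else 0)" for i
    by (rule pad_sums)
  show ?thesis
    unfolding sys_conditions_def core_def e5 e1 e7 e4 e3 unfolding P7pos ev
  proof (intro iffI conjI allI impI; elim conjE)
    fix i
    assume *: "\<forall>i<s. (i < g \<longrightarrow> Dx x i \<le> d i * t) \<and> (i < m \<longrightarrow> Bx x i + b i * t = Ay i * t) \<and> (i < n \<longrightarrow> 0 \<le> y i) \<and>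
       (i < n \<longrightarrow> \<Delta> * Au u i \<le> \<Delta> * (Cx x i + c i * t) - (if md = 1 \<and> \<not> y i > 0 then 1 else 0)) \<and>
       (i < n \<and> 0 < y i \<longrightarrow> (i < n \<longrightarrow> Au u i = Cx x i + c i * t) \<and>
         (if i < n then \<Delta> * Au v i else 0) = (if md = 1 \<and> i = j then 1 else 0))"
    {
      assume i: "i < g" then show "Dx x i \<le> d i * t" using *[rule_format, of i] dims by simp
    next
      assume i: "i < m" then show "Bx x i + b i * t = Ay i * t" using *[rule_format, of i] dims by simp
    next
      assume i: "i < n"
      note ** = *[rule_format, OF order.strict_trans[OF i dims(2)]]
      show "0 \<le> y i" using ** i by simp
      show "\<Delta> * Au u i \<le> \<Delta> * (Cx x i + c i * t) - (if md = 1 \<and> \<not> y i > 0 then 1 else 0)" using ** i by simp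
      assume "y i > 0"
      then show "Au u i = Cx x i + c i * t" "\<Delta> * Au v i = (if md = 1 \<and> i = j then 1 else 0)" using ** i by simp_all
    }
  qed (simp_all)
qed (simp add: sys_conditions_def core_def)

definition optimum where
  "optimum x \<longleftrightarrow> (if md = 1 then std_unique else std_optimal) m n A (\<lambda>i. Bx x i + b i) (\<lambda>l. Cx x l + c l) y"

text \<open>A certificate (u, t) at x gives the solution (t x, u, v, t): the substitution of t x for
  x makes the product t (C x + c) linear. In the optimistic case t = 1.\<close>

lemma optimum_imp_core:
  assumes x: "\<forall>i<g. Dx x i \<le> d i" and opt: "optimum x"
  shows "\<exists>x u v t. core j x u v t"
proof -
  have D: "real_of_int \<Delta> \<ge> 1" using \<Delta> by simp
  have y: "std_feasible m n A (\<lambda>i. Bx x i + b i) y"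
    using opt by (auto simp: optimum_def std_unique_def std_optimal_def split: if_splits)
  have "\<exists>u t. t \<ge> 1 \<and> (\<forall>l<n. Au u l \<le> t * (Cx x l + c l) - (if md = 1 \<and> \<not> y l > 0 then 1 else 0) \<and>
        (y l > 0 \<longrightarrow> Au u l = t * (Cx x l + c l)))"
  proof (cases "md = 1")
    case True
    then have un: "std_unique m n A (\<lambda>i. Bx x i + b i) (\<lambda>l. Cx x l + c l) y" using opt[unfolded optimum_def] True by simp
    obtain u t where ut: "t \<ge> 1" "\<forall>l<n. Au u l \<le> t * (Cx x l + c l) - (if y l > 0 then 0 else 1) \<and>
        (y l > 0 \<longrightarrow> Au u l = t * (Cx x l + c l))"
      using un[unfolded std_unique_iff] by blast
    have "(if md = 1 \<and> \<not> y l > 0 then 1 else 0 :: real) = (if y l > 0 then 0 else 1)" for l using True by simp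
    then show ?thesis using ut by (intro exI[of _ u] exI[of _ t]) simp
  next
    case False
    then have op: "std_optimal m n A (\<lambda>i. Bx x i + b i) (\<lambda>l. Cx x l + c l) y" using opt[unfolded optimum_def] False by simp
    obtain u where "\<forall>l<n. Au u l \<le> Cx x l + c l \<and> (y l > 0 \<longrightarrow> Au u l = Cx x l + c l)"
      using op[unfolded std_optimal_iff] by blast
    then show ?thesis using False by (intro exI[of _ u] exI[of _ 1]) simp
  qed
  then obtain u t where t: "t \<ge> 1"
    and u1: "\<And>l. l < n \<Longrightarrow> Au u l \<le> t * (Cx x l + c l) - (if md = 1 \<and> \<not> y l > 0 then 1 else 0)"
    and u2: "\<And>l. l < n \<Longrightarrow> y l > 0 \<Longrightarrow> Au u l = t * (Cx x l + c l)" by blast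
  have "\<exists>v. \<forall>l<n. y l > 0 \<longrightarrow> \<Delta> * Au v l = (if md = 1 \<and> l = j then 1 else 0)"
  proof (cases "md = 1 \<and> j < n")
    case True
    then have un: "std_unique m n A (\<lambda>i. Bx x i + b i) (\<lambda>l. Cx x l + c l) y" using opt[unfolded optimum_def] True by simp
    obtain v where v: "\<forall>l<n. y l > 0 \<longrightarrow> Au v l = (if l = j then 1 else 0)"
      using un[unfolded std_unique_iff] True by blast
    \<comment> \<open>The rows of \<open>A\<close> are scaled by \<open>\<Delta>\<close> and the
      right-hand side 1 is not; dividing \<open>v\<close> compensates.\<close>
    have "\<Delta> * Au (\<lambda>i. v i / \<Delta>) l = Au v l" for l
      using D by (simp add: sum_divide_distrib[symmetric])
    then show ?thesis using v True by (intro exI[of _ "\<lambda>i. v i / \<Delta>"]) simp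
  next
    case False
    then show ?thesis by (intro exI[of _ "\<lambda>_. 0"]) auto
  qed
  then obtain v where v: "\<And>l. l < n \<Longrightarrow> y l > 0 \<Longrightarrow> \<Delta> * Au v l = (if md = 1 \<and> l = j then 1 else 0)" by blast
  have scale: "(\<Sum>l<N. M i l * (t * x l)) = t * (\<Sum>l<N. M i l * x l)" for M :: "nat \<Rightarrow> nat \<Rightarrow> real" and i N
    by (simp add: sum_distrib_left mult_ac)
  have "core j (\<lambda>i. t * x i) u v t"
    unfolding core_def scale
  proof (intro conjI allI impI)
    show "t \<ge> 1" by (rule t)
    fix i assume "i < g"
    then have "t * Dx x i \<le> t * d i" using x t by (intro mult_left_mono) auto
    then show "t * Dx x i \<le> d i * t" by (simp add: mult.commute)
  next
    fix i assume "i < m"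
    then have "Bx x i + b i = Ay i" using y by (simp add: std_feasible_def)
    then show "t * Bx x i + b i * t = Ay i * t" by (metis distrib_left mult.commute)
  next
    fix l assume l: "l < n"
    show "0 \<le> y l" using y l by (simp add: std_feasible_def)
    have eq: "t * Cx x l + c l * t = t * (Cx x l + c l)" by (simp add: algebra_simps)
    have "\<Delta> * Au u l \<le> \<Delta> * (t * (Cx x l + c l) - (if md = 1 \<and> \<not> y l > 0 then 1 else 0))"
      using D u1[OF l] by (intro mult_left_mono) auto
    also have "\<dots> \<le> \<Delta> * (t * (Cx x l + c l)) - (if md = 1 \<and> \<not> y l > 0 then 1 else 0)"
      using D by (simp add: right_diff_distrib)
    finally show "\<Delta> * Au u l \<le> \<Delta> * (t * Cx x l + c l * t) - (if md = 1 \<and> \<not> y l > 0 then 1 else 0)"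
      unfolding eq .
    assume p: "y l > 0"
    show "Au u l = t * Cx x l + c l * t" unfolding eq by (rule u2[OF l p])
    show "\<Delta> * Au v l = (if md = 1 \<and> l = j then 1 else 0)" by (rule v[OF l p])
  qed
  then show ?thesis by blast
qed

lemma core_imp_optimum:
  assumes ex: "\<forall>j<s. \<exists>x u v t. core j x u v t"
  shows "\<exists>x. (\<forall>i<g. Dx x i \<le> d i) \<and> optimum x"
proof -
  have D: "real_of_int \<Delta> \<ge> 1" using \<Delta> by simp
  \<comment> \<open>Any index would do for x, u, t; \<open>n\<close> is below \<open>s\<close> in
    every instance.\<close>
  obtain x u v t where cr: "core n x u v t" using ex dims by blast
  then have t: "t \<ge> 1" and c1: "\<And>i. i < g \<Longrightarrow> Dx x i \<le> d i * t" and c2: "\<And>i. i < m \<Longrightarrow> Bx x i + b i * t = Ay i * t"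
    and c3: "\<And>l. l < n \<Longrightarrow> 0 \<le> y l"
    and c4: "\<And>l. l < n \<Longrightarrow> \<Delta> * Au u l \<le> \<Delta> * (Cx x l + c l * t) - (if md = 1 \<and> \<not> y l > 0 then 1 else 0)"
    and c5: "\<And>l. l < n \<Longrightarrow> y l > 0 \<Longrightarrow> Au u l = Cx x l + c l * t"
    unfolding core_def by auto
  define X where "X i = x i / t" for i
  have X: "(\<Sum>l<N. M i l * X l) = (\<Sum>l<N. M i l * x l) / t" for M :: "nat \<Rightarrow> nat \<Rightarrow> real" and i N
    by (simp add: X_def sum_divide_distrib)
  have "\<forall>i<g. Dx X i \<le> d i" unfolding X using c1 t by (simp add: divide_le_eq)
  moreover have "optimum X"
  proof -
    have y: "std_feasible m n A (\<lambda>i. Bx X i + b i) y"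
      unfolding std_feasible_def X using c2 c3 t by (auto simp: field_simps)
    have tw: "t * (Cx X l + c l) = Cx x l + c l * t" for l unfolding X using t by (simp add: field_simps)
    show ?thesis
    proof (cases "md = 1")
      case False
      have ut: "Au (\<lambda>i. u i / t) l = Au u l / t" for l by (simp add: sum_divide_distrib)
      have le: "Au u l \<le> t * (Cx X l + c l)" if "l < n" for l
      proof -
        have "\<Delta> * Au u l \<le> \<Delta> * (Cx x l + c l * t)" using c4[OF that] False by simp
        then show ?thesis using D unfolding tw by simp
      qed
      have dual: "\<forall>l<n. Au (\<lambda>i. u i / t) l \<le> Cx X l + c l \<and> (y l > 0 \<longrightarrow> Au (\<lambda>i. u i / t) l = Cx X l + c l)"
      proof (intro allI impI conjI)
        fix l assume l: "l < n"
        show "Au (\<lambda>i. u i / t) l \<le> Cx X l + c l" unfolding ut using le[OF l] t by (simp add: divide_le_eq mult.commute)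
        assume "y l > 0"
        then have "Au u l = t * (Cx X l + c l)" using c5 l tw by simp
        then show "Au (\<lambda>i. u i / t) l = Cx X l + c l" unfolding ut using t by simp
      qed
      have "std_optimal m n A (\<lambda>i. Bx X i + b i) (\<lambda>l. Cx X l + c l) y"
        unfolding std_optimal_iff by (intro conjI y exI[of _ "\<lambda>i. u i / t"]) (fact dual)
      then show ?thesis unfolding optimum_def using False by simp
    next
      case True
      have Au: "Au (\<lambda>i. \<Delta> * u i) l = \<Delta> * Au u l" for u :: "nat \<Rightarrow> real" and l by (simp add: sum_distrib_left mult_ac)
      have "std_unique m n A (\<lambda>i. Bx X i + b i) (\<lambda>l. Cx X l + c l) y"
        unfolding std_unique_iff
      proof (intro conjI y)
        \<comment> \<open>Multiplying u and t by \<open>\<Delta>\<close> turns slack 1 in the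
          integer system into slack 1 in the rational one.\<close>
        have "\<Delta> * t \<ge> 1" using D t mult_mono[of 1 "real_of_int \<Delta>" 1 t] by simp
        moreover have "Au (\<lambda>i. \<Delta> * u i) l \<le> \<Delta> * t * (Cx X l + c l) - (if y l > 0 then 0 else 1)" if "l < n" for l
          unfolding Au mult.assoc tw using c4[OF that] True by (auto split: if_splits)
        moreover have "Au (\<lambda>i. \<Delta> * u i) l = \<Delta> * t * (Cx X l + c l)" if "l < n" "y l > 0" for l
          unfolding Au mult.assoc tw using c5[OF that] by simp
        ultimately show "\<exists>u t. 1 \<le> t \<and> (\<forall>l<n. Au u l \<le> t * (Cx X l + c l) - (if 0 < y l then 0 else 1) \<and>
            (0 < y l \<longrightarrow> Au u l = t * (Cx X l + c l)))"
          by (intro exI[of _ "\<lambda>i. \<Delta> * u i"] exI[of _ "\<Delta> * t"] conjI allI impI) blast+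
        show "\<forall>j<n. \<exists>v. \<forall>l<n. 0 < y l \<longrightarrow> Au v l = (if l = j then 1 else 0)"
        proof (intro allI impI)
          fix j assume "j < n"
          then have "j < s" using dims by simp
          then obtain x' u' v' t' where "core j x' u' v' t'" using ex by blast
          note cj = this[unfolded core_def, THEN conjunct2, THEN conjunct2, THEN conjunct2, rule_format]
          have "\<forall>l<n. 0 < y l \<longrightarrow> Au (\<lambda>i. \<Delta> * v' i) l = (if l = j then 1 else 0)"
          proof (intro allI impI)
            fix l assume "l < n" "0 < y l"
            then have "\<Delta> * Au v' l = (if md = 1 \<and> l = j then 1 else 0)" using cj by blast
            then show "Au (\<lambda>i. \<Delta> * v' i) l = (if l = j then 1 else 0)" unfolding Au using True by simp
          qed
          then show "\<exists>v. \<forall>l<n. 0 < y l \<longrightarrow> Au v l = (if l = j then 1 else 0)"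
            by (rule exI[of _ "\<lambda>i. \<Delta> * v' i"])
        qed
      qed
      then show ?thesis unfolding optimum_def using True by simp
    qed
  qed
  ultimately show ?thesis by blast
qed

theorem systems_feasible_iff:
  "(\<forall>j<s. lin_feasible (10 * s) (3 * s + 1) (sys_mat P \<Delta> s) (sys_rhs P md n j)) \<longleftrightarrow>
   (\<exists>x. (\<forall>i<g. Dx x i \<le> d i) \<and> optimum x)"
proof -
  have s: "s > 0" using dims by simp
  have "real_of_int (P k i s) = 0" if "k \<in> {1, 3, 5}" for k i
    using that dims by (elim insertE) (simp_all add: P1 P3 P5 P1[unfolded One_nat_def])
  then have pad: "P k i s = 0" if "k \<in> {1, 3, 5}" for k i using that by (metis of_int_eq_0_iff)
  have "lin_feasible (10 * s) (3 * s + 1) (sys_mat P \<Delta> s) (sys_rhs P md n j)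
      \<longleftrightarrow> (\<exists>x u v t. sys_conditions P \<Delta> s md n j x u v t)" for j
    by (rule lin_feasible_sys_iff[OF s _ md]) (rule pad)
  then show ?thesis
    unfolding sys_conditions_iff
  proof (simp only:, intro iffI)
    assume "\<exists>x. (\<forall>i<g. Dx x i \<le> d i) \<and> optimum x"
    then obtain x where x: "\<forall>i<g. Dx x i \<le> d i" "optimum x" by blast
    show "\<forall>j<s. \<exists>x u v t. core j x u v t" by (intro allI impI optimum_imp_core[OF x])
  qed (rule core_imp_optimum)
qed

end

section \<open>From vectors and matrices to functions on indices\<close>

lemma mult_mat_vec_index_sum:
  assumes "A \<in> carrier_mat m n" "x \<in> carrier_vec n" "i < m"
  shows "(A *\<^sub>v x) $ i = (\<Sum>l<n. A $$ (i, l) * x $ l)"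
  using assms by (simp add: scalar_prod_def atLeast0LessThan)

lemma mem_lp_feasible_iff:
  assumes A: "A \<in> carrier_mat m n" and r: "r \<in> carrier_vec m"
  shows "y \<in> lp_feasible A r \<longleftrightarrow> y \<in> carrier_vec n \<and> std_feasible m n (\<lambda>i l. A $$ (i, l)) (\<lambda>i. r $ i) (\<lambda>l. y $ l)"
proof (cases "y \<in> carrier_vec n")
  case True
  have "A *\<^sub>v y = r \<longleftrightarrow> (\<forall>i<m. (\<Sum>l<n. A $$ (i, l) * y $ l) = r $ i)"
  proof -
    have "A *\<^sub>v y = r \<longleftrightarrow> (\<forall>i<m. (A *\<^sub>v y) $ i = r $ i)"
      using A r by (auto simp del: index_mult_mat_vec intro!: eq_vecI)
    also have "\<dots> \<longleftrightarrow> (\<forall>i<m. (\<Sum>l<n. A $$ (i, l) * y $ l) = r $ i)"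
      using mult_mat_vec_index_sum[OF A True] by metis
    finally show ?thesis .
  qed
  moreover have "0\<^sub>v n \<le> y \<longleftrightarrow> (\<forall>l<n. 0 \<le> y $ l)"
    using True by (auto simp: less_eq_vec_def)
  ultimately show ?thesis using A True by (simp add: lp_feasible_def std_feasible_def)
qed (use A in \<open>simp add: lp_feasible_def\<close>)

lemma mem_lp_argmin_iff:
  assumes A: "A \<in> carrier_mat m n" and r: "r \<in> carrier_vec m" and w: "w \<in> carrier_vec n"
  shows "y \<in> lp_argmin w A r \<longleftrightarrow>
    y \<in> carrier_vec n \<and> std_optimal m n (\<lambda>i l. A $$ (i, l)) (\<lambda>i. r $ i) (\<lambda>l. w $ l) (\<lambda>l. y $ l)"
proof -
  have obj: "w \<bullet> z = (\<Sum>l<n. w $ l * z $ l)" if "z \<in> carrier_vec n" for z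
    using that by (simp add: scalar_prod_def atLeast0LessThan)
  have restrict: "(\<Sum>l<n. q l * vec n z $ l) = (\<Sum>l<n. q l * z l)" for q z :: "nat \<Rightarrow> real"
    by (intro sum.cong) auto
  have "(\<forall>z\<in>lp_feasible A r. w \<bullet> y \<le> w \<bullet> z) \<longleftrightarrow>
      (\<forall>z. std_feasible m n (\<lambda>i l. A $$ (i, l)) (\<lambda>i. r $ i) z \<longrightarrow> (\<Sum>l<n. w $ l * y $ l) \<le> (\<Sum>l<n. w $ l * z l))"
    if y: "y \<in> carrier_vec n"
  proof (intro iffI allI impI ballI)
    fix z assume le: "\<forall>z\<in>lp_feasible A r. w \<bullet> y \<le> w \<bullet> z"
      and z: "std_feasible m n (\<lambda>i l. A $$ (i, l)) (\<lambda>i. r $ i) z"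
    then have "std_feasible m n (\<lambda>i l. A $$ (i, l)) (\<lambda>i. r $ i) (\<lambda>l. vec n z $ l)"
      by (simp add: std_feasible_def restrict)
    then have "vec n z \<in> lp_feasible A r" by (simp add: mem_lp_feasible_iff[OF A r])
    then have "w \<bullet> y \<le> w \<bullet> vec n z" using le by blast
    then show "(\<Sum>l<n. w $ l * y $ l) \<le> (\<Sum>l<n. w $ l * z l)" using y by (simp add: obj restrict)
  next
    fix z assume "\<forall>z. std_feasible m n (\<lambda>i l. A $$ (i, l)) (\<lambda>i. r $ i) z \<longrightarrow> (\<Sum>l<n. w $ l * y $ l) \<le> (\<Sum>l<n. w $ l * z l)"
      and "z \<in> lp_feasible A r"
    then show "w \<bullet> y \<le> w \<bullet> z" using y by (simp add: mem_lp_feasible_iff[OF A r] obj)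
  qed
  then show ?thesis by (auto simp: lp_argmin_def std_optimal_def mem_lp_feasible_iff[OF A r])
qed

lemma lp_argmin_eq_singleton_iff:
  assumes A: "A \<in> carrier_mat m n" and r: "r \<in> carrier_vec m" and w: "w \<in> carrier_vec n"
    and y: "y \<in> carrier_vec n"
  shows "lp_argmin w A r = {y} \<longleftrightarrow>
    std_unique m n (\<lambda>i l. A $$ (i, l)) (\<lambda>i. r $ i) (\<lambda>l. w $ l) (\<lambda>l. y $ l)"
proof -
  have restrict: "(\<Sum>l<n. q l * vec n z $ l) = (\<Sum>l<n. q l * z l)" for q z :: "nat \<Rightarrow> real"
    by (intro sum.cong) auto
  \<comment> \<open>Optimality depends on the first n values only, so every optimal function is
    represented by a vector.\<close>
  have opt_restrict: "std_optimal m n (\<lambda>i l. A $$ (i, l)) (\<lambda>i. r $ i) (\<lambda>l. w $ l) (\<lambda>l. vec n z $ l)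
      \<longleftrightarrow> std_optimal m n (\<lambda>i l. A $$ (i, l)) (\<lambda>i. r $ i) (\<lambda>l. w $ l) z" for z
    by (simp add: std_optimal_def std_feasible_def restrict)
  show ?thesis
    unfolding std_unique_def
  proof (intro iffI conjI allI impI)
    assume eq: "lp_argmin w A r = {y}"
    then have "y \<in> lp_argmin w A r" by simp
    then show "std_optimal m n (\<lambda>i l. A $$ (i, l)) (\<lambda>i. r $ i) (\<lambda>l. w $ l) (\<lambda>l. y $ l)"
      by (simp add: mem_lp_argmin_iff[OF A r w])
    fix z l assume z: "std_optimal m n (\<lambda>i l. A $$ (i, l)) (\<lambda>i. r $ i) (\<lambda>l. w $ l) z" and l: "l < n"
    have "vec n z \<in> lp_argmin w A r" using z by (simp add: mem_lp_argmin_iff[OF A r w] opt_restrict)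
    then have "vec n z = y" using eq by simp
    then show "z l = y $ l" using l by auto
  next
    assume *: "std_optimal m n (\<lambda>i l. A $$ (i, l)) (\<lambda>i. r $ i) (\<lambda>l. w $ l) (\<lambda>l. y $ l) \<and>
      (\<forall>z. std_optimal m n (\<lambda>i l. A $$ (i, l)) (\<lambda>i. r $ i) (\<lambda>l. w $ l) z \<longrightarrow> (\<forall>l<n. z l = y $ l))"
    show "lp_argmin w A r = {y}"
    proof (intro equalityI subsetI)
      fix z assume "z \<in> lp_argmin w A r"
      then have z: "z \<in> carrier_vec n" "\<forall>l<n. z $ l = y $ l"
        using * by (auto simp: mem_lp_argmin_iff[OF A r w])
      then have "z = y" using y by (intro eq_vecI) auto
      then show "z \<in> {y}" by simp
    next
      fix z assume "z \<in> {y}"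
      then show "z \<in> lp_argmin w A r" using * y by (simp add: mem_lp_argmin_iff[OF A r w])
    qed
  qed
qed

lemma map_vec_index_sum:
  assumes M: "M \<in> carrier_mat p k" and q: "q \<in> carrier_vec p" and x: "x \<in> carrier_vec k" and i: "i < p"
  shows "(real_mat M *\<^sub>v x + real_vec q) $ i = (\<Sum>l<k. real_of_rat (M $$ (i, l)) * x $ l) + real_of_rat (q $ i)"
proof -
  have RM: "real_mat M \<in> carrier_mat p k" using M by simp
  have "(\<Sum>l<k. real_mat M $$ (i, l) * x $ l) = (\<Sum>l<k. real_of_rat (M $$ (i, l)) * x $ l)"
    using M i by (intro sum.cong) auto
  moreover have "(real_mat M *\<^sub>v x + real_vec q) $ i = (real_mat M *\<^sub>v x) $ i + real_vec q $ i"
    using q i M by (simp del: index_mult_mat_vec)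
  ultimately show ?thesis
    using mult_mat_vec_index_sum[OF RM x i] q i by simp
qed

lemma std_cong:
  assumes "\<And>i. i < m \<Longrightarrow> r i = r' i" "\<And>l. l < n \<Longrightarrow> w l = w' l" "\<And>l. l < n \<Longrightarrow> y l = y' l"
    "\<And>i l. i < m \<Longrightarrow> l < n \<Longrightarrow> A i l = A' i l"
  shows "std_optimal m n A r w y = std_optimal m n A' r' w' y'"
    "std_unique m n A r w y = std_unique m n A' r' w' y'"
proof -
  have f: "std_feasible m n A r z = std_feasible m n A' r' z'" if "\<And>l. l < n \<Longrightarrow> z l = z' l" for z z'
    unfolding std_feasible_def using assms that by (intro arg_cong2[where f = "(\<and>)"] all_cong) (auto intro!: sum.cong)
  have o: "std_optimal m n A r w z = std_optimal m n A' r' w' z'" if "\<And>l. l < n \<Longrightarrow> z l = z' l" for z z'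
  proof -
    have "(\<Sum>l<n. w l * z l) = (\<Sum>l<n. w' l * z' l)" "(\<Sum>l<n. w l * x l) = (\<Sum>l<n. w' l * x l)" for x
      using assms(2) that by (auto intro!: sum.cong)
    then show ?thesis unfolding std_optimal_def using f[OF that] f[OF refl] by simp
  qed
  show "std_optimal m n A r w y = std_optimal m n A' r' w' y'" by (rule o[OF assms(3)])
  then show "std_unique m n A r w y = std_unique m n A' r' w' y'"
    unfolding std_unique_def using o[OF refl] assms(3) by simp
qed

lemma instance_iff:
  assumes A: "A \<in> carrier_mat m n" and B: "B \<in> carrier_mat m k" and b: "b \<in> carrier_vec m"
    and C: "C \<in> carrier_mat n k" and c: "c \<in> carrier_vec n" and D: "D \<in> carrier_mat g k"
    and d: "d \<in> carrier_vec g" and y: "y \<in> carrier_vec n"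
  defines "F \<equiv> \<lambda>M i l. real_of_rat (M $$ (i, l))" and "G \<equiv> \<lambda>v i. real_of_rat (v $ i)"
  shows "optimistic (A, B, b, C, c, D, d, y) \<longleftrightarrow> (\<exists>x. (\<forall>i<g. (\<Sum>l<k. F D i l * x l) \<le> G d i) \<and>
      std_optimal m n (F A) (\<lambda>i. (\<Sum>l<k. F B i l * x l) + G b i) (\<lambda>i. (\<Sum>l<k. F C i l * x l) + G c i) (G y))"
    and "pessimistic (A, B, b, C, c, D, d, y) \<longleftrightarrow> (\<exists>x. (\<forall>i<g. (\<Sum>l<k. F D i l * x l) \<le> G d i) \<and>
      std_unique m n (F A) (\<lambda>i. (\<Sum>l<k. F B i l * x l) + G b i) (\<lambda>i. (\<Sum>l<k. F C i l * x l) + G c i) (G y))"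
proof -
  have RA: "real_mat A \<in> carrier_mat m n" using A by simp
  have rv: "real_mat B *\<^sub>v x + real_vec b \<in> carrier_vec m" "real_mat C *\<^sub>v x + real_vec c \<in> carrier_vec n" for x
  proof -
    have "dim_vec (real_mat B *\<^sub>v x + real_vec b) = m" using b by simp
    then show "real_mat B *\<^sub>v x + real_vec b \<in> carrier_vec m" by (rule carrier_vecI)
    have "dim_vec (real_mat C *\<^sub>v x + real_vec c) = n" using c by simp
    then show "real_mat C *\<^sub>v x + real_vec c \<in> carrier_vec n" by (rule carrier_vecI)
  qed
  have yv: "real_vec y \<in> carrier_vec n" using y by simp
  have poly: "x \<in> polyhedron (real_mat D) (real_vec d) \<longleftrightarrow>
      x \<in> carrier_vec k \<and> (\<forall>i<g. (\<Sum>l<k. F D i l * x $ l) \<le> G d i)" for x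
  proof (cases "x \<in> carrier_vec k")
    case True
    have RD: "real_mat D \<in> carrier_mat g k" using D by simp
    have "(real_mat D *\<^sub>v x) $ i = (\<Sum>l<k. F D i l * x $ l)" if "i < g" for i
      unfolding mult_mat_vec_index_sum[OF RD True that] F_def using D that by (intro sum.cong) auto
    then show ?thesis using True D d by (simp add: polyhedron_def less_eq_vec_def G_def)
  qed (use D in \<open>simp add: polyhedron_def\<close>)
  have ex: "(\<exists>x\<in>polyhedron (real_mat D) (real_vec d). Q (\<lambda>l. x $ l)) \<longleftrightarrow>
      (\<exists>x. (\<forall>i<g. (\<Sum>l<k. F D i l * x l) \<le> G d i) \<and> Q x)"
    if Q: "\<And>x x'. (\<forall>l<k. x l = x' l) \<Longrightarrow> Q x = Q x'" for Q
  proof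
    assume "\<exists>x. (\<forall>i<g. (\<Sum>l<k. F D i l * x l) \<le> G d i) \<and> Q x"
    then obtain x where x: "\<forall>i<g. (\<Sum>l<k. F D i l * x l) \<le> G d i" "Q x" by blast
    have "(\<Sum>l<k. F D i l * vec k x $ l) = (\<Sum>l<k. F D i l * x l)" for i by (intro sum.cong) auto
    then have "vec k x \<in> polyhedron (real_mat D) (real_vec d)" using x by (simp add: poly)
    moreover have "Q (\<lambda>l. vec k x $ l)" using Q[of "\<lambda>l. vec k x $ l" x] x(2) by simp
    ultimately show "\<exists>x\<in>polyhedron (real_mat D) (real_vec d). Q (\<lambda>l. x $ l)" by blast
  next
    assume "\<exists>x\<in>polyhedron (real_mat D) (real_vec d). Q (\<lambda>l. x $ l)"
    then obtain x where "x \<in> polyhedron (real_mat D) (real_vec d)" "Q (\<lambda>l. x $ l)" by blast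
    then show "\<exists>x. (\<forall>i<g. (\<Sum>l<k. F D i l * x l) \<le> G d i) \<and> Q x"
      by (intro exI[of _ "\<lambda>l. x $ l"]) (simp add: poly)
  qed
  define Opt where "Opt x \<longleftrightarrow> std_optimal m n (F A) (\<lambda>i. (\<Sum>l<k. F B i l * x l) + G b i) (\<lambda>i. (\<Sum>l<k. F C i l * x l) + G c i) (G y)" for x
  define Uni where "Uni x \<longleftrightarrow> std_unique m n (F A) (\<lambda>i. (\<Sum>l<k. F B i l * x l) + G b i) (\<lambda>i. (\<Sum>l<k. F C i l * x l) + G c i) (G y)" for x
  have OU: "real_vec y \<in> lp_argmin (real_mat C *\<^sub>v x + real_vec c) (real_mat A) (real_mat B *\<^sub>v x + real_vec b) \<longleftrightarrow> Opt (\<lambda>l. x $ l)"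
    "lp_argmin (real_mat C *\<^sub>v x + real_vec c) (real_mat A) (real_mat B *\<^sub>v x + real_vec b) = {real_vec y} \<longleftrightarrow> Uni (\<lambda>l. x $ l)"
    if x: "x \<in> carrier_vec k" for x
  proof -
    have rB: "(real_mat B *\<^sub>v x + real_vec b) $ i = (\<Sum>l<k. F B i l * x $ l) + G b i" if "i < m" for i
      unfolding F_def G_def by (rule map_vec_index_sum[OF B b x that])
    have wC: "(real_mat C *\<^sub>v x + real_vec c) $ i = (\<Sum>l<k. F C i l * x $ l) + G c i" if "i < n" for i
      unfolding F_def G_def by (rule map_vec_index_sum[OF C c x that])
    have yG: "real_vec y $ l = G y l" if "l < n" for l using y that by (simp add: G_def)
    have AF: "real_mat A $$ (i, l) = F A i l" if "i < m" "l < n" for i l using A that by (simp add: F_def)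
    show "real_vec y \<in> lp_argmin (real_mat C *\<^sub>v x + real_vec c) (real_mat A) (real_mat B *\<^sub>v x + real_vec b) \<longleftrightarrow> Opt (\<lambda>l. x $ l)"
      unfolding mem_lp_argmin_iff[OF RA rv] Opt_def using yv std_cong(1)[OF rB wC yG AF] by simp
    show "lp_argmin (real_mat C *\<^sub>v x + real_vec c) (real_mat A) (real_mat B *\<^sub>v x + real_vec b) = {real_vec y} \<longleftrightarrow> Uni (\<lambda>l. x $ l)"
      unfolding lp_argmin_eq_singleton_iff[OF RA rv yv] Uni_def by (rule std_cong(2)[OF rB wC yG AF])
  qed
  have cong: "(\<Sum>l<k. M l * x l) = (\<Sum>l<k. M l * x' l)" if "\<forall>l<k. x l = x' l" for M x x' :: "nat \<Rightarrow> real"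
    using that by (intro sum.cong) auto
  have "Opt x = Opt x'" "Uni x = Uni x'" if "\<forall>l<k. x l = x' l" for x x' :: "nat \<Rightarrow> real"
    unfolding Opt_def Uni_def by (simp_all only: cong[OF that])
  note exOU = ex[of Opt, OF this(1)] ex[of Uni, OF this(2)]
  have "optimistic (A, B, b, C, c, D, d, y) \<longleftrightarrow> (\<exists>x\<in>polyhedron (real_mat D) (real_vec d). Opt (\<lambda>l. x $ l))"
    "pessimistic (A, B, b, C, c, D, d, y) \<longleftrightarrow> (\<exists>x\<in>polyhedron (real_mat D) (real_vec d). Uni (\<lambda>l. x $ l))"
    using OU by (auto simp: poly)
  note trans[OF this(1) exOU(1)] trans[OF this(2) exOU(2)]
  from this[unfolded Opt_def Uni_def] show "optimistic (A, B, b, C, c, D, d, y) \<longleftrightarrow> (\<exists>x. (\<forall>i<g. (\<Sum>l<k. F D i l * x l) \<le> G d i) \<and>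
      std_optimal m n (F A) (\<lambda>i. (\<Sum>l<k. F B i l * x l) + G b i) (\<lambda>i. (\<Sum>l<k. F C i l * x l) + G c i) (G y))"
    "pessimistic (A, B, b, C, c, D, d, y) \<longleftrightarrow> (\<exists>x. (\<forall>i<g. (\<Sum>l<k. F D i l * x l) \<le> G d i) \<and>
      std_unique m n (F A) (\<lambda>i. (\<Sum>l<k. F B i l * x l) + G b i) (\<lambda>i. (\<Sum>l<k. F C i l * x l) + G c i) (G y))"
    by simp_all
qed

section \<open>Cost-aware weakest preconditions\<close>

definition bounded_memory :: "nat \<Rightarrow> memory \<Rightarrow> bool" where
  "bounded_memory b \<sigma> \<longleftrightarrow> (\<forall>a. \<bar>\<sigma> a\<bar> \<le> 2 ^ b)"

text \<open>In a memory whose cells are at most 2^b in absolute value, that of the value of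
  \<open>e\<close> is at most 2 to the power \<open>exp_size e * Suc b\<close>. Exponents add under
  multiplication; the extra 1 at a sum pays for the carry.\<close>

fun exp_size :: "exp \<Rightarrow> nat" where
  "exp_size (Const i) = int_length i"
| "exp_size (Mem e) = exp_size e + 1"
| "exp_size (Plus e1 e2) = exp_size e1 + exp_size e2 + 1"
| "exp_size (Minus e1 e2) = exp_size e1 + exp_size e2 + 1"
| "exp_size (Times e1 e2) = exp_size e1 + exp_size e2 + 1"
| "exp_size (Div e1 e2) = exp_size e1 + exp_size e2 + 1"

text \<open>Every node is charged the length of its own value; the 2 covers the sign bit and the
  boundary case |v| = 2^k in \<open>int_length_le\<close>.\<close>

fun exp_weight :: "exp \<Rightarrow> nat" where
  "exp_weight (Const i) = int_length i"
| "exp_weight (Mem e) = exp_weight e + exp_size (Mem e) + 2"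
| "exp_weight (Plus e1 e2) = exp_weight e1 + exp_weight e2 + exp_size (Plus e1 e2) + 2"
| "exp_weight (Minus e1 e2) = exp_weight e1 + exp_weight e2 + exp_size (Minus e1 e2) + 2"
| "exp_weight (Times e1 e2) = exp_weight e1 + exp_weight e2 + exp_size (Times e1 e2) + 2"
| "exp_weight (Div e1 e2) = exp_weight e1 + exp_weight e2 + exp_size (Div e1 e2) + 2"

lemma abs_le_two_power_int_length: "\<bar>i\<bar> \<le> 2 ^ int_length i"
proof (cases "i = 0")
  case False
  then have "\<bar>i\<bar> < 2 ^ nat (bitlen \<bar>i\<bar>)" using bitlen_bounds[of "\<bar>i\<bar>"] by simp
  also have "\<dots> \<le> 2 ^ int_length i" by (intro power_increasing) (auto simp: int_length_def)
  finally show ?thesis by simp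
qed simp

lemma int_length_le:
  assumes "\<bar>v\<bar> \<le> 2 ^ k"
  shows "int_length v \<le> k + 2"
proof -
  have "(0 :: int) < 2 ^ k" by simp
  then have "\<bar>v\<bar> < 2 ^ Suc k" using assms unfolding power_Suc by linarith
  then have "bitlen \<bar>v\<bar> \<le> int (Suc k)" unfolding bitlen_le_iff_power nat_int by simp
  then show ?thesis by (simp add: int_length_def)
qed

lemma abs_div_le: "\<bar>x div y\<bar> \<le> \<bar>x :: int\<bar>"
proof (cases "y = 0")
  case False
  have "\<bar>real_of_int x / real_of_int y\<bar> \<le> \<bar>real_of_int x\<bar> / 1"
    unfolding abs_divide using False by (intro divide_left_mono) auto
  then have "real_of_int (- \<bar>x\<bar>) \<le> real_of_int x / real_of_int y" "real_of_int x / real_of_int y \<le> real_of_int \<bar>x\<bar>"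
    unfolding of_int_minus of_int_abs by linarith+
  then have "- \<bar>x\<bar> \<le> \<lfloor>real_of_int x / real_of_int y\<rfloor>" "\<lfloor>real_of_int x / real_of_int y\<rfloor> \<le> \<bar>x\<bar>"
    by (simp_all only: le_floor_iff floor_le_iff)
  then show ?thesis unfolding floor_divide_of_int_eq by linarith
qed simp

lemma exp_val_bound:
  assumes b: "bounded_memory b \<sigma>"
  shows "\<bar>exp_val e \<sigma>\<bar> \<le> 2 ^ (exp_size e * Suc b)"
proof (induction e)
  case (Const i)
  have "\<bar>i\<bar> \<le> 2 ^ int_length i" by (rule abs_le_two_power_int_length)
  also have "\<dots> \<le> 2 ^ (int_length i * Suc b)" by (intro power_increasing) auto
  finally show ?case by simp
next
  case (Mem e)
  have "\<bar>\<sigma> (exp_val e \<sigma>)\<bar> \<le> 2 ^ b" using b by (simp add: bounded_memory_def)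
  also have "\<dots> \<le> 2 ^ (exp_size (Mem e) * Suc b)" by (intro power_increasing) auto
  finally show ?case by simp
next
  case (Plus e1 e2)
  have "\<bar>exp_val e1 \<sigma> + exp_val e2 \<sigma>\<bar> \<le> 2 ^ (exp_size e1 * Suc b) + 2 ^ (exp_size e2 * Suc b)"
    using Plus.IH by linarith
  also have "\<dots> \<le> 2 ^ ((exp_size e1 + exp_size e2) * Suc b) + 2 ^ ((exp_size e1 + exp_size e2) * Suc b)"
    by (intro add_mono power_increasing mult_right_mono) auto
  also have "\<dots> = 2 ^ Suc ((exp_size e1 + exp_size e2) * Suc b)" by simp
  also have "\<dots> \<le> 2 ^ (exp_size (Plus e1 e2) * Suc b)" by (intro power_increasing) auto
  finally show ?case by simp
next
  case (Minus e1 e2)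
  have "\<bar>exp_val e1 \<sigma> - exp_val e2 \<sigma>\<bar> \<le> 2 ^ (exp_size e1 * Suc b) + 2 ^ (exp_size e2 * Suc b)"
    using Minus.IH by linarith
  also have "\<dots> \<le> 2 ^ ((exp_size e1 + exp_size e2) * Suc b) + 2 ^ ((exp_size e1 + exp_size e2) * Suc b)"
    by (intro add_mono power_increasing mult_right_mono) auto
  also have "\<dots> = 2 ^ Suc ((exp_size e1 + exp_size e2) * Suc b)" by simp
  also have "\<dots> \<le> 2 ^ (exp_size (Minus e1 e2) * Suc b)" by (intro power_increasing) auto
  finally show ?case by simp
next
  case (Times e1 e2)
  have "\<bar>exp_val e1 \<sigma> * exp_val e2 \<sigma>\<bar> \<le> 2 ^ (exp_size e1 * Suc b) * 2 ^ (exp_size e2 * Suc b)"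
    unfolding abs_mult using Times.IH by (intro mult_mono) auto
  also have "\<dots> = 2 ^ ((exp_size e1 + exp_size e2) * Suc b)" by (simp only: power_add distrib_right)
  also have "\<dots> \<le> 2 ^ (exp_size (Times e1 e2) * Suc b)" by (intro power_increasing) auto
  finally show ?case by simp
next
  case (Div e1 e2)
  have "\<bar>exp_val e1 \<sigma> div exp_val e2 \<sigma>\<bar> \<le> 2 ^ (exp_size e1 * Suc b)"
    using Div.IH(1) abs_div_le order_trans by blast
  also have "\<dots> \<le> 2 ^ (exp_size (Div e1 e2) * Suc b)" by (intro power_increasing mult_right_mono) auto
  finally show ?case by simp
qed

lemma int_length_exp_val_le:
  assumes "bounded_memory b \<sigma>"
  shows "int_length (exp_val e \<sigma>) \<le> (exp_size e + 2) * Suc b"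
proof -
  have "int_length (exp_val e \<sigma>) \<le> exp_size e * Suc b + 2"
    by (rule int_length_le[OF exp_val_bound[OF assms]])
  then show ?thesis by simp
qed

lemma exp_cost_le:
  assumes b: "bounded_memory b \<sigma>"
  shows "exp_cost e \<sigma> \<le> exp_weight e * Suc b"
proof (induction e)
  case (Mem e)
  then show ?case using int_length_exp_val_le[OF b, of "Mem e"] by (simp add: algebra_simps)
next
  case (Plus e1 e2)
  then show ?case using int_length_exp_val_le[OF b, of "Plus e1 e2"] by (simp add: algebra_simps)
next
  case (Minus e1 e2)
  then show ?case using int_length_exp_val_le[OF b, of "Minus e1 e2"] by (simp add: algebra_simps)
next
  case (Times e1 e2)
  then show ?case using int_length_exp_val_le[OF b, of "Times e1 e2"] by (simp add: algebra_simps)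
next
  case (Div e1 e2)
  then show ?case using int_length_exp_val_le[OF b, of "Div e1 e2"] by (simp add: algebra_simps)
qed simp

text \<open>
  A bound on the running time, up to a factor linear in the number of bits per memory cell,
  as a polynomial in an upper bound on the number of iterations of every single loop.
\<close>
fun loop_time :: "prog \<Rightarrow> nat poly" where
  "loop_time Skip = [:1:]"
| "loop_time (Store e1 e2) = [:1 + exp_weight e1 + exp_weight e2:]"
| "loop_time (Seq p1 p2) = 1 + loop_time p1 + loop_time p2"
| "loop_time (If e p1 p2) = [:1 + exp_weight e:] + loop_time p1 + loop_time p2"
| "loop_time (While e p) = [:1, 1:] * ([:1 + exp_weight e:] + loop_time p)"

section \<open>Rules for weakest preconditions\<close>

text \<open>Both bounds are fixed beforehand and the time bound is read off the syntax, so that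
  reasoning about a program involves no arithmetic on costs: it remains to show that stored values
  fit and that loops end in time. Boundedness of the memory passes silently from rule to
  rule.\<close>

definition wp :: "nat \<Rightarrow> nat \<Rightarrow> prog \<Rightarrow> (memory \<Rightarrow> bool) \<Rightarrow> memory \<Rightarrow> bool" where
  "wp b n p Q \<sigma> \<longleftrightarrow> (bounded_memory b \<sigma> \<longrightarrow>
     (\<exists>t \<tau>. exec p \<sigma> t \<tau> \<and> bounded_memory b \<tau> \<and> t \<le> poly (loop_time p) n * Suc b \<and> Q \<tau>))"

lemma wp_mono: "wp b n p Q \<sigma> \<Longrightarrow> (\<And>\<tau>. Q \<tau> \<Longrightarrow> R \<tau>) \<Longrightarrow> wp b n p R \<sigma>"
  unfolding wp_def by blast

lemma wp_Skip: "Q \<sigma> \<Longrightarrow> wp b n Skip Q \<sigma>"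
  unfolding wp_def by (auto intro!: exI exec.Skip)

lemma wp_Store:
  assumes "\<bar>exp_val e2 \<sigma>\<bar> \<le> 2 ^ b" "Q (\<sigma>(exp_val e1 \<sigma> := exp_val e2 \<sigma>))"
  shows "wp b n (Store e1 e2) Q \<sigma>"
  unfolding wp_def
proof
  assume b: "bounded_memory b \<sigma>"
  have "1 + exp_cost e1 \<sigma> + exp_cost e2 \<sigma> \<le> poly (loop_time (Store e1 e2)) n * Suc b"
    using exp_cost_le[OF b, of e1] exp_cost_le[OF b, of e2] by (simp add: algebra_simps)
  moreover have "bounded_memory b (\<sigma>(exp_val e1 \<sigma> := exp_val e2 \<sigma>))"
    using b assms(1) by (simp add: bounded_memory_def)
  ultimately show "\<exists>t \<tau>. exec (Store e1 e2) \<sigma> t \<tau> \<and> bounded_memory b \<tau> \<and> t \<le> poly (loop_time (Store e1 e2)) n * Suc b \<and> Q \<tau>"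
    using exec.Store[of e1 e2 \<sigma>] assms(2) by blast
qed

lemma wp_Seq:
  assumes "wp b n p1 (wp b n p2 Q) \<sigma>"
  shows "wp b n (Seq p1 p2) Q \<sigma>"
  unfolding wp_def
proof
  assume "bounded_memory b \<sigma>"
  then obtain t1 \<rho> where 1: "exec p1 \<sigma> t1 \<rho>" "bounded_memory b \<rho>" "t1 \<le> poly (loop_time p1) n * Suc b" "wp b n p2 Q \<rho>"
    using assms unfolding wp_def[of b n p1] by blast
  then obtain t2 \<tau> where 2: "exec p2 \<rho> t2 \<tau>" "bounded_memory b \<tau>" "t2 \<le> poly (loop_time p2) n * Suc b" "Q \<tau>"
    unfolding wp_def by blast
  have "1 + t1 + t2 \<le> poly (loop_time (Seq p1 p2)) n * Suc b"
    using 1(3) 2(3) by (simp add: algebra_simps)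
  then show "\<exists>t \<tau>. exec (Seq p1 p2) \<sigma> t \<tau> \<and> bounded_memory b \<tau> \<and> t \<le> poly (loop_time (Seq p1 p2)) n * Suc b \<and> Q \<tau>"
    using exec.Seq[OF 1(1) 2(1)] 2 by blast
qed

lemma wp_If:
  assumes "exp_val e \<sigma> > 0 \<Longrightarrow> wp b n p1 Q \<sigma>" "\<not> exp_val e \<sigma> > 0 \<Longrightarrow> wp b n p2 Q \<sigma>"
  shows "wp b n (If e p1 p2) Q \<sigma>"
  unfolding wp_def
proof
  assume b: "bounded_memory b \<sigma>"
  note c = exp_cost_le[OF b, of e]
  show "\<exists>t \<tau>. exec (If e p1 p2) \<sigma> t \<tau> \<and> bounded_memory b \<tau> \<and> t \<le> poly (loop_time (If e p1 p2)) n * Suc b \<and> Q \<tau>"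
  proof (cases "exp_val e \<sigma> > 0")
    case True
    then obtain t \<tau> where t: "exec p1 \<sigma> t \<tau>" "bounded_memory b \<tau>" "t \<le> poly (loop_time p1) n * Suc b" "Q \<tau>"
      using assms(1) b unfolding wp_def by blast
    have "1 + exp_cost e \<sigma> + t \<le> poly (loop_time (If e p1 p2)) n * Suc b" using c t(3) by (simp add: algebra_simps)
    then show ?thesis using exec.IfTrue[OF True t(1), of p2] t by blast
  next
    case False
    then obtain t \<tau> where t: "exec p2 \<sigma> t \<tau>" "bounded_memory b \<tau>" "t \<le> poly (loop_time p2) n * Suc b" "Q \<tau>"
      using assms(2) b unfolding wp_def by blast
    have "1 + exp_cost e \<sigma> + t \<le> poly (loop_time (If e p1 p2)) n * Suc b" using c t(3) by (simp add: algebra_simps)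
    then show ?thesis using exec.IfFalse[OF False t(1), of p1] t by blast
  qed
qed

text \<open>The number m of iterations is known in advance and indexes the invariant, which makes m
  - i the termination measure.\<close>

lemma wp_While:
  assumes m: "m \<le> n" and init: "Inv 0 \<sigma>"
    and step: "\<And>i \<tau>. i < m \<Longrightarrow> Inv i \<tau> \<Longrightarrow> exp_val e \<tau> > 0 \<and> wp b n p (Inv (Suc i)) \<tau>"
    and fin: "\<And>\<tau>. Inv m \<tau> \<Longrightarrow> \<not> exp_val e \<tau> > 0 \<and> Q \<tau>"
  shows "wp b n (While e p) Q \<sigma>"
proof -
  define X where "X = (1 + exp_weight e + poly (loop_time p) n) * Suc b"
  have run: "\<exists>t \<tau>'. exec (While e p) \<tau> t \<tau>' \<and> bounded_memory b \<tau>' \<and> t \<le> (m - i + 1) * X \<and> Q \<tau>'"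
    if "i \<le> m" "Inv i \<tau>" "bounded_memory b \<tau>" for i \<tau>
    using that
  proof (induction "m - i" arbitrary: i \<tau>)
    case 0
    then have "i = m" by simp
    then have "\<not> exp_val e \<tau> > 0" "Q \<tau>" using fin 0 by auto
    moreover have "1 + exp_cost e \<tau> \<le> (m - i + 1) * X"
      using exp_cost_le[OF 0(4), of e] \<open>i = m\<close> by (simp add: X_def algebra_simps)
    ultimately show ?case using exec.WhileFalse[of e \<tau> p] 0 by blast
  next
    case (Suc k)
    then have i: "i < m" by simp
    with step[OF i Suc.prems(2)] have pos: "exp_val e \<tau> > 0" and w: "wp b n p (Inv (Suc i)) \<tau>" by auto
    obtain t1 \<rho> where 1: "exec p \<tau> t1 \<rho>" "bounded_memory b \<rho>" "t1 \<le> poly (loop_time p) n * Suc b" "Inv (Suc i) \<rho>"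
      using w Suc.prems(3) unfolding wp_def by blast
    obtain t2 \<tau>' where 2: "exec (While e p) \<rho> t2 \<tau>'" "bounded_memory b \<tau>'" "t2 \<le> (m - Suc i + 1) * X" "Q \<tau>'"
      using Suc.hyps(1)[of "Suc i" \<rho>, OF _ _ 1(4) 1(2)] Suc.hyps(2) i by (metis Suc_leI Suc_inject Suc_diff_Suc)
    have "1 + exp_cost e \<tau> + t1 \<le> X"
      using exp_cost_le[OF Suc.prems(3), of e] 1(3) by (simp add: X_def algebra_simps)
    moreover have "m - i + 1 = (m - Suc i + 1) + 1" using i by simp
    ultimately have "1 + exp_cost e \<tau> + t1 + t2 \<le> (m - i + 1) * X"
      using 2(3) by (simp only: distrib_right)
    then show ?case using exec.WhileTrue[OF pos 1(1) 2(1)] 2 by blast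
  qed
  show ?thesis
    unfolding wp_def
  proof
    assume "bounded_memory b \<sigma>"
    then obtain t \<tau> where t: "exec (While e p) \<sigma> t \<tau>" "bounded_memory b \<tau>" "t \<le> (m + 1) * X" "Q \<tau>"
      using run[of 0 \<sigma>] init by auto
    have "(m + 1) * X \<le> (n + 1) * X" using m by (intro mult_right_mono) auto
    also have "\<dots> = poly (loop_time (While e p)) n * Suc b" by (simp add: X_def algebra_simps)
    finally show "\<exists>t \<tau>. exec (While e p) \<sigma> t \<tau> \<and> bounded_memory b \<tau> \<and> t \<le> poly (loop_time (While e p)) n * Suc b \<and> Q \<tau>"
      using t order_trans by blast
  qed
qed

definition For :: "int \<Rightarrow> exp \<Rightarrow> prog \<Rightarrow> prog" where
  "For r e p = Seq (Store (Const r) (Const 0))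
     (While (Minus e (Mem (Const r))) (Seq p (Store (Const r) (Plus (Mem (Const r)) (Const 1)))))"

text \<open>The limit is evaluated anew in every round, hence \<open>lim\<close> at every stage. The
  invariant is demanded after the counter has been advanced, so it may contain frame conditions that
  mention the counter; n <= 2^b lets the counter fit into a cell.\<close>

lemma wp_For:
  assumes m: "m \<le> n" "n \<le> 2 ^ b" and init: "Inv 0 (\<sigma>(r := 0))"
    and lim: "\<And>i \<tau>. i \<le> m \<Longrightarrow> Inv i \<tau> \<Longrightarrow> \<tau> r = int i \<Longrightarrow> exp_val e \<tau> = int m"
    and step: "\<And>i \<tau>. i < m \<Longrightarrow> Inv i \<tau> \<Longrightarrow> \<tau> r = int i \<Longrightarrow>
      wp b n p (\<lambda>\<tau>'. \<tau>' r = int i \<and> Inv (Suc i) (\<tau>'(r := int (Suc i)))) \<tau>"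
    and fin: "\<And>\<tau>. Inv m \<tau> \<Longrightarrow> \<tau> r = int m \<Longrightarrow> Q \<tau>"
  shows "wp b n (For r e p) Q \<sigma>"
  unfolding For_def
proof (intro wp_Seq wp_Store)
  show "wp b n (While (Minus e (Mem (Const r))) (Seq p (Store (Const r) (Plus (Mem (Const r)) (Const 1))))) Q
     (\<sigma>(exp_val (Const r) \<sigma> := exp_val (Const 0) \<sigma>))"
  proof (rule wp_While[where m = m and Inv = "\<lambda>i \<tau>. Inv i \<tau> \<and> \<tau> r = int i"])
    fix i \<tau> assume i: "i < m" and inv: "Inv i \<tau> \<and> \<tau> r = int i"
    have "wp b n (Seq p (Store (Const r) (Plus (Mem (Const r)) (Const 1)))) (\<lambda>\<tau>. Inv (Suc i) \<tau> \<and> \<tau> r = int (Suc i)) \<tau>"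
    proof (rule wp_Seq, rule wp_mono[OF step[OF i]])
      fix \<rho> assume \<rho>: "\<rho> r = int i \<and> Inv (Suc i) (\<rho>(r := int (Suc i)))"
      have "Suc i \<le> 2 ^ b" using i m by simp
      then have "int (Suc i) \<le> 2 ^ b" by (metis of_nat_le_iff of_nat_numeral of_nat_power)
      then show "wp b n (Store (Const r) (Plus (Mem (Const r)) (Const 1))) (\<lambda>\<tau>. Inv (Suc i) \<tau> \<and> \<tau> r = int (Suc i)) \<rho>"
        using \<rho> by (intro wp_Store) (simp_all add: add.commute)
    qed (use inv in auto)
    then show "exp_val (Minus e (Mem (Const r))) \<tau> > 0 \<and>
        wp b n (Seq p (Store (Const r) (Plus (Mem (Const r)) (Const 1)))) (\<lambda>\<tau>. Inv (Suc i) \<tau> \<and> \<tau> r = int (Suc i)) \<tau>"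
      using lim[of i \<tau>] inv i by simp
  next
    fix \<tau> assume "Inv m \<tau> \<and> \<tau> r = int m"
    then show "\<not> exp_val (Minus e (Mem (Const r))) \<tau> > 0 \<and> Q \<tau>" using lim[of m \<tau>] fin[of \<tau>] by simp
  qed (use m init in simp_all)
qed simp

text \<open>
  Array \<open>k\<close> is two-dimensional with unbounded index ranges: \<open>(i, c) \<mapsto> (i + c)\<^sup>2 + c\<close> is injective
  on the natural numbers. All arrays live at negative addresses and are therefore initially zero.
\<close>
definition loc :: "int \<Rightarrow> int \<Rightarrow> int \<Rightarrow> int" where
  "loc k i c = - 1 - k - 64 * ((i + c) * (i + c) + c)"

definition adr :: "int \<Rightarrow> exp \<Rightarrow> exp \<Rightarrow> exp" where
  "adr k e1 e2 = Minus (Const (- 1 - k)) (Times (Const 64) (Plus (Times (Plus e1 e2) (Plus e1 e2)) e2))"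

definition arr :: "int \<Rightarrow> exp \<Rightarrow> exp \<Rightarrow> exp" where "arr k e1 e2 = Mem (adr k e1 e2)"

abbreviation reg :: "int \<Rightarrow> int" where "reg k \<equiv> loc k 0 0"

abbreviation rv :: "int \<Rightarrow> exp" where "rv k \<equiv> Mem (Const (reg k))"

lemma exp_val_adr [simp]: "exp_val (adr k e1 e2) \<sigma> = loc k (exp_val e1 \<sigma>) (exp_val e2 \<sigma>)"
  by (simp add: adr_def loc_def)

lemma exp_val_arr [simp]: "exp_val (arr k e1 e2) \<sigma> = \<sigma> (loc k (exp_val e1 \<sigma>) (exp_val e2 \<sigma>))"
  by (simp add: arr_def)

text \<open>As 0 <= c <= i + c, the value is at least (i + c)^2 and below the next square, and so
  determines i + c.\<close>

lemma square_pairing_inj: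
  fixes i c i' c' :: int
  assumes eq: "(i + c) * (i + c) + c = (i' + c') * (i' + c') + c'"
    and nn: "0 \<le> i" "0 \<le> c" "0 \<le> i'" "0 \<le> c'"
  shows "i = i' \<and> c = c'"
proof -
  have le: "x \<le> y" if "x * x + p = y * y + q" "0 \<le> p" "p \<le> x" "0 \<le> q" "q \<le> y" for x y p q :: int
  proof (rule ccontr)
    assume "\<not> x \<le> y"
    then have "(y + 1) * (y + 1) \<le> x * x" using that by (intro mult_mono) auto
    then show False using that by (simp add: algebra_simps)
  qed
  have "i + c = i' + c'" using le[OF eq] le[OF eq[symmetric]] nn by simp
  then show ?thesis using eq by simp
qed

lemma loc_inject:
  assumes "0 \<le> k" "k < 64" "0 \<le> k'" "k' < 64" "0 \<le> i" "0 \<le> c" "0 \<le> i'" "0 \<le> c'"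
  shows "loc k i c = loc k' i' c' \<longleftrightarrow> k = k' \<and> i = i' \<and> c = c'"
proof
  assume "loc k i c = loc k' i' c'"
  then have eq: "k + 64 * ((i + c) * (i + c) + c) = k' + 64 * ((i' + c') * (i' + c') + c')"
    unfolding loc_def by linarith
  have "k = k'"
    using arg_cong[OF eq, of "\<lambda>z. z mod 64"] assms(1-4) by (simp only: mod_mult_self2 mod_pos_pos_trivial)
  then show "k = k' \<and> i = i' \<and> c = c'" using eq square_pairing_inj[of i c i' c'] assms by simp
qed simp

lemma loc_neg:
  assumes "0 \<le> k" "0 \<le> c"
  shows "loc k i c < 0"
proof -
  have "0 \<le> 64 * ((i + c) * (i + c) + c)" using assms by simp
  then show ?thesis using assms unfolding loc_def by linarith
qed

section \<open>Frame conditions\<close>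

text \<open>Only arrays with a number in \<open>K\<close> may differ. A register is the entry (0, 0)
  of the array with its number, so one set of numbers covers arrays and registers; the input cells
  have nonnegative addresses and are never affected by array numbers from 0 to 63.\<close>

definition same_except :: "int set \<Rightarrow> memory \<Rightarrow> memory \<Rightarrow> bool" where
  "same_except K \<sigma> \<tau> \<longleftrightarrow> (\<forall>a. (\<forall>k\<in>K. \<forall>i\<ge>0. \<forall>c\<ge>0. a \<noteq> loc k i c) \<longrightarrow> \<tau> a = \<sigma> a)"

lemma same_except_refl [simp]: "same_except K \<sigma> \<sigma>"
  by (simp add: same_except_def)

lemma same_except_trans:
  "same_except K \<sigma> \<rho> \<Longrightarrow> same_except K' \<rho> \<tau> \<Longrightarrow> K \<subseteq> L \<Longrightarrow> K' \<subseteq> L \<Longrightarrow> same_except L \<sigma> \<tau>"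
  unfolding same_except_def by (metis subsetD)

lemma same_except_upd:
  "same_except K \<sigma> \<tau> \<Longrightarrow> k \<in> K \<Longrightarrow> 0 \<le> i \<Longrightarrow> 0 \<le> c \<Longrightarrow> same_except K \<sigma> (\<tau>(loc k i c := v))"
  unfolding same_except_def by auto

lemma same_except_loc:
  assumes "same_except K \<sigma> \<tau>" "k \<notin> K" "K \<subseteq> {0..<64}" "0 \<le> k" "k < 64" "0 \<le> i" "0 \<le> c"
  shows "\<tau> (loc k i c) = \<sigma> (loc k i c)"
proof -
  have "loc k i c \<noteq> loc k' i' c'" if "k' \<in> K" "0 \<le> i'" "0 \<le> c'" for k' i' c'
    using loc_inject[of k k' i c i' c'] that assms by force
  then show ?thesis using assms(1) unfolding same_except_def by blast
qed

lemma same_except_nonneg: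
  assumes "same_except K \<sigma> \<tau>" "K \<subseteq> {0..<64}" "0 \<le> a"
  shows "\<tau> a = \<sigma> a"
proof -
  have "a \<noteq> loc k i c" if "k \<in> K" "0 \<le> c" for k i c
    using loc_neg[of k c i] that assms by force
  then show ?thesis using assms(1) unfolding same_except_def by blast
qed

section \<open>Linear feasibility by cone shrinking\<close>

definition cone_values :: "nat \<Rightarrow> int \<Rightarrow> (nat \<Rightarrow> nat \<Rightarrow> int) \<Rightarrow> (nat \<Rightarrow> int) \<Rightarrow> (nat \<Rightarrow> nat \<Rightarrow> int) \<Rightarrow> nat \<Rightarrow> nat \<Rightarrow> int" where
  "cone_values n W F h V i l = (\<Sum>c<Suc n. hom_row n W F h i c * V c l)"

primrec argmax :: "(nat \<Rightarrow> int) \<Rightarrow> nat \<Rightarrow> nat" where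
  "argmax p 0 = 0"
| "argmax p (Suc l) = (if p l > p (argmax p l) then l else argmax p l)"

lemma argmax_less: "N > 0 \<Longrightarrow> argmax p N < N"
proof (induction N)
  case (Suc N)
  then show ?case by (cases N) (auto simp: less_Suc_eq)
qed simp

lemma argmax_le: "l < N \<Longrightarrow> p l \<le> p (argmax p N)"
  by (induction N) (auto simp: less_Suc_eq)

text \<open>The sum of the values is the value at the sum of the generators, the candidate
  solution.\<close>

definition row_sat where
  "row_sat n W F h V i \<longleftrightarrow> (\<Sum>l<Suc n. cone_values n W F h V i l) > 0"

text \<open>In the feasible case \<open>p j > 0\<close> always holds for an unsatisfied row of a
  reachable cone. In the infeasible case the cone may miss the half-space altogether; the guard then
  keeps the integers bounded.\<close>

definition row_step where
  "row_step n W F h V i =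
     (let p = cone_values n W F h V i; j = argmax p (Suc n)
      in if \<not> row_sat n W F h V i \<and> p j > 0 then shrink (Suc n) p j V else V)"

primrec row_steps where
  "row_steps n W F h V 0 = V"
| "row_steps n W F h V (Suc i) = row_step n W F h (row_steps n W F h V i) i"

primrec passes where
  "passes r n W F h 0 = cone_init n W"
| "passes r n W F h (Suc t) = row_steps n W F h (passes r n W F h t) r"

lemma row_steps_sat:
  assumes "\<And>i'. i' < i \<Longrightarrow> row_sat n W F h (row_steps n W F h V i') i'"
  shows "row_steps n W F h V i = V"
  using assms
proof (induction i)
  case (Suc i)
  then have "row_steps n W F h V i = V" by simp
  moreover from this Suc.prems[of i] have "row_sat n W F h V i" by simp
  ultimately show ?case by (simp add: row_step_def Let_def)
qed simp

text \<open>A pass that finds every row satisfied leaves the cone unchanged, so the sum of its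
  generators satisfies all rows at once, and all later passes repeat it. Hence the last pass alone
  decides. In the feasible case every other pass loses the factor \<gamma> at least once, and T such
  losses contradict the lower bound for the volume.\<close>

lemma solver_correct:
  assumes W: "W = lin_size r n F h ^ (4 * n + 8)" and n: "n \<ge> 1"
    and zero: "i0 < r" "\<And>c. c < n \<Longrightarrow> F i0 c = 0" "h i0 = 0"
    and \<beta>: "lin_size r n F h < 2 ^ \<beta>" and T: "T \<ge> 640 * Suc n ^ 4 * \<beta>" "T = Suc T'"
  shows "(\<forall>i<r. row_sat n W F h (row_steps n W F h (passes r n W F h T') i) i) \<longleftrightarrow> lin_feasible r n F h"
proof
  define V where "V = passes r n W F h T'"
  assume "\<forall>i<r. row_sat n W F h (row_steps n W F h (passes r n W F h T') i) i"
  then have sat: "row_sat n W F h (row_steps n W F h V i) i" if "i < r" for i using that by (simp add: V_def)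
  have sat': "row_sat n W F h V i" if "i < r" for i
  proof -
    have "row_steps n W F h V i = V" by (rule row_steps_sat) (use sat that in auto)
    then show ?thesis using sat[OF that] by simp
  qed
  show "lin_feasible r n F h"
  proof (rule center_feasible[of r n F h W "\<lambda>c. \<Sum>l<Suc n. V c l" i0])
    fix i assume i: "i < r"
    have "(\<Sum>c<Suc n. hom_row n W F h i c * (\<Sum>l<Suc n. V c l)) = (\<Sum>l<Suc n. cone_values n W F h V i l)"
      unfolding cone_values_def sum_distrib_left by (rule sum.swap)
    then show "(\<Sum>c<Suc n. hom_row n W F h i c * (\<Sum>l<Suc n. V c l)) > 0"
      using sat'[OF i] unfolding row_sat_def by simp
  qed (use W zero in auto)
next
  assume feas: "lin_feasible r n F h"
  from lin_feasible_cone_state[OF feas W] obtain Z :: "(nat \<Rightarrow> real) set" and B where ZB: "Z \<noteq> {} \<and>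
    (\<forall>z\<in>Z. \<forall>i<r. (\<Sum>c<Suc n. real_of_int (hom_row n W F h i c) * z c) > 0) \<and>
    cone_state (Suc n) Z B (cone_init n W) 1 \<and>
    (\<forall>V \<delta>. cone_state (Suc n) Z B V \<delta> \<longrightarrow> 1 \<le> \<delta> * real_of_int W ^ (5 * Suc n))"
    by (elim exE)
  note Z = ZB[THEN conjunct1] and pos' = ZB[THEN conjunct2, THEN conjunct1]
    and init = ZB[THEN conjunct2, THEN conjunct2, THEN conjunct1]
    and lower' = ZB[THEN conjunct2, THEN conjunct2, THEN conjunct2]
  have pos: "(\<Sum>c<Suc n. real_of_int (hom_row n W F h i c) * z c) > 0" if "z \<in> Z" "i < r" for z i
    using pos'[rule_format, OF that] .
  define \<gamma> where "\<gamma> = 1 / (1 + 1 / (16 * real (Suc n) ^ 2))"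
  have "1 + 1 / (16 * real (Suc n) ^ 2) \<ge> 1" by simp
  then have "0 \<le> \<gamma>" "\<gamma> \<le> 1 / 1" unfolding \<gamma>_def by (simp, intro frac_le) auto
  then have \<gamma>: "0 \<le> \<gamma>" "\<gamma> \<le> 1" by simp_all
  have mono: "cone_state N Z B V \<delta> \<Longrightarrow> \<delta> \<le> \<delta>' \<Longrightarrow> cone_state N Z B V \<delta>'" for N V \<delta> \<delta>'
    unfolding cone_state_def by (meson order_trans)
  have nonneg: "cone_state N Z B V \<delta> \<Longrightarrow> 0 \<le> \<delta>" for N V \<delta>
    unfolding cone_state_def by (meson abs_ge_zero order_trans)
  have stepd: "cone_state (Suc n) Z B (row_step n W F h V i) (\<delta> * \<gamma>)"
    if st: "cone_state (Suc n) Z B V \<delta>" and i: "i < r" and ns: "\<not> row_sat n W F h V i" for V \<delta> i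
  proof -
    define p where "p = cone_values n W F h V i"
    have j: "argmax p (Suc n) < Suc n" by (rule argmax_less) simp
    have n2: "Suc n \<ge> 2" using n by simp
    have posi: "(\<Sum>c<Suc n. hom_row n W F h i c * z c) > 0" if "z \<in> Z" for z :: "nat \<Rightarrow> real"
      using pos that i .
    have pdef: "p l = (\<Sum>c<Suc n. hom_row n W F h i c * V c l)" for l by (simp only: p_def cone_values_def)
    have ple: "p l \<le> p (argmax p (Suc n))" if "l < Suc n" for l using that by (rule argmax_le)
    have psum: "(\<Sum>l<Suc n. p l) \<le> 0" using ns unfolding row_sat_def p_def by simp
    note sh = cone_state_shrink[OF st n2 j posi Z pdef ple psum]
    have "p (argmax p (Suc n)) > 0" using sh(1) .
    moreover have "cone_state (Suc n) Z B (shrink (Suc n) p (argmax p (Suc n)) V) (\<delta> / (1 + 1 / (16 * real (Suc n) ^ 2)))"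
      using sh(2) .
    ultimately show ?thesis using ns unfolding row_step_def Let_def p_def \<gamma>_def by simp
  qed
  have stepn: "cone_state (Suc n) Z B (row_step n W F h V i) \<delta>"
    if st: "cone_state (Suc n) Z B V \<delta>" and i: "i < r" for V \<delta> i
  proof (cases "row_sat n W F h V i")
    case False
    have "\<delta> * \<gamma> \<le> \<delta> * 1" using \<gamma> nonneg[OF st] by (intro mult_left_mono) auto
    then show ?thesis using mono[OF stepd[OF st i False]] by simp
  qed (use st in \<open>simp add: row_step_def\<close>)
  \<comment> \<open>The first unsatisfied row earns the factor, and the rows after it cannot lose it
    again.\<close>
  have rows: "cone_state (Suc n) Z B (row_steps n W F h V i)
      (if \<forall>i'<i. row_sat n W F h (row_steps n W F h V i') i' then \<delta> else \<delta> * \<gamma>)"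
    if st: "cone_state (Suc n) Z B V \<delta>" and i: "i \<le> r" for V \<delta> i
    using i
  proof (induction i)
    case (Suc i)
    then have i: "i < r" and IH: "cone_state (Suc n) Z B (row_steps n W F h V i)
      (if \<forall>i'<i. row_sat n W F h (row_steps n W F h V i') i' then \<delta> else \<delta> * \<gamma>)" by simp_all
    show ?case
    proof (cases "\<forall>i'<i. row_sat n W F h (row_steps n W F h V i') i'")
      case True
      then have st': "cone_state (Suc n) Z B (row_steps n W F h V i) \<delta>" using IH by simp
      show ?thesis
      proof (cases "row_sat n W F h (row_steps n W F h V i) i")
        case True': True
        then show ?thesis using stepn[OF st' i] True by (simp add: less_Suc_eq)
      next
        case False
        then have nall: "\<not> (\<forall>i'<Suc i. row_sat n W F h (row_steps n W F h V i') i')" by blast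
        show ?thesis unfolding if_not_P[OF nall] row_steps.simps by (rule stepd[OF st' i False])
      qed
    next
      case False
      then have nall: "\<not> (\<forall>i'<Suc i. row_sat n W F h (row_steps n W F h V i') i')" using less_SucI by blast
      show ?thesis unfolding if_not_P[OF nall] row_steps.simps
        by (rule stepn[OF IH[unfolded if_not_P[OF False]] i])
    qed
  qed (use st in simp)
  define ok where "ok t \<longleftrightarrow> (\<forall>i<r. row_sat n W F h (row_steps n W F h (passes r n W F h t) i) i)" for t
  have ok_fix: "ok t \<Longrightarrow> ok (Suc t)" for t
    using row_steps_sat[of r n W F h "passes r n W F h t"] unfolding ok_def by simp
  have ok_mono: "ok t \<Longrightarrow> ok (t + k)" for t k by (induction k) (auto intro: ok_fix)
  have "ok T'"
  proof (rule ccontr)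
    assume nok: "\<not> ok T'"
    have nok': "\<not> ok t" if "t \<le> T'" for t using nok ok_mono[of t "T' - t"] that by auto
    have "cone_state (Suc n) Z B (passes r n W F h t) (\<gamma> ^ t)" if "t \<le> T" for t
      using that
    proof (induction t)
      case (Suc t)
      then have nall: "\<not> (\<forall>i<r. row_sat n W F h (row_steps n W F h (passes r n W F h t) i) i)"
        using nok'[of t] T(2) unfolding ok_def by simp
      have "cone_state (Suc n) Z B (passes r n W F h t) (\<gamma> ^ t)" using Suc by simp
      from rows[OF this order_refl, unfolded if_not_P[OF nall]]
      show ?case unfolding passes.simps power_Suc2 .
    qed (use init in simp)
    from this[OF order_refl] have "1 \<le> \<gamma> ^ T * real_of_int W ^ (5 * Suc n)" by (rule lower'[rule_format])
    note count = this[unfolded \<gamma>_def]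
    show False
    proof (rule shrink_count_bound[OF _ count])
      have "real_of_int (lin_size r n F h) \<ge> 0"
        using lin_size_bounds(1)[where n = n and r = r and F = F and h = h] by linarith
      then show "0 \<le> lin_size r n F h" by simp
      show "W = lin_size r n F h ^ (4 * Suc n + 4)" using W by (simp add: algebra_simps)
    qed (use \<beta> T in simp_all)
  qed
  then show "\<forall>i<r. row_sat n W F h (row_steps n W F h (passes r n W F h T') i) i" by (simp add: ok_def)
qed

lemma shrink_prec_ge1: "shrink_prec (Suc n) \<ge> 1"
proof -
  have "int (Suc n) ^ 3 \<ge> 1" by (rule one_le_power) simp
  then show ?thesis unfolding shrink_prec_def by linarith
qed

text \<open>A new entry combines at most 2 Q times the old one with at most Q times the pivot entry,
  where Q is \<open>shrink_prec N\<close>.\<close>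

lemma shrink_bound:
  assumes V: "\<And>c l. c < N \<Longrightarrow> l < N \<Longrightarrow> \<bar>V c l\<bar> \<le> M" and N: "N \<ge> 2"
    and p: "p j > 0" "p l \<le> p j" and cl: "c < N" "l < N" "j < N"
  shows "\<bar>shrink N p j V c l\<bar> \<le> 3 * shrink_prec N * M"
proof -
  define Q where "Q = shrink_prec N"
  have Q0: "Q \<ge> 0" by (simp add: Q_def shrink_prec_def)
  have M0: "M \<ge> 0" using V[OF cl(1,2)] by simp
  define H where "H = shrink_coeff N p j l"
  have H: "\<bar>H\<bar> \<le> Q" unfolding H_def Q_def by (rule shrink_coeff_bounds(4)[where p = p and j = j and l = l, OF N p])
  have "shrink N p j V c l = (Q + H) * V c l - H * V c j" by (simp add: shrink_def H_def Q_def)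
  then have "\<bar>shrink N p j V c l\<bar> \<le> \<bar>Q + H\<bar> * \<bar>V c l\<bar> + \<bar>H\<bar> * \<bar>V c j\<bar>"
    by (simp add: abs_mult[symmetric])
  also have "\<dots> \<le> (2 * Q) * M + Q * M"
    using H Q0 V[OF cl(1,2)] V[OF cl(1,3)] M0 by (intro add_mono mult_mono) auto
  finally show ?thesis by (simp add: Q_def algebra_simps)
qed

lemma row_step_bound:
  assumes V: "\<And>c l. c < Suc n \<Longrightarrow> l < Suc n \<Longrightarrow> \<bar>V c l\<bar> \<le> M" and n: "n \<ge> 1"
    and cl: "c < Suc n" "l < Suc n"
  shows "\<bar>row_step n W F h V i c l\<bar> \<le> 3 * shrink_prec (Suc n) * M"
proof -
  have M0: "M \<ge> 0" using V[of 0 0] by simp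
  define p where "p = cone_values n W F h V i"
  define j where "j = argmax p (Suc n)"
  have j: "j < Suc n" unfolding j_def by (rule argmax_less) simp
  have le: "p l \<le> p j" unfolding j_def by (rule argmax_le[OF cl(2)])
  show ?thesis
  proof (cases "\<not> row_sat n W F h V i \<and> p j > 0")
    case True
    then have "row_step n W F h V i = shrink (Suc n) p j V" by (simp add: row_step_def Let_def p_def j_def)
    moreover have "\<bar>shrink (Suc n) p j V c l\<bar> \<le> 3 * shrink_prec (Suc n) * M"
      by (rule shrink_bound[OF V]) (use n True le cl j in simp_all)
    ultimately show ?thesis by simp
  next
    case False
    then have "row_step n W F h V i = V" by (auto simp: row_step_def Let_def p_def j_def)
    moreover have "1 * M \<le> 3 * shrink_prec (Suc n) * M"
      using shrink_prec_ge1[of n] M0 by (intro mult_right_mono) auto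
    ultimately show ?thesis using V[OF cl] by simp
  qed
qed

text \<open>Common factors are never cancelled: each row step costs a constant factor, and the
  exponent counts the row steps made so far.\<close>

lemma passes_bound:
  assumes W: "W \<ge> 1" and n: "n \<ge> 1" and cl: "c < Suc n" "l < Suc n"
  shows "\<bar>row_steps n W F h (passes r n W F h t) i c l\<bar> \<le> W * (3 * shrink_prec (Suc n)) ^ (t * r + i)"
proof -
  have rows: "\<bar>row_steps n W F h V i c l\<bar> \<le> M * (3 * shrink_prec (Suc n)) ^ i"
    if "\<And>c l. c < Suc n \<Longrightarrow> l < Suc n \<Longrightarrow> \<bar>V c l\<bar> \<le> M" "c < Suc n" "l < Suc n" for V M i c l
    using that
  proof (induction i arbitrary: c l)
    case (Suc i)
    have "\<bar>row_step n W F h (row_steps n W F h V i) i c l\<bar> \<le> 3 * shrink_prec (Suc n) * (M * (3 * shrink_prec (Suc n)) ^ i)"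
      by (rule row_step_bound) (use Suc n in auto)
    then show ?case by (simp add: mult_ac)
  qed simp
  have ps: "\<bar>passes r n W F h t c l\<bar> \<le> W * (3 * shrink_prec (Suc n)) ^ (t * r)"
    if "c < Suc n" "l < Suc n" for t c l
    using that
  proof (induction t arbitrary: c l)
    case (Suc t)
    have "\<bar>row_steps n W F h (passes r n W F h t) r c l\<bar> \<le> W * (3 * shrink_prec (Suc n)) ^ (t * r) * (3 * shrink_prec (Suc n)) ^ r"
      by (rule rows) (use Suc in auto)
    then show ?case by (simp add: power_add mult_ac)
  qed (use W in \<open>auto simp: cone_init_def\<close>)
  have "\<bar>row_steps n W F h (passes r n W F h t) i c l\<bar>
      \<le> W * (3 * shrink_prec (Suc n)) ^ (t * r) * (3 * shrink_prec (Suc n)) ^ i"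
    by (rule rows) (use ps cl in blast)+
  then show ?thesis by (simp add: power_add mult_ac)
qed

section \<open>Programs for the linear feasibility problem\<close>

definition eqe :: "exp \<Rightarrow> exp \<Rightarrow> exp" where
  "eqe a b = Div (Const 1) (Plus (Const 1) (Times (Minus a b) (Minus a b)))"
definition pose :: "exp \<Rightarrow> exp" where
  "pose y = Minus (Const 0) (Div (Minus (Const 0) y) (Plus (Const 1) (Times y y)))"

lemma exp_val_eqe [simp]: "exp_val (eqe a b) \<sigma> = eqi (exp_val a \<sigma>) (exp_val b \<sigma>)"
  by (simp add: eqe_def eqi_def)
lemma exp_val_pose [simp]: "exp_val (pose y) \<sigma> = posi (exp_val y \<sigma>)"
  by (simp add: pose_def posi_def)

definition row_exp :: exp where
  "row_exp = Minus (Times (eqe (rv 23) (rv 38)) (Plus (Times (rv 27) (arr 10 (rv 21) (Const 0))) (Const 1)))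
     (Times (Minus (Const 1) (eqe (rv 23) (rv 38))) (Times (rv 27) (arr 9 (rv 21) (rv 23))))"

definition dim_exp :: exp where "dim_exp = Plus (rv 38) (Const 1)"
definition prec_exp :: exp where "prec_exp = Times (Const 32) (Times dim_exp (Times dim_exp dim_exp))"
definition num_exp :: exp where "num_exp = Times (Const 2) (Times dim_exp dim_exp)"

text \<open>
  Arrays: 0 to 7 the scaled data, 8 the product \<open>A y\<close>, 9 and 10 the system \<open>F, h\<close>, 11 the cone \<open>V\<close>,
  12 the values of an inequality at the generators, 13 a copy of the pivot column. Registers: 14 to 17
  \<open>m, n, k, g\<close>, 18 \<open>s\<close>, 19 \<open>\<Delta>\<close>, 20 \<open>j\<close>, 21 to 25 loop counters and local variables, 26 \<open>S\<close>, 27 \<open>W\<close>,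
  28 \<open>\<beta>\<close>, 29 the number of passes, 30 the result of the feasibility test, 31 the answer, 32 the pivot,
  33 to 36 local variables, 37 and 38 the numbers of rows and columns of \<open>F\<close>.
\<close>
abbreviation setr :: "int \<Rightarrow> exp \<Rightarrow> prog" where "setr k e \<equiv> Store (Const (reg k)) e"

definition dot_prog :: prog where
  "dot_prog = Seq (setr 25 (Const 0)) (For (reg 23) dim_exp
     (setr 25 (Plus (rv 25) (Times row_exp (arr 11 (rv 23) (rv 22))))))"

definition values_prog :: prog where
  "values_prog = For (reg 22) dim_exp (Seq dot_prog (Seq (Store (adr 12 (rv 22) (Const 0)) (rv 25))
     (Seq (setr 34 (Plus (rv 34) (rv 25)))
       (If (Minus (rv 25) (arr 12 (rv 32) (Const 0))) (setr 32 (rv 22)) Skip))))"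

definition coeff_exp :: exp where
  "coeff_exp = Minus (Const 0) (Div (Minus (Const 0) (Times prec_exp (arr 12 (rv 22) (Const 0))))
     (Minus (Times num_exp (arr 12 (rv 32) (Const 0))) (arr 12 (rv 22) (Const 0))))"

text \<open>The pivot column is itself rescaled on the way, hence the copy made beforehand.\<close>

definition shrink_prog :: prog where
  "shrink_prog = Seq (For (reg 23) dim_exp (Store (adr 13 (rv 23) (Const 0)) (arr 11 (rv 23) (rv 32))))
     (For (reg 22) dim_exp (Seq (setr 33 coeff_exp)
       (For (reg 23) dim_exp (Store (adr 11 (rv 23) (rv 22))
         (Minus (Times (Plus prec_exp (rv 33)) (arr 11 (rv 23) (rv 22))) (Times (rv 33) (arr 13 (rv 23) (Const 0))))))))"

text \<open>For an integer, 1 - sum > 0 says that the sum is not positive. Register 30 is only ever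
  cleared here, so after all rows it tells whether each of them was satisfied.\<close>

definition row_prog :: prog where
  "row_prog = Seq (setr 34 (Const 0)) (Seq (setr 32 (Const 0)) (Seq values_prog
     (If (Minus (Const 1) (rv 34))
       (Seq (setr 30 (Const 0)) (If (arr 12 (rv 32) (Const 0)) shrink_prog Skip)) Skip)))"

definition pass_prog :: prog where
  "pass_prog = Seq (setr 30 (Const 1)) (For (reg 21) (rv 37) row_prog)"

lemmas upd_simps = fun_upd_apply loc_inject same_except_upd

section \<open>Correctness of the shrinking passes\<close>

text \<open>\<open>HB\<close> bounds the coefficients of an inequality and \<open>M\<close> the
  entries of the cone before a step. The product with \<open>HB\<close> covers the sum of the values
  at all generators, itself a double sum; the other one covers the entries after a step.\<close>

locale solver_memory =
  fixes b nn n r :: nat and W :: int and F :: "nat \<Rightarrow> nat \<Rightarrow> int" and h :: "nat \<Rightarrow> int" and HB M :: int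
  assumes nn: "Suc n \<le> nn" "r \<le> nn" "nn \<le> 2 ^ b" and n1: "n \<ge> 1"
    and HB: "\<And>i c. i < r \<Longrightarrow> c < Suc n \<Longrightarrow> \<bar>hom_row n W F h i c\<bar> \<le> HB" "HB \<ge> 1"
    and M: "M \<ge> 1" "int (Suc n) * int (Suc n) * HB * M \<le> 2 ^ b" "3 * shrink_prec (Suc n) * M \<le> 2 ^ b"
begin

definition static where
  "static \<tau> \<longleftrightarrow> \<tau> (reg 37) = int r \<and> \<tau> (reg 38) = int n \<and> \<tau> (reg 27) = W \<and>
     (\<forall>i<r. \<tau> (loc 10 (int i) 0) = h i \<and> (\<forall>c<n. \<tau> (loc 9 (int i) (int c)) = F i c))"

definition cone_mem where
  "cone_mem V \<tau> \<longleftrightarrow> (\<forall>c<Suc n. \<forall>l<Suc n. \<tau> (loc 11 (int c) (int l)) = V c l)"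

definition small where
  "small V \<longleftrightarrow> (\<forall>c<Suc n. \<forall>l<Suc n. \<bar>V c l :: int\<bar> \<le> M)"

lemma static_same:
  assumes "same_except K \<sigma> \<tau>" "static \<sigma>" "K \<subseteq> {0..<64} - {9, 10, 27, 37, 38}"
  shows "static \<tau>"
proof -
  have "\<tau> (loc k (int i) (int c)) = \<sigma> (loc k (int i) (int c))" if "k \<in> {9, 10, 27, 37, 38}" for k i c
    using assms(3) that by (intro same_except_loc[OF assms(1)]) auto
  note * = this this[of _ _ 0, simplified] this[of _ 0 0, simplified]
  show ?thesis using assms(2) unfolding static_def by (simp add: *)
qed

lemma cone_mem_same:
  assumes "same_except K \<sigma> \<tau>" "cone_mem V \<sigma>" "K \<subseteq> {0..<64} - {11}"
  shows "cone_mem V \<tau>"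
proof -
  have "\<tau> (loc 11 (int i) (int c)) = \<sigma> (loc 11 (int i) (int c))" for i c
    using assms(3) by (intro same_except_loc[OF assms(1)]) auto
  then show ?thesis using assms(2) by (simp add: cone_mem_def)
qed

lemma exp_val_dim: "static \<tau> \<Longrightarrow> exp_val dim_exp \<tau> = int (Suc n)"
  by (simp add: dim_exp_def static_def)

lemma exp_val_prec: "static \<tau> \<Longrightarrow> exp_val prec_exp \<tau> = shrink_prec (Suc n)"
  by (simp add: prec_exp_def shrink_prec_def exp_val_dim power3_eq_cube del: of_nat_Suc)

lemma exp_val_num: "static \<tau> \<Longrightarrow> exp_val num_exp \<tau> = shrink_num (Suc n)"
  by (simp add: num_exp_def shrink_num_def exp_val_dim power2_eq_square del: of_nat_Suc)

lemma exp_val_row: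
  assumes "static \<tau>" "\<tau> (reg 21) = int i" "i < r" "\<tau> (reg 23) = int c" "c < Suc n"
  shows "exp_val row_exp \<tau> = hom_row n W F h i c"
  using assms by (cases "c = n") (simp_all add: row_exp_def static_def hom_row_def eqi_eq)

lemma partial_sum_bound:
  assumes V: "small V" and i: "i < r" and l: "l < Suc n" and m: "m \<le> Suc n"
  shows "\<bar>\<Sum>c<m. hom_row n W F h i c * V c l\<bar> \<le> int (Suc n) * (HB * M)"
proof -
  have "\<bar>\<Sum>c<m. hom_row n W F h i c * V c l\<bar> \<le> (\<Sum>c<m. HB * M)"
    using V m l HB i M unfolding small_def
    by (intro order.trans[OF sum_abs] sum_mono) (auto simp: abs_mult intro!: mult_mono)
  also have "\<dots> \<le> int (Suc n) * (HB * M)"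
    using m HB(2) M(1) by (simp del: of_nat_Suc)
  finally show ?thesis .
qed

lemma bounds_2b: "int (Suc n) * (int (Suc n) * (HB * M)) \<le> 2 ^ b" "int (Suc n) * (HB * M) \<le> 2 ^ b" "M \<le> 2 ^ b"
  "int (Suc n) \<le> 2 ^ b" "shrink_prec (Suc n) \<le> 2 ^ b"
proof -
  have 1: "1 \<le> HB * M" using HB(2) M(1) mult_mono[of 1 HB 1 M] by simp
  show 2: "int (Suc n) * (int (Suc n) * (HB * M)) \<le> 2 ^ b" using M(2) by (simp only: mult.assoc)
  have "1 * (int (Suc n) * (HB * M)) \<le> int (Suc n) * (int (Suc n) * (HB * M))" using 1 by (intro mult_right_mono) auto
  then show 3: "int (Suc n) * (HB * M) \<le> 2 ^ b" using 2 unfolding mult_1 by linarith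
  have "int (Suc n) * 1 \<le> int (Suc n) * (HB * M)" using 1 by (intro mult_left_mono) auto
  then show "int (Suc n) \<le> 2 ^ b" using 3 unfolding mult_1_right by linarith
  have "1 ^ 3 \<le> int (Suc n) ^ 3" by (intro power_mono) auto
  then have Q: "1 \<le> shrink_prec (Suc n)" unfolding shrink_prec_def power_one by linarith
  have "1 * M \<le> (3 * shrink_prec (Suc n)) * M" using Q M(1) by (intro mult_right_mono) auto
  then show "M \<le> 2 ^ b" using M(3) unfolding mult_1 by linarith
  have "shrink_prec (Suc n) * 1 \<le> (3 * shrink_prec (Suc n)) * M" using Q M(1) by (intro mult_mono) linarith+
  then show "shrink_prec (Suc n) \<le> 2 ^ b" using M(3) unfolding mult_1_right by linarith
qed

lemma wp_dot:
  assumes st: "static \<sigma>" and V: "cone_mem V \<sigma>" "small V" and i: "\<sigma> (reg 21) = int i" "i < r"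
    and l: "\<sigma> (reg 22) = int l" "l < Suc n"
  shows "wp b nn dot_prog (\<lambda>\<tau>. same_except {23, 25} \<sigma> \<tau> \<and> \<tau> (reg 25) = cone_values n W F h V i l) \<sigma>"
  unfolding dot_prog_def
proof (rule wp_Seq, rule wp_Store)
  define Inv where "Inv m \<tau> \<longleftrightarrow> same_except {23, 25} \<sigma> \<tau> \<and> \<tau> (reg 25) = (\<Sum>c<m. hom_row n W F h i c * V c l)" for m \<tau>
  have fr: "static \<tau>" "cone_mem V \<tau>" "\<tau> (reg 21) = int i" "\<tau> (reg 22) = int l" if "Inv m \<tau>" for m \<tau>
  proof -
    have s: "same_except {23, 25} \<sigma> \<tau>" using that by (simp add: Inv_def)
    show "static \<tau>" by (rule static_same[OF s st]) simp
    show "cone_mem V \<tau>" by (rule cone_mem_same[OF s V(1)]) simp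
    show "\<tau> (reg 21) = int i" "\<tau> (reg 22) = int l"
      using same_except_loc[OF s, of 21 0 0] same_except_loc[OF s, of 22 0 0] i l by simp_all
  qed
  show "wp b nn (For (reg 23) dim_exp (setr 25 (Plus (rv 25) (Times row_exp (arr 11 (rv 23) (rv 22))))))
     (\<lambda>\<tau>. same_except {23, 25} \<sigma> \<tau> \<and> \<tau> (reg 25) = cone_values n W F h V i l)
     (\<sigma>(exp_val (Const (reg 25)) \<sigma> := exp_val (Const 0) \<sigma>))"
  proof (rule wp_For[where m = "Suc n" and Inv = Inv])
    fix m \<tau> assume m: "m < Suc n" and inv: "Inv m \<tau>" and c: "\<tau> (reg 23) = int m"
    have val: "exp_val (Plus (rv 25) (Times row_exp (arr 11 (rv 23) (rv 22)))) \<tau> = (\<Sum>c<Suc m. hom_row n W F h i c * V c l)"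
      using exp_val_row[OF fr(1,3)[OF inv] i(2) c m] fr(2,4)[OF inv] inv c m l
      by (simp add: Inv_def cone_mem_def)
    show "wp b nn (setr 25 (Plus (rv 25) (Times row_exp (arr 11 (rv 23) (rv 22)))))
       (\<lambda>\<tau>'. \<tau>' (reg 23) = int m \<and> Inv (Suc m) (\<tau>'(reg 23 := int (Suc m)))) \<tau>"
    proof (rule wp_Store)
      show "\<bar>exp_val (Plus (rv 25) (Times row_exp (arr 11 (rv 23) (rv 22)))) \<tau>\<bar> \<le> 2 ^ b"
        unfolding val using partial_sum_bound[OF V(2) i(2) l(2), of "Suc m"] m bounds_2b(2) by linarith
    qed (use inv c in \<open>simp add: val Inv_def upd_simps del: exp_val.simps(3)\<close>)
  qed (use nn fr(1) in \<open>auto simp: Inv_def upd_simps exp_val_dim cone_values_def simp del: of_nat_Suc\<close>)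
qed simp

lemma wp_values:
  assumes st: "static \<sigma>" and V: "cone_mem V \<sigma>" "small V" and i: "\<sigma> (reg 21) = int i" "i < r"
    and z: "\<sigma> (reg 34) = 0" "\<sigma> (reg 32) = 0"
  defines "p \<equiv> cone_values n W F h V i"
  shows "wp b nn values_prog (\<lambda>\<tau>. same_except {12, 22, 23, 25, 32, 34} \<sigma> \<tau> \<and>
     (\<forall>l<Suc n. \<tau> (loc 12 (int l) 0) = p l) \<and> \<tau> (reg 34) = (\<Sum>l<Suc n. p l) \<and>
     \<tau> (reg 32) = int (argmax p (Suc n))) \<sigma>"
  unfolding values_prog_def
proof -
  define K where "K = {12, 22, 23, 25, 32, 34 :: int}"
  define Inv where "Inv m \<tau> \<longleftrightarrow> same_except K \<sigma> \<tau> \<and> (\<forall>l<m. \<tau> (loc 12 (int l) 0) = p l) \<and>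
     \<tau> (reg 34) = (\<Sum>l<m. p l) \<and> \<tau> (reg 32) = int (argmax p m)" for m \<tau>
  have fr: "static \<tau>" "cone_mem V \<tau>" "\<tau> (reg 21) = int i" if "Inv m \<tau>" for m \<tau>
  proof -
    have s: "same_except K \<sigma> \<tau>" using that by (simp add: Inv_def)
    show "static \<tau>" by (rule static_same[OF s st]) (simp add: K_def)
    show "cone_mem V \<tau>" by (rule cone_mem_same[OF s V(1)]) (simp add: K_def)
    show "\<tau> (reg 21) = int i" using same_except_loc[OF s, of 21 0 0] i by (simp add: K_def)
  qed
  have pb: "\<bar>p l\<bar> \<le> int (Suc n) * (HB * M)" if "l < Suc n" for l
    unfolding p_def cone_values_def using partial_sum_bound[OF V(2) i(2) that, of "Suc n"] by simp
  have sb: "\<bar>\<Sum>l<m. p l\<bar> \<le> 2 ^ b" if "m \<le> Suc n" for m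
  proof -
    have "\<bar>\<Sum>l<m. p l\<bar> \<le> (\<Sum>l<m. int (Suc n) * (HB * M))"
      by (rule order.trans[OF sum_abs], rule sum_mono) (use pb that in simp)
    also have "\<dots> = int m * (int (Suc n) * (HB * M))" by simp
    also have "\<dots> \<le> int (Suc n) * (int (Suc n) * (HB * M))"
      using that HB(2) M(1) by (intro mult_right_mono) auto
    finally show ?thesis using bounds_2b(1) by linarith
  qed
  show "wp b nn (For (reg 22) dim_exp (Seq dot_prog (Seq (Store (adr 12 (rv 22) (Const 0)) (rv 25))
     (Seq (setr 34 (Plus (rv 34) (rv 25)))
       (If (Minus (rv 25) (arr 12 (rv 32) (Const 0))) (setr 32 (rv 22)) Skip)))))
     (\<lambda>\<tau>. same_except {12, 22, 23, 25, 32, 34} \<sigma> \<tau> \<and>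
     (\<forall>l<Suc n. \<tau> (loc 12 (int l) 0) = p l) \<and> \<tau> (reg 34) = (\<Sum>l<Suc n. p l) \<and>
     \<tau> (reg 32) = int (argmax p (Suc n))) \<sigma>"
  proof (rule wp_For[where m = "Suc n" and Inv = Inv])
    show "exp_val dim_exp \<tau> = int (Suc n)" if "Inv i \<tau>" for i \<tau>
      using fr(1)[OF that] by (rule exp_val_dim)
    fix m \<tau> assume m: "m < Suc n" and inv: "Inv m \<tau>" and c: "\<tau> (reg 22) = int m"
    show "wp b nn (Seq dot_prog (Seq (Store (adr 12 (rv 22) (Const 0)) (rv 25))
     (Seq (setr 34 (Plus (rv 34) (rv 25)))
       (If (Minus (rv 25) (arr 12 (rv 32) (Const 0))) (setr 32 (rv 22)) Skip))))
       (\<lambda>\<tau>'. \<tau>' (reg 22) = int m \<and> Inv (Suc m) (\<tau>'(reg 22 := int (Suc m)))) \<tau>"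
    proof (rule wp_Seq, rule wp_mono[OF wp_dot[OF fr(1,2)[OF inv] V(2) fr(3)[OF inv] i(2) c m]])
      fix \<rho> assume \<rho>: "same_except {23, 25} \<tau> \<rho> \<and> \<rho> (reg 25) = cone_values n W F h V i m"
      note f = same_except_loc[OF \<rho>[THEN conjunct1]]
      have r: "\<rho> (reg 25) = p m" "\<rho> (reg 22) = int m" "\<rho> (reg 34) = (\<Sum>l<m. p l)" "\<rho> (reg 32) = int (argmax p m)"
        "\<And>l. l < m \<Longrightarrow> \<rho> (loc 12 (int l) 0) = p l"
        using \<rho> c inv by (simp_all add: f p_def Inv_def)
      have sK: "same_except K \<sigma> \<rho>"
        using same_except_trans[OF _ \<rho>[THEN conjunct1], of K \<sigma> K] inv by (simp add: Inv_def K_def)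
      define \<rho>2 where "\<rho>2 = (\<rho>(loc 12 (int m) 0 := p m))(reg 34 := (\<Sum>l<Suc m. p l))"
      have r2: "\<rho>2 (reg 25) = p m" "\<rho>2 (reg 22) = int m" "\<rho>2 (reg 34) = (\<Sum>l<Suc m. p l)" "\<rho>2 (reg 32) = int (argmax p m)"
        "\<And>l. l < Suc m \<Longrightarrow> \<rho>2 (loc 12 (int l) 0) = p l"
        using r by (auto simp: \<rho>2_def upd_simps less_Suc_eq)
      have s2: "same_except K \<sigma> \<rho>2" using sK by (simp add: \<rho>2_def upd_simps K_def)
      have am: "\<rho>2 (loc 12 (int (argmax p m)) 0) = p (argmax p m)"
      proof (rule r2(5))
        show "argmax p m < Suc m" using argmax_less[of m p] by (cases "m = 0") auto
      qed
      have "wp b nn (If (Minus (rv 25) (arr 12 (rv 32) (Const 0))) (setr 32 (rv 22)) Skip)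
         (\<lambda>\<tau>'. \<tau>' (reg 22) = int m \<and> Inv (Suc m) (\<tau>'(reg 22 := int (Suc m)))) \<rho>2"
      proof (rule wp_If)
        assume "0 < exp_val (Minus (rv 25) (arr 12 (rv 32) (Const 0))) \<rho>2"
        then have g: "p (argmax p m) < p m" by (simp add: r2 am)
        show "wp b nn (setr 32 (rv 22)) (\<lambda>\<tau>'. \<tau>' (reg 22) = int m \<and> Inv (Suc m) (\<tau>'(reg 22 := int (Suc m)))) \<rho>2"
        proof (rule wp_Store)
          have e: "exp_val (rv 22) \<rho>2 = int m" by (simp add: r2)
          show "\<bar>exp_val (rv 22) \<rho>2\<bar> \<le> 2 ^ b" unfolding e using m bounds_2b(4) by linarith
          show "(\<rho>2(exp_val (Const (reg 32)) \<rho>2 := exp_val (rv 22) \<rho>2)) (reg 22) = int m \<and>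
            Inv (Suc m) ((\<rho>2(exp_val (Const (reg 32)) \<rho>2 := exp_val (rv 22) \<rho>2))(reg 22 := int (Suc m)))"
            unfolding Inv_def using s2 r2 g by (simp add: upd_simps K_def del: sum.lessThan_Suc of_nat_Suc)
        qed
      next
        assume "\<not> 0 < exp_val (Minus (rv 25) (arr 12 (rv 32) (Const 0))) \<rho>2"
        then have g: "\<not> p (argmax p m) < p m" by (simp add: r2 am)
        show "wp b nn Skip (\<lambda>\<tau>'. \<tau>' (reg 22) = int m \<and> Inv (Suc m) (\<tau>'(reg 22 := int (Suc m)))) \<rho>2"
          by (rule wp_Skip) (use s2 r2 g in \<open>simp add: Inv_def upd_simps K_def del: sum.lessThan_Suc of_nat_Suc\<close>)
      qed
      then show "wp b nn (Seq (Store (adr 12 (rv 22) (Const 0)) (rv 25)) (Seq (setr 34 (Plus (rv 34) (rv 25)))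
       (If (Minus (rv 25) (arr 12 (rv 32) (Const 0))) (setr 32 (rv 22)) Skip)))
       (\<lambda>\<tau>'. \<tau>' (reg 22) = int m \<and> Inv (Suc m) (\<tau>'(reg 22 := int (Suc m)))) \<rho>"
        using sb[of "Suc m"] pb[OF m] bounds_2b(2) m
        by (intro wp_Seq wp_Store) (simp_all add: \<rho>2_def r upd_simps)
    qed
  qed (use nn z fr(1) in \<open>simp_all add: Inv_def K_def upd_simps exp_val_dim del: of_nat_Suc sum.lessThan_Suc argmax.simps(2)\<close>)
qed

lemma wp_shrink:
  assumes st: "static \<sigma>" and V: "cone_mem V \<sigma>" "small V"
    and p: "\<And>l. l < Suc n \<Longrightarrow> \<sigma> (loc 12 (int l) 0) = p l" "\<sigma> (reg 32) = int j" "j < Suc n" "p j > 0"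
      "\<And>l. l < Suc n \<Longrightarrow> p l \<le> p j"
  shows "wp b nn shrink_prog (\<lambda>\<tau>. same_except {11, 13, 22, 23, 33} \<sigma> \<tau> \<and> cone_mem (shrink (Suc n) p j V) \<tau>) \<sigma>"
  unfolding shrink_prog_def
proof (rule wp_Seq)
  define I1 where "I1 m \<tau> \<longleftrightarrow> same_except {13, 23} \<sigma> \<tau> \<and> (\<forall>c<m. \<tau> (loc 13 (int c) 0) = V c j)" for m \<tau>
  define V' where "V' = shrink (Suc n) p j V"
  \<comment> \<open>The matrix in mid-update: the columns below m and the first q entries of column
    m are new.\<close>
  define A where "A q m \<tau> \<longleftrightarrow> (\<forall>c<Suc n. \<forall>l<Suc n. \<tau> (loc 11 (int c) (int l)) =
     (if l < m \<or> (l = m \<and> c < q) then V' c l else V c l))" for q m \<tau>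
  have Vj: "V c l \<le> 2 ^ b" "- (2 ^ b) \<le> V c l" if "c < Suc n" "l < Suc n" for c l
    using V(2)[unfolded small_def, rule_format, OF that] bounds_2b(3) by linarith+
  have V'b: "\<bar>V' c l\<bar> \<le> 2 ^ b" if "c < Suc n" "l < Suc n" for c l
  proof -
    have "\<bar>V' c l\<bar> \<le> 3 * shrink_prec (Suc n) * M" unfolding V'_def
      by (rule shrink_bound) (use V(2) n1 p that in \<open>simp_all add: small_def\<close>)
    then show ?thesis using M(3) by linarith
  qed
  have Hb: "\<bar>shrink_coeff (Suc n) p j l\<bar> \<le> 2 ^ b" if "l < Suc n" for l
  proof -
    have n2: "Suc n \<ge> 2" using n1 by simp
    show ?thesis using shrink_coeff_bounds(4)[where p = p and j = j and l = l, OF n2 p(4) p(5)[OF that]] bounds_2b(5) by linarith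
  qed
  show "wp b nn (For (reg 23) dim_exp (Store (adr 13 (rv 23) (Const 0)) (arr 11 (rv 23) (rv 32))))
     (wp b nn (For (reg 22) dim_exp (Seq (setr 33 coeff_exp)
       (For (reg 23) dim_exp (Store (adr 11 (rv 23) (rv 22))
         (Minus (Times (Plus prec_exp (rv 33)) (arr 11 (rv 23) (rv 22))) (Times (rv 33) (arr 13 (rv 23) (Const 0))))))))
       (\<lambda>\<tau>. same_except {11, 13, 22, 23, 33} \<sigma> \<tau> \<and> cone_mem (shrink (Suc n) p j V) \<tau>)) \<sigma>"
  proof (rule wp_For[where m = "Suc n" and Inv = I1])
    fix m \<tau> assume m: "m < Suc n" and inv: "I1 m \<tau>" and c: "\<tau> (reg 23) = int m"
    note f = same_except_loc[OF inv[unfolded I1_def, THEN conjunct1]]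
    show "wp b nn (Store (adr 13 (rv 23) (Const 0)) (arr 11 (rv 23) (rv 32)))
       (\<lambda>\<tau>'. \<tau>' (reg 23) = int m \<and> I1 (Suc m) (\<tau>'(reg 23 := int (Suc m)))) \<tau>"
    proof (rule wp_Store)
      have v: "exp_val (arr 11 (rv 23) (rv 32)) \<tau> = V m j" using c p(2,3) V(1) m by (simp add: f cone_mem_def)
      show "\<bar>exp_val (arr 11 (rv 23) (rv 32)) \<tau>\<bar> \<le> 2 ^ b" unfolding v using Vj[OF m p(3)] by linarith
      show "(\<tau>(exp_val (adr 13 (rv 23) (Const 0)) \<tau> := exp_val (arr 11 (rv 23) (rv 32)) \<tau>)) (reg 23) = int m \<and>
        I1 (Suc m) ((\<tau>(exp_val (adr 13 (rv 23) (Const 0)) \<tau> := exp_val (arr 11 (rv 23) (rv 32)) \<tau>))(reg 23 := int (Suc m)))"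
        unfolding v using inv c by (auto simp: I1_def upd_simps less_Suc_eq)
    qed
  next
    fix \<tau> i assume "I1 i \<tau>"
    then have "same_except {13, 23} \<sigma> \<tau>" by (simp add: I1_def)
    then have "static \<tau>" by (rule static_same[OF _ st]) simp
    then show "exp_val dim_exp \<tau> = int (Suc n)" by (rule exp_val_dim)
  next
    fix \<sigma>1 assume "I1 (Suc n) \<sigma>1"
    then have s1: "same_except {13, 23} \<sigma> \<sigma>1" and col: "\<And>c. c < Suc n \<Longrightarrow> \<sigma>1 (loc 13 (int c) 0) = V c j"
      by (simp_all add: I1_def)
    note f1 = same_except_loc[OF s1]
    have st1: "static \<sigma>1" by (rule static_same[OF s1 st]) simp
    define K where "K = {11, 22, 23, 33 :: int}"
    define I2 where "I2 m \<tau> \<longleftrightarrow> same_except K \<sigma>1 \<tau> \<and> A 0 m \<tau>" for m \<tau>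
    have st2: "static \<tau>" if "same_except K \<sigma>1 \<tau>" for \<tau> by (rule static_same[OF that st1]) (simp add: K_def)
    show "wp b nn (For (reg 22) dim_exp (Seq (setr 33 coeff_exp)
       (For (reg 23) dim_exp (Store (adr 11 (rv 23) (rv 22))
         (Minus (Times (Plus prec_exp (rv 33)) (arr 11 (rv 23) (rv 22))) (Times (rv 33) (arr 13 (rv 23) (Const 0))))))))
       (\<lambda>\<tau>. same_except {11, 13, 22, 23, 33} \<sigma> \<tau> \<and> cone_mem (shrink (Suc n) p j V) \<tau>) \<sigma>1"
    proof (rule wp_For[where m = "Suc n" and Inv = I2])
      fix m \<tau> assume m: "m < Suc n" and inv: "I2 m \<tau>" and c: "\<tau> (reg 22) = int m"
      note s = inv[unfolded I2_def, THEN conjunct1]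
      note f2 = same_except_loc[OF s, unfolded K_def]
      define H where "H = shrink_coeff (Suc n) p j m"
      have H: "exp_val coeff_exp \<tau> = H"
        using p(1)[OF m] p(1)[OF p(3)] p(2) c
        by (simp add: coeff_exp_def exp_val_prec[OF st2[OF s]] exp_val_num[OF st2[OF s]] f2 f1 H_def shrink_coeff_def)
      define I3 where "I3 q \<tau> \<longleftrightarrow> same_except K \<sigma>1 \<tau> \<and> \<tau> (reg 22) = int m \<and> \<tau> (reg 33) = H \<and> A q m \<tau>" for q \<tau>
      show "wp b nn (Seq (setr 33 coeff_exp) (For (reg 23) dim_exp (Store (adr 11 (rv 23) (rv 22))
         (Minus (Times (Plus prec_exp (rv 33)) (arr 11 (rv 23) (rv 22))) (Times (rv 33) (arr 13 (rv 23) (Const 0)))))))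
         (\<lambda>\<tau>'. \<tau>' (reg 22) = int m \<and> I2 (Suc m) (\<tau>'(reg 22 := int (Suc m)))) \<tau>"
      proof (rule wp_Seq, rule wp_Store)
        show "\<bar>exp_val coeff_exp \<tau>\<bar> \<le> 2 ^ b" unfolding H H_def by (rule Hb[OF m])
        show "wp b nn (For (reg 23) dim_exp (Store (adr 11 (rv 23) (rv 22))
         (Minus (Times (Plus prec_exp (rv 33)) (arr 11 (rv 23) (rv 22))) (Times (rv 33) (arr 13 (rv 23) (Const 0))))))
         (\<lambda>\<tau>'. \<tau>' (reg 22) = int m \<and> I2 (Suc m) (\<tau>'(reg 22 := int (Suc m))))
         (\<tau>(exp_val (Const (reg 33)) \<tau> := exp_val coeff_exp \<tau>))"
        proof (rule wp_For[where m = "Suc n" and Inv = I3])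
          show "I3 0 ((\<tau>(exp_val (Const (reg 33)) \<tau> := exp_val coeff_exp \<tau>))(reg 23 := 0))"
            unfolding H using inv c by (simp add: I3_def I2_def A_def K_def upd_simps)
          show "exp_val dim_exp \<tau>' = int (Suc n)" if "I3 i \<tau>'" for i \<tau>'
            using that st2 exp_val_dim unfolding I3_def by blast
          fix \<tau>' assume i3: "I3 (Suc n) \<tau>'"
          have "A 0 (Suc m) \<tau>'" using i3 by (auto simp: I3_def A_def less_Suc_eq)
          then show "\<tau>' (reg 22) = int m \<and> I2 (Suc m) (\<tau>'(reg 22 := int (Suc m)))"
            using i3 by (simp add: I3_def I2_def A_def K_def upd_simps)
        next
          fix q \<tau>' assume q: "q < Suc n" and i3: "I3 q \<tau>'" and cq: "\<tau>' (reg 23) = int q"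
          note s3 = i3[unfolded I3_def, THEN conjunct1]
          note f3 = same_except_loc[OF s3, unfolded K_def]
          have v: "exp_val (Minus (Times (Plus prec_exp (rv 33)) (arr 11 (rv 23) (rv 22))) (Times (rv 33) (arr 13 (rv 23) (Const 0)))) \<tau>' = V' q m"
            using i3 cq col[OF q] q m
            by (simp add: exp_val_prec[OF st2[OF s3]] f3 I3_def A_def V'_def shrink_def H_def)
          show "wp b nn (Store (adr 11 (rv 23) (rv 22))
             (Minus (Times (Plus prec_exp (rv 33)) (arr 11 (rv 23) (rv 22))) (Times (rv 33) (arr 13 (rv 23) (Const 0)))))
             (\<lambda>\<tau>. \<tau> (reg 23) = int q \<and> I3 (Suc q) (\<tau>(reg 23 := int (Suc q)))) \<tau>'"
          proof (rule wp_Store)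
            show "\<bar>exp_val (Minus (Times (Plus prec_exp (rv 33)) (arr 11 (rv 23) (rv 22))) (Times (rv 33) (arr 13 (rv 23) (Const 0)))) \<tau>'\<bar> \<le> 2 ^ b"
              unfolding v by (rule V'b[OF q m])
            show "(\<tau>'(exp_val (adr 11 (rv 23) (rv 22)) \<tau>' := exp_val (Minus (Times (Plus prec_exp (rv 33)) (arr 11 (rv 23) (rv 22))) (Times (rv 33) (arr 13 (rv 23) (Const 0)))) \<tau>')) (reg 23) = int q \<and>
              I3 (Suc q) ((\<tau>'(exp_val (adr 11 (rv 23) (rv 22)) \<tau>' := exp_val (Minus (Times (Plus prec_exp (rv 33)) (arr 11 (rv 23) (rv 22))) (Times (rv 33) (arr 13 (rv 23) (Const 0)))) \<tau>'))(reg 23 := int (Suc q)))"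
              unfolding v using i3 cq by (auto simp: I3_def A_def K_def upd_simps less_Suc_eq)
          qed
        qed (use nn in simp_all)
      qed
    next
      fix \<tau> assume i2: "I2 (Suc n) \<tau>"
      then have "same_except {11, 13, 22, 23, 33} \<sigma> \<tau>"
        by (intro same_except_trans[OF s1, of K]) (auto simp: I2_def K_def)
      then show "same_except {11, 13, 22, 23, 33} \<sigma> \<tau> \<and> cone_mem (shrink (Suc n) p j V) \<tau>"
        using i2 by (simp add: I2_def A_def cone_mem_def V'_def)
    next
      show "I2 0 (\<sigma>1(reg 22 := 0))" using V(1) by (simp add: I2_def A_def K_def upd_simps f1 cone_mem_def)
      show "exp_val dim_exp \<tau>' = int (Suc n)" if "I2 i \<tau>'" for i \<tau>'
        using that st2 exp_val_dim unfolding I2_def by blast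
    qed (use nn in simp_all)
  qed (use nn in \<open>simp_all add: I1_def upd_simps\<close>)
qed

end

definition main_prog :: prog where "main_prog = For (reg 24) (rv 29) pass_prog"

definition solver_regs :: "int set" where "solver_regs = {11, 12, 13, 22, 23, 25, 30, 32, 33, 34}"

context solver_memory
begin

lemma wp_row:
  assumes st: "static \<sigma>" and V: "cone_mem V \<sigma>" "small V" and i: "\<sigma> (reg 21) = int i" "i < r"
  shows "wp b nn row_prog (\<lambda>\<tau>. same_except solver_regs \<sigma> \<tau> \<and> cone_mem (row_step n W F h V i) \<tau> \<and>
     \<tau> (reg 30) = (if row_sat n W F h V i then \<sigma> (reg 30) else 0)) \<sigma>" (is "wp _ _ _ ?Q _")
proof -
  define p where "p = cone_values n W F h V i"
  define j where "j = argmax p (Suc n)"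
  define \<sigma>1 where "\<sigma>1 = \<sigma>(reg 34 := 0, reg 32 := 0)"
  have s1: "same_except {32, 34} \<sigma> \<sigma>1" by (simp add: \<sigma>1_def upd_simps)
  have st1: "static \<sigma>1" by (rule static_same[OF s1 st]) simp
  have V1: "cone_mem V \<sigma>1" by (rule cone_mem_same[OF s1 V(1)]) simp
  have i1: "\<sigma>1 (reg 21) = int i" "\<sigma>1 (reg 34) = 0" "\<sigma>1 (reg 32) = 0" using i by (simp_all add: \<sigma>1_def upd_simps)
  have j: "j < Suc n" unfolding j_def by (rule argmax_less) simp
  have le: "p l \<le> p j" if "l < Suc n" for l unfolding j_def using that by (rule argmax_le)
  have w: "wp b nn (Seq values_prog (If (Minus (Const 1) (rv 34))
       (Seq (setr 30 (Const 0)) (If (arr 12 (rv 32) (Const 0)) shrink_prog Skip)) Skip)) ?Q \<sigma>1"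
  proof (rule wp_Seq, rule wp_mono[OF wp_values[OF st1 V1 V(2) i1(1) i(2) i1(2,3)]], fold p_def)
    fix \<rho> assume *: "same_except {12, 22, 23, 25, 32, 34} \<sigma>1 \<rho> \<and> (\<forall>l<Suc n. \<rho> (loc 12 (int l) 0) = p l) \<and>
      \<rho> (reg 34) = sum p {..<Suc n} \<and> \<rho> (reg 32) = int (argmax p (Suc n))"
    then have s2: "same_except {12, 22, 23, 25, 32, 34} \<sigma>1 \<rho>" and pl: "\<And>l. l < Suc n \<Longrightarrow> \<rho> (loc 12 (int l) 0) = p l"
      and sm: "\<rho> (reg 34) = sum p {..<Suc n}" and jr: "\<rho> (reg 32) = int j" unfolding j_def by blast+
    have s: "same_except solver_regs \<sigma> \<rho>"
      by (rule same_except_trans[OF s1 s2]) (simp_all add: solver_regs_def)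
    have r30: "\<rho> (reg 30) = \<sigma> (reg 30)" using same_except_loc[OF s2, of 30 0 0] by (simp add: \<sigma>1_def upd_simps)
    have V2: "cone_mem V \<rho>" by (rule cone_mem_same[OF s2 V1]) simp
    have st2: "static \<rho>" by (rule static_same[OF s2 st1]) simp
    have sat: "row_sat n W F h V i \<longleftrightarrow> sum p {..<Suc n} > 0" by (simp only: row_sat_def p_def)
    show "wp b nn (If (Minus (Const 1) (rv 34))
       (Seq (setr 30 (Const 0)) (If (arr 12 (rv 32) (Const 0)) shrink_prog Skip)) Skip) ?Q \<rho>"
    proof (rule wp_If)
      assume "0 < exp_val (Minus (Const 1) (rv 34)) \<rho>"
      then have ns: "\<not> row_sat n W F h V i" unfolding sat using sm by simp
      define \<rho>1 where "\<rho>1 = \<rho>(reg 30 := 0)"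
      have s3: "same_except {30} \<rho> \<rho>1" by (simp add: \<rho>1_def upd_simps)
      have s4: "same_except solver_regs \<sigma> \<rho>1"
        by (rule same_except_trans[OF s s3]) (simp_all add: solver_regs_def)
      have V3: "cone_mem V \<rho>1" by (rule cone_mem_same[OF s3 V2]) simp
      have st3: "static \<rho>1" by (rule static_same[OF s3 st2]) simp
      have m3: "\<And>l. l < Suc n \<Longrightarrow> \<rho>1 (loc 12 (int l) 0) = p l" "\<rho>1 (reg 32) = int j" "\<rho>1 (reg 30) = 0"
        using pl jr by (simp_all add: \<rho>1_def upd_simps)
      have "wp b nn (If (arr 12 (rv 32) (Const 0)) shrink_prog Skip) ?Q \<rho>1"
      proof (rule wp_If)
        assume "0 < exp_val (arr 12 (rv 32) (Const 0)) \<rho>1"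
        then have pj: "p j > 0" using m3 j by simp
        show "wp b nn shrink_prog ?Q \<rho>1"
        proof (rule wp_mono[OF wp_shrink[OF st3 V3 V(2) m3(1,2) j pj le]])
          fix \<tau> assume t: "same_except {11, 13, 22, 23, 33} \<rho>1 \<tau> \<and> cone_mem (shrink (Suc n) p j V) \<tau>"
          have "same_except solver_regs \<sigma> \<tau>"
            by (rule same_except_trans[OF s4 t[THEN conjunct1]]) (simp_all add: solver_regs_def)
          moreover have "row_step n W F h V i = shrink (Suc n) p j V"
            using ns pj by (simp add: row_step_def Let_def p_def j_def)
          moreover have "\<tau> (reg 30) = 0" using same_except_loc[OF t[THEN conjunct1], of 30 0 0] m3(3) by simp
          ultimately show "?Q \<tau>" using t ns by simp
        qed simp_all
      next
        assume "\<not> 0 < exp_val (arr 12 (rv 32) (Const 0)) \<rho>1"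
        then have pj: "\<not> p j > 0" using m3 j by simp
        then have "row_step n W F h V i = V" unfolding row_step_def Let_def p_def[symmetric] j_def[symmetric] by simp
        then show "wp b nn Skip ?Q \<rho>1" using s4 V3 m3(3) ns by (intro wp_Skip) simp
      qed
      then show "wp b nn (Seq (setr 30 (Const 0)) (If (arr 12 (rv 32) (Const 0)) shrink_prog Skip)) ?Q \<rho>"
        by (intro wp_Seq wp_Store) (simp_all add: \<rho>1_def)
    next
      assume "\<not> 0 < exp_val (Minus (Const 1) (rv 34)) \<rho>"
      then have sa: "row_sat n W F h V i" unfolding sat using sm by simp
      then have "row_step n W F h V i = V" by (simp add: row_step_def)
      then show "wp b nn Skip ?Q \<rho>" using s V2 r30 sa by (intro wp_Skip) simp
    qed
  qed
  show ?thesis unfolding row_prog_def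
    by ((rule wp_Seq, rule wp_Store, simp)+, simp only: exp_val.simps, rule w[unfolded \<sigma>1_def])
qed

lemma wp_pass:
  assumes st: "static \<sigma>" and V: "cone_mem V \<sigma>" "\<And>i. i < r \<Longrightarrow> small (row_steps n W F h V i)"
  shows "wp b nn pass_prog (\<lambda>\<tau>. same_except (insert 21 solver_regs) \<sigma> \<tau> \<and> cone_mem (row_steps n W F h V r) \<tau> \<and>
     \<tau> (reg 30) = (if \<forall>i<r. row_sat n W F h (row_steps n W F h V i) i then 1 else 0)) \<sigma>"
  unfolding pass_prog_def
proof (rule wp_Seq, rule wp_Store)
  define Inv where "Inv i \<tau> \<longleftrightarrow> same_except (insert 21 solver_regs) \<sigma> \<tau> \<and> cone_mem (row_steps n W F h V i) \<tau> \<and>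
     \<tau> (reg 30) = (if \<forall>i'<i. row_sat n W F h (row_steps n W F h V i') i' then 1 else 0)" for i \<tau>
  have st': "static \<tau>" if "Inv i \<tau>" for i \<tau>
    by (rule static_same[OF that[unfolded Inv_def, THEN conjunct1] st]) (simp add: solver_regs_def)
  show "wp b nn (For (reg 21) (rv 37) row_prog) (\<lambda>\<tau>. same_except (insert 21 solver_regs) \<sigma> \<tau> \<and> cone_mem (row_steps n W F h V r) \<tau> \<and>
     \<tau> (reg 30) = (if \<forall>i<r. row_sat n W F h (row_steps n W F h V i) i then 1 else 0))
     (\<sigma>(exp_val (Const (reg 30)) \<sigma> := exp_val (Const 1) \<sigma>))"
  proof (rule wp_For[where m = r and Inv = Inv])
    have "same_except {21, 30} \<sigma> (\<sigma>(reg 30 := 1, reg 21 := 0))" by (simp add: upd_simps)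
    then have "cone_mem V (\<sigma>(reg 30 := 1, reg 21 := 0))" by (rule cone_mem_same[OF _ V(1)]) simp
    then show "Inv 0 ((\<sigma>(exp_val (Const (reg 30)) \<sigma> := exp_val (Const 1) \<sigma>))(reg 21 := 0))"
      by (simp add: Inv_def upd_simps solver_regs_def)
    show "exp_val (rv 37) \<tau> = int r" if "Inv i \<tau>" for i \<tau> using st'[OF that] by (simp add: static_def)
    fix i \<tau> assume i: "i < r" and inv: "Inv i \<tau>" and c: "\<tau> (reg 21) = int i"
    note V' = inv[unfolded Inv_def, THEN conjunct2, THEN conjunct1]
    show "wp b nn row_prog (\<lambda>\<tau>'. \<tau>' (reg 21) = int i \<and> Inv (Suc i) (\<tau>'(reg 21 := int (Suc i)))) \<tau>"
    proof (rule wp_mono[OF wp_row[OF st'[OF inv] V' V(2)[OF i] c i]])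
      fix \<tau>' assume t: "same_except solver_regs \<tau> \<tau>' \<and> cone_mem (row_step n W F h (row_steps n W F h V i) i) \<tau>' \<and>
        \<tau>' (reg 30) = (if row_sat n W F h (row_steps n W F h V i) i then \<tau> (reg 30) else 0)"
      have "same_except (insert 21 solver_regs) \<sigma> \<tau>'"
        by (rule same_except_trans[OF inv[unfolded Inv_def, THEN conjunct1] t[THEN conjunct1]]) auto
      then have s: "same_except (insert 21 solver_regs) \<sigma> (\<tau>'(reg 21 := int (Suc i)))" by (rule same_except_upd) auto
      have s21: "same_except {21} \<tau>' (\<tau>'(reg 21 := int (Suc i)))" by (rule same_except_upd) auto
      have cm: "cone_mem (row_steps n W F h V (Suc i)) (\<tau>'(reg 21 := int (Suc i)))"
        unfolding row_steps.simps by (rule cone_mem_same[OF s21]) (use t in auto)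
      have "\<tau>' (reg 21) = int i" using same_except_loc[OF t[THEN conjunct1], of 21 0 0] c by (simp add: solver_regs_def)
      moreover have "(\<tau>'(reg 21 := int (Suc i))) (reg 30) = (if \<forall>i'<Suc i. row_sat n W F h (row_steps n W F h V i') i' then 1 else 0)"
        using t inv by (auto simp: upd_simps Inv_def less_Suc_eq)
      ultimately show "\<tau>' (reg 21) = int i \<and> Inv (Suc i) (\<tau>'(reg 21 := int (Suc i)))" using s cm unfolding Inv_def by blast
    qed
  qed (use nn in \<open>simp_all add: Inv_def\<close>)
qed (use nn in simp)

lemma wp_main:
  assumes st: "static \<sigma>" and V: "cone_mem (cone_init n W) \<sigma>"
    and sm: "\<And>t i. t < T \<Longrightarrow> i < r \<Longrightarrow> small (row_steps n W F h (passes r n W F h t) i)"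
    and T: "\<sigma> (reg 29) = int T" "T \<le> nn" "T = Suc T'"
  shows "wp b nn main_prog (\<lambda>\<tau>. same_except ({21, 24} \<union> solver_regs) \<sigma> \<tau> \<and>
     \<tau> (reg 30) = (if \<forall>i<r. row_sat n W F h (row_steps n W F h (passes r n W F h T') i) i then 1 else 0)) \<sigma>"
  unfolding main_prog_def
proof -
  define ok where "ok t = (if \<forall>i<r. row_sat n W F h (row_steps n W F h (passes r n W F h t) i) i then 1 else 0 :: int)" for t
  \<comment> \<open>Before the first pass register 30 has no meaningful value, so nothing is claimed
    about it for t = 0.\<close>
  define Inv where "Inv t \<tau> \<longleftrightarrow> same_except ({21, 24} \<union> solver_regs) \<sigma> \<tau> \<and> cone_mem (passes r n W F h t) \<tau> \<and>
     (\<forall>t'. t = Suc t' \<longrightarrow> \<tau> (reg 30) = ok t')" for t \<tau>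
  have st': "static \<tau>" if "Inv i \<tau>" for i \<tau>
    by (rule static_same[OF that[unfolded Inv_def, THEN conjunct1] st]) (simp add: solver_regs_def)
  show "wp b nn (For (reg 24) (rv 29) pass_prog) (\<lambda>\<tau>. same_except ({21, 24} \<union> solver_regs) \<sigma> \<tau> \<and>
     \<tau> (reg 30) = (if \<forall>i<r. row_sat n W F h (row_steps n W F h (passes r n W F h T') i) i then 1 else 0)) \<sigma>"
    unfolding ok_def[symmetric]
  proof (rule wp_For[where m = T and Inv = Inv])
    have "same_except {24} \<sigma> (\<sigma>(reg 24 := 0))" by (simp add: upd_simps)
    then have "cone_mem (cone_init n W) (\<sigma>(reg 24 := 0))" by (rule cone_mem_same[OF _ V]) simp
    then show "Inv 0 (\<sigma>(reg 24 := 0))" by (simp add: Inv_def upd_simps)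
    show "exp_val (rv 29) \<tau> = int T" if "Inv t \<tau>" for t \<tau>
      using same_except_loc[OF that[unfolded Inv_def, THEN conjunct1], of 29 0 0] T(1) by (simp add: solver_regs_def)
    fix t \<tau> assume t: "t < T" and inv: "Inv t \<tau>" and c: "\<tau> (reg 24) = int t"
    note V' = inv[unfolded Inv_def, THEN conjunct2, THEN conjunct1]
    show "wp b nn pass_prog (\<lambda>\<tau>'. \<tau>' (reg 24) = int t \<and> Inv (Suc t) (\<tau>'(reg 24 := int (Suc t)))) \<tau>"
    proof (rule wp_mono[OF wp_pass[OF st'[OF inv] V' sm[OF t]]], assumption, fold ok_def)
      fix \<tau>' assume u: "same_except (insert 21 solver_regs) \<tau> \<tau>' \<and> cone_mem (row_steps n W F h (passes r n W F h t) r) \<tau>' \<and> \<tau>' (reg 30) = ok t"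
      have "same_except ({21, 24} \<union> solver_regs) \<sigma> \<tau>'"
        by (rule same_except_trans[OF inv[unfolded Inv_def, THEN conjunct1] u[THEN conjunct1]]) auto
      then have s: "same_except ({21, 24} \<union> solver_regs) \<sigma> (\<tau>'(reg 24 := int (Suc t)))" by (rule same_except_upd) auto
      have s24: "same_except {24} \<tau>' (\<tau>'(reg 24 := int (Suc t)))" by (rule same_except_upd) auto
      have cm: "cone_mem (passes r n W F h (Suc t)) (\<tau>'(reg 24 := int (Suc t)))"
        unfolding passes.simps by (rule cone_mem_same[OF s24]) (use u in auto)
      have "\<tau>' (reg 24) = int t" using same_except_loc[OF u[THEN conjunct1], of 24 0 0] c by (simp add: solver_regs_def)
      moreover have "(\<tau>'(reg 24 := int (Suc t))) (reg 30) = ok t" using u by (simp add: upd_simps)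
      ultimately show "\<tau>' (reg 24) = int t \<and> Inv (Suc t) (\<tau>'(reg 24 := int (Suc t)))" using s cm unfolding Inv_def by blast
    qed
  next
    fix \<tau> assume "Inv T \<tau>"
    then show "same_except ({21, 24} \<union> solver_regs) \<sigma> \<tau> \<and> \<tau> (reg 30) = ok T'" using T(3) by (simp add: Inv_def)
  qed (use nn T in simp_all)
qed

end

section \<open>Parameters of the solver, computed by the machine\<close>

definition size_prog :: prog where
  "size_prog = Seq (setr 26 (Plus (Plus (rv 37) (rv 38)) (Const 2)))
     (For (reg 21) (rv 37) (Seq
       (For (reg 22) (rv 38) (setr 26 (Plus (rv 26) (Times (arr 9 (rv 21) (rv 22)) (arr 9 (rv 21) (rv 22))))))
       (setr 26 (Plus (rv 26) (Times (arr 10 (rv 21) (Const 0)) (arr 10 (rv 21) (Const 0)))))))"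

definition bits_prog :: prog where
  "bits_prog = Seq (setr 35 (rv 26)) (Seq (setr 28 (Const 0)) (While (rv 35)
     (Seq (setr 35 (Div (rv 35) (Const 2))) (setr 28 (Plus (rv 28) (Const 1))))))"

definition big_prog :: prog where
  "big_prog = Seq (setr 27 (Const 1)) (For (reg 21) (Plus (Times (Const 4) (rv 38)) (Const 8)) (setr 27 (Times (rv 27) (rv 26))))"

definition count_prog :: prog where
  "count_prog = setr 29 (Times (Times (Const 640) (Times (Times dim_exp dim_exp) (Times dim_exp dim_exp))) (rv 28))"

definition init_prog :: prog where
  "init_prog = For (reg 21) dim_exp (For (reg 22) dim_exp (Store (adr 11 (rv 21) (rv 22))
     (Minus (eqe (rv 21) (rv 22)) (Times (Times (eqe (rv 22) (rv 38)) (Minus (Const 1) (eqe (rv 21) (rv 22)))) (rv 27)))))"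

definition solve_prog :: prog where
  "solve_prog = Seq size_prog (Seq bits_prog (Seq big_prog (Seq count_prog (Seq init_prog main_prog))))"

definition lin_mem where
  "lin_mem r n F h \<tau> \<longleftrightarrow> \<tau> (reg 37) = int r \<and> \<tau> (reg 38) = int n \<and>
     (\<forall>i<r. \<tau> (loc 10 (int i) 0) = h i \<and> (\<forall>c<n. \<tau> (loc 9 (int i) (int c)) = F i c))"

lemma lin_mem_same:
  assumes "same_except K \<sigma> \<tau>" "lin_mem r n F h \<sigma>" "K \<subseteq> {0..<64} - {9, 10, 37, 38}"
  shows "lin_mem r n F h \<tau>"
proof -
  have "\<tau> (loc k (int i) (int c)) = \<sigma> (loc k (int i) (int c))" if "k \<in> {9, 10, 37, 38}" for k i c
    using assms(3) that by (intro same_except_loc[OF assms(1)]) auto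
  note * = this this[of _ _ 0, simplified] this[of _ 0 0, simplified]
  show ?thesis using assms(2) unfolding lin_mem_def by (simp add: *)
qed

lemma partial_size_le:
  assumes "i < r" "m \<le> n"
  shows "\<bar>int r + int n + 2 + (\<Sum>i'<i. (\<Sum>c<n. F i' c * F i' c) + h i' * h i') + (\<Sum>c<m. F i c * F i c)\<bar> \<le> lin_size r n F h"
    "\<bar>int r + int n + 2 + (\<Sum>i'<Suc i. (\<Sum>c<n. F i' c * F i' c) + h i' * h i')\<bar> \<le> lin_size r n F h"
    "int r + int n + 2 \<le> lin_size r n F h"
proof -
  define R where "R i = (\<Sum>c<n. F i c * F i c) + h i * h i" for i
  have R0: "R i \<ge> 0" for i unfolding R_def by (intro add_nonneg_nonneg sum_nonneg) auto
  have mono: "sum R {..<k} \<le> sum R {..<r}" if "k \<le> r" for k using that R0 by (intro sum_mono2) auto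
  have nn: "sum R {..<k} \<ge> 0" for k using R0 by (intro sum_nonneg) auto
  have p0: "0 \<le> (\<Sum>c<m. F i c * F i c)" by (intro sum_nonneg) auto
  have "(\<Sum>c<m. F i c * F i c) \<le> (\<Sum>c<n. F i c * F i c)" using assms by (intro sum_mono2) auto
  then have "(\<Sum>c<m. F i c * F i c) \<le> R i" unfolding R_def by (simp add: add_increasing2)
  moreover have "sum R {..<i} + R i \<le> sum R {..<r}" using mono[of "Suc i"] assms by simp
  ultimately show "\<bar>int r + int n + 2 + (\<Sum>i'<i. (\<Sum>c<n. F i' c * F i' c) + h i' * h i') + (\<Sum>c<m. F i c * F i c)\<bar> \<le> lin_size r n F h"
    using p0 nn[of i] unfolding lin_size_def R_def[symmetric] by linarith
  show "\<bar>int r + int n + 2 + (\<Sum>i'<Suc i. (\<Sum>c<n. F i' c * F i' c) + h i' * h i')\<bar> \<le> lin_size r n F h"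
    using mono[of "Suc i"] nn[of "Suc i"] assms unfolding lin_size_def R_def[symmetric] by linarith
  show "int r + int n + 2 \<le> lin_size r n F h" using nn[of r] unfolding lin_size_def R_def[symmetric] by linarith
qed

lemma wp_size:
  assumes lm: "lin_mem r n F h \<sigma>" and nn: "r \<le> nn" "n \<le> nn" "nn \<le> 2 ^ b" and S: "lin_size r n F h \<le> 2 ^ b"
  shows "wp b nn size_prog (\<lambda>\<tau>. same_except {21, 22, 26} \<sigma> \<tau> \<and> \<tau> (reg 26) = lin_size r n F h) \<sigma>"
proof -
  define R where "R i = (\<Sum>c<n. F i c * F i c) + h i * h i" for i
  define Inv where "Inv i \<tau> \<longleftrightarrow> same_except {21, 22, 26} \<sigma> \<tau> \<and> \<tau> (reg 26) = int r + int n + 2 + sum R {..<i}" for i \<tau>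
  have lm': "lin_mem r n F h \<tau>" if "same_except {21, 22, 26} \<sigma> \<tau>" for \<tau> by (rule lin_mem_same[OF that lm]) simp
  show ?thesis unfolding size_prog_def
  proof (rule wp_Seq, rule wp_Store)
    have "int r + int n + 2 \<le> lin_size r n F h"
      unfolding lin_size_def by (simp add: sum_nonneg)
    then show "\<bar>exp_val (Plus (Plus (rv 37) (rv 38)) (Const 2)) \<sigma>\<bar> \<le> 2 ^ b"
      using S lm by (simp add: lin_mem_def)
    show "wp b nn (For (reg 21) (rv 37) (Seq
       (For (reg 22) (rv 38) (setr 26 (Plus (rv 26) (Times (arr 9 (rv 21) (rv 22)) (arr 9 (rv 21) (rv 22))))))
       (setr 26 (Plus (rv 26) (Times (arr 10 (rv 21) (Const 0)) (arr 10 (rv 21) (Const 0)))))))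
      (\<lambda>\<tau>. same_except {21, 22, 26} \<sigma> \<tau> \<and> \<tau> (reg 26) = lin_size r n F h)
      (\<sigma>(exp_val (Const (reg 26)) \<sigma> := exp_val (Plus (Plus (rv 37) (rv 38)) (Const 2)) \<sigma>))"
    proof (rule wp_For[where m = r and Inv = Inv])
      show "Inv 0 ((\<sigma>(exp_val (Const (reg 26)) \<sigma> := exp_val (Plus (Plus (rv 37) (rv 38)) (Const 2)) \<sigma>))(reg 21 := 0))"
        using lm by (simp add: Inv_def upd_simps lin_mem_def)
      show "exp_val (rv 37) \<tau> = int r" if "Inv i \<tau>" for i \<tau>
        using lm'[OF that[unfolded Inv_def, THEN conjunct1]] by (simp add: lin_mem_def)
      show "same_except {21, 22, 26} \<sigma> \<tau> \<and> \<tau> (reg 26) = lin_size r n F h" if "Inv r \<tau>" for \<tau>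
        using that by (simp add: Inv_def lin_size_def R_def)
      fix i \<tau> assume i: "i < r" and inv: "Inv i \<tau>" and c: "\<tau> (reg 21) = int i"
      define I2 where "I2 m \<tau> \<longleftrightarrow> same_except {21, 22, 26} \<sigma> \<tau> \<and> \<tau> (reg 21) = int i \<and>
        \<tau> (reg 26) = int r + int n + 2 + sum R {..<i} + (\<Sum>c<m. F i c * F i c)" for m \<tau>
      note pb = partial_size_le[OF i, of _ n F h, folded R_def]
      show "wp b nn (Seq (For (reg 22) (rv 38) (setr 26 (Plus (rv 26) (Times (arr 9 (rv 21) (rv 22)) (arr 9 (rv 21) (rv 22))))))
       (setr 26 (Plus (rv 26) (Times (arr 10 (rv 21) (Const 0)) (arr 10 (rv 21) (Const 0))))))
       (\<lambda>\<tau>'. \<tau>' (reg 21) = int i \<and> Inv (Suc i) (\<tau>'(reg 21 := int (Suc i)))) \<tau>"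
      proof (rule wp_Seq, rule wp_For[where m = n and Inv = I2])
        show "I2 0 (\<tau>(reg 22 := 0))" using inv c by (simp add: I2_def Inv_def upd_simps)
        show "exp_val (rv 38) \<rho> = int n" if "I2 m \<rho>" for m \<rho>
          using lm'[OF that[unfolded I2_def, THEN conjunct1]] by (simp add: lin_mem_def)
        fix \<rho> assume i2: "I2 n \<rho>"
        have v: "exp_val (Plus (rv 26) (Times (arr 10 (rv 21) (Const 0)) (arr 10 (rv 21) (Const 0)))) \<rho>
            = int r + int n + 2 + sum R {..<Suc i}"
          using i2 lm'[OF i2[unfolded I2_def, THEN conjunct1]] i by (simp add: I2_def lin_mem_def R_def)
        show "wp b nn (setr 26 (Plus (rv 26) (Times (arr 10 (rv 21) (Const 0)) (arr 10 (rv 21) (Const 0)))))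
          (\<lambda>\<tau>'. \<tau>' (reg 21) = int i \<and> Inv (Suc i) (\<tau>'(reg 21 := int (Suc i)))) \<rho>"
        proof (rule wp_Store, unfold v)
          show "\<bar>int r + int n + 2 + sum R {..<Suc i}\<bar> \<le> 2 ^ b" using pb(2)[of n] S by linarith
          show "(\<rho>(exp_val (Const (reg 26)) \<rho> := int r + int n + 2 + sum R {..<Suc i})) (reg 21) = int i \<and>
            Inv (Suc i) ((\<rho>(exp_val (Const (reg 26)) \<rho> := int r + int n + 2 + sum R {..<Suc i}))(reg 21 := int (Suc i)))"
            using i2 by (simp add: I2_def Inv_def upd_simps del: sum.lessThan_Suc)
        qed
      next
        fix m \<rho> assume m: "m < n" and i2: "I2 m \<rho>" and cm: "\<rho> (reg 22) = int m"
        have v: "exp_val (Plus (rv 26) (Times (arr 9 (rv 21) (rv 22)) (arr 9 (rv 21) (rv 22)))) \<rho>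
            = int r + int n + 2 + sum R {..<i} + (\<Sum>c<Suc m. F i c * F i c)"
          using i2 lm'[OF i2[unfolded I2_def, THEN conjunct1]] i m cm by (simp add: I2_def lin_mem_def)
        show "wp b nn (setr 26 (Plus (rv 26) (Times (arr 9 (rv 21) (rv 22)) (arr 9 (rv 21) (rv 22)))))
          (\<lambda>\<tau>'. \<tau>' (reg 22) = int m \<and> I2 (Suc m) (\<tau>'(reg 22 := int (Suc m)))) \<rho>"
        proof (rule wp_Store, unfold v)
          show "\<bar>int r + int n + 2 + sum R {..<i} + (\<Sum>c<Suc m. F i c * F i c)\<bar> \<le> 2 ^ b"
            using pb(1)[of "Suc m"] m S by linarith
          show "(\<rho>(exp_val (Const (reg 26)) \<rho> := int r + int n + 2 + sum R {..<i} + (\<Sum>c<Suc m. F i c * F i c))) (reg 22) = int m \<and>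
            I2 (Suc m) ((\<rho>(exp_val (Const (reg 26)) \<rho> := int r + int n + 2 + sum R {..<i} + (\<Sum>c<Suc m. F i c * F i c)))(reg 22 := int (Suc m)))"
            using i2 cm by (simp add: I2_def upd_simps del: sum.lessThan_Suc)
        qed
      qed (use nn in simp_all)
    qed (use nn in simp_all)
  qed
qed

lemma wp_bits:
  assumes S: "\<sigma> (reg 26) = S" "S \<ge> 1" "S \<le> 2 ^ b" and nn: "nat (bitlen S) \<le> nn" "nn \<le> 2 ^ b"
  shows "wp b nn bits_prog (\<lambda>\<tau>. same_except {28, 35} \<sigma> \<tau> \<and> \<tau> (reg 28) = int (nat (bitlen S))) \<sigma>"
proof -
  \<comment> \<open>After i halvings \<open>S div 2 ^ i\<close> remains, which is positive as long
    as i is below the bit length.\<close>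
  define Inv where "Inv i \<tau> \<longleftrightarrow> same_except {28, 35} \<sigma> \<tau> \<and> \<tau> (reg 35) = S div 2 ^ i \<and> \<tau> (reg 28) = int i" for i \<tau>
  define m where "m = nat (bitlen S)"
  have bl: "2 ^ nat (bitlen S - 1) \<le> S" "S < 2 ^ m" using bitlen_bounds[of S] S by (auto simp: m_def)
  have pos: "S div 2 ^ i > 0" if "i < m" for i
  proof -
    have "(2 :: int) ^ i \<le> 2 ^ nat (bitlen S - 1)" using that by (intro power_increasing) (auto simp: m_def)
    then have "2 ^ i \<le> S" using bl(1) by linarith
    then show ?thesis by (simp add: pos_imp_zdiv_pos_iff)
  qed
  have mb: "int m \<le> 2 ^ b"
  proof -
    have "m \<le> 2 ^ b" unfolding m_def using nn by (rule order_trans)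
    then show ?thesis by (metis of_nat_le_iff of_nat_numeral of_nat_power)
  qed
  have "wp b nn (While (rv 35) (Seq (setr 35 (Div (rv 35) (Const 2))) (setr 28 (Plus (rv 28) (Const 1)))))
     (\<lambda>\<tau>. same_except {28, 35} \<sigma> \<tau> \<and> \<tau> (reg 28) = int m) (\<sigma>(reg 35 := S, reg 28 := 0))"
  proof (rule wp_While[where m = m and Inv = Inv])
    fix i \<tau> assume i: "i < m" and inv: "Inv i \<tau>"
    have d: "S div 2 ^ i div 2 = S div 2 ^ Suc i" by (simp add: zdiv_zmult2_eq[symmetric] mult.commute)
    have q: "S div 2 ^ Suc i \<le> S" "0 \<le> S div 2 ^ Suc i"
      using abs_div_le[of S "2 ^ Suc i"] S(2) by (simp_all add: pos_imp_zdiv_nonneg_iff)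
    have "wp b nn (Seq (setr 35 (Div (rv 35) (Const 2))) (setr 28 (Plus (rv 28) (Const 1)))) (Inv (Suc i)) \<tau>"
    proof -
      have "int (Suc i) \<le> 2 ^ b" using mb i by linarith
      then have "1 + int i \<le> 2 ^ b" by simp
      then show ?thesis
        using inv S q by (intro wp_Seq wp_Store) (simp_all add: Inv_def upd_simps d add.commute del: power_Suc)
    qed
    then show "exp_val (rv 35) \<tau> > 0 \<and> wp b nn (Seq (setr 35 (Div (rv 35) (Const 2))) (setr 28 (Plus (rv 28) (Const 1)))) (Inv (Suc i)) \<tau>"
      using inv pos[OF i] by (simp add: Inv_def)
  next
    fix \<tau> assume "Inv m \<tau>"
    then show "\<not> exp_val (rv 35) \<tau> > 0 \<and> same_except {28, 35} \<sigma> \<tau> \<and> \<tau> (reg 28) = int m"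
      using bl(2) S(2) by (simp add: Inv_def)
  qed (use nn in \<open>simp_all add: Inv_def upd_simps m_def\<close>)
  then show ?thesis unfolding bits_prog_def
    using S by (intro wp_Seq wp_Store) (simp_all add: upd_simps m_def)
qed

lemma wp_big:
  assumes S: "\<sigma> (reg 26) = S" "S \<ge> 1" "\<sigma> (reg 38) = int n" and W: "S ^ (4 * n + 8) \<le> 2 ^ b"
    and nn: "4 * n + 8 \<le> nn" "nn \<le> 2 ^ b"
  shows "wp b nn big_prog (\<lambda>\<tau>. same_except {21, 27} \<sigma> \<tau> \<and> \<tau> (reg 27) = S ^ (4 * n + 8)) \<sigma>"
proof -
  define Inv where "Inv i \<tau> \<longleftrightarrow> same_except {21, 27} \<sigma> \<tau> \<and> \<tau> (reg 27) = S ^ i" for i \<tau>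
  have fr: "\<tau> (reg 26) = S" "\<tau> (reg 38) = int n" if "Inv i \<tau>" for i \<tau>
    using same_except_loc[OF that[unfolded Inv_def, THEN conjunct1], of 26 0 0]
      same_except_loc[OF that[unfolded Inv_def, THEN conjunct1], of 38 0 0] S by simp_all
  show ?thesis unfolding big_prog_def
  proof (rule wp_Seq, rule wp_Store)
    show "wp b nn (For (reg 21) (Plus (Times (Const 4) (rv 38)) (Const 8)) (setr 27 (Times (rv 27) (rv 26))))
      (\<lambda>\<tau>. same_except {21, 27} \<sigma> \<tau> \<and> \<tau> (reg 27) = S ^ (4 * n + 8)) (\<sigma>(exp_val (Const (reg 27)) \<sigma> := exp_val (Const 1) \<sigma>))"
    proof (rule wp_For[where m = "4 * n + 8" and Inv = Inv])
      show "exp_val (Plus (Times (Const 4) (rv 38)) (Const 8)) \<tau> = int (4 * n + 8)" if "Inv i \<tau>" for i \<tau>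
        using fr[OF that] by simp
      fix i \<tau> assume i: "i < 4 * n + 8" and inv: "Inv i \<tau>" and c: "\<tau> (reg 21) = int i"
      have "S ^ Suc i \<le> S ^ (4 * n + 8)" using i S(2) by (intro power_increasing) auto
      then have "\<bar>S ^ Suc i\<bar> \<le> 2 ^ b" using W S(2) by simp
      moreover have v: "exp_val (Times (rv 27) (rv 26)) \<tau> = S ^ Suc i" using inv fr[OF inv] by (simp add: Inv_def)
      ultimately show "wp b nn (setr 27 (Times (rv 27) (rv 26))) (\<lambda>\<tau>'. \<tau>' (reg 21) = int i \<and> Inv (Suc i) (\<tau>'(reg 21 := int (Suc i)))) \<tau>"
        using inv c by (intro wp_Store) (simp_all only: v, simp add: Inv_def upd_simps del: power_Suc)
    qed (use nn in \<open>simp_all add: Inv_def upd_simps\<close>)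
  qed simp
qed

lemma wp_init:
  assumes st: "\<sigma> (reg 38) = int n" "\<sigma> (reg 27) = W" and W: "1 \<le> W" "W \<le> 2 ^ b"
    and nn: "Suc n \<le> nn" "nn \<le> 2 ^ b"
  shows "wp b nn init_prog (\<lambda>\<tau>. same_except {11, 21, 22} \<sigma> \<tau> \<and>
     (\<forall>c<Suc n. \<forall>l<Suc n. \<tau> (loc 11 (int c) (int l)) = cone_init n W c l)) \<sigma>"
proof -
  define Inv where "Inv i \<tau> \<longleftrightarrow> same_except {11, 21, 22} \<sigma> \<tau> \<and>
     (\<forall>c<i. \<forall>l<Suc n. \<tau> (loc 11 (int c) (int l)) = cone_init n W c l)" for i \<tau>
  have dim: "exp_val dim_exp \<tau> = int (Suc n)" "\<tau> (reg 38) = int n" "\<tau> (reg 27) = W" if "same_except {11, 21, 22} \<sigma> \<tau>" for \<tau>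
    using same_except_loc[OF that, of 38 0 0] same_except_loc[OF that, of 27 0 0] st by (simp_all add: dim_exp_def)
  have cb: "\<bar>cone_init n W c l\<bar> \<le> 2 ^ b" for c l
    using W by (simp add: cone_init_def)
  show ?thesis unfolding init_prog_def
  proof (rule wp_For[where m = "Suc n" and Inv = Inv])
    show "Inv 0 (\<sigma>(reg 21 := 0))" by (simp add: Inv_def upd_simps)
    show "exp_val dim_exp \<tau> = int (Suc n)" if "Inv i \<tau>" for i \<tau> using that dim(1) by (simp add: Inv_def)
    show "same_except {11, 21, 22} \<sigma> \<tau> \<and> (\<forall>c<Suc n. \<forall>l<Suc n. \<tau> (loc 11 (int c) (int l)) = cone_init n W c l)"
      if "Inv (Suc n) \<tau>" for \<tau> using that by (simp add: Inv_def)
    fix i \<tau> assume i: "i < Suc n" and inv: "Inv i \<tau>" and ci: "\<tau> (reg 21) = int i"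
    define I2 where "I2 m \<tau> \<longleftrightarrow> Inv i \<tau> \<and> \<tau> (reg 21) = int i \<and> (\<forall>l<m. \<tau> (loc 11 (int i) (int l)) = cone_init n W i l)" for m \<tau>
    show "wp b nn (For (reg 22) dim_exp (Store (adr 11 (rv 21) (rv 22))
     (Minus (eqe (rv 21) (rv 22)) (Times (Times (eqe (rv 22) (rv 38)) (Minus (Const 1) (eqe (rv 21) (rv 22)))) (rv 27)))))
     (\<lambda>\<tau>'. \<tau>' (reg 21) = int i \<and> Inv (Suc i) (\<tau>'(reg 21 := int (Suc i)))) \<tau>"
    proof (rule wp_For[where m = "Suc n" and Inv = I2])
      show "I2 0 (\<tau>(reg 22 := 0))" using inv ci by (simp add: I2_def Inv_def upd_simps)
      show "exp_val dim_exp \<rho> = int (Suc n)" if "I2 m \<rho>" for m \<rho> using that dim(1) by (simp add: I2_def Inv_def)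
      show "\<rho> (reg 21) = int i \<and> Inv (Suc i) (\<rho>(reg 21 := int (Suc i)))" if "I2 (Suc n) \<rho>" for \<rho>
        using that by (auto simp: I2_def Inv_def upd_simps less_Suc_eq)
      fix m \<rho> assume m: "m < Suc n" and i2: "I2 m \<rho>" and cm: "\<rho> (reg 22) = int m"
      have s: "same_except {11, 21, 22} \<sigma> \<rho>" "\<rho> (reg 21) = int i" using i2 by (simp_all add: I2_def Inv_def)
      have v: "exp_val (Minus (eqe (rv 21) (rv 22)) (Times (Times (eqe (rv 22) (rv 38)) (Minus (Const 1) (eqe (rv 21) (rv 22)))) (rv 27))) \<rho>
          = cone_init n W i m"
        using dim(2,3)[OF s(1)] s(2) cm by (simp add: eqi_eq cone_init_def)
      show "wp b nn (Store (adr 11 (rv 21) (rv 22))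
       (Minus (eqe (rv 21) (rv 22)) (Times (Times (eqe (rv 22) (rv 38)) (Minus (Const 1) (eqe (rv 21) (rv 22)))) (rv 27))))
       (\<lambda>\<tau>'. \<tau>' (reg 22) = int m \<and> I2 (Suc m) (\<tau>'(reg 22 := int (Suc m)))) \<rho>"
      proof (rule wp_Store, unfold v)
        show "\<bar>cone_init n W i m\<bar> \<le> 2 ^ b" by (rule cb)
        show "(\<rho>(exp_val (adr 11 (rv 21) (rv 22)) \<rho> := cone_init n W i m)) (reg 22) = int m \<and>
          I2 (Suc m) ((\<rho>(exp_val (adr 11 (rv 21) (rv 22)) \<rho> := cone_init n W i m))(reg 22 := int (Suc m)))"
          using i2 s cm by (auto simp: I2_def Inv_def upd_simps less_Suc_eq)
      qed
    qed (use nn in simp_all)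
  qed (use nn in simp_all)
qed

definition solve_regs :: "int set" where "solve_regs = {21, 24, 26, 27, 28, 29, 35} \<union> solver_regs"

definition pass_count :: "nat \<Rightarrow> int \<Rightarrow> nat" where "pass_count n S = 640 * Suc n ^ 4 * nat (bitlen S)"

text \<open>The value of the bound in \<open>passes_bound\<close> after the row steps of all
  passes.\<close>

definition cone_bound :: "nat \<Rightarrow> nat \<Rightarrow> int \<Rightarrow> int" where
  "cone_bound r n S = S ^ (4 * n + 8) * (3 * shrink_prec (Suc n)) ^ (pass_count n S * r)"

lemma wp_solve:
  assumes lm: "lin_mem r n F h \<sigma>" and n: "n \<ge> 1"
    and zero: "i0 < r" "\<And>c. c < n \<Longrightarrow> F i0 c = 0" "h i0 = 0"
    and S: "S = lin_size r n F h"
    and nn: "4 * n + 8 \<le> nn" "r \<le> nn" "nat (bitlen S) \<le> nn" "pass_count n S \<le> nn" "nn \<le> 2 ^ b"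
    and big: "int (Suc n) * int (Suc n) * (2 * S ^ (4 * n + 8) * S) * cone_bound r n S \<le> 2 ^ b"
      "3 * shrink_prec (Suc n) * cone_bound r n S \<le> 2 ^ b"
  shows "wp b nn solve_prog (\<lambda>\<tau>. same_except solve_regs \<sigma> \<tau> \<and> \<tau> (reg 30) = (if lin_feasible r n F h then 1 else 0)) \<sigma>"
proof -
  define W where "W = S ^ (4 * n + 8)"
  define \<beta> where "\<beta> = nat (bitlen S)"
  define T where "T = pass_count n S"
  define M where "M = cone_bound r n S"
  \<comment> \<open>A homogenized coefficient is at most W S + 1 in absolute value, and W S >=
    1.\<close>
  define HB where "HB = 2 * W * S"
  have S2: "S \<ge> 2" using partial_size_le(3)[of i0 r 0 n F h] zero(1) S by simp
  have W1: "W \<ge> 1" unfolding W_def using S2 by (intro one_le_power) simp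
  have SW: "S \<le> W" unfolding W_def using S2 power_increasing[of 1 "4 * n + 8" S] by simp
  have Q3: "1 \<le> 3 * shrink_prec (Suc n)" using shrink_prec_ge1[of n] by simp
  have M_def': "M = W * (3 * shrink_prec (Suc n)) ^ (T * r)" by (simp add: M_def cone_bound_def W_def T_def)
  have Q3p: "1 \<le> (3 * shrink_prec (Suc n)) ^ k" for k using Q3 by (rule one_le_power)
  have WM: "W \<le> M" using mult_left_mono[OF Q3p, of W "T * r"] W1 by (simp add: M_def')
  have M1: "M \<ge> 1" using WM W1 by simp
  have "1 * M \<le> 3 * shrink_prec (Suc n) * M" using Q3 M1 by (intro mult_right_mono) auto
  then have Mb: "M \<le> 2 ^ b" using big(2)[folded M_def] unfolding mult_1 by linarith
  have SF: "\<bar>F i c\<bar> \<le> S" "\<bar>h i\<bar> \<le> S" if "i < r" "c < n" for i c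
  proof -
    have "\<bar>real_of_int (F i c)\<bar> \<le> (\<Sum>c<n. \<bar>real_of_int (F i c)\<bar>)" using that by (intro member_le_sum) auto
    also have "\<dots> \<le> real_of_int S" unfolding S by (rule lin_size_bounds(2)[OF that(1)])
    finally show "\<bar>F i c\<bar> \<le> S" by (metis of_int_abs of_int_le_iff)
    have "\<bar>real_of_int (h i)\<bar> \<le> real_of_int S" unfolding S by (rule lin_size_bounds(3)[OF that(1)])
    then show "\<bar>h i\<bar> \<le> S" by (metis of_int_abs of_int_le_iff)
  qed
  have HBb: "\<bar>hom_row n W F h i c\<bar> \<le> HB" if i: "i < r" for i c
  proof (cases "c < n")
    case True
    have "W * \<bar>F i c\<bar> \<le> W * S" using SF(1)[OF i True] W1 by (intro mult_left_mono) auto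
    moreover have "0 \<le> W * S" using W1 S2 by simp
    ultimately show ?thesis using True W1 by (simp add: hom_row_def abs_mult HB_def)
  next
    case False
    have "W * \<bar>h i\<bar> \<le> W * S" using SF(2)[OF i, of 0] n W1 by (intro mult_left_mono) auto
    moreover have "\<bar>W * h i + 1\<bar> \<le> W * \<bar>h i\<bar> + 1" using W1 abs_triangle_ineq[of "W * h i" 1] by (simp add: abs_mult)
    moreover have "1 \<le> W * S" using W1 S2 mult_mono[of 1 W 1 S] by simp
    ultimately show ?thesis using False unfolding hom_row_def HB_def by simp
  qed
  have "1 * 1 \<le> W * S" using W1 S2 by (intro mult_mono) auto
  then have HB1: "HB \<ge> 1" by (simp add: HB_def)
  note lim = nn
  interpret solver_memory b nn n r W F h HB M
  proof
    show "int (Suc n) * int (Suc n) * HB * M \<le> 2 ^ b" using big(1) by (simp only: HB_def W_def M_def)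
    show "3 * shrink_prec (Suc n) * M \<le> 2 ^ b" using big(2) by (simp only: M_def)
  qed (use nn n HBb HB1 M1 in simp_all)
  have static: "static \<tau> \<longleftrightarrow> lin_mem r n F h \<tau> \<and> \<tau> (reg 27) = W" for \<tau>
    by (auto simp: static_def lin_mem_def)
  have \<beta>S: "S < 2 ^ \<beta>" using bitlen_bounds[of S] S2 by (simp add: \<beta>_def)
  have \<beta>1: "\<beta> \<ge> 1" using \<beta>S S2 by (cases \<beta>) auto
  have T_eq: "T = 640 * Suc n ^ 4 * \<beta>" by (simp add: T_def pass_count_def \<beta>_def)
  have "T > 0" using \<beta>1 by (simp add: T_eq)
  then obtain T' where T': "T = Suc T'" by (cases T) auto
  have sm: "small (row_steps n W F h (passes r n W F h t) i)" if "t < T" "i < r" for t i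
    unfolding small_def
  proof (intro allI impI)
    fix c l assume "c < Suc n" "l < Suc n"
    then have "\<bar>row_steps n W F h (passes r n W F h t) i c l\<bar> \<le> W * (3 * shrink_prec (Suc n)) ^ (t * r + i)"
      by (rule passes_bound[OF W1 n])
    also have "\<dots> \<le> M" unfolding M_def'
    proof (intro mult_left_mono power_increasing Q3)
      \<comment> \<open>Row i of pass t is preceded by t r + i row steps, fewer than the T r steps
        of the whole run.\<close>
      have "Suc t * r \<le> T * r" using that by (intro mult_right_mono) auto
      then show "t * r + i \<le> T * r" using that by simp
    qed (use W1 in simp)
    finally show "\<bar>row_steps n W F h (passes r n W F h t) i c l\<bar> \<le> M" .
  qed
  have correct: "(\<forall>i<r. row_sat n W F h (row_steps n W F h (passes r n W F h T') i) i) \<longleftrightarrow> lin_feasible r n F h"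
    by (rule solver_correct[where ?i0.0 = i0 and T = T and \<beta> = \<beta>]) (use n zero T' \<beta>S T_eq in \<open>simp_all add: W_def S\<close>)
  have Sb: "S \<le> 2 ^ b" using SW WM Mb by linarith
  have Wb: "S ^ (4 * n + 8) \<le> 2 ^ b" using WM Mb by (simp add: W_def)
  let ?Q = "\<lambda>\<tau>. same_except solve_regs \<sigma> \<tau> \<and> \<tau> (reg 30) = (if lin_feasible r n F h then 1 else 0)"
  show ?thesis unfolding solve_prog_def
  proof (rule wp_Seq, rule wp_mono[OF wp_size[where nn = nn and b = b, OF lm]])
    fix \<sigma>1 assume 1: "same_except {21, 22, 26} \<sigma> \<sigma>1 \<and> \<sigma>1 (reg 26) = lin_size r n F h"
    note s1 = 1[THEN conjunct1]
    have S1: "\<sigma>1 (reg 26) = S" using 1 by (simp add: S)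
    show "wp b nn (Seq bits_prog (Seq big_prog (Seq count_prog (Seq init_prog main_prog)))) ?Q \<sigma>1"
    proof (rule wp_Seq, rule wp_mono[OF wp_bits[where \<sigma> = \<sigma>1 and S = S and b = b and nn = nn, OF S1]])
      fix \<sigma>2 assume 2: "same_except {28, 35} \<sigma>1 \<sigma>2 \<and> \<sigma>2 (reg 28) = int (nat (bitlen S))"
      have s2: "same_except {21, 22, 26, 28, 35} \<sigma> \<sigma>2" by (rule same_except_trans[OF s1 2[THEN conjunct1]]) auto
      have l2: "lin_mem r n F h \<sigma>2" by (rule lin_mem_same[OF s2 lm]) simp
      have S2': "\<sigma>2 (reg 26) = S" using same_except_loc[OF 2[THEN conjunct1], of 26 0 0] S1 by simp
      have n2: "\<sigma>2 (reg 38) = int n" using l2 by (simp add: lin_mem_def)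
      show "wp b nn (Seq big_prog (Seq count_prog (Seq init_prog main_prog))) ?Q \<sigma>2"
      proof (rule wp_Seq, rule wp_mono[OF wp_big[where \<sigma> = \<sigma>2 and S = S and n = n and b = b and nn = nn, OF S2' _ n2 Wb]])
        fix \<sigma>3 assume 3: "same_except {21, 27} \<sigma>2 \<sigma>3 \<and> \<sigma>3 (reg 27) = S ^ (4 * n + 8)"
        have l3: "lin_mem r n F h \<sigma>3" by (rule lin_mem_same[OF 3[THEN conjunct1] l2]) simp
        have st3: "static \<sigma>3" unfolding static using l3 3 by (simp add: W_def)
        have b3: "\<sigma>3 (reg 28) = int \<beta>" using same_except_loc[OF 3[THEN conjunct1], of 28 0 0] 2 by (simp add: \<beta>_def)
        have s3: "same_except {21, 22, 26, 27, 28, 35} \<sigma> \<sigma>3" by (rule same_except_trans[OF s2 3[THEN conjunct1]]) auto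
        have v: "exp_val (Times (Times (Const 640) (Times (Times dim_exp dim_exp) (Times dim_exp dim_exp))) (rv 28)) \<sigma>3 = int T"
          by (simp only: T_eq of_nat_mult of_nat_power power4_eq_xxxx exp_val.simps exp_val_dim[OF st3]
              of_nat_numeral mult.assoc b3)
        define \<sigma>4 where "\<sigma>4 = \<sigma>3(reg 29 := int T)"
        have s34: "same_except {29} \<sigma>3 \<sigma>4" by (simp add: \<sigma>4_def upd_simps)
        have st4: "static \<sigma>4" by (rule static_same[OF s34 st3]) simp
        have s4: "same_except {21, 22, 26, 27, 28, 29, 35} \<sigma> \<sigma>4" by (rule same_except_trans[OF s3 s34]) auto
        have W4: "\<sigma>4 (reg 38) = int n" "\<sigma>4 (reg 27) = W" using st4 by (simp_all add: static_def)
        have w4: "wp b nn (Seq init_prog main_prog) ?Q \<sigma>4"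
        proof (rule wp_Seq, rule wp_mono[OF wp_init[where \<sigma> = \<sigma>4 and n = n and W = W and b = b and nn = nn, OF W4 W1]])
          fix \<sigma>5 assume 5: "same_except {11, 21, 22} \<sigma>4 \<sigma>5 \<and>
            (\<forall>c<Suc n. \<forall>l<Suc n. \<sigma>5 (loc 11 (int c) (int l)) = cone_init n W c l)"
          have st5: "static \<sigma>5" by (rule static_same[OF 5[THEN conjunct1] st4]) simp
          have c5: "cone_mem (cone_init n W) \<sigma>5" using 5 by (simp add: cone_mem_def)
          have T5: "\<sigma>5 (reg 29) = int T" using same_except_loc[OF 5[THEN conjunct1], of 29 0 0] by (simp add: \<sigma>4_def)
          have s5: "same_except ({21, 22, 26, 27, 28, 29, 35} \<union> {11}) \<sigma> \<sigma>5"
            by (rule same_except_trans[OF s4 5[THEN conjunct1]]) auto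
          have Tn: "T \<le> nn" using lim(4) by (simp add: T_def)
          show "wp b nn main_prog ?Q \<sigma>5"
          proof (rule wp_mono[OF wp_main[OF st5 c5 sm T5 Tn T']], assumption, assumption)
            fix \<tau> assume t: "same_except ({21, 24} \<union> solver_regs) \<sigma>5 \<tau> \<and>
              \<tau> (reg 30) = (if \<forall>i<r. row_sat n W F h (row_steps n W F h (passes r n W F h T') i) i then 1 else 0)"
            have "same_except solve_regs \<sigma> \<tau>"
              by (rule same_except_trans[OF s5 t[THEN conjunct1]]) (auto simp: solve_regs_def solver_regs_def)
            then show "?Q \<tau>" using t unfolding correct by blast
          qed
        qed (use lim WM Mb in simp_all)
        show "wp b nn (Seq count_prog (Seq init_prog main_prog)) ?Q \<sigma>3"
          unfolding count_prog_def
        proof (rule wp_Seq, rule wp_Store, unfold v exp_val.simps(1))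
          have "T \<le> 2 ^ b" using lim(4,5) unfolding T_def by (rule order_trans)
          then show "\<bar>int T\<bar> \<le> 2 ^ b" by (metis abs_of_nat of_nat_le_iff of_nat_numeral of_nat_power)
          show "wp b nn (Seq init_prog main_prog) ?Q (\<sigma>3(reg 29 := int T))" using w4 unfolding \<sigma>4_def .
        qed
      qed (use lim S2 in simp_all)
    qed (use lim S2 Sb in simp_all)
  qed (use lim Sb S in simp_all)
qed

section \<open>Programs for the inverse problem\<close>

text \<open>Families 1 and 2 contain A y, a sum of variable length that no single expression can
  compute; it is therefore tabulated beforehand.\<close>

definition products_prog :: prog where
  "products_prog = For (reg 21) (rv 18) (Seq (setr 25 (Const 0)) (Seq
     (For (reg 22) (rv 18) (setr 25 (Plus (rv 25) (Times (arr 0 (rv 21) (rv 22)) (arr 7 (rv 22) (Const 0))))))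
     (Store (adr 8 (rv 21) (Const 0)) (rv 25))))"

definition mat_exp :: exp where
  "mat_exp = (let f = rv 33; g = rv 25; i = rv 22; c = rv 24; t = eqe (rv 23) (Times (Const 3) (rv 18));
      p = pose (arr 7 i (Const 0)); P = \<lambda>k. arr k i c; v = \<lambda>k. arr k i (Const 0) in
     Minus (Plus (Plus (Minus (Plus
       (Times (eqe f (Const 0)) (Minus (Times (eqe g (Const 0)) (P 5)) (Times t (v 6))))
       (Times (Minus (eqe f (Const 1)) (eqe f (Const 2)))
         (Plus (Times (eqe g (Const 0)) (Times (rv 19) (P 1))) (Times t (Minus (Times (rv 19) (v 2)) (v 8))))))
       (Times (eqe f (Const 3)) (Times t (v 7))))
       (Times (Minus (eqe f (Const 4)) (Times (eqe f (Const 5)) p))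
         (Minus (Minus (Times (eqe g (Const 1)) (arr 0 c i)) (Times (eqe g (Const 0)) (P 3))) (Times t (v 4)))))
       (Times (Minus (eqe f (Const 6)) (eqe f (Const 7))) (Times p (Times (eqe g (Const 2)) (arr 0 c i)))))
       (Times (eqe f (Const 8)) t))"

definition rhs_exp :: "int \<Rightarrow> exp" where
  "rhs_exp md = (let f = rv 33; i = rv 22; p = pose (arr 7 i (Const 0)) in
     Minus (Times (Const md) (Minus
       (Times (eqe i (rv 20)) (Times p (Minus (eqe f (Const 6)) (eqe f (Const 7)))))
       (Times (eqe f (Const 4)) (Times (Minus (Const 1) p) (pose (Minus (rv 15) i))))))
       (eqe f (Const 8)))"

text \<open>The flag \<open>md\<close> is \<open>0\<close> in the optimistic and \<open>1\<close> in the pessimistic scenario.\<close>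
definition build_prog :: "int \<Rightarrow> prog" where
  "build_prog md = For (reg 21) (Times (Const 10) (rv 18)) (Seq (setr 22 (Div (rv 21) (Const 10)))
     (Seq (setr 33 (Minus (rv 21) (Times (Const 10) (rv 22)))) (Seq (Store (adr 10 (rv 21) (Const 0)) (rhs_exp md))
       (For (reg 23) (Plus (Times (Const 3) (rv 18)) (Const 1)) (Seq (setr 24 (Div (rv 23) (Const 3)))
         (Seq (setr 25 (Minus (rv 23) (Times (Const 3) (rv 24)))) (Store (adr 9 (rv 21) (rv 23)) mat_exp)))))))"

text \<open>There is no early exit: the number of rounds is then known in advance, as the loop rule
  demands, and the answer is set to 1 at the start and afterwards only ever cleared.\<close>

definition query_prog :: "int \<Rightarrow> prog" where
  "query_prog md = Seq (setr 31 (Const 1)) (For (reg 20) (rv 18) (Seq (build_prog md)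
     (Seq (setr 37 (Times (Const 10) (rv 18))) (Seq (setr 38 (Plus (Times (Const 3) (rv 18)) (Const 1)))
       (Seq solve_prog (If (rv 30) Skip (setr 31 (Const 0))))))))"

text \<open>Indices beyond the dimensions are covered as well, since the arrays must hold the zeros
  of the padding there.\<close>

definition data_mem where
  "data_mem P \<Delta> n s \<tau> \<longleftrightarrow> (\<forall>k<8. \<forall>i c. \<tau> (loc (int k) (int i) (int c)) = P k i c) \<and>
     \<tau> (reg 18) = int s \<and> \<tau> (reg 19) = \<Delta> \<and> \<tau> (reg 15) = int n"

definition product_mem where
  "product_mem P s \<tau> \<longleftrightarrow> (\<forall>i<s. \<tau> (loc 8 (int i) 0) = (\<Sum>l<s. P 0 i l * P 7 l 0))"
  for P :: "nat \<Rightarrow> nat \<Rightarrow> nat \<Rightarrow> int"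

lemma data_memD:
  assumes "data_mem P \<Delta> n s \<tau>"
  shows "\<tau> (loc 0 (int i) (int c)) = P 0 i c" "\<tau> (loc 1 (int i) (int c)) = P 1 i c" "\<tau> (loc 2 (int i) 0) = P 2 i 0"
    "\<tau> (loc 3 (int i) (int c)) = P 3 i c" "\<tau> (loc 4 (int i) 0) = P 4 i 0" "\<tau> (loc 5 (int i) (int c)) = P 5 i c"
    "\<tau> (loc 6 (int i) 0) = P 6 i 0" "\<tau> (loc 7 (int i) 0) = P 7 i 0"
    "\<tau> (reg 18) = int s" "\<tau> (reg 19) = \<Delta>" "\<tau> (reg 15) = int n"
proof -
  have *: "\<tau> (loc (int k) (int i) (int c)) = P k i c" if "k < 8" for k i c using assms that by (simp add: data_mem_def)
  show "\<tau> (loc 0 (int i) (int c)) = P 0 i c" "\<tau> (loc 1 (int i) (int c)) = P 1 i c" "\<tau> (loc 2 (int i) 0) = P 2 i 0"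
    "\<tau> (loc 3 (int i) (int c)) = P 3 i c" "\<tau> (loc 4 (int i) 0) = P 4 i 0" "\<tau> (loc 5 (int i) (int c)) = P 5 i c"
    "\<tau> (loc 6 (int i) 0) = P 6 i 0" "\<tau> (loc 7 (int i) 0) = P 7 i 0"
    using *[of 0 i c] *[of 1 i c] *[of 2 i 0] *[of 3 i c] *[of 4 i 0] *[of 5 i c] *[of 6 i 0] *[of 7 i 0] by simp_all
  show "\<tau> (reg 18) = int s" "\<tau> (reg 19) = \<Delta>" "\<tau> (reg 15) = int n" using assms by (simp_all add: data_mem_def)
qed

lemma data_mem_same:
  assumes "same_except K \<sigma> \<tau>" "data_mem P \<Delta> n s \<sigma>" "K \<subseteq> {8..<64} - {15, 18, 19}"
  shows "data_mem P \<Delta> n s \<tau>"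
proof -
  have K: "K \<subseteq> {0..<64}" using assms(3) by auto
  have a: "\<tau> (loc (int k) (int i) (int c)) = \<sigma> (loc (int k) (int i) (int c))" if "k < 8" for k i c
    using assms(3) that K by (intro same_except_loc[OF assms(1)]) auto
  have "\<tau> (reg k) = \<sigma> (reg k)" if "k \<in> {15, 18, 19}" for k
    using assms(3) that K by (intro same_except_loc[OF assms(1)]) auto
  then show ?thesis using assms(2) a by (simp add: data_mem_def)
qed

lemma product_mem_same:
  assumes "same_except K \<sigma> \<tau>" "product_mem P s \<sigma>" "K \<subseteq> {0..<64} - {8}"
  shows "product_mem P s \<tau>"
proof -
  have "\<tau> (loc 8 (int i) 0) = \<sigma> (loc 8 (int i) 0)" for i
    using assms(3) by (intro same_except_loc[OF assms(1)]) auto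
  then show ?thesis using assms(2) by (simp add: product_mem_def)
qed

lemma wp_products:
  assumes dm: "data_mem P \<Delta> n s \<sigma>" and X: "\<And>k i c. \<bar>P k i c\<bar> \<le> X" and b: "int s * (X * X) \<le> 2 ^ b"
    and nn: "s \<le> nn" "nn \<le> 2 ^ b"
  shows "wp b nn products_prog (\<lambda>\<tau>. same_except {8, 21, 22, 25} \<sigma> \<tau> \<and> product_mem P s \<tau>) \<sigma>"
proof -
  define R where "R i m = (\<Sum>l<m. P 0 i l * P 7 l 0)" for i m
  define Inv where "Inv i \<tau> \<longleftrightarrow> same_except {8, 21, 22, 25} \<sigma> \<tau> \<and> (\<forall>i'<i. \<tau> (loc 8 (int i') 0) = R i' s)" for i \<tau>
  have dm': "data_mem P \<Delta> n s \<tau>" if "same_except {8, 21, 22, 25} \<sigma> \<tau>" for \<tau> by (rule data_mem_same[OF that dm]) auto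
  have X0: "X \<ge> 0" using X[of 0 0 0] by simp
  have Rb: "\<bar>R i m\<bar> \<le> 2 ^ b" if "m \<le> s" for i m
  proof -
    have "\<bar>R i m\<bar> \<le> (\<Sum>l<m. X * X)" unfolding R_def
      by (intro order.trans[OF sum_abs] sum_mono) (auto simp: abs_mult X0 intro!: mult_mono X)
    also have "\<dots> \<le> int s * (X * X)" using that X0 by (simp add: mult_right_mono)
    finally show ?thesis using b by linarith
  qed
  show ?thesis unfolding products_prog_def
  proof (rule wp_For[where m = s and Inv = Inv])
    show "Inv 0 (\<sigma>(reg 21 := 0))" by (simp add: Inv_def upd_simps)
    show "exp_val (rv 18) \<tau> = int s" if "Inv i \<tau>" for i \<tau>
      using data_memD(9)[OF dm'[OF that[unfolded Inv_def, THEN conjunct1]]] by simp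
    show "same_except {8, 21, 22, 25} \<sigma> \<tau> \<and> product_mem P s \<tau>" if "Inv s \<tau>" for \<tau>
      using that by (simp add: Inv_def product_mem_def R_def)
    fix i \<tau> assume i: "i < s" and inv: "Inv i \<tau>" and ci: "\<tau> (reg 21) = int i"
    define I2 where "I2 m \<tau> \<longleftrightarrow> Inv i \<tau> \<and> \<tau> (reg 21) = int i \<and> \<tau> (reg 25) = R i m" for m \<tau>
    have "wp b nn (Seq (For (reg 22) (rv 18) (setr 25 (Plus (rv 25) (Times (arr 0 (rv 21) (rv 22)) (arr 7 (rv 22) (Const 0))))))
       (Store (adr 8 (rv 21) (Const 0)) (rv 25))) (\<lambda>\<tau>'. \<tau>' (reg 21) = int i \<and> Inv (Suc i) (\<tau>'(reg 21 := int (Suc i)))) (\<tau>(reg 25 := 0))"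
    proof (rule wp_Seq, rule wp_For[where m = s and Inv = I2])
      show "I2 0 (\<tau>(reg 25 := 0, reg 22 := 0))" using inv ci by (simp add: I2_def Inv_def upd_simps R_def)
      show "exp_val (rv 18) \<rho> = int s" if "I2 m \<rho>" for m \<rho>
        using data_memD(9)[OF dm'] that by (simp add: I2_def Inv_def)
      fix \<rho> assume i2: "I2 s \<rho>"
      then have v: "exp_val (rv 25) \<rho> = R i s" by (simp add: I2_def)
      show "wp b nn (Store (adr 8 (rv 21) (Const 0)) (rv 25)) (\<lambda>\<tau>'. \<tau>' (reg 21) = int i \<and> Inv (Suc i) (\<tau>'(reg 21 := int (Suc i)))) \<rho>"
      proof (rule wp_Store, unfold v)
        show "\<bar>R i s\<bar> \<le> 2 ^ b" by (rule Rb) simp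
        show "(\<rho>(exp_val (adr 8 (rv 21) (Const 0)) \<rho> := R i s)) (reg 21) = int i \<and>
          Inv (Suc i) ((\<rho>(exp_val (adr 8 (rv 21) (Const 0)) \<rho> := R i s))(reg 21 := int (Suc i)))"
          using i2 by (auto simp: I2_def Inv_def upd_simps less_Suc_eq)
      qed
    next
      fix m \<rho> assume m: "m < s" and i2: "I2 m \<rho>" and cm: "\<rho> (reg 22) = int m"
      have s: "same_except {8, 21, 22, 25} \<sigma> \<rho>" using i2 by (simp add: I2_def Inv_def)
      have v: "exp_val (Plus (rv 25) (Times (arr 0 (rv 21) (rv 22)) (arr 7 (rv 22) (Const 0)))) \<rho> = R i (Suc m)"
        using i2 cm by (simp add: I2_def R_def data_memD[OF dm'[OF s]])
      show "wp b nn (setr 25 (Plus (rv 25) (Times (arr 0 (rv 21) (rv 22)) (arr 7 (rv 22) (Const 0)))))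
        (\<lambda>\<tau>'. \<tau>' (reg 22) = int m \<and> I2 (Suc m) (\<tau>'(reg 22 := int (Suc m)))) \<rho>"
      proof (rule wp_Store, unfold v)
        show "\<bar>R i (Suc m)\<bar> \<le> 2 ^ b" using m by (intro Rb) simp
        show "(\<rho>(exp_val (Const (reg 25)) \<rho> := R i (Suc m))) (reg 22) = int m \<and>
          I2 (Suc m) ((\<rho>(exp_val (Const (reg 25)) \<rho> := R i (Suc m)))(reg 22 := int (Suc m)))"
          using i2 cm by (simp add: I2_def Inv_def upd_simps)
      qed
    qed (use nn in simp_all)
    then show "wp b nn (Seq (setr 25 (Const 0)) (Seq
     (For (reg 22) (rv 18) (setr 25 (Plus (rv 25) (Times (arr 0 (rv 21) (rv 22)) (arr 7 (rv 22) (Const 0))))))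
     (Store (adr 8 (rv 21) (Const 0)) (rv 25)))) (\<lambda>\<tau>'. \<tau>' (reg 21) = int i \<and> Inv (Suc i) (\<tau>'(reg 21 := int (Suc i)))) \<tau>"
      by (intro wp_Seq[of b nn "setr 25 (Const 0)"] wp_Store) simp_all
  qed (use nn in simp_all)
qed

section \<open>Sizes of the coefficients and assembly of the systems\<close>

lemma abs_mult_le_snd: "\<bar>a\<bar> \<le> 1 \<Longrightarrow> \<bar>x\<bar> \<le> y \<Longrightarrow> \<bar>a * x\<bar> \<le> (y :: int)"
  using mult_mono[of "\<bar>a\<bar>" 1 "\<bar>x\<bar>" y] by (simp add: abs_mult)

lemma sys_coeff_bound:
  assumes X: "\<And>k i c. \<bar>P k i c\<bar> \<le> X" "\<bar>\<Delta>\<bar> \<le> X" "X \<ge> 1" and t: "\<bar>t\<bar> \<le> 1" and s: "s \<ge> 1"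
  shows "\<bar>sys_coeff P \<Delta> s f g i c t\<bar> \<le> 11 * int s * (X * X)"
proof -
  have e: "\<bar>eqi a b\<bar> \<le> 1" "\<bar>posi y\<bar> \<le> 1" for a b y by (simp_all add: eqi_eq posi_eq)
  have XX: "X \<le> X * X" using X(3) mult_left_mono[of 1 X X] by simp
  have d: "\<bar>\<Delta> * P k i c\<bar> \<le> X * X" for k i c using X by (simp add: abs_mult mult_mono)
  have sm: "\<bar>\<Sum>l<s. P 0 i l * P 7 l 0\<bar> \<le> int s * (X * X)"
  proof -
    have "\<bar>\<Sum>l<s. P 0 i l * P 7 l 0\<bar> \<le> (\<Sum>l<s. X * X)"
      using X by (intro order.trans[OF sum_abs] sum_mono) (auto simp: abs_mult intro!: mult_mono)
    then show ?thesis by simp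
  qed
  have d12: "\<bar>eqi f a - eqi f b\<bar> \<le> 1" "\<bar>eqi f a - eqi f b * posi y\<bar> \<le> 1" if "a \<noteq> b" for a b y
    using that by (simp_all add: eqi_eq posi_eq)
  have X1: "\<bar>eqi g a * P k i' c'\<bar> \<le> X" "\<bar>t * P k i' c'\<bar> \<le> X" "\<bar>eqi g a * (\<Delta> * P k i' c')\<bar> \<le> X * X" for a k i' c'
    by (intro abs_mult_le_snd e t X d)+
  have T1: "\<bar>eqi f 0 * (eqi g 0 * P 5 i c - t * P 6 i 0)\<bar> \<le> 2 * X"
    using X1(1)[of 0 5 i c] X1(2)[of 6 i 0] by (intro abs_mult_le_snd e) linarith
  have "\<bar>t * (\<Delta> * P 2 i 0 - (\<Sum>l<s. P 0 i l * P 7 l 0))\<bar> \<le> X * X + int s * (X * X)"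
    using d[of 2 i 0] sm by (intro abs_mult_le_snd t) linarith
  then have T2: "\<bar>(eqi f 1 - eqi f 2) * (eqi g 0 * (\<Delta> * P 1 i c) + t * (\<Delta> * P 2 i 0 - (\<Sum>l<s. P 0 i l * P 7 l 0)))\<bar>
      \<le> 2 * (X * X) + int s * (X * X)"
    using X1(3)[of 0 1 i c] by (intro abs_mult_le_snd d12) (simp, linarith)
  have T3: "\<bar>eqi f 3 * (t * P 7 i 0)\<bar> \<le> X" by (intro abs_mult_le_snd e X1)
  have T4: "\<bar>(eqi f 4 - eqi f 5 * posi (P 7 i 0)) * (eqi g 1 * P 0 c i - eqi g 0 * P 3 i c - t * P 4 i 0)\<bar> \<le> 3 * X"
    using X1(1)[of 1 0 c i] X1(1)[of 0 3 i c] X1(2)[of 4 i 0] by (intro abs_mult_le_snd d12) (simp, linarith)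
  have T5: "\<bar>(eqi f 6 - eqi f 7) * (posi (P 7 i 0) * (eqi g 2 * P 0 c i))\<bar> \<le> X"
    by (intro abs_mult_le_snd d12 e X1) simp
  have T6: "\<bar>eqi f 8 * t\<bar> \<le> 1" by (intro abs_mult_le_snd e t)
  \<comment> \<open>The six terms add up to at most 10 + s multiples of X^2, hence 11 s.\<close>
  have "1 * (X * X) \<le> int s * (X * X)" using s X(3) by (intro mult_right_mono) auto
  then show ?thesis
    using T1 T2 T3 T4 T5 T6 XX X(3) unfolding sys_coeff_def mult.assoc by linarith
qed

lemma sys_mat_bound:
  assumes "\<And>k i c. \<bar>P k i c\<bar> \<le> X" "\<bar>\<Delta>\<bar> \<le> X" "X \<ge> 1" "s \<ge> 1"
  shows "\<bar>sys_mat P \<Delta> s q c\<bar> \<le> 11 * int s * (X * X)"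
  unfolding sys_mat_def by (rule sys_coeff_bound) (use assms in \<open>auto simp: eqi_eq\<close>)

lemma sys_rhs_bound: "md = 0 \<or> md = 1 \<Longrightarrow> \<bar>sys_rhs P md n j q\<bar> \<le> 3"
  by (auto simp: sys_rhs_def Let_def eqi_eq posi_eq)

lemma wp_build:
  assumes dm: "data_mem P \<Delta> n s \<sigma>" "product_mem P s \<sigma>" "\<sigma> (reg 20) = int j"
    and X: "\<And>k i c. \<bar>P k i c\<bar> \<le> X" "\<bar>\<Delta>\<bar> \<le> X" "X \<ge> 1" and s: "s \<ge> 1" and md: "md = 0 \<or> md = 1"
    and b: "11 * int s * (X * X) \<le> 2 ^ b" and nn: "10 * s \<le> nn" "nn \<le> 2 ^ b"
  shows "wp b nn (build_prog md) (\<lambda>\<tau>. same_except {9, 10, 21, 22, 23, 24, 25, 33} \<sigma> \<tau> \<and>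
    (\<forall>q<10 * s. \<tau> (loc 10 (int q) 0) = sys_rhs P md n j q \<and>
      (\<forall>c<3 * s + 1. \<tau> (loc 9 (int q) (int c)) = sys_mat P \<Delta> s q c))) \<sigma>"
proof -
  define K where "K = {9, 10, 21, 22, 23, 24, 25, 33 :: int}"
  define Inv where "Inv q \<tau> \<longleftrightarrow> same_except K \<sigma> \<tau> \<and> (\<forall>q'<q. \<tau> (loc 10 (int q') 0) = sys_rhs P md n j q' \<and>
      (\<forall>c<3 * s + 1. \<tau> (loc 9 (int q') (int c)) = sys_mat P \<Delta> s q' c))" for q \<tau>
  have dm': "data_mem P \<Delta> n s \<tau>" "product_mem P s \<tau>" "\<tau> (reg 20) = int j" if "same_except K \<sigma> \<tau>" for \<tau>
  proof -
    show "data_mem P \<Delta> n s \<tau>" by (rule data_mem_same[OF that dm(1)]) (auto simp: K_def)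
    show "product_mem P s \<tau>" by (rule product_mem_same[OF that dm(2)]) (auto simp: K_def)
    show "\<tau> (reg 20) = int j" using same_except_loc[OF that, of 20 0 0] dm(3) by (simp add: K_def)
  qed
  have nb: "int m \<le> 2 ^ b" if "m \<le> 10 * s" for m
  proof -
    have "m \<le> 2 ^ b" using that nn by linarith
    then show ?thesis by (metis of_nat_le_iff of_nat_numeral of_nat_power)
  qed
  have mb: "\<bar>sys_mat P \<Delta> s q c\<bar> \<le> 2 ^ b" for q c using sys_mat_bound[where P = P and \<Delta> = \<Delta> and X = X and s = s and q = q and c = c, OF X s] b by linarith
  have b3: "3 \<le> (2 :: int) ^ b"
  proof -
    have "1 * 1 \<le> int s * (X * X)" using s X(3) mult_mono[of 1 X 1 X] by (intro mult_mono) auto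
    then show ?thesis using b unfolding mult.assoc by linarith
  qed
  have rb: "\<bar>sys_rhs P md n j q\<bar> \<le> 2 ^ b" for q using sys_rhs_bound[where P = P and n = n and j = j and q = q, OF md] b3 by linarith
  show ?thesis unfolding build_prog_def K_def[symmetric]
  proof (rule wp_For[where m = "10 * s" and Inv = Inv])
    show "Inv 0 (\<sigma>(reg 21 := 0))" by (simp add: Inv_def upd_simps K_def)
    show "exp_val (Times (Const 10) (rv 18)) \<tau> = int (10 * s)" if "Inv i \<tau>" for i \<tau>
      using data_memD(9)[OF dm'(1)] that by (simp add: Inv_def)
    fix \<tau> assume "Inv (10 * s) \<tau>"
    then show "same_except K \<sigma> \<tau> \<and> (\<forall>q<10 * s. \<tau> (loc 10 (int q) 0) = sys_rhs P md n j q \<and>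
      (\<forall>c<3 * s + 1. \<tau> (loc 9 (int q) (int c)) = sys_mat P \<Delta> s q c))" by (simp add: Inv_def)
  next
    fix q \<tau> assume q: "q < 10 * s" and inv: "Inv q \<tau>" and cq: "\<tau> (reg 21) = int q"
    define i where "i = q div 10"
    define f where "f = int q - 10 * int i"
    have i: "int q div 10 = int i" "i \<le> q" "i < s" using q by (auto simp: i_def)
    have f: "0 \<le> f" "f < 10" unfolding f_def i_def by linarith+
    define \<tau>1 where "\<tau>1 = \<tau>(reg 22 := int i, reg 33 := f)"
    have s1: "same_except K \<sigma> \<tau>1" using inv by (simp add: \<tau>1_def Inv_def upd_simps K_def)
    have r1: "\<tau>1 (reg 21) = int q" "\<tau>1 (reg 22) = int i" "\<tau>1 (reg 33) = f" using cq by (simp_all add: \<tau>1_def upd_simps)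
    have vr: "exp_val (rhs_exp md) \<tau>1 = sys_rhs P md n j q"
      using r1 dm'(3)[OF s1] by (simp add: rhs_exp_def Let_def sys_rhs_def data_memD[OF dm'(1)[OF s1]] i f_def i_def[symmetric])
    define I2 where "I2 m \<tau> \<longleftrightarrow> Inv q \<tau> \<and> \<tau> (reg 21) = int q \<and> \<tau> (reg 22) = int i \<and> \<tau> (reg 33) = f \<and>
      \<tau> (loc 10 (int q) 0) = sys_rhs P md n j q \<and> (\<forall>c<m. \<tau> (loc 9 (int q) (int c)) = sys_mat P \<Delta> s q c)" for m \<tau>
    define \<tau>2 where "\<tau>2 = \<tau>1(loc 10 (int q) 0 := sys_rhs P md n j q)"
    let ?Q = "\<lambda>\<tau>'. \<tau>' (reg 21) = int q \<and> Inv (Suc q) (\<tau>'(reg 21 := int (Suc q)))"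
    have w: "wp b nn (For (reg 23) (Plus (Times (Const 3) (rv 18)) (Const 1)) (Seq (setr 24 (Div (rv 23) (Const 3)))
         (Seq (setr 25 (Minus (rv 23) (Times (Const 3) (rv 24)))) (Store (adr 9 (rv 21) (rv 23)) mat_exp)))) ?Q \<tau>2"
    proof (rule wp_For[where m = "3 * s + 1" and Inv = I2])
      show "I2 0 (\<tau>2(reg 23 := 0))" using inv cq s1 by (auto simp: I2_def Inv_def \<tau>2_def \<tau>1_def upd_simps K_def)
      show "exp_val (Plus (Times (Const 3) (rv 18)) (Const 1)) \<rho> = int (3 * s + 1)" if "I2 m \<rho>" for m \<rho>
        using data_memD(9)[OF dm'(1)] that by (simp add: I2_def Inv_def)
      show "\<rho> (reg 21) = int q \<and> Inv (Suc q) (\<rho>(reg 21 := int (Suc q)))" if "I2 (3 * s + 1) \<rho>" for \<rho>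
        using that by (auto simp: I2_def Inv_def upd_simps K_def less_Suc_eq)
      fix m \<rho> assume m: "m < 3 * s + 1" and i2: "I2 m \<rho>" and cm: "\<rho> (reg 23) = int m"
      define c where "c = m div 3"
      define g where "g = int m - 3 * int c"
      have c: "int m div 3 = int c" "c \<le> m" by (auto simp: c_def)
      have g: "0 \<le> g" "g < 3" unfolding g_def c_def by linarith+
      define \<rho>1 where "\<rho>1 = \<rho>(reg 24 := int c, reg 25 := g)"
      have t1: "same_except K \<sigma> \<rho>1" using i2 by (simp add: \<rho>1_def I2_def Inv_def upd_simps K_def)
      have q1: "\<rho>1 (reg 21) = int q" "\<rho>1 (reg 22) = int i" "\<rho>1 (reg 33) = f" "\<rho>1 (reg 23) = int m"
        "\<rho>1 (reg 24) = int c" "\<rho>1 (reg 25) = g" using i2 cm by (simp_all add: \<rho>1_def I2_def upd_simps)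
      have p8: "\<rho>1 (loc 8 (int i) 0) = (\<Sum>l<s. P 0 i l * P 7 l 0)" using dm'(2)[OF t1] i by (simp add: product_mem_def)
      have vm: "exp_val mat_exp \<rho>1 = sys_mat P \<Delta> s q m"
        using q1 p8 by (simp add: mat_exp_def Let_def sys_mat_def sys_coeff_def data_memD[OF dm'(1)[OF t1]] i c f_def g_def
          i_def[symmetric] c_def[symmetric])
      have w3: "wp b nn (Store (adr 9 (rv 21) (rv 23)) mat_exp) (\<lambda>\<tau>'. \<tau>' (reg 23) = int m \<and> I2 (Suc m) (\<tau>'(reg 23 := int (Suc m)))) \<rho>1"
      proof (rule wp_Store, unfold vm)
        show "\<bar>sys_mat P \<Delta> s q m\<bar> \<le> 2 ^ b" by (rule mb)
        show "(\<rho>1(exp_val (adr 9 (rv 21) (rv 23)) \<rho>1 := sys_mat P \<Delta> s q m)) (reg 23) = int m \<and>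
          I2 (Suc m) ((\<rho>1(exp_val (adr 9 (rv 21) (rv 23)) \<rho>1 := sys_mat P \<Delta> s q m))(reg 23 := int (Suc m)))"
          using i2 cm q1 by (auto simp: I2_def Inv_def \<rho>1_def upd_simps K_def less_Suc_eq)
      qed
      have cb: "int c \<le> 2 ^ b" using c(2) m s by (intro nb) linarith
      have gb: "\<bar>g\<bar> \<le> 2 ^ b" using g b3 by linarith
      show "wp b nn (Seq (setr 24 (Div (rv 23) (Const 3)))
         (Seq (setr 25 (Minus (rv 23) (Times (Const 3) (rv 24)))) (Store (adr 9 (rv 21) (rv 23)) mat_exp)))
         (\<lambda>\<tau>'. \<tau>' (reg 23) = int m \<and> I2 (Suc m) (\<tau>'(reg 23 := int (Suc m)))) \<rho>"
      proof (rule wp_Seq, rule wp_Store)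
        have v: "exp_val (Div (rv 23) (Const 3)) \<rho> = int c" using cm c by simp
        show "\<bar>exp_val (Div (rv 23) (Const 3)) \<rho>\<bar> \<le> 2 ^ b" unfolding v using cb by linarith
        show "wp b nn (Seq (setr 25 (Minus (rv 23) (Times (Const 3) (rv 24)))) (Store (adr 9 (rv 21) (rv 23)) mat_exp))
         (\<lambda>\<tau>'. \<tau>' (reg 23) = int m \<and> I2 (Suc m) (\<tau>'(reg 23 := int (Suc m)))) (\<rho>(exp_val (Const (reg 24)) \<rho> := exp_val (Div (rv 23) (Const 3)) \<rho>))"
          unfolding v
        proof (rule wp_Seq, rule wp_Store)
          have v2: "exp_val (Minus (rv 23) (Times (Const 3) (rv 24))) (\<rho>(exp_val (Const (reg 24)) \<rho> := int c)) = g"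
            using cm by (simp add: g_def upd_simps)
          show "\<bar>exp_val (Minus (rv 23) (Times (Const 3) (rv 24))) (\<rho>(exp_val (Const (reg 24)) \<rho> := int c))\<bar> \<le> 2 ^ b"
            unfolding v2 by (rule gb)
          show "wp b nn (Store (adr 9 (rv 21) (rv 23)) mat_exp) (\<lambda>\<tau>'. \<tau>' (reg 23) = int m \<and> I2 (Suc m) (\<tau>'(reg 23 := int (Suc m))))
            ((\<rho>(exp_val (Const (reg 24)) \<rho> := int c))(exp_val (Const (reg 25)) (\<rho>(exp_val (Const (reg 24)) \<rho> := int c)) :=
              exp_val (Minus (rv 23) (Times (Const 3) (rv 24))) (\<rho>(exp_val (Const (reg 24)) \<rho> := int c))))"
            unfolding v2 using w3 by (simp add: \<rho>1_def)
        qed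
      qed
    qed (use nn s in simp_all)
    have ib: "\<bar>int i\<bar> \<le> 2 ^ b" using nb[of i] i q by simp
    have fb: "\<bar>f\<bar> \<le> 2 ^ b" using f nb[of 10] s by simp
    show "wp b nn (Seq (setr 22 (Div (rv 21) (Const 10)))
     (Seq (setr 33 (Minus (rv 21) (Times (Const 10) (rv 22)))) (Seq (Store (adr 10 (rv 21) (Const 0)) (rhs_exp md))
       (For (reg 23) (Plus (Times (Const 3) (rv 18)) (Const 1)) (Seq (setr 24 (Div (rv 23) (Const 3)))
         (Seq (setr 25 (Minus (rv 23) (Times (Const 3) (rv 24)))) (Store (adr 9 (rv 21) (rv 23)) mat_exp))))))) ?Q \<tau>"
    proof (rule wp_Seq, rule wp_Store)
      have v: "exp_val (Div (rv 21) (Const 10)) \<tau> = int i" using cq i by simp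
      show "\<bar>exp_val (Div (rv 21) (Const 10)) \<tau>\<bar> \<le> 2 ^ b" unfolding v by (rule ib)
      have v2: "exp_val (Minus (rv 21) (Times (Const 10) (rv 22))) (\<tau>(reg 22 := int i)) = f"
        using cq by (simp add: f_def upd_simps)
      have w2: "wp b nn (Seq (Store (adr 10 (rv 21) (Const 0)) (rhs_exp md))
       (For (reg 23) (Plus (Times (Const 3) (rv 18)) (Const 1)) (Seq (setr 24 (Div (rv 23) (Const 3)))
         (Seq (setr 25 (Minus (rv 23) (Times (Const 3) (rv 24)))) (Store (adr 9 (rv 21) (rv 23)) mat_exp))))) ?Q \<tau>1"
        by (rule wp_Seq, rule wp_Store, unfold vr, rule rb) (use w r1 in \<open>simp add: \<tau>2_def\<close>)
      show "wp b nn (Seq (setr 33 (Minus (rv 21) (Times (Const 10) (rv 22)))) (Seq (Store (adr 10 (rv 21) (Const 0)) (rhs_exp md))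
       (For (reg 23) (Plus (Times (Const 3) (rv 18)) (Const 1)) (Seq (setr 24 (Div (rv 23) (Const 3)))
         (Seq (setr 25 (Minus (rv 23) (Times (Const 3) (rv 24)))) (Store (adr 9 (rv 21) (rv 23)) mat_exp)))))) ?Q
         (\<tau>(exp_val (Const (reg 22)) \<tau> := exp_val (Div (rv 21) (Const 10)) \<tau>))"
        unfolding v exp_val.simps(1)
        by (rule wp_Seq, rule wp_Store, unfold v2, rule fb) (use w2 in \<open>simp add: \<tau>1_def\<close>)
    qed
  qed (use nn in simp_all)
qed

definition query_regs :: "int set" where
  "query_regs = {9, 10, 20, 21, 22, 23, 24, 25, 31, 33, 37, 38} \<union> solve_regs"

lemma wp_query:
  assumes dm: "data_mem P \<Delta> n s \<sigma>" "product_mem P s \<sigma>"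
    and X: "\<And>k i c. \<bar>P k i c\<bar> \<le> X" "\<bar>\<Delta>\<bar> \<le> X" "X \<ge> 1" and s: "s \<ge> 1" and md: "md = 0 \<or> md = 1"
    and b: "11 * int s * (X * X) \<le> 2 ^ b" and nn: "4 * (3 * s + 1) + 8 \<le> nn" "nn \<le> 2 ^ b"
    and lim: "\<And>j S. j < s \<Longrightarrow> S = lin_size (10 * s) (3 * s + 1) (sys_mat P \<Delta> s) (sys_rhs P md n j) \<Longrightarrow>
      nat (bitlen S) \<le> nn \<and> pass_count (3 * s + 1) S \<le> nn \<and>
      int (Suc (3 * s + 1)) * int (Suc (3 * s + 1)) * (2 * S ^ (4 * (3 * s + 1) + 8) * S) * cone_bound (10 * s) (3 * s + 1) S \<le> 2 ^ b \<and>
      3 * shrink_prec (Suc (3 * s + 1)) * cone_bound (10 * s) (3 * s + 1) S \<le> 2 ^ b"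
  shows "wp b nn (query_prog md) (\<lambda>\<tau>. \<tau> (reg 31) =
    (if \<forall>j<s. lin_feasible (10 * s) (3 * s + 1) (sys_mat P \<Delta> s) (sys_rhs P md n j) then 1 else 0)) \<sigma>"
proof -
  define LF where "LF j \<longleftrightarrow> lin_feasible (10 * s) (3 * s + 1) (sys_mat P \<Delta> s) (sys_rhs P md n j)" for j
  define Inv where "Inv j \<tau> \<longleftrightarrow> same_except query_regs \<sigma> \<tau> \<and> \<tau> (reg 31) = (if \<forall>j'<j. LF j' then 1 else 0)" for j \<tau>
  have qr: "query_regs \<subseteq> {8..<64} - {15, 18, 19}" "query_regs \<subseteq> {0..<64} - {8}"
    by (auto simp: query_regs_def solve_regs_def solver_regs_def)
  have dm': "data_mem P \<Delta> n s \<tau>" "product_mem P s \<tau>" if "same_except query_regs \<sigma> \<tau>" for \<tau>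
    using data_mem_same[OF that dm(1) qr(1)] product_mem_same[OF that dm(2) qr(2)] by blast+
  \<comment> \<open>Row 9 belongs to family 9 and is identically zero; it yields the positivity of
    the homogenizing coordinate inside the solver.\<close>
  have i9: "9 < 10 * s" using s by simp
  have z1: "sys_mat P \<Delta> s 9 c = 0" for c by (simp add: sys_mat_def sys_coeff_def eqi_eq)
  have z2: "sys_rhs P md n j 9 = 0" for j by (simp add: sys_rhs_def eqi_eq Let_def)
  have sb: "int (10 * s) \<le> 2 ^ b" "int (3 * s + 1) \<le> 2 ^ b"
  proof -
    have "10 * s \<le> 2 ^ b" by (rule order.trans[of _ nn]) (use nn in simp_all)
    moreover have "3 * s + 1 \<le> 2 ^ b" by (rule order.trans[of _ nn]) (use nn in simp_all)
    ultimately show "int (10 * s) \<le> 2 ^ b" "int (3 * s + 1) \<le> 2 ^ b"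
      by (metis of_nat_le_iff of_nat_numeral of_nat_power, metis of_nat_le_iff of_nat_numeral of_nat_power)
  qed
  have w: "wp b nn (For (reg 20) (rv 18) (Seq (build_prog md)
     (Seq (setr 37 (Times (Const 10) (rv 18))) (Seq (setr 38 (Plus (Times (Const 3) (rv 18)) (Const 1)))
       (Seq solve_prog (If (rv 30) Skip (setr 31 (Const 0)))))))) (\<lambda>\<tau>. \<tau> (reg 31) = (if \<forall>j<s. LF j then 1 else 0)) (\<sigma>(reg 31 := 1))"
  proof (rule wp_For[where m = s and Inv = Inv])
    show "Inv 0 (\<sigma>(reg 31 := 1, reg 20 := 0))" by (simp add: Inv_def upd_simps query_regs_def)
    show "exp_val (rv 18) \<tau> = int s" if "Inv j \<tau>" for j \<tau>
      using data_memD(9)[OF dm'(1)] that by (simp add: Inv_def)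
    show "\<tau> (reg 31) = (if \<forall>j<s. LF j then 1 else 0)" if "Inv s \<tau>" for \<tau> using that by (simp add: Inv_def)
    fix j \<tau> assume j: "j < s" and inv: "Inv j \<tau>" and cj: "\<tau> (reg 20) = int j"
    have s0: "same_except query_regs \<sigma> \<tau>" using inv by (simp add: Inv_def)
    have nn10: "10 * s \<le> nn" using nn by simp
    let ?Q = "\<lambda>\<tau>'. \<tau>' (reg 20) = int j \<and> Inv (Suc j) (\<tau>'(reg 20 := int (Suc j)))"
    show "wp b nn (Seq (build_prog md)
     (Seq (setr 37 (Times (Const 10) (rv 18))) (Seq (setr 38 (Plus (Times (Const 3) (rv 18)) (Const 1)))
       (Seq solve_prog (If (rv 30) Skip (setr 31 (Const 0))))))) ?Q \<tau>"
    proof (rule wp_Seq, rule wp_mono[OF wp_build[OF dm'[OF s0] cj X s md b nn10 nn(2)]])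
      fix \<rho> assume r: "same_except {9, 10, 21, 22, 23, 24, 25, 33} \<tau> \<rho> \<and>
        (\<forall>q<10 * s. \<rho> (loc 10 (int q) 0) = sys_rhs P md n j q \<and>
          (\<forall>c<3 * s + 1. \<rho> (loc 9 (int q) (int c)) = sys_mat P \<Delta> s q c))"
      define \<rho>2 where "\<rho>2 = \<rho>(reg 37 := int (10 * s), reg 38 := int (3 * s + 1))"
      have sr: "same_except query_regs \<sigma> \<rho>"
        by (rule same_except_trans[OF s0 r[THEN conjunct1]]) (auto simp: query_regs_def)
      have s18: "\<rho> (reg 18) = int s" using data_memD(9)[OF dm'(1)[OF sr]] .
      have s2: "same_except query_regs \<sigma> \<rho>2" using sr by (simp add: \<rho>2_def upd_simps query_regs_def)
      have r2: "\<rho>2 (reg 20) = int j" "\<rho>2 (reg 31) = (if \<forall>j'<j. LF j' then 1 else 0)"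
        using same_except_loc[OF r[THEN conjunct1], of 20 0 0] same_except_loc[OF r[THEN conjunct1], of 31 0 0] cj inv
        by (simp_all add: \<rho>2_def upd_simps Inv_def)
      have lm: "lin_mem (10 * s) (3 * s + 1) (sys_mat P \<Delta> s) (sys_rhs P md n j) \<rho>2"
        using r by (simp add: lin_mem_def \<rho>2_def upd_simps)
      note l = lim[OF j refl]
      have ws: "wp b nn (Seq solve_prog (If (rv 30) Skip (setr 31 (Const 0)))) ?Q \<rho>2"
      proof (rule wp_Seq, rule wp_mono[OF wp_solve[OF lm _ i9 z1 z2 refl]])
        fix \<tau>' assume t: "same_except solve_regs \<rho>2 \<tau>' \<and>
          \<tau>' (reg 30) = (if lin_feasible (10 * s) (3 * s + 1) (sys_mat P \<Delta> s) (sys_rhs P md n j) then 1 else 0)"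
        have t30: "\<tau>' (reg 30) = (if LF j then 1 else 0)" using t unfolding LF_def by blast
        have t31: "\<tau>' (reg 31) = (if \<forall>j'<j. LF j' then 1 else 0)" "\<tau>' (reg 20) = int j"
          using same_except_loc[OF t[THEN conjunct1], of 31 0 0] same_except_loc[OF t[THEN conjunct1], of 20 0 0] r2
          by (simp_all add: solve_regs_def solver_regs_def)
        have st: "same_except query_regs \<sigma> \<tau>'"
          by (rule same_except_trans[OF s2 t[THEN conjunct1]]) (auto simp: query_regs_def)
        have Inv': "Inv (Suc j) \<upsilon>" if "same_except query_regs \<sigma> \<upsilon>" "\<upsilon> (reg 31) = (if (\<forall>j'<j. LF j') \<and> LF j then 1 else 0)" for \<upsilon>
          using that by (simp add: Inv_def All_less_Suc conj_commute)
        show "wp b nn (If (rv 30) Skip (setr 31 (Const 0))) ?Q \<tau>'"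
        proof (rule wp_If)
          assume "0 < exp_val (rv 30) \<tau>'"
          then have "LF j" using t30 by (simp split: if_splits)
          then show "wp b nn Skip ?Q \<tau>'"
            using st t31 by (intro wp_Skip conjI Inv') (simp_all add: upd_simps query_regs_def)
        next
          assume "\<not> 0 < exp_val (rv 30) \<tau>'"
          then have "\<not> LF j" using t30 by (simp split: if_splits)
          then show "wp b nn (setr 31 (Const 0)) ?Q \<tau>'"
            using st t31 by (intro wp_Store conjI Inv') (simp_all add: upd_simps query_regs_def)
        qed
      qed (use nn l nn10 in simp_all)
      have v: "exp_val (Times (Const 10) (rv 18)) \<rho> = int (10 * s)"
        "exp_val (Plus (Times (Const 3) (rv 18)) (Const 1)) (\<rho>(reg 37 := int (10 * s))) = int (3 * s + 1)"
        using s18 by (simp_all add: upd_simps)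
      show "wp b nn (Seq (setr 37 (Times (Const 10) (rv 18))) (Seq (setr 38 (Plus (Times (Const 3) (rv 18)) (Const 1)))
       (Seq solve_prog (If (rv 30) Skip (setr 31 (Const 0)))))) ?Q \<rho>"
      proof (rule wp_Seq, rule wp_Store, unfold v exp_val.simps(1))
        show "\<bar>int (10 * s)\<bar> \<le> 2 ^ b" using sb(1) by linarith
        show "wp b nn (Seq (setr 38 (Plus (Times (Const 3) (rv 18)) (Const 1))) (Seq solve_prog (If (rv 30) Skip (setr 31 (Const 0))))) ?Q
          (\<rho>(reg 37 := int (10 * s)))"
        proof (rule wp_Seq, rule wp_Store, unfold v exp_val.simps(1))
          show "\<bar>int (3 * s + 1)\<bar> \<le> 2 ^ b" using sb(2) by linarith
          show "wp b nn (Seq solve_prog (If (rv 30) Skip (setr 31 (Const 0)))) ?Q (\<rho>(reg 37 := int (10 * s), reg 38 := int (3 * s + 1)))"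
            using ws unfolding \<rho>2_def .
        qed
      qed
    qed
  qed (use nn in simp_all)
  show ?thesis unfolding query_prog_def LF_def[symmetric]
    by (rule wp_Seq, rule wp_Store, unfold exp_val.simps(1), simp, rule w)
qed

section \<open>Reading and scaling the input\<close>

definition scaled_entry :: "int \<Rightarrow> rat \<Rightarrow> int" where
  "scaled_entry \<Delta> q = fst (quotient_of q) * (\<Delta> div snd (quotient_of q))"

text \<open>The offset 4 skips the dimensions; numerators and denominators alternate.\<close>

definition input_mem :: "rat list \<Rightarrow> memory \<Rightarrow> bool" where
  "input_mem ds \<sigma> \<longleftrightarrow> (\<forall>e<length ds. \<sigma> (4 + 2 * int e) = fst (quotient_of (ds ! e)) \<and> \<sigma> (5 + 2 * int e) = snd (quotient_of (ds ! e)))"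

lemma input_mem_same: "same_except K \<sigma> \<tau> \<Longrightarrow> K \<subseteq> {0..<64} \<Longrightarrow> input_mem ds \<sigma> \<Longrightarrow> input_mem ds \<tau>"
  unfolding input_mem_def using same_except_nonneg[of K \<sigma> \<tau>] by simp

definition block_prog :: "int \<Rightarrow> exp \<Rightarrow> exp \<Rightarrow> prog" where
  "block_prog k R C = For (reg 21) R (For (reg 22) C (Seq
     (Store (adr k (rv 21) (rv 22)) (Times (Mem (Plus (Const 4) (Times (Const 2) (rv 36))))
        (Div (rv 19) (Mem (Plus (Const 5) (Times (Const 2) (rv 36)))))))
     (setr 36 (Plus (rv 36) (Const 1)))))"

text \<open>The array is required to be zero beforehand, so what lies outside the block becomes the
  padding.\<close>

lemma wp_block:
  assumes k: "0 \<le> k" "k < 8" and inp: "input_mem ds \<sigma>" and ptr: "\<sigma> (reg 36) = int p" "p + a * c \<le> length ds"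
    and D: "\<sigma> (reg 19) = \<Delta>" and zero: "\<And>i l. \<sigma> (loc k (int i) (int l)) = 0"
    and R: "\<And>\<tau>. same_except {k, 21, 22, 36} \<sigma> \<tau> \<Longrightarrow> exp_val R \<tau> = int a"
    and C: "\<And>\<tau>. same_except {k, 21, 22, 36} \<sigma> \<tau> \<Longrightarrow> exp_val C \<tau> = int c"
    and X: "\<And>e. e < length ds \<Longrightarrow> \<bar>scaled_entry \<Delta> (ds ! e)\<bar> \<le> 2 ^ b"
    and nn: "a \<le> nn" "c \<le> nn" "length ds \<le> nn" "nn \<le> 2 ^ b"
  shows "wp b nn (block_prog k R C) (\<lambda>\<tau>. same_except {k, 21, 22, 36} \<sigma> \<tau> \<and> \<tau> (reg 36) = int (p + a * c) \<and>
    (\<forall>i l. \<tau> (loc k (int i) (int l)) = (if i < a \<and> l < c then scaled_entry \<Delta> (ds ! (p + i * c + l)) else 0))) \<sigma>"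
proof -
  define E where "E i l = scaled_entry \<Delta> (ds ! (p + i * c + l))" for i l
  define K where "K = {k, 21, 22, 36}"
  have K: "K \<subseteq> {0..<64}" using k by (auto simp: K_def)
  define Inv where "Inv i \<tau> \<longleftrightarrow> same_except K \<sigma> \<tau> \<and> \<tau> (reg 36) = int (p + i * c) \<and>
    (\<forall>i' l. \<tau> (loc k (int i') (int l)) = (if i' < i \<and> l < c then E i' l else 0))" for i \<tau>
  show ?thesis unfolding block_prog_def E_def[symmetric] K_def[symmetric]
  proof (rule wp_For[where m = a and Inv = Inv])
    show "Inv 0 (\<sigma>(reg 21 := 0))" using ptr zero k by (simp add: Inv_def upd_simps K_def)
    show "exp_val R \<tau> = int a" if "Inv i \<tau>" for i \<tau> using R that by (simp add: Inv_def K_def)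
    show "same_except K \<sigma> \<tau> \<and> \<tau> (reg 36) = int (p + a * c) \<and> (\<forall>i l. \<tau> (loc k (int i) (int l)) = (if i < a \<and> l < c then E i l else 0))"
      if "Inv a \<tau>" for \<tau> using that by (simp add: Inv_def)
    fix i \<tau> assume i: "i < a" and inv: "Inv i \<tau>" and ci: "\<tau> (reg 21) = int i"
    define I2 where "I2 q \<tau> \<longleftrightarrow> same_except K \<sigma> \<tau> \<and> \<tau> (reg 21) = int i \<and> \<tau> (reg 36) = int (p + i * c + q) \<and>
      (\<forall>i' l. \<tau> (loc k (int i') (int l)) = (if i' < i \<and> l < c \<or> i' = i \<and> l < q then E i' l else 0))" for q \<tau>
    show "wp b nn (For (reg 22) C (Seq
     (Store (adr k (rv 21) (rv 22)) (Times (Mem (Plus (Const 4) (Times (Const 2) (rv 36))))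
        (Div (rv 19) (Mem (Plus (Const 5) (Times (Const 2) (rv 36)))))))
     (setr 36 (Plus (rv 36) (Const 1))))) (\<lambda>\<tau>'. \<tau>' (reg 21) = int i \<and> Inv (Suc i) (\<tau>'(reg 21 := int (Suc i)))) \<tau>"
    proof (rule wp_For[where m = c and Inv = I2])
      show "I2 0 (\<tau>(reg 22 := 0))" using inv ci k by (simp add: I2_def Inv_def upd_simps K_def)
      show "exp_val C \<rho> = int c" if "I2 q \<rho>" for q \<rho> using C that by (simp add: I2_def K_def)
      show "\<rho> (reg 21) = int i \<and> Inv (Suc i) (\<rho>(reg 21 := int (Suc i)))" if "I2 c \<rho>" for \<rho>
        using that k by (auto simp: I2_def Inv_def upd_simps K_def less_Suc_eq add.commute add.left_commute)
      fix q \<rho> assume q: "q < c" and i2: "I2 q \<rho>" and cq: "\<rho> (reg 22) = int q"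
      have "Suc i * c \<le> a * c" using i by (intro mult_right_mono) auto
      then have e: "p + i * c + q < length ds" using q ptr(2) by simp
      have s: "same_except K \<sigma> \<rho>" using i2 by (simp add: I2_def)
      have im: "input_mem ds \<rho>" by (rule input_mem_same[OF s K inp])
      have D': "\<rho> (reg 19) = \<Delta>" using same_except_loc[OF s, of 19 0 0] K D k by (auto simp: K_def)
      have pt: "\<rho> (reg 36) = int (p + i * c + q)" "\<rho> (reg 21) = int i" using i2 by (simp_all add: I2_def)
      have v: "exp_val (Times (Mem (Plus (Const 4) (Times (Const 2) (rv 36))))
        (Div (rv 19) (Mem (Plus (Const 5) (Times (Const 2) (rv 36)))))) \<rho> = E i q"
        using im[unfolded input_mem_def, rule_format, OF e]
        by (simp only: exp_val.simps pt(1) D' E_def scaled_entry_def)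
      define \<rho>1 where "\<rho>1 = \<rho>(loc k (int i) (int q) := E i q)"
      have v1: "exp_val (Plus (rv 36) (Const 1)) \<rho>1 = int (Suc (p + i * c + q))"
        using pt k by (simp add: \<rho>1_def upd_simps)
      have pb: "int (Suc (p + i * c + q)) \<le> 2 ^ b"
      proof -
        have "Suc (p + i * c + q) \<le> 2 ^ b" using e nn by linarith
        then show ?thesis by (metis of_nat_le_iff of_nat_numeral of_nat_power)
      qed
      let ?Q = "\<lambda>\<tau>'. \<tau>' (reg 22) = int q \<and> I2 (Suc q) (\<tau>'(reg 22 := int (Suc q)))"
      have w: "wp b nn (setr 36 (Plus (rv 36) (Const 1))) ?Q \<rho>1"
      proof (rule wp_Store, unfold v1)
        show "\<bar>int (Suc (p + i * c + q))\<bar> \<le> 2 ^ b" using pb by linarith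
        show "(\<rho>1(exp_val (Const (reg 36)) \<rho>1 := int (Suc (p + i * c + q)))) (reg 22) = int q \<and>
          I2 (Suc q) ((\<rho>1(exp_val (Const (reg 36)) \<rho>1 := int (Suc (p + i * c + q))))(reg 22 := int (Suc q)))"
          using i2 cq k by (auto simp: I2_def \<rho>1_def upd_simps K_def less_Suc_eq)
      qed
      have ad: "exp_val (adr k (rv 21) (rv 22)) \<rho> = loc k (int i) (int q)" using pt cq by simp
      show "wp b nn (Seq (Store (adr k (rv 21) (rv 22)) (Times (Mem (Plus (Const 4) (Times (Const 2) (rv 36))))
        (Div (rv 19) (Mem (Plus (Const 5) (Times (Const 2) (rv 36))))))) (setr 36 (Plus (rv 36) (Const 1)))) ?Q \<rho>"
      proof (rule wp_Seq, rule wp_Store, unfold v ad)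
        show "\<bar>E i q\<bar> \<le> 2 ^ b" unfolding E_def by (rule X[OF e])
        show "wp b nn (setr 36 (Plus (rv 36) (Const 1))) ?Q (\<rho>(loc k (int i) (int q) := E i q))" using w unfolding \<rho>1_def .
      qed
    qed (use nn in simp_all)
  qed (use nn in simp_all)
qed

fun blocks_prog :: "(int \<times> exp \<times> exp) list \<Rightarrow> prog" where
  "blocks_prog [] = Skip"
| "blocks_prog ((k, R, C) # bs) = Seq (block_prog k R C) (blocks_prog bs)"

fun blocks_size :: "(exp \<Rightarrow> nat) \<Rightarrow> (int \<times> exp \<times> exp) list \<Rightarrow> nat" where
  "blocks_size v [] = 0"
| "blocks_size v ((k, R, C) # bs) = v R * v C + blocks_size v bs"

text \<open>\<open>v\<close> gives the values of the dimension expressions independently of any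
  memory, and \<open>p\<close> is the position of the first datum of the current block.\<close>

fun blocks_entry :: "(exp \<Rightarrow> nat) \<Rightarrow> (int \<times> exp \<times> exp) list \<Rightarrow> nat \<Rightarrow> (nat \<Rightarrow> int) \<Rightarrow> int \<Rightarrow> nat \<Rightarrow> nat \<Rightarrow> int" where
  "blocks_entry v [] p E k i l = 0"
| "blocks_entry v ((k', R, C) # bs) p E k i l = (if k = k' then (if i < v R \<and> l < v C then E (p + i * v C + l) else 0)
     else blocks_entry v bs (p + v R * v C) E k i l)"

text \<open>The dimension expressions must keep their values while any of the arrays 0 to 7 is being
  written, hence the generous frame in the assumption on \<open>v\<close>.\<close>

lemma wp_blocks:
  assumes "distinct (map fst bs)" "set (map fst bs) \<subseteq> {0..<8}" "input_mem ds \<sigma>" "\<sigma> (reg 36) = int p"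
    "p + blocks_size v bs \<le> length ds" "\<sigma> (reg 19) = \<Delta>"
    and zero: "\<And>k i l. k \<in> set (map fst bs) \<Longrightarrow> \<sigma> (loc k (int i) (int l)) = 0"
    and v: "\<And>k R C \<tau>. (k, R, C) \<in> set bs \<Longrightarrow> same_except ({0..<8} \<union> {21, 22, 36}) \<sigma> \<tau> \<Longrightarrow>
      exp_val R \<tau> = int (v R) \<and> exp_val C \<tau> = int (v C)"
    and X: "\<And>e. e < length ds \<Longrightarrow> \<bar>scaled_entry \<Delta> (ds ! e)\<bar> \<le> 2 ^ b"
    and vn: "\<And>k R C. (k, R, C) \<in> set bs \<Longrightarrow> v R \<le> nn \<and> v C \<le> nn" and nn: "length ds \<le> nn" "nn \<le> 2 ^ b"
  shows "wp b nn (blocks_prog bs) (\<lambda>\<tau>. same_except (set (map fst bs) \<union> {21, 22, 36}) \<sigma> \<tau> \<and>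
    (\<forall>k\<in>set (map fst bs). \<forall>i l. \<tau> (loc k (int i) (int l)) = blocks_entry v bs p (\<lambda>e. scaled_entry \<Delta> (ds ! e)) k i l)) \<sigma>"
  using assms(1-8) vn
proof (induction bs arbitrary: \<sigma> p)
  case Nil
  then show ?case by (auto intro: wp_Skip)
next
  case (Cons x bs)
  obtain k R C where x: "x = (k, R, C)" by (cases x) auto
  note prems = Cons.prems[unfolded x]
  have k: "0 \<le> k" "k < 8" using prems(2) by auto
  have kbs: "k \<notin> set (map fst bs)" using prems(1) by auto
  have widen: "same_except ({0..<8} \<union> {21, 22, 36}) \<sigma> \<tau>" if "same_except {k, 21, 22, 36} \<sigma> \<tau>" for \<tau>
    by (rule same_except_trans[OF that same_except_refl[of "{}"]]) (use k in auto)
  have RC: "exp_val R \<tau> = int (v R)" "exp_val C \<tau> = int (v C)" if "same_except {k, 21, 22, 36} \<sigma> \<tau>" for \<tau>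
    using prems(8)[of k R C \<tau>] widen[OF that] by simp_all
  have zk: "\<sigma> (loc k (int i) (int l)) = 0" for i l using prems(7)[of k i l] by simp
  have pl: "p + v R * v C \<le> length ds" using prems(5) by simp
  have vnk: "v R \<le> nn" "v C \<le> nn" using prems(9)[of k R C] by simp_all
  have "wp b nn (Seq (block_prog k R C) (blocks_prog bs)) (\<lambda>\<tau>. same_except (set (map fst (x # bs)) \<union> {21, 22, 36}) \<sigma> \<tau> \<and>
    (\<forall>k\<in>set (map fst (x # bs)). \<forall>i l. \<tau> (loc k (int i) (int l)) = blocks_entry v (x # bs) p (\<lambda>e. scaled_entry \<Delta> (ds ! e)) k i l)) \<sigma>"
  proof (rule wp_Seq, rule wp_mono[OF wp_block[OF k prems(3,4) pl prems(6) zk RC X vnk nn]], assumption, assumption, assumption)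
    fix \<rho> assume r: "same_except {k, 21, 22, 36} \<sigma> \<rho> \<and> \<rho> (reg 36) = int (p + v R * v C) \<and>
      (\<forall>i l. \<rho> (loc k (int i) (int l)) = (if i < v R \<and> l < v C then scaled_entry \<Delta> (ds ! (p + i * v C + l)) else 0))"
    note s = r[THEN conjunct1]
    have K: "{k, 21, 22, 36} \<subseteq> {0..<64}" using k by auto
    have IH: "wp b nn (blocks_prog bs) (\<lambda>\<tau>. same_except (set (map fst bs) \<union> {21, 22, 36}) \<rho> \<tau> \<and>
      (\<forall>k\<in>set (map fst bs). \<forall>i l. \<tau> (loc k (int i) (int l)) =
        blocks_entry v bs (p + v R * v C) (\<lambda>e. scaled_entry \<Delta> (ds ! e)) k i l)) \<rho>"
    proof (rule Cons.IH)
      show "distinct (map fst bs)" "set (map fst bs) \<subseteq> {0..<8}" "p + v R * v C + blocks_size v bs \<le> length ds"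
        using prems(1,2,5) by auto
      show "input_mem ds \<rho>" by (rule input_mem_same[OF s K prems(3)])
      show "\<rho> (reg 36) = int (p + v R * v C)" using r by blast
      show "\<rho> (reg 19) = \<Delta>" using same_except_loc[OF s _ K, of 19 0 0] k prems(6) by auto
      fix k' i l assume k': "k' \<in> set (map fst bs)"
      then have "0 \<le> k'" "k' < 8" "k' \<noteq> k" using prems(2) kbs by auto
      moreover have "\<sigma> (loc k' (int i) (int l)) = 0" using prems(7)[of k' i l] k' by simp
      ultimately show "\<rho> (loc k' (int i) (int l)) = 0"
        using same_except_loc[OF s _ K, of k' "int i" "int l"] by auto
    next
      fix k' R' C' \<tau> assume m: "(k', R', C') \<in> set bs" and t: "same_except ({0..<8} \<union> {21, 22, 36}) \<rho> \<tau>"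
      have "same_except ({0..<8} \<union> {21, 22, 36}) \<sigma> \<tau>" by (rule same_except_trans[OF s t]) (use k in auto)
      then show "exp_val R' \<tau> = int (v R') \<and> exp_val C' \<tau> = int (v C')" using prems(8)[of k' R' C' \<tau>] m by simp
    next
      fix k' R' C' assume "(k', R', C') \<in> set bs"
      then show "v R' \<le> nn \<and> v C' \<le> nn" using prems(9)[of k' R' C'] by simp
    qed
    show "wp b nn (blocks_prog bs) (\<lambda>\<tau>. same_except (set (map fst (x # bs)) \<union> {21, 22, 36}) \<sigma> \<tau> \<and>
      (\<forall>k\<in>set (map fst (x # bs)). \<forall>i l. \<tau> (loc k (int i) (int l)) = blocks_entry v (x # bs) p (\<lambda>e. scaled_entry \<Delta> (ds ! e)) k i l)) \<rho>"
    proof (rule wp_mono[OF IH], intro conjI ballI allI)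
      fix \<tau> assume t: "same_except (set (map fst bs) \<union> {21, 22, 36}) \<rho> \<tau> \<and>
        (\<forall>k\<in>set (map fst bs). \<forall>i l. \<tau> (loc k (int i) (int l)) =
        blocks_entry v bs (p + v R * v C) (\<lambda>e. scaled_entry \<Delta> (ds ! e)) k i l)"
      show "same_except (set (map fst (x # bs)) \<union> {21, 22, 36}) \<sigma> \<tau>"
        by (rule same_except_trans[OF s t[THEN conjunct1]]) (auto simp: x)
      have K2: "set (map fst bs) \<union> {21, 22, 36} \<subseteq> {0..<64}" using prems(2) by auto
      have "k \<notin> set (map fst bs) \<union> {21, 22, 36}" using kbs k by auto
      then have tk: "\<tau> (loc k (int i) (int l)) = \<rho> (loc k (int i) (int l))" for i l
        using same_except_loc[OF t[THEN conjunct1] _ K2, of k "int i" "int l"] k by simp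
      fix k' i l assume "k' \<in> set (map fst (x # bs))"
      then consider "k' = k" | "k' \<noteq> k" "k' \<in> set (map fst bs)" by (auto simp: x)
      then show "\<tau> (loc k' (int i) (int l)) = blocks_entry v (x # bs) p (\<lambda>e. scaled_entry \<Delta> (ds ! e)) k' i l"
        using tk r t by cases (auto simp: x)
    qed
  qed
  then show ?case by (simp only: x blocks_prog.simps)
qed

section \<open>Resource bounds\<close>

lemma lin_size_le:
  assumes F: "\<And>i c. \<bar>F i c\<bar> \<le> M" and h: "\<And>i. \<bar>h i\<bar> \<le> M"
  shows "lin_size r n F h \<le> int r + int n + 2 + int r * ((int n + 1) * (M * M))"
proof -
  have M: "M \<ge> 0" using h[of 0] by linarith
  have sq: "x * x \<le> M * M" if "\<bar>x\<bar> \<le> M" for x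
    using mult_mono[OF that that] M by simp
  have "(\<Sum>c<n. F i c * F i c) + h i * h i \<le> (int n + 1) * (M * M)" for i
  proof -
    have "(\<Sum>c<n. F i c * F i c) \<le> of_nat (card {..<n}) * (M * M)"
      by (intro sum_bounded_above sq F)
    moreover have "(int n + 1) * (M * M) = int n * (M * M) + M * M" by (simp add: algebra_simps)
    ultimately show ?thesis using sq[OF h[of i]] by simp
  qed
  then have "(\<Sum>i<r. (\<Sum>c<n. F i c * F i c) + h i * h i) \<le> of_nat (card {..<r}) * ((int n + 1) * (M * M))"
    by (intro sum_bounded_above)
  then show ?thesis unfolding lin_size_def by simp
qed

text \<open>
  Serves both as a bound on loop iterations and on bit lengths, where \<open>u\<close> bounds the size of the
  systems and the bit lengths of the scaled data.
\<close>
definition resource_bound :: "nat \<Rightarrow> nat" where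
  "resource_bound u = 2000000000 * u ^ 7"

context
  fixes s u b :: nat and F :: "nat \<Rightarrow> nat \<Rightarrow> int" and h :: "nat \<Rightarrow> int" and S :: int
  assumes s: "1 \<le> s" "s \<le> u"
    and F: "\<And>i c. \<bar>F i c\<bar> \<le> 11 * int s * (2 ^ u * 2 ^ u)" and h: "\<And>i. \<bar>h i\<bar> \<le> 3"
  defines "b \<equiv> resource_bound u" and "S \<equiv> lin_size (10 * s) (3 * s + 1) F h"
begin

lemma u_power_le: "1 \<le> k \<Longrightarrow> k \<le> 7 \<Longrightarrow> u ^ k \<le> u ^ 7" "u \<le> u ^ 7" "1 \<le> u ^ 7"
  using s power_increasing[of k 7 u] power_increasing[of 1 7 u] by simp_all

lemma two_power_le_b: "k \<le> b \<Longrightarrow> (2 :: int) ^ k \<le> 2 ^ b"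
  by (intro power_increasing) auto

lemma s_le_two_power: "int s \<le> 2 ^ u"
proof -
  have "s \<le> 2 ^ u" using s(2) less_exp[of u] by linarith
  then show ?thesis by (metis of_nat_le_iff of_nat_numeral of_nat_power)
qed

lemma coeff_le: "11 * int s * (2 ^ u * 2 ^ u) \<le> 2 ^ (3 * u + 4)" "11 * int s * (2 ^ u * 2 ^ u) \<le> 2 ^ b"
proof -
  have "11 * int s \<le> 16 * 2 ^ u" using s_le_two_power by (intro mult_mono) auto
  then have "11 * int s * (2 ^ u * 2 ^ u) \<le> (16 * 2 ^ u) * (2 ^ u * 2 ^ u)" by (intro mult_right_mono) auto
  also have "\<dots> = 2 ^ (4 + (u + (u + u)))" unfolding power_add by simp
  also have "4 + (u + (u + u)) = 3 * u + 4" by simp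
  finally show *: "11 * int s * (2 ^ u * 2 ^ u) \<le> 2 ^ (3 * u + 4)" .
  also have "\<dots> \<le> 2 ^ b" using u_power_le(2,3) s by (intro two_power_le_b) (simp add: b_def resource_bound_def)
  finally show "11 * int s * (2 ^ u * 2 ^ u) \<le> 2 ^ b" .
qed

text \<open>With G the square of the coefficient bound, the size is at most 66 s^2 G: 16 from the
  linear terms and 50 from the sum of squares. That is at most 2^(8u+15), and 8 u + 15 <= 23 u as u
  >= 1.\<close>

lemma S_bounds: "1 \<le> S" "S \<le> 2 ^ (23 * u)" "nat (bitlen S) \<le> 24 * u"
proof -
  define M :: int where "M = 2 ^ (3 * u + 4)"
  define G where "G = M * M"
  have M3: "3 \<le> M" using power_increasing[of 4 "3 * u + 4" "2 :: int"] by (simp add: M_def)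
  have G1: "1 \<le> G" using mult_mono[of 1 M 1 M] M3 by (simp add: G_def)
  have "S \<le> int (10 * s) + int (3 * s + 1) + 2 + int (10 * s) * ((int (3 * s + 1) + 1) * G)"
    unfolding S_def G_def using F coeff_le(1) h M3
    by (intro lin_size_le) (auto simp: M_def intro: order.trans)
  also have "\<dots> = 13 * int s + 3 + (30 * (int s * int s) + 20 * int s) * G" by (simp add: algebra_simps)
  also have "\<dots> \<le> 66 * (int s * int s) * G"
  proof -
    have ss: "int s \<le> int s * int s" "1 \<le> int s * int s"
      using s(1) mult_mono[of 1 "int s" "int s" "int s"] mult_mono[of 1 "int s" 1 "int s"] by simp_all
    have "13 * int s + 3 \<le> 16 * (int s * int s) * 1" using ss by linarith
    also have "\<dots> \<le> 16 * (int s * int s) * G" using G1 by (intro mult_left_mono) auto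
    finally have a: "13 * int s + 3 \<le> 16 * (int s * int s) * G" .
    have "(30 * (int s * int s) + 20 * int s) * G \<le> (50 * (int s * int s)) * G"
      using ss G1 by (intro mult_right_mono) auto
    with a show ?thesis by (simp add: algebra_simps)
  qed
  also have "\<dots> \<le> (128 * (2 ^ u * 2 ^ u)) * G"
    using s_le_two_power G1 by (intro mult_right_mono mult_mono) auto
  also have "\<dots> = 2 ^ (8 * u + 15)"
  proof -
    have "(128 * (2 ^ u * 2 ^ u)) * G = 2 ^ (7 + (u + u) + ((3 * u + 4) + (3 * u + 4)))"
      unfolding G_def M_def power_add by simp
    also have "7 + (u + u) + ((3 * u + 4) + (3 * u + 4)) = 8 * u + 15" by simp
    finally show ?thesis .
  qed
  also have "\<dots> \<le> 2 ^ (23 * u)" using s by (intro power_increasing) auto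
  finally show S: "S \<le> 2 ^ (23 * u)" .
  have "0 \<le> (\<Sum>i<10 * s. (\<Sum>c<3 * s + 1. F i c * F i c) + h i * h i)" by (intro sum_nonneg add_nonneg_nonneg) simp_all
  then show S1: "1 \<le> S" unfolding S_def lin_size_def by linarith
  have "S < 2 ^ (23 * u + 1)" by (rule le_less_trans[OF S]) simp
  then have "bitlen S \<le> int (23 * u + 1)" using S1 bitlen_le_iff_power[of S "int (23 * u + 1)"] by (simp add: nat_add_distrib nat_mult_distrib)
  then show "nat (bitlen S) \<le> 24 * u" using s by simp
qed

text \<open>3 s + 2 <= 5 u, and 640 times 5^4 times 24 is 9600000.\<close>

lemma pass_count_le: "pass_count (3 * s + 1) S \<le> 9600000 * u ^ 5"
proof -
  have "Suc (3 * s + 1) ^ 4 \<le> (5 * u) ^ 4" using s by (intro power_mono) auto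
  then have "640 * Suc (3 * s + 1) ^ 4 * nat (bitlen S) \<le> 640 * (5 * u) ^ 4 * (24 * u)"
    using S_bounds(3) by (intro mult_mono) auto
  also have "\<dots> = 9600000 * u ^ 5" using power_Suc2[of u 4] by (simp add: power_mult_distrib)
  finally show ?thesis unfolding pass_count_def .
qed

text \<open>96 times 5^3 is 12000, which is below 2^14.\<close>

lemma prec_le: "0 \<le> 3 * shrink_prec (Suc (3 * s + 1))" "3 * shrink_prec (Suc (3 * s + 1)) \<le> 2 ^ (17 * u)"
proof -
  have "int (Suc (3 * s + 1)) = 3 * int s + 2" by simp
  then have "int (Suc (3 * s + 1)) \<le> 5 * 2 ^ u" using s_le_two_power s(1) by linarith
  then have "int (Suc (3 * s + 1)) ^ 3 \<le> (5 * 2 ^ u) ^ 3" by (intro power_mono) auto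
  then have "3 * shrink_prec (Suc (3 * s + 1)) \<le> 96 * (5 * 2 ^ u) ^ 3" unfolding shrink_prec_def by linarith
  also have "\<dots> = 12000 * 2 ^ (u * 3)" by (simp add: power_mult_distrib power_mult)
  also have "\<dots> \<le> 2 ^ 14 * 2 ^ (u * 3)" by (intro mult_right_mono) auto
  also have "\<dots> = 2 ^ (14 + u * 3)" by (simp only: power_add)
  also have "\<dots> \<le> 2 ^ (17 * u)" using s by (intro power_increasing) auto
  finally show "3 * shrink_prec (Suc (3 * s + 1)) \<le> 2 ^ (17 * u)" .
  show "0 \<le> 3 * shrink_prec (Suc (3 * s + 1))" by (simp add: shrink_prec_def)
qed

lemma S_power_le: "S ^ (4 * (3 * s + 1) + 8) \<le> 2 ^ (552 * u ^ 2)" "1 \<le> S ^ (4 * (3 * s + 1) + 8)"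
proof -
  have "S ^ (4 * (3 * s + 1) + 8) \<le> (2 ^ (23 * u)) ^ (4 * (3 * s + 1) + 8)"
    using S_bounds by (intro power_mono) auto
  also have "\<dots> \<le> (2 ^ (23 * u)) ^ (24 * u)" using s by (intro power_increasing) auto
  also have "\<dots> = 2 ^ (552 * u ^ 2)" by (simp add: power_mult[symmetric] power2_eq_square)
  finally show "S ^ (4 * (3 * s + 1) + 8) \<le> 2 ^ (552 * u ^ 2)" .
  show "1 \<le> S ^ (4 * (3 * s + 1) + 8)" using S_bounds(1) by (rule one_le_power)
qed

text \<open>The dominant quantity and the source of the exponent 7: at most 9600000 u^5 passes of at
  most 10 u row steps, each of which adds at most 17 u bits to the entries of the cone. The constant
  of \<open>resource_bound\<close> exceeds the present one by a margin for the lower-order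
  contributions.\<close>

lemma cone_bound_le: "0 \<le> cone_bound (10 * s) (3 * s + 1) S" "cone_bound (10 * s) (3 * s + 1) S \<le> 2 ^ (1632000552 * u ^ 7)"
proof -
  have e: "pass_count (3 * s + 1) S * (10 * s) \<le> 96000000 * u ^ 6"
  proof -
    have "pass_count (3 * s + 1) S * (10 * s) \<le> (9600000 * u ^ 5) * (10 * u)"
      using pass_count_le s by (intro mult_mono) auto
    then show ?thesis using power_Suc2[of u 5] by simp
  qed
  have "(3 * shrink_prec (Suc (3 * s + 1))) ^ (pass_count (3 * s + 1) S * (10 * s)) \<le>
      (2 ^ (17 * u)) ^ (pass_count (3 * s + 1) S * (10 * s))" using prec_le by (intro power_mono)
  also have "\<dots> \<le> (2 ^ (17 * u)) ^ (96000000 * u ^ 6)" using e by (intro power_increasing) auto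
  also have "\<dots> = 2 ^ (1632000000 * u ^ 7)"
  proof -
    have "17 * u * (96000000 * u ^ 6) = 1632000000 * u ^ 7" using power_Suc[of u 6] by simp
    then show ?thesis by (simp only: power_mult[symmetric])
  qed
  finally have "cone_bound (10 * s) (3 * s + 1) S \<le> 2 ^ (552 * u ^ 2) * 2 ^ (1632000000 * u ^ 7)"
    unfolding cone_bound_def using S_power_le prec_le(1) by (intro mult_mono) auto
  also have "\<dots> = 2 ^ (552 * u ^ 2 + 1632000000 * u ^ 7)" by (simp only: power_add)
  also have "\<dots> \<le> 2 ^ (1632000552 * u ^ 7)" using u_power_le(1)[of 2] by (intro power_increasing) auto
  finally show "cone_bound (10 * s) (3 * s + 1) S \<le> 2 ^ (1632000552 * u ^ 7)" .
  show "0 \<le> cone_bound (10 * s) (3 * s + 1) S" unfolding cone_bound_def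
    using S_bounds(1) prec_le(1) by (intro mult_nonneg_nonneg zero_le_power) auto
qed

lemma solver_resources:
  "nat (bitlen S) \<le> b \<and> pass_count (3 * s + 1) S \<le> b \<and>
    int (Suc (3 * s + 1)) * int (Suc (3 * s + 1)) * (2 * S ^ (4 * (3 * s + 1) + 8) * S) * cone_bound (10 * s) (3 * s + 1) S \<le> 2 ^ b \<and>
    3 * shrink_prec (Suc (3 * s + 1)) * cone_bound (10 * s) (3 * s + 1) S \<le> 2 ^ b"
proof (intro conjI)
  note u7 = u_power_le(1)[of 2] u_power_le(1)[of 5] u_power_le(2,3)
  show "nat (bitlen S) \<le> b" unfolding b_def resource_bound_def using S_bounds(3) u7 by linarith
  show "pass_count (3 * s + 1) S \<le> b" unfolding b_def resource_bound_def using pass_count_le u7 by linarith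
  define N where "N = int (Suc (3 * s + 1))"
  define W where "W = S ^ (4 * (3 * s + 1) + 8)"
  define Q where "Q = cone_bound (10 * s) (3 * s + 1) S"
  have N3: "N = 3 * int s + 2" by (simp add: N_def)
  then have N0: "0 \<le> N" by simp
  have "N \<le> 8 * 2 ^ u" using N3 s_le_two_power s(1) by linarith
  then have N: "0 \<le> N" "N \<le> 2 ^ (3 + u)" using N0 by (simp_all add: power_add)
  have "N * N * (2 * W * S) * Q \<le> 2 ^ (3 + u) * 2 ^ (3 + u) * (2 ^ 1 * 2 ^ (552 * u ^ 2) * 2 ^ (23 * u)) * 2 ^ (1632000552 * u ^ 7)"
    using N S_bounds S_power_le cone_bound_le unfolding W_def[symmetric] Q_def[symmetric]
    by (intro mult_mono mult_nonneg_nonneg) auto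
  also have "\<dots> = 2 ^ (3 + u + (3 + u) + (1 + 552 * u ^ 2 + 23 * u) + 1632000552 * u ^ 7)" by (simp only: power_add)
  also have "\<dots> \<le> 2 ^ b" using u7 by (intro two_power_le_b) (unfold b_def resource_bound_def, simp)
  finally show "int (Suc (3 * s + 1)) * int (Suc (3 * s + 1)) * (2 * S ^ (4 * (3 * s + 1) + 8) * S) * cone_bound (10 * s) (3 * s + 1) S \<le> 2 ^ b"
    unfolding N_def W_def Q_def .
  have "3 * shrink_prec (Suc (3 * s + 1)) * Q \<le> 2 ^ (17 * u) * 2 ^ (1632000552 * u ^ 7)"
    using prec_le cone_bound_le unfolding Q_def[symmetric] by (intro mult_mono) auto
  also have "\<dots> = 2 ^ (17 * u + 1632000552 * u ^ 7)" by (simp only: power_add)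
  also have "\<dots> \<le> 2 ^ b" using u7 by (intro two_power_le_b) (unfold b_def resource_bound_def, simp)
  finally show "3 * shrink_prec (Suc (3 * s + 1)) * cone_bound (10 * s) (3 * s + 1) S \<le> 2 ^ b" unfolding Q_def .
qed

lemma size_resources: "4 * (3 * s + 1) + 8 \<le> b" "u \<le> b" "b \<le> 2 ^ b" "(2 :: int) ^ u \<le> 2 ^ b"
proof -
  have "4 * (3 * s + 1) + 8 \<le> 24 * u" using s by simp
  also have "\<dots> \<le> 2000000000 * u ^ 7" using u_power_le(2) by (intro mult_mono) auto
  finally show "4 * (3 * s + 1) + 8 \<le> b" unfolding b_def resource_bound_def .
  show "u \<le> b" unfolding b_def resource_bound_def using u_power_le(2) by linarith
  then show "(2 :: int) ^ u \<le> 2 ^ b" by (intro power_increasing) auto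
  show "b \<le> 2 ^ b" using less_exp[of b] by simp
qed

end

section \<open>The decision program\<close>

text \<open>The order is that of the input encoding; vectors are matrices with one column.\<close>

definition silfp_blocks :: "(int \<times> exp \<times> exp) list" where
  "silfp_blocks = [(0, rv 14, rv 15), (1, rv 14, rv 16), (2, rv 14, Const 1), (3, rv 15, rv 16), (4, rv 15, Const 1),
     (5, rv 17, rv 16), (6, rv 17, Const 1), (7, rv 15, Const 1)]"

definition dim_val :: "nat \<Rightarrow> nat \<Rightarrow> nat \<Rightarrow> nat \<Rightarrow> exp \<Rightarrow> nat" where
  "dim_val m n k g e = nat (exp_val e ((\<lambda>_. 0)(reg 14 := int m, reg 15 := int n, reg 16 := int k, reg 17 := int g)))"

lemma dim_val_simps [simp]:
  "dim_val m n k g (rv 14) = m" "dim_val m n k g (rv 15) = n" "dim_val m n k g (rv 16) = k" "dim_val m n k g (rv 17) = g"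
  "dim_val m n k g (Const 1) = 1"
  by (simp_all add: dim_val_def loc_inject)

definition den :: "rat \<Rightarrow> int" where "den q = snd (quotient_of q)"

lemma den_pos: "den q > 0"
  unfolding den_def by (rule quotient_of_denom_pos')

text \<open>The product rather than the least common multiple: it is computed without gcds, and its
  bit length is still bounded by the total length of the denominators.\<close>

definition common_den :: "rat list \<Rightarrow> int" where "common_den ds = (\<Prod>e<length ds. den (ds ! e))"

definition instance_array :: "nat \<Rightarrow> nat \<Rightarrow> nat \<Rightarrow> nat \<Rightarrow> rat list \<Rightarrow> nat \<Rightarrow> nat \<Rightarrow> nat \<Rightarrow> int" where
  "instance_array m n k g ds \<kappa> i l = blocks_entry (dim_val m n k g) silfp_blocks 0
     (\<lambda>e. scaled_entry (common_den ds) (ds ! e)) (int \<kappa>) i l"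

lemma blocks_entry_le:
  assumes "\<And>e. e < p + blocks_size v bs \<Longrightarrow> \<bar>E e\<bar> \<le> X" "0 \<le> X"
  shows "\<bar>blocks_entry v bs p E k i l\<bar> \<le> X"
  using assms(1)
proof (induction bs arbitrary: p)
  case Nil
  then show ?case using assms(2) by simp
next
  case (Cons x bs)
  obtain k' R C where x: "x = (k', R, C)" by (cases x) auto
  have "\<bar>E (p + i * v C + l)\<bar> \<le> X" if "i < v R" "l < v C"
  proof (rule Cons.prems)
    have "Suc i * v C \<le> v R * v C" using that by (intro mult_right_mono) auto
    then show "p + i * v C + l < p + blocks_size v (x # bs)" using that by (simp add: x)
  qed
  moreover have "\<bar>blocks_entry v bs (p + v R * v C) E k i l\<bar> \<le> X"
    using Cons.prems by (intro Cons.IH) (simp add: x add.assoc)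
  ultimately show ?case using assms(2) by (simp add: x)
qed

text \<open>Register 36 first holds the number of data, the limit of the loop that multiplies the
  denominators, and then becomes the read position.\<close>

definition load_prog :: prog where
  "load_prog = Seq (setr 14 (Mem (Const 0))) (Seq (setr 15 (Mem (Const 1))) (Seq (setr 16 (Mem (Const 2))) (Seq (setr 17 (Mem (Const 3)))
     (Seq (setr 18 (Plus (Plus (Plus (Plus (rv 14) (rv 15)) (rv 16)) (rv 17)) (Const 1)))
     (Seq (setr 36 (Plus (Plus (Plus (Plus (Plus (Plus (Plus (Times (rv 14) (rv 15)) (Times (rv 14) (rv 16))) (rv 14))
        (Times (rv 15) (rv 16))) (rv 15)) (Times (rv 17) (rv 16))) (rv 17)) (rv 15)))
     (Seq (setr 19 (Const 1))
     (Seq (For (reg 21) (rv 36) (setr 19 (Times (rv 19) (Mem (Plus (Const 5) (Times (Const 2) (rv 21)))))))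
     (Seq (setr 36 (Const 0)) (blocks_prog silfp_blocks)))))))))"

text \<open>
  If \<open>m = n = g = 0\<close>, the answer is positive, but \<open>k\<close> may be exponential in the length of the input.
  Otherwise \<open>k\<close> is at most the number of matrix entries.
\<close>
definition decide_prog :: "int \<Rightarrow> prog" where
  "decide_prog md = If (Plus (Plus (Mem (Const 0)) (Mem (Const 1))) (Mem (Const 3)))
     (Seq load_prog (Seq products_prog (Seq (query_prog md) (Store (Const 0) (rv 31)))))
     (Store (Const 0) (Const 1))"

lemma wp_setr_Seq:
  assumes "exp_val e \<sigma> = v" "\<bar>v\<bar> \<le> 2 ^ b" "wp b nn p Q (\<sigma>(reg k := v))"
  shows "wp b nn (Seq (setr k e) p) Q \<sigma>"
  using assms by (intro wp_Seq wp_Store) simp_all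

lemma wp_load:
  assumes inp: "input_mem ds \<sigma>" "\<sigma> 0 = int m" "\<sigma> 1 = int n" "\<sigma> 2 = int k" "\<sigma> 3 = int g"
    and zero: "\<And>a. a < 0 \<Longrightarrow> \<sigma> a = 0"
    and len: "length ds = m * n + m * k + m + n * k + n + g * k + g + n"
    and prefix: "\<And>q. q \<le> length ds \<Longrightarrow> (\<Prod>e<q. den (ds ! e)) \<le> 2 ^ b"
    and entries: "\<And>e. e < length ds \<Longrightarrow> \<bar>scaled_entry (common_den ds) (ds ! e)\<bar> \<le> 2 ^ b"
    and s: "s = m + n + k + g + 1" and nn: "s \<le> nn" "length ds \<le> nn" "nn \<le> 2 ^ b"
  shows "wp b nn load_prog (data_mem (instance_array m n k g ds) (common_den ds) n s) \<sigma>"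
proof -
  have nb: "\<bar>int q\<bar> \<le> 2 ^ b" if "q \<le> nn" for q
  proof -
    have "q \<le> 2 ^ b" using that nn(3) by (rule order.trans)
    then have "int q \<le> 2 ^ b" by (metis of_nat_le_iff of_nat_numeral of_nat_power)
    then show ?thesis by linarith
  qed
  have dims: "m \<le> nn" "n \<le> nn" "k \<le> nn" "g \<le> nn" "1 \<le> nn" using s nn(1) by simp_all
  have reg: "reg \<kappa> < 0" if "0 \<le> \<kappa>" for \<kappa> using loc_neg[of \<kappa> 0 0] that by simp
  define \<sigma>1 where "\<sigma>1 = \<sigma>(reg 14 := int m, reg 15 := int n, reg 16 := int k, reg 17 := int g, reg 18 := int s,
     reg 36 := int (length ds), reg 19 := 1)"
  have s1: "same_except {14, 15, 16, 17, 18, 19, 36} \<sigma> \<sigma>1" by (simp add: \<sigma>1_def upd_simps)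
  have r1: "\<sigma>1 (reg 14) = int m" "\<sigma>1 (reg 15) = int n" "\<sigma>1 (reg 16) = int k" "\<sigma>1 (reg 17) = int g"
    "\<sigma>1 (reg 18) = int s" "\<sigma>1 (reg 36) = int (length ds)" "\<sigma>1 (reg 19) = 1"
    by (simp_all add: \<sigma>1_def upd_simps)
  have im1: "input_mem ds \<sigma>1" by (rule input_mem_same[OF s1 _ inp(1)]) auto
  have z1: "\<sigma>1 (loc \<kappa> (int i) (int l)) = 0" if "0 \<le> \<kappa>" "\<kappa> < 8" for \<kappa> i l
    using same_except_loc[OF s1, of \<kappa> "int i" "int l"] that zero[OF loc_neg[of \<kappa> "int l" "int i"]] by auto
  define Inv where "Inv q \<tau> \<longleftrightarrow> same_except {19, 21} \<sigma>1 \<tau> \<and> \<tau> (reg 19) = (\<Prod>e<q. den (ds ! e))" for q \<tau>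
  have fin: "wp b nn (Seq (setr 36 (Const 0)) (blocks_prog silfp_blocks)) (data_mem (instance_array m n k g ds) (common_den ds) n s) \<rho>"
    if inv: "Inv (length ds) \<rho>" for \<rho>
  proof (rule wp_setr_Seq[where v = 0])
    define \<rho>1 where "\<rho>1 = \<rho>(reg 36 := 0)"
    have t: "same_except {19, 21} \<sigma>1 \<rho>" using inv by (simp add: Inv_def)
    have t1: "same_except {19, 21, 36} \<sigma>1 \<rho>1"
      unfolding \<rho>1_def by (intro same_except_upd same_except_trans[OF t same_except_refl[of "{}"]]) auto
    have w: "wp b nn (blocks_prog silfp_blocks) (\<lambda>\<tau>. same_except (set (map fst silfp_blocks) \<union> {21, 22, 36}) \<rho>1 \<tau> \<and>
      (\<forall>\<kappa>\<in>set (map fst silfp_blocks). \<forall>i l. \<tau> (loc \<kappa> (int i) (int l)) =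
        blocks_entry (dim_val m n k g) silfp_blocks 0 (\<lambda>e. scaled_entry (common_den ds) (ds ! e)) \<kappa> i l)) \<rho>1"
    proof (rule wp_blocks)
      show "distinct (map fst silfp_blocks)" "set (map fst silfp_blocks) \<subseteq> {0..<8}" by (simp_all add: silfp_blocks_def)
      show "input_mem ds \<rho>1" by (rule input_mem_same[OF t1 _ im1]) auto
      show "\<rho>1 (reg 36) = int 0" by (simp add: \<rho>1_def)
      show "0 + blocks_size (dim_val m n k g) silfp_blocks \<le> length ds" by (simp add: silfp_blocks_def len)
      show "\<rho>1 (reg 19) = common_den ds" using inv by (simp add: \<rho>1_def upd_simps Inv_def common_den_def)
      show "\<bar>scaled_entry (common_den ds) (ds ! e)\<bar> \<le> 2 ^ b" if "e < length ds" for e by (rule entries[OF that])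
      show "length ds \<le> nn" "nn \<le> 2 ^ b" by (fact nn)+
      fix \<kappa> i l assume "\<kappa> \<in> set (map fst silfp_blocks)"
      then have \<kappa>: "0 \<le> \<kappa>" "\<kappa> < 8" by (auto simp: silfp_blocks_def)
      then show "\<rho>1 (loc \<kappa> (int i) (int l)) = 0"
        using same_except_loc[OF t1, of \<kappa> "int i" "int l"] z1[OF \<kappa>] by auto
    next
      fix \<kappa> R C \<tau> assume m: "(\<kappa>, R, C) \<in> set silfp_blocks" and t2: "same_except ({0..<8} \<union> {21, 22, 36}) \<rho>1 \<tau>"
      have t3: "same_except ({0..<8} \<union> {19, 21, 22, 36}) \<sigma>1 \<tau>" by (rule same_except_trans[OF t1 t2]) auto
      have "\<tau> (reg \<kappa>) = \<sigma>1 (reg \<kappa>)" if "\<kappa> \<in> {14, 15, 16, 17}" for \<kappa>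
        using that by (intro same_except_loc[OF t3]) auto
      then show "exp_val R \<tau> = int (dim_val m n k g R) \<and> exp_val C \<tau> = int (dim_val m n k g C)"
        using m r1 by (auto simp: silfp_blocks_def)
    next
      fix \<kappa> R C assume "(\<kappa>, R, C) \<in> set silfp_blocks"
      then show "dim_val m n k g R \<le> nn \<and> dim_val m n k g C \<le> nn" using dims by (auto simp: silfp_blocks_def)
    qed
    have "wp b nn (blocks_prog silfp_blocks) (data_mem (instance_array m n k g ds) (common_den ds) n s) \<rho>1"
    proof (rule wp_mono[OF w])
      fix \<tau> assume a: "same_except (set (map fst silfp_blocks) \<union> {21, 22, 36}) \<rho>1 \<tau> \<and>
        (\<forall>\<kappa>\<in>set (map fst silfp_blocks). \<forall>i l. \<tau> (loc \<kappa> (int i) (int l)) =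
        blocks_entry (dim_val m n k g) silfp_blocks 0 (\<lambda>e. scaled_entry (common_den ds) (ds ! e)) \<kappa> i l)"
      have e: "set (map fst silfp_blocks) = {0..<8}" by (auto simp: silfp_blocks_def)
      note a' = a[unfolded e]
      have "\<tau> (reg \<kappa>) = \<rho>1 (reg \<kappa>)" if "\<kappa> \<in> {15, 18, 19}" for \<kappa>
        using that by (intro same_except_loc[OF a'[THEN conjunct1]]) auto
      moreover have "\<rho>1 (reg \<kappa>) = \<sigma>1 (reg \<kappa>)" if "\<kappa> \<in> {15, 18}" for \<kappa>
        using that by (intro same_except_loc[OF t1]) auto
      moreover have "\<rho>1 (reg 19) = common_den ds" using inv by (simp add: \<rho>1_def upd_simps Inv_def common_den_def)
      moreover have "\<tau> (loc (int \<kappa>) (int i) (int l)) = instance_array m n k g ds \<kappa> i l" if "\<kappa> < 8" for \<kappa> i l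
        using a'[THEN conjunct2] that by (simp add: instance_array_def)
      ultimately show "data_mem (instance_array m n k g ds) (common_den ds) n s \<tau>"
        using r1 by (simp add: data_mem_def)
    qed
    then show "wp b nn (blocks_prog silfp_blocks) (data_mem (instance_array m n k g ds) (common_den ds) n s) (\<rho>(reg 36 := 0))"
      unfolding \<rho>1_def .
  qed simp_all
  have loop: "wp b nn (Seq (For (reg 21) (rv 36) (setr 19 (Times (rv 19) (Mem (Plus (Const 5) (Times (Const 2) (rv 21)))))))
     (Seq (setr 36 (Const 0)) (blocks_prog silfp_blocks))) (data_mem (instance_array m n k g ds) (common_den ds) n s) \<sigma>1"
  proof (rule wp_Seq, rule wp_For[where m = "length ds" and Inv = Inv])
    show "Inv 0 (\<sigma>1(reg 21 := 0))" using r1 by (simp add: Inv_def upd_simps)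
    show "exp_val (rv 36) \<tau> = int (length ds)" if "Inv q \<tau>" for q \<tau>
      using same_except_loc[of "{19, 21}" \<sigma>1 \<tau> 36 0 0] that r1 by (simp add: Inv_def)
    fix q \<tau> assume q: "q < length ds" and inv: "Inv q \<tau>" and cq: "\<tau> (reg 21) = int q"
    have "input_mem ds \<tau>" by (rule input_mem_same[OF _ _ im1, of "{19, 21}"]) (use inv in \<open>auto simp: Inv_def\<close>)
    then have v: "exp_val (Times (rv 19) (Mem (Plus (Const 5) (Times (Const 2) (rv 21))))) \<tau> = (\<Prod>e<Suc q. den (ds ! e))"
      using inv cq q by (simp add: Inv_def input_mem_def den_def)
    have pos: "0 < (\<Prod>e<Suc q. den (ds ! e))" by (intro prod_pos den_pos)
    show "wp b nn (setr 19 (Times (rv 19) (Mem (Plus (Const 5) (Times (Const 2) (rv 21))))))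
      (\<lambda>\<tau>'. \<tau>' (reg 21) = int q \<and> Inv (Suc q) (\<tau>'(reg 21 := int (Suc q)))) \<tau>"
    proof (rule wp_Store, unfold v)
      show "\<bar>\<Prod>e<Suc q. den (ds ! e)\<bar> \<le> 2 ^ b" using prefix[of "Suc q"] q pos by simp
      show "(\<tau>(exp_val (Const (reg 19)) \<tau> := \<Prod>e<Suc q. den (ds ! e))) (reg 21) = int q \<and>
        Inv (Suc q) ((\<tau>(exp_val (Const (reg 19)) \<tau> := \<Prod>e<Suc q. den (ds ! e)))(reg 21 := int (Suc q)))"
        using inv cq by (simp add: Inv_def upd_simps del: prod.lessThan_Suc)
    qed
  next
    fix \<tau> assume "Inv (length ds) \<tau>"
    then show "wp b nn (Seq (setr 36 (Const 0)) (blocks_prog silfp_blocks)) (data_mem (instance_array m n k g ds) (common_den ds) n s) \<tau>"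
      by (rule fin)
  qed (use nn in simp_all)
  \<comment> \<open>Registers have negative addresses, so storing one dimension does not disturb the
    input cells that are still to be read.\<close>
  have ne: "reg \<kappa> \<noteq> 0" "reg \<kappa> \<noteq> 1" "reg \<kappa> \<noteq> 2" "reg \<kappa> \<noteq> 3" if "0 \<le> \<kappa>" for \<kappa> using reg[OF that] by linarith+
  have ne': "0 \<noteq> reg \<kappa>" "1 \<noteq> reg \<kappa>" "2 \<noteq> reg \<kappa>" "3 \<noteq> reg \<kappa>" if "0 \<le> \<kappa>" for \<kappa> using reg[OF that] by linarith+
  show ?thesis
    unfolding load_prog_def
    apply (rule wp_setr_Seq[where v = "int m"], simp add: inp, rule nb[OF dims(1)])
    apply (rule wp_setr_Seq[where v = "int n"], simp add: inp fun_upd_apply ne', rule nb[OF dims(2)])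
    apply (rule wp_setr_Seq[where v = "int k"], simp add: inp fun_upd_apply ne', rule nb[OF dims(3)])
    apply (rule wp_setr_Seq[where v = "int g"], simp add: inp fun_upd_apply ne', rule nb[OF dims(4)])
    apply (rule wp_setr_Seq[where v = "int s"], simp add: fun_upd_apply loc_inject s, rule nb[OF nn(1)])
    apply (rule wp_setr_Seq[where v = "int (length ds)"], simp add: fun_upd_apply loc_inject len, rule nb[OF nn(2)])
    apply (rule wp_setr_Seq[where v = 1], simp, simp)
    using loop unfolding \<sigma>1_def by assumption
qed

lemma wp_decide:
  assumes inp: "input_mem ds \<sigma>" "\<sigma> 0 = int m" "\<sigma> 1 = int n" "\<sigma> 2 = int k" "\<sigma> 3 = int g"
    and zero: "\<And>a. a < 0 \<Longrightarrow> \<sigma> a = 0" and pos: "m + n + g > 0"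
    and len: "length ds = m * n + m * k + m + n * k + n + g * k + g + n"
    and prefix: "\<And>q. q \<le> length ds \<Longrightarrow> (\<Prod>e<q. den (ds ! e)) \<le> 2 ^ u"
    and entries: "\<And>e. e < length ds \<Longrightarrow> \<bar>scaled_entry (common_den ds) (ds ! e)\<bar> \<le> 2 ^ u"
    and s: "s = m + n + k + g + 1" and u: "s \<le> u" "length ds \<le> u" and md: "md = 0 \<or> md = 1"
    and b: "b = resource_bound u"
  shows "wp b b (decide_prog md) (\<lambda>\<tau>. \<tau> 0 = (if \<forall>j<s. lin_feasible (10 * s) (3 * s + 1)
    (sys_mat (instance_array m n k g ds) (common_den ds) s) (sys_rhs (instance_array m n k g ds) md n j) then 1 else 0)) \<sigma>"
proof -
  define P where "P = instance_array m n k g ds"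
  define \<Delta> where "\<Delta> = common_den ds"
  define X :: int where "X = 2 ^ u"
  have s1: "1 \<le> s" using s by simp
  have X1: "X \<ge> 1" by (simp add: X_def)
  have PX: "\<bar>P \<kappa> i c\<bar> \<le> X" for \<kappa> i c
    unfolding P_def instance_array_def X_def
    by (intro blocks_entry_le entries) (simp_all add: silfp_blocks_def len)
  have \<Delta>X: "\<bar>\<Delta>\<bar> \<le> X"
  proof -
    have "0 < \<Delta>" unfolding \<Delta>_def common_den_def by (intro prod_pos den_pos)
    then show ?thesis using prefix[of "length ds"] by (simp add: X_def \<Delta>_def common_den_def)
  qed
  have mat: "\<bar>sys_mat P \<Delta> s q c\<bar> \<le> 11 * int s * (2 ^ u * 2 ^ u)" for q c
    unfolding X_def[symmetric] by (rule sys_mat_bound[where X = X, OF PX \<Delta>X X1 s1])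
  have rhs: "\<bar>sys_rhs P md n j q\<bar> \<le> 3" for j q by (rule sys_rhs_bound[OF md])
  note size = size_resources[where s = s and u = u, OF s1 u(1) mat rhs, folded b]
  note cb = coeff_le(2)[where s = s and u = u, OF s1 u(1) mat rhs, folded b]
  have ub: "x \<le> 2 ^ b" if "x \<le> 2 ^ u" for x :: int using that size(4) by (rule order.trans)
  have bb: "b \<le> 2 ^ b" and sb: "4 * (3 * s + 1) + 8 \<le> b" and u_b: "u \<le> b"
    using size(1,2,3) by simp_all
  have XX: "int s * (X * X) \<le> 2 ^ b"
  proof -
    have "0 \<le> int s * (X * X)" by (simp add: X_def)
    then show ?thesis using cb unfolding X_def mult.assoc by linarith
  qed
  have XX11: "11 * int s * (X * X) \<le> 2 ^ b" using cb unfolding X_def .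
  have sb': "s \<le> b" using u(1) u_b by (rule order.trans)
  have dsb: "length ds \<le> b" using u(2) u_b by (rule order.trans)
  have wl: "wp b b load_prog (data_mem P \<Delta> n s) \<sigma>"
    unfolding P_def \<Delta>_def
    by (rule wp_load[OF inp zero len ub[OF prefix] ub[OF entries] s sb' dsb bb])
  define res where "res = (if \<forall>j<s. lin_feasible (10 * s) (3 * s + 1) (sys_mat P \<Delta> s) (sys_rhs P md n j) then 1 else 0 :: int)"
  have "wp b b (decide_prog md) (\<lambda>\<tau>. \<tau> 0 = res) \<sigma>"
    unfolding decide_prog_def
  proof (rule wp_If)
    show "wp b b (Seq load_prog (Seq products_prog (Seq (query_prog md) (Store (Const 0) (rv 31))))) (\<lambda>\<tau>. \<tau> 0 = res) \<sigma>"
    proof (rule wp_Seq, rule wp_mono[OF wl])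
      fix \<tau> assume d: "data_mem P \<Delta> n s \<tau>"
      show "wp b b (Seq products_prog (Seq (query_prog md) (Store (Const 0) (rv 31)))) (\<lambda>\<tau>. \<tau> 0 = res) \<tau>"
      proof (rule wp_Seq, rule wp_mono[OF wp_products[OF d PX XX sb' bb]])
        fix \<rho> assume r: "same_except {8, 21, 22, 25} \<tau> \<rho> \<and> product_mem P s \<rho>"
        have d': "data_mem P \<Delta> n s \<rho>" by (rule data_mem_same[OF r[THEN conjunct1] d]) auto
        show "wp b b (Seq (query_prog md) (Store (Const 0) (rv 31))) (\<lambda>\<tau>. \<tau> 0 = res) \<rho>"
        proof (rule wp_Seq, rule wp_mono[OF wp_query[OF d' r[THEN conjunct2] PX \<Delta>X X1 s1 md XX11 sb bb]])
          fix j S assume "S = lin_size (10 * s) (3 * s + 1) (sys_mat P \<Delta> s) (sys_rhs P md n j)"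
          then show "nat (bitlen S) \<le> b \<and> pass_count (3 * s + 1) S \<le> b \<and>
            int (Suc (3 * s + 1)) * int (Suc (3 * s + 1)) * (2 * S ^ (4 * (3 * s + 1) + 8) * S) * cone_bound (10 * s) (3 * s + 1) S \<le> 2 ^ b \<and>
            3 * shrink_prec (Suc (3 * s + 1)) * cone_bound (10 * s) (3 * s + 1) S \<le> 2 ^ b"
            using solver_resources[where s = s and u = u and F = "sys_mat P \<Delta> s" and h = "sys_rhs P md n j", OF s1 u(1) mat rhs, folded b]
            by (simp only:)
        next
          fix \<upsilon> :: memory assume "\<upsilon> (reg 31) = (if \<forall>j<s. lin_feasible (10 * s) (3 * s + 1) (sys_mat P \<Delta> s) (sys_rhs P md n j) then 1 else 0)"
          then have "exp_val (rv 31) \<upsilon> = res" by (simp add: res_def)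
          then show "wp b b (Store (Const 0) (rv 31)) (\<lambda>\<tau>. \<tau> 0 = res) \<upsilon>" by (intro wp_Store) (simp_all add: res_def)
        qed
      qed
    qed
  next
    assume "\<not> 0 < exp_val (Plus (Plus (Mem (Const 0)) (Mem (Const 1))) (Mem (Const 3))) \<sigma>"
    then show "wp b b (Store (Const 0) (Const 1)) (\<lambda>\<tau>. \<tau> 0 = res) \<sigma>" using pos inp by simp
  qed
  then show ?thesis unfolding res_def P_def \<Delta>_def .
qed

section \<open>The encoding and its length\<close>

fun silfp_data :: "silfp \<Rightarrow> rat list" where
  "silfp_data (A, B, b, C, c, D, d, y) = concat (mat_to_list A) @ concat (mat_to_list B) @ list_of_vec b @
     concat (mat_to_list C) @ list_of_vec c @ concat (mat_to_list D) @ list_of_vec d @ list_of_vec y"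

lemma silfp_encoding_eq:
  "silfp_encoding (A, B, b, C, c, D, d, y) = [int (dim_row A), int (dim_col A), int (dim_col B), int (dim_row D)] @
     concat (map rat_encoding (silfp_data (A, B, b, C, c, D, d, y)))"
  by (simp add: mat_encoding_def vec_encoding_def)

lemma length_rat_encodings: "length (concat (map rat_encoding ds)) = 2 * length ds"
  by (induction ds) (simp_all add: rat_encoding_def)

lemma nth_rat_encodings:
  "e < length ds \<Longrightarrow> concat (map rat_encoding ds) ! (2 * e) = fst (quotient_of (ds ! e)) \<and>
     concat (map rat_encoding ds) ! Suc (2 * e) = den (ds ! e)"
proof (induction ds arbitrary: e)
  case (Cons q ds)
  then show ?case by (cases e) (simp_all add: rat_encoding_def den_def)
qed simp

lemma nth_concat_rows:
  "length (concat (map (\<lambda>i. map (f i) [0..<c]) [0..<r])) = r * c"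
  "i < r \<Longrightarrow> l < c \<Longrightarrow> concat (map (\<lambda>i. map (f i) [0..<c]) [0..<r]) ! (i * c + l) = f i l"
proof (induction r)
  case (Suc r)
  {
    case 1
    then show ?case using Suc.IH(1) by simp
  next
    case 2
    show ?case
    proof (cases "i < r")
      case True
      have "Suc i * c \<le> r * c" using True by (intro mult_right_mono) auto
      then have "i * c + l < r * c" using 2 by simp
      then show ?thesis using Suc.IH True 2 by (simp add: nth_append)
    next
      case False
      then have "i = r" using 2 by simp
      then show ?thesis using Suc.IH(1) 2 by (simp add: nth_append)
    qed
  }
qed simp_all

lemma mat_to_list_nth:
  assumes "M \<in> carrier_mat r c"
  shows "length (concat (mat_to_list M)) = r * c"
    and "i < r \<Longrightarrow> l < c \<Longrightarrow> concat (mat_to_list M) ! (i * c + l) = M $$ (i, l)"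
  using assms nth_concat_rows[where f = "\<lambda>i l. M $$ (i, l)" and c = c and r = r] by (simp_all add: mat_to_list_def)

lemma list_of_vec_nth: "v \<in> carrier_vec r \<Longrightarrow> i < r \<Longrightarrow> list_of_vec v ! i = v $ i"
  by (simp add: list_of_vec_index)

lemma real_scaled_entry:
  assumes "den q dvd \<Delta>"
  shows "real_of_int (scaled_entry \<Delta> q) = real_of_int \<Delta> * real_of_rat q"
proof -
  have q: "q = of_int (fst (quotient_of q)) / of_int (den q)"
    unfolding den_def by (intro quotient_of_div) simp
  have "real_of_rat q = real_of_int (fst (quotient_of q)) / real_of_int (den q)"
    by (subst q) (simp add: of_rat_divide)
  then show ?thesis using assms by (simp add: scaled_entry_def den_def[symmetric] real_of_int_div)
qed

lemma den_dvd_common_den: "e < length ds \<Longrightarrow> den (ds ! e) dvd common_den ds"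
  unfolding common_den_def by (intro dvd_prodI) auto

lemma nth_segment: "length xs = p \<Longrightarrow> q < length ys \<Longrightarrow> (xs @ ys @ zs) ! (p + q) = ys ! q"
  by (simp add: nth_append)

text \<open>The position of an entry is the total length of the preceding blocks plus its row-major
  index; the common denominator is divisible by every denominator, so scaling is exact.\<close>

lemma instance_array_padded:
  assumes A: "A \<in> carrier_mat m n" and B: "B \<in> carrier_mat m k" and b: "b \<in> carrier_vec m"
    and C: "C \<in> carrier_mat n k" and c: "c \<in> carrier_vec n" and D: "D \<in> carrier_mat g k"
    and d: "d \<in> carrier_vec g" and y: "y \<in> carrier_vec n" and md: "md = 0 \<or> md = 1"
  defines "ds \<equiv> silfp_data (A, B, b, C, c, D, d, y)"
  defines "F \<equiv> \<lambda>M i l. real_of_rat (M $$ (i, l))" and "G \<equiv> \<lambda>v i. real_of_rat (v $ i)"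
  shows "length ds = m * n + m * k + m + n * k + n + g * k + g + n"
    and "padded_instance (instance_array m n k g ds) (common_den ds) m n k g (m + n + k + g + 1)
      (F A) (F B) (F C) (F D) (G b) (G c) (G d) (G y) md"
proof -
  define LA where "LA = concat (mat_to_list A)"
  define LB where "LB = concat (mat_to_list B)"
  define LC where "LC = concat (mat_to_list C)"
  define LD where "LD = concat (mat_to_list D)"
  define Lb where "Lb = list_of_vec b"
  define Lc where "Lc = list_of_vec c"
  define Ld where "Ld = list_of_vec d"
  define Ly where "Ly = list_of_vec y"
  have ds: "ds = LA @ LB @ Lb @ LC @ Lc @ LD @ Ld @ Ly"
    by (simp add: ds_def LA_def LB_def LC_def LD_def Lb_def Lc_def Ld_def Ly_def)
  have len: "length LA = m * n" "length LB = m * k" "length Lb = m" "length LC = n * k" "length Lc = n"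
    "length LD = g * k" "length Ld = g" "length Ly = n"
    using assms(1-8) by (simp_all add: LA_def LB_def LC_def LD_def Lb_def Lc_def Ld_def Ly_def mat_to_list_nth(1)[OF A]
      mat_to_list_nth(1)[OF B] mat_to_list_nth(1)[OF C] mat_to_list_nth(1)[OF D])
  show lds: "length ds = m * n + m * k + m + n * k + n + g * k + g + n" by (simp add: ds len)
  define \<Delta> where "\<Delta> = common_den ds"
  have \<Delta>: "\<Delta> > 0" unfolding \<Delta>_def common_den_def by (intro prod_pos den_pos)
  define P where "P = instance_array m n k g ds"
  define E where "E e = scaled_entry \<Delta> (ds ! e)" for e
  have E: "real_of_int (E e) = \<Delta> * real_of_rat q" if "ds ! e = q" "e < length ds" for e q
    unfolding E_def that(1) using den_dvd_common_den[OF that(2)] that(1) by (intro real_scaled_entry) (simp add: \<Delta>_def)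
  note pd = instance_array_def silfp_blocks_def P_def E_def \<Delta>_def
  have entries:
    "P 0 i l = (if i < m \<and> l < n then E (0 + (i * n + l)) else 0)"
    "P 1 i l = (if i < m \<and> l < k then E (m * n + (i * k + l)) else 0)"
    "P 2 i 0 = (if i < m then E (m * n + m * k + i) else 0)"
    "P 3 i l = (if i < n \<and> l < k then E (m * n + m * k + m + (i * k + l)) else 0)"
    "P 4 i 0 = (if i < n then E (m * n + m * k + m + n * k + i) else 0)"
    "P 5 i l = (if i < g \<and> l < k then E (m * n + m * k + m + n * k + n + (i * k + l)) else 0)"
    "P 6 i 0 = (if i < g then E (m * n + m * k + m + n * k + n + g * k + i) else 0)"
    "P 7 i 0 = (if i < n then E (m * n + m * k + m + n * k + n + g * k + g + i) else 0)" for i l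
    unfolding pd by (simp_all add: add.assoc)
  have idx: "i * c + l < r * c" if "i < r" "l < c" for i l r c :: nat
  proof -
    have "Suc i * c \<le> r * c" using that by (intro mult_right_mono) auto
    then show ?thesis using that by simp
  qed
  have nA: "ds ! (0 + q) = LA ! q" if "q < m * n" for q
    unfolding ds by (rule nth_segment[of "[]", simplified append.left_neutral]) (simp_all add: len that)
  have nB: "ds ! (m * n + q) = LB ! q" if "q < m * k" for q
    unfolding ds by (rule nth_segment) (simp_all add: len that)
  have nb: "ds ! (m * n + m * k + q) = Lb ! q" if "q < m" for q
    using nth_segment[of "LA @ LB" "m * n + m * k" q Lb] that by (simp add: ds len)
  have nC: "ds ! (m * n + m * k + m + q) = LC ! q" if "q < n * k" for q
    using nth_segment[of "LA @ LB @ Lb" "m * n + m * k + m" q LC] that by (simp add: ds len)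
  have nc: "ds ! (m * n + m * k + m + n * k + q) = Lc ! q" if "q < n" for q
    using nth_segment[of "LA @ LB @ Lb @ LC" "m * n + m * k + m + n * k" q Lc] that by (simp add: ds len)
  have nD: "ds ! (m * n + m * k + m + n * k + n + q) = LD ! q" if "q < g * k" for q
    using nth_segment[of "LA @ LB @ Lb @ LC @ Lc" "m * n + m * k + m + n * k + n" q LD] that by (simp add: ds len)
  have nd: "ds ! (m * n + m * k + m + n * k + n + g * k + q) = Ld ! q" if "q < g" for q
    using nth_segment[of "LA @ LB @ Lb @ LC @ Lc @ LD" "m * n + m * k + m + n * k + n + g * k" q Ld] that by (simp add: ds len)
  have ny: "ds ! (m * n + m * k + m + n * k + n + g * k + g + q) = Ly ! q" if "q < n" for q
    using nth_segment[of "LA @ LB @ Lb @ LC @ Lc @ LD @ Ld" "m * n + m * k + m + n * k + n + g * k + g" q Ly "[]"] that by (simp add: ds len)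
  have "padded_instance P \<Delta> m n k g (m + n + k + g + 1) (F A) (F B) (F C) (F D) (G b) (G c) (G d) (G y) md"
  proof (unfold_locales)
    show "\<Delta> > 0" "md = 0 \<or> md = 1" "m < m + n + k + g + 1" "n < m + n + k + g + 1" "k < m + n + k + g + 1" "g < m + n + k + g + 1"
      using \<Delta> md by simp_all
    fix i l :: nat
    show "real_of_int (P 0 i l) = (if i < m \<and> l < n then \<Delta> * F A i l else 0)"
    proof (cases "i < m \<and> l < n")
      case True
      have "ds ! (0 + (i * n + l)) = A $$ (i, l)" using True nA[OF idx] mat_to_list_nth(2)[OF A] by (simp add: LA_def)
      moreover have "0 + (i * n + l) < length ds" using True idx[of i m l n] unfolding lds by linarith
      ultimately show ?thesis unfolding entries(1) F_def using True E by simp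
    qed (unfold entries(1), auto)
    show "real_of_int (P 1 i l) = (if i < m \<and> l < k then \<Delta> * F B i l else 0)"
    proof (cases "i < m \<and> l < k")
      case True
      have "ds ! (m * n + (i * k + l)) = B $$ (i, l)" using True nB[OF idx] mat_to_list_nth(2)[OF B] by (simp add: LB_def)
      moreover have "m * n + (i * k + l) < length ds" using True idx[of i m l k] unfolding lds by linarith
      ultimately show ?thesis unfolding entries(2) F_def using True E by simp
    qed (unfold entries(2), auto)
    show "real_of_int (P 2 i 0) = (if i < m then \<Delta> * G b i else 0)"
    proof (cases "i < m")
      case True
      have "ds ! (m * n + m * k + i) = b $ i" using True nb list_of_vec_nth[OF b] by (simp add: Lb_def)
      moreover have "m * n + m * k + i < length ds" using True unfolding lds by linarith
      ultimately show ?thesis unfolding entries(3) G_def using True E by simp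
    qed (unfold entries(3), auto)
    show "real_of_int (P 3 i l) = (if i < n \<and> l < k then \<Delta> * F C i l else 0)"
    proof (cases "i < n \<and> l < k")
      case True
      have "ds ! (m * n + m * k + m + (i * k + l)) = C $$ (i, l)" using True nC[OF idx] mat_to_list_nth(2)[OF C] by (simp add: LC_def)
      moreover have "m * n + m * k + m + (i * k + l) < length ds" using True idx[of i n l k] unfolding lds by linarith
      ultimately show ?thesis unfolding entries(4) F_def using True E by simp
    qed (unfold entries(4), auto)
    show "real_of_int (P 4 i 0) = (if i < n then \<Delta> * G c i else 0)"
    proof (cases "i < n")
      case True
      have "ds ! (m * n + m * k + m + n * k + i) = c $ i" using True nc list_of_vec_nth[OF c] by (simp add: Lc_def)
      moreover have "m * n + m * k + m + n * k + i < length ds" using True unfolding lds by linarith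
      ultimately show ?thesis unfolding entries(5) G_def using True E by simp
    qed (unfold entries(5), auto)
    show "real_of_int (P 5 i l) = (if i < g \<and> l < k then \<Delta> * F D i l else 0)"
    proof (cases "i < g \<and> l < k")
      case True
      have "ds ! (m * n + m * k + m + n * k + n + (i * k + l)) = D $$ (i, l)" using True nD[OF idx] mat_to_list_nth(2)[OF D] by (simp add: LD_def)
      moreover have "m * n + m * k + m + n * k + n + (i * k + l) < length ds" using True idx[of i g l k] unfolding lds by linarith
      ultimately show ?thesis unfolding entries(6) F_def using True E by simp
    qed (unfold entries(6), auto)
    show "real_of_int (P 6 i 0) = (if i < g then \<Delta> * G d i else 0)"
    proof (cases "i < g")
      case True
      have "ds ! (m * n + m * k + m + n * k + n + g * k + i) = d $ i" using True nd list_of_vec_nth[OF d] by (simp add: Ld_def)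
      moreover have "m * n + m * k + m + n * k + n + g * k + i < length ds" using True unfolding lds by linarith
      ultimately show ?thesis unfolding entries(7) G_def using True E by simp
    qed (unfold entries(7), auto)
    show "real_of_int (P 7 i 0) = (if i < n then \<Delta> * G y i else 0)"
    proof (cases "i < n")
      case True
      have "ds ! (m * n + m * k + m + n * k + n + g * k + g + i) = y $ i" using True ny list_of_vec_nth[OF y] by (simp add: Ly_def)
      moreover have "m * n + m * k + m + n * k + n + g * k + g + i < length ds" using True unfolding lds by linarith
      ultimately show ?thesis unfolding entries(8) G_def using True E by simp
    qed (unfold entries(8), auto)
  qed
  then show "padded_instance (instance_array m n k g ds) (common_den ds) m n k g (m + n + k + g + 1)
      (F A) (F B) (F C) (F D) (G b) (G c) (G d) (G y) md" by (simp only: P_def \<Delta>_def)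
qed

text \<open>Owing to the sign bit, even the integer 0 has length at least 1.\<close>

lemma length_le_encoding_length: "length xs \<le> encoding_length xs"
  by (induction xs) (simp_all add: encoding_length_def int_length_def)

lemma mem_le_encoding_length:
  assumes "z \<in> set xs"
  shows "\<bar>z\<bar> \<le> 2 ^ encoding_length xs"
proof -
  have "int_length z \<le> encoding_length xs"
    unfolding encoding_length_def using assms by (intro member_le_sum_list) auto
  then have "(2 :: int) ^ int_length z \<le> 2 ^ encoding_length xs" by (intro power_increasing) auto
  then show ?thesis using abs_le_two_power_int_length[of z] by linarith
qed

lemma load_le: "\<bar>load xs a\<bar> \<le> 2 ^ encoding_length xs"
proof (cases "0 \<le> a \<and> a < int (length xs)")
  case True
  then have "load xs a \<in> set xs" by (auto simp: load_def)
  then show ?thesis by (rule mem_le_encoding_length)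
qed (auto simp: load_def)

lemma sum_int_length_den_le:
  assumes "q \<le> length ds"
  shows "(\<Sum>e<q. int_length (den (ds ! e))) \<le> encoding_length (concat (map rat_encoding ds))"
proof -
  have eq: "encoding_length (concat (map rat_encoding ds)) = sum_list (map (\<lambda>r. int_length (fst (quotient_of r)) + int_length (den r)) ds)"
    by (induction ds) (simp_all add: encoding_length_def rat_encoding_def den_def)
  have "(\<Sum>e<q. int_length (den (ds ! e))) \<le> (\<Sum>e<length ds. int_length (den (ds ! e)))"
    using assms by (intro sum_mono2) auto
  also have "\<dots> \<le> (\<Sum>e<length ds. int_length (fst (quotient_of (ds ! e))) + int_length (den (ds ! e)))"
    by (intro sum_mono) simp
  also have "\<dots> = encoding_length (concat (map rat_encoding ds))"
    unfolding eq by (simp add: sum_list_sum_nth atLeast0LessThan)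
  finally show ?thesis .
qed

text \<open>Bit lengths add under multiplication, and all denominators are part of the encoding.
  Prefixes are covered because the partial products are stored too.\<close>

lemma prod_den_le:
  assumes "q \<le> length ds"
  shows "(\<Prod>e<q. den (ds ! e)) \<le> 2 ^ encoding_length (concat (map rat_encoding ds))"
proof -
  have "(\<Prod>e<q. den (ds ! e)) \<le> (\<Prod>e<q. 2 ^ int_length (den (ds ! e)))"
  proof (rule prod_mono)
    fix e show "0 \<le> den (ds ! e) \<and> den (ds ! e) \<le> 2 ^ int_length (den (ds ! e))"
      using den_pos[of "ds ! e"] abs_le_two_power_int_length[of "den (ds ! e)"] by linarith
  qed
  also have "\<dots> = 2 ^ (\<Sum>e<q. int_length (den (ds ! e)))" by (simp add: power_sum)
  also have "\<dots> \<le> 2 ^ encoding_length (concat (map rat_encoding ds))"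
    using sum_int_length_den_le[OF assms] by (intro power_increasing) auto
  finally show ?thesis .
qed

section \<open>Polynomial running time\<close>

text \<open>The choice u = 2 L covers the scaled data: an entry is the product of a numerator and a
  quotient of the common denominator, each at most 2^L in absolute value. It also bounds the number
  s of rows and columns after padding.\<close>

lemma decide_prog_correct:
  assumes I: "I \<in> silfp_instances" and md: "md = 0 \<or> md = 1"
  defines "L \<equiv> encoding_length (silfp_encoding I)"
  shows "\<exists>t \<tau>. exec (decide_prog md) (load (silfp_encoding I)) t \<tau> \<and>
    t \<le> poly (loop_time (decide_prog md)) (resource_bound (2 * L)) * Suc (resource_bound (2 * L)) \<and>
    \<tau> 0 = (if (if md = 1 then pessimistic I else optimistic I) then 1 else 0)"
proof -
  obtain A B b C c D d y m n k g where Ieq: "I = (A, B, b, C, c, D, d, y)"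
    and car: "A \<in> carrier_mat m n" "B \<in> carrier_mat m k" "b \<in> carrier_vec m" "C \<in> carrier_mat n k" "c \<in> carrier_vec n"
      "D \<in> carrier_mat g k" "d \<in> carrier_vec g" "y \<in> carrier_vec n"
    using I unfolding silfp_instances_def by blast
  define ds where "ds = silfp_data I"
  define \<sigma> where "\<sigma> = load (silfp_encoding I)"
  define b' where "b' = resource_bound (2 * L)"
  define ok where "ok = (if md = 1 then pessimistic I else optimistic I)"
  note pad = instance_array_padded[OF car md, folded Ieq, folded ds_def]
  note iff = instance_iff[OF car, folded Ieq]
  have enc: "silfp_encoding I = [int m, int n, int k, int g] @ concat (map rat_encoding ds)"
    unfolding Ieq silfp_encoding_eq ds_def using car by simp
  have len: "length (silfp_encoding I) = 4 + 2 * length ds" unfolding enc by (simp add: length_rat_encodings)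
  then have L: "4 + 2 * length ds \<le> L" unfolding L_def using length_le_encoding_length[of "silfp_encoding I"] by simp
  have EL: "encoding_length (concat (map rat_encoding ds)) \<le> L" unfolding L_def enc by (simp add: encoding_length_def)
  have Lb: "2 * L \<le> b'"
  proof -
    have "2 * L \<le> (2 * L) ^ 7" using power_increasing[of 1 7 "2 * L"] L by simp
    then show ?thesis unfolding b'_def resource_bound_def by linarith
  qed
  have bm: "bounded_memory b' \<sigma>"
  proof -
    have "L \<le> b'" using Lb by linarith
    then have "(2 :: int) ^ L \<le> 2 ^ b'" by (intro power_increasing) auto
    then show ?thesis unfolding bounded_memory_def \<sigma>_def L_def using load_le by (blast intro: order.trans)
  qed
  have dims: "\<sigma> 0 = int m" "\<sigma> 1 = int n" "\<sigma> 2 = int k" "\<sigma> 3 = int g"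
    unfolding \<sigma>_def load_def len by (simp_all add: enc)
  have "wp b' b' (decide_prog md) (\<lambda>\<tau>. \<tau> 0 = (if ok then 1 else 0)) \<sigma>"
  proof (cases "m + n + g = 0")
    \<comment> \<open>Without variables y, equations and inequalities on x, all conditions hold
      vacuously.\<close>
    case True
    then have ok unfolding ok_def iff by (simp add: std_optimal_def std_unique_def std_feasible_def)
    then show ?thesis unfolding decide_prog_def using True dims by (intro wp_If wp_Store) simp_all
  next
    case False
    define s where "s = m + n + k + g + 1"
    have dl: "m + n + g \<le> length ds" unfolding pad(1) by simp
    have kl: "k \<le> length ds"
    proof -
      have "1 * k \<le> (m + n + g) * k" using False by (intro mult_right_mono) auto
      also have "\<dots> \<le> length ds" unfolding pad(1) by (simp add: distrib_right)
      finally show ?thesis by simp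
    qed
    have inp: "input_mem ds \<sigma>"
      unfolding input_mem_def
    proof (intro allI impI)
      fix e assume e: "e < length ds"
      have a: "nat (4 + 2 * int e) = Suc (Suc (Suc (Suc (2 * e))))" "nat (5 + 2 * int e) = Suc (Suc (Suc (Suc (Suc (2 * e)))))"
        by simp_all
      have "4 + 2 * int e < int (length (silfp_encoding I))" "5 + 2 * int e < int (length (silfp_encoding I))"
        unfolding len using e by simp_all
      then show "\<sigma> (4 + 2 * int e) = fst (quotient_of (ds ! e)) \<and> \<sigma> (5 + 2 * int e) = snd (quotient_of (ds ! e))"
        unfolding \<sigma>_def load_def a using nth_rat_encodings[OF e] by (simp add: enc den_def)
    qed
    have zero: "\<sigma> a = 0" if "a < 0" for a using that by (simp add: \<sigma>_def load_def)
    have prefix: "(\<Prod>e<q. den (ds ! e)) \<le> 2 ^ L" if "q \<le> length ds" for q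
    proof -
      have "(2 :: int) ^ encoding_length (concat (map rat_encoding ds)) \<le> 2 ^ L" using EL by (intro power_increasing) auto
      then show ?thesis using prod_den_le[OF that] by linarith
    qed
    have prefix2: "(\<Prod>e<q. den (ds ! e)) \<le> 2 ^ (2 * L)" if "q \<le> length ds" for q
      by (rule order.trans[OF prefix[OF that]]) (intro power_increasing, simp_all)
    have entries: "\<bar>scaled_entry (common_den ds) (ds ! e)\<bar> \<le> 2 ^ (2 * L)" if e: "e < length ds" for e
    proof -
      have "fst (quotient_of (ds ! e)) \<in> set (silfp_encoding I)" using e unfolding enc by (auto simp: rat_encoding_def)
      then have a: "\<bar>fst (quotient_of (ds ! e))\<bar> \<le> 2 ^ L" unfolding L_def by (rule mem_le_encoding_length)
      have "0 < common_den ds" unfolding common_den_def by (intro prod_pos den_pos)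
      then have "\<bar>common_den ds\<bar> \<le> 2 ^ L" using prefix[of "length ds"] by (simp add: common_den_def)
      then have "\<bar>common_den ds div snd (quotient_of (ds ! e))\<bar> \<le> 2 ^ L" by (rule order.trans[OF abs_div_le])
      then have "\<bar>scaled_entry (common_den ds) (ds ! e)\<bar> \<le> 2 ^ L * 2 ^ L"
        unfolding scaled_entry_def abs_mult using a by (intro mult_mono) auto
      then show ?thesis by (simp add: mult_2 power_add)
    qed
    have su: "s \<le> 2 * L" "length ds \<le> 2 * L" using dl kl L unfolding s_def by linarith+
    have pos: "m + n + g > 0" using False by simp
    have ok_iff: "ok \<longleftrightarrow> (\<forall>j<s. lin_feasible (10 * s) (3 * s + 1)
      (sys_mat (instance_array m n k g ds) (common_den ds) s) (sys_rhs (instance_array m n k g ds) md n j))"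
      unfolding s_def padded_instance.systems_feasible_iff[OF pad(2)] ok_def iff padded_instance.optimum_def[OF pad(2)]
      by (cases "md = 1") simp_all
    show ?thesis unfolding ok_iff
      by (rule wp_decide[OF inp dims zero pos pad(1) prefix2 entries s_def su md b'_def])
  qed
  then show ?thesis using bm unfolding wp_def \<sigma>_def b'_def ok_def by blast
qed

lemma polytime_decidable_silfp:
  fixes md :: int
  assumes md: "md = 0 \<or> md = 1"
  shows "polytime_decidable silfp_instances silfp_encoding (\<lambda>I. if md = 1 then pessimistic I else optimistic I)"
proof -
  \<comment> \<open>\<open>resource_bound (2 * x)\<close> as a polynomial in x; composed with
    \<open>loop_time\<close> it turns both bounds into one polynomial in the length of the
    input.\<close>
  define r :: "nat poly" where "r = monom (2000000000 * 2 ^ 7) 7"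
  have r: "poly r x = resource_bound (2 * x)" for x
    by (simp add: r_def resource_bound_def poly_monom power_mult_distrib)
  have "\<exists>t \<tau>. exec (decide_prog md) (load (silfp_encoding I)) t \<tau> \<and>
      t \<le> poly (pcompose (loop_time (decide_prog md)) r * (1 + r)) (encoding_length (silfp_encoding I)) \<and>
      \<tau> 0 = (if (if md = 1 then pessimistic I else optimistic I) then 1 else 0)" if "I \<in> silfp_instances" for I
    using decide_prog_correct[OF that md] by (simp only: poly_mult poly_pcompose poly_add poly_1 r Suc_eq_plus1_left)
  then show ?thesis unfolding polytime_decidable_def by blast
qed

theorem theorem5:
  shows "polytime_decidable silfp_instances silfp_encoding optimistic \<and>
         polytime_decidable silfp_instances silfp_encoding pessimistic"
  using polytime_decidable_silfp[of 0] polytime_decidable_silfp[of 1] by simp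

end
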